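(* Let $A=\mathbb{k}Q/I$ be a toupie algebra and $\mathbb{E}^*=\mathrm{Ext}_A^*(E,E)$, identified as a graded vector space with $(\mathbb{T}_* )^\vee$, with basis the duals $\gamma^\vee$ of chains $\gamma$. There is a canonical $A_\infty$-algebra structure on $\mathbb{E}^*$ given on dual basis elements as follows. (i) If $\gamma_i$ is an $r_i$-chain in $\mathbb{T}_{r_i+1}$, $1\le i\le n$, and $\gamma=\gamma_1\cdots\gamma_n$ is an $r$-chain with $r=r_1+\cdots+r_n+1$ which does not contain non monomial relations, then $$m_n(\gamma_1^\vee\otimes\cdots\otimes\gamma_n^\vee)=(-1)^M\gamma^\vee,\qquad M=r_1+\sum_{i=1}^n(n+i+1)r_i+\sum_{i<j}r_ir_j+\frac{n(n+1)}{2}.$$ (ii) If $a_1,\dots,a_n$ are arrows such that $a_1\cdots a_n$ is a branch involved in a non monomial relation, then $$m_n(a_1^\vee\otimes\cdots\otimes a_n^\vee)=\sum(-1)^{n(n+1)/2}\,c(a_1\cdots a_n)\,[w_0|w_1]^\vee,$$ where the sum is over the $\rho_i\in\mathcal{G}_{nomon}$ such that $c(a_1\cdots a_n)\,a_1\cdots a_n$ is a (nonzero) summand of $\rho_i$, and $[w_0|w_1]$ is determined by $\mathrm{Tip}(\rho_i)=w_0w_1$ with $w_0\in Q_1$. (iii) Otherwise, the higher product is zero.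
   Context: $\mathbb{k}$ is a field of characteristic zero, $\otimes=\otimes_{\mathbb{k}}$, $(-)^\vee=\mathrm{Hom}_{\mathbb{k}}(-,\mathbb{k})$, Koszul sign rule. Paths are written from left to right, $Q$ also denotes the set of paths, $Q_n$ the paths of length $n$, $E=\mathbb{k}Q_0$. **Toupie algebras.** A finite quiver $Q$ is toupie if it has a unique source $0$ and a unique sink $\omega$ and every other vertex is the source of exactly one arrow and the target of exactly one arrow. A toupie algebra is $A=\mathbb{k}Q/I$ with $Q$ toupie and $I$ admissible. Branches are the paths from $0$ to $\omega$; they are ordered as $B_1$ (arrows, $\alpha^{(1)},\dots,\alpha^{(a)}$), $B_2$ (length $>1$, involved in no relation, next $l$ ones), $B_3$ (containing monomial relations, next $m$ ones), $B_4=\{\alpha^{(a+l+m+1)},\dots,\alpha^{(a+l+m+n)}\}$ (involved in non monomial relations, listed with non-increasing lengths). The non monomial relations are taken in reduced row echelon form: $\rho_i=\alpha^{(a+l+m+k_i)}+\sum_{j>k_i}a_{ij}\alpha^{(a+l+m+j)}$, $1\le i\le r$ (coefficient matrix reduced of rank $r$). $\mathrm{Tip}(\rho_i)=\alpha^{(a+l+m+k_i)}$, and $c(\cdot)$ denotes the coefficient of a branch in the relation $\rho_i$ under consideration. $\mathcal{G}=\mathcal{G}_{mon}\sqcup\mathcal{G}_{nomon}$ is a minimal generating set of $I$ with $\mathcal{G}_{nomon}=\{\rho_i\}$ and $\mathcal{G}_{mon}$ consisting of paths. $W=\mathrm{Tip}\,\mathcal{G}=\mathcal{G}_{mon}\cup\{\mathrm{Tip}(\rho_i)\}$,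 and $\mathrm{NonTip}(I)$ is the set of paths having no subpath in $W$; it gives a basis of $A$. **Chains.** The Uf-graph $Q_W$ has vertex set $Q_0\cup Q_1\cup\{\text{proper right factors of elements of }W\}$ and arrows $e\to x$ for $e\in Q_0$, $x=ex\in Q_1$, and $u\to v$ whenever the path $uv$ lies in $\langle W\rangle$ but every proper left factor of $uv$ does not. $W^{(i)}$, the set of $i$-chains ($i\ge0$), consists of the sequences $[w_1|\cdots|w_{i+1}]$ with $w_k\in\mathrm{NonTip}(I)\setminus Q_0$ such that $e\to w_1\to\cdots\to w_{i+1}$ is a path in $Q_W$; $W^{(-1)}=Q_0$. A chain is identified with the path $w_1\cdots w_{i+1}$; it contains a non monomial relation if this path has a subpath among the $\mathrm{Tip}(\rho_i)$. $\mathbb{T}_n=\mathrm{Tor}^A_n(E,E)=\mathbb{k}W^{(n-1)}$, so an $r$-chain has degree $r+1$. The operations concern the positive-degree part, i.e. chains with $r_i\ge0$. **$A_\infty$-algebras.** An $A_\infty$-algebra is a graded $\mathbb{k}$-space with maps $m_n:A^{\otimes n}\to A$ ($n\ge1$) of degree $2-n$ such that $\sum_{r+s+t=n,\,r,t\ge0,\,s\ge1}(-1)^{r+st}m_{r+1+t}(\mathrm{Id}^{\otimes r}\otimes m_s\otimes\mathrm{Id}^{\otimes t})=0$ for all $n\ge1$. **Canonical.** Let $\mathbb{B}'_*$ be the bar construction: $\mathbb{B}'_n=\overline{A}^{\otimes_E n}$ ($n\ge1$), where $\overline{A}$ is the span of $\mathrm{NonTip}(I)\setminus Q_0$, with $d([a_1|\cdots|a_n])=\sum_{i=1}^{n-1}(-1)^i[a_1|\cdots|a_ia_{i+1}|\cdots|a_n]$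 and coproduct $\Delta'([a_1|\cdots|a_n])=\sum_{i=1}^{n-1}[a_1|\cdots|a_i]\otimes[a_{i+1}|\cdots|a_n]$ (for $a_j$ basis paths). Its dual $\mathbb{B}'^*=(\mathbb{B}'_* )^\vee$ is a DG associative algebra with product $(\Delta')^\vee\circ D^2$, where $D^2:(\mathbb{B}'_* )^\vee\otimes(\mathbb{B}'_* )^\vee\to(\mathbb{B}'_*\otimes\mathbb{B}'_* )^\vee$ is the canonical map. An $A_\infty$-algebra structure on $\mathbb{E}^*$ is called canonical if it is quasi-isomorphic (as an $A_\infty$-algebra) to this DG associative algebra. *)

theory Defs
  imports Complex_Main
    "HOL-Library.Function_Algebras"
    "HOL-Algebra.QuotRing"
    "HOL-Algebra.Ideal_Product"
    "Graph_Theory.Graph_Theory"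
begin

section \<open>Vectors given by coordinates\<close>

text \<open>
  A vector of a space with a distinguished basis, and likewise a linear functional on such a space,
  is given by the function of its coordinates, respectively of its values on the basis.
\<close>

definition delta :: "'b \<Rightarrow> 'b \<Rightarrow> 'k::zero_neq_one" where
  "delta x = (\<lambda>y. if y = x then 1 else 0)"

definition fscale :: "'k::times \<Rightarrow> ('b \<Rightarrow> 'k) \<Rightarrow> 'b \<Rightarrow> 'k" where
  "fscale c f = (\<lambda>x. c * f x)"


section \<open>Graded spaces and A-infinity algebras\<close>

text \<open>
  Gradings are internal: the components are independent subspaces of one ambient vector space with
  scalar multiplication \<open>s\<close>.
\<close>

definition graded_space ::
  "('k::field \<Rightarrow> 'v::ab_group_add \<Rightarrow> 'v) \<Rightarrow> (int \<Rightarrow> 'v set) \<Rightarrow> bool" where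
  "graded_space s V \<longleftrightarrow> vector_space s \<and> (\<forall>d. module.subspace s (V d)) \<and>
     (\<forall>D x. finite D \<longrightarrow> (\<forall>d\<in>D. x d \<in> V d) \<longrightarrow> (\<Sum>d\<in>D. x d) = 0 \<longrightarrow> (\<forall>d\<in>D. x d = 0))"

definition homogeneous :: "(int \<Rightarrow> 'v set) \<Rightarrow> int list \<Rightarrow> 'v list \<Rightarrow> bool" where
  "homogeneous V ds xs \<longleftrightarrow> list_all2 (\<lambda>d x. x \<in> V d) ds xs"

text \<open>
  A linear map of degree \<open>e\<close> from the \<open>n\<close>-th tensor power of \<open>V\<close> to \<open>V'\<close>, as a multilinear map on
  lists of \<open>n\<close> homogeneous elements.
\<close>

definition graded_multilinear ::
  "('k::field \<Rightarrow> 'v::ab_group_add \<Rightarrow> 'v) \<Rightarrow> (int \<Rightarrow> 'v set) \<Rightarrow>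
   ('k \<Rightarrow> 'w::ab_group_add \<Rightarrow> 'w) \<Rightarrow> (int \<Rightarrow> 'w set) \<Rightarrow> nat \<Rightarrow> int \<Rightarrow> ('v list \<Rightarrow> 'w) \<Rightarrow> bool" where
  "graded_multilinear s V s' V' n e f \<longleftrightarrow>
     (\<forall>ds xs. length xs = n \<longrightarrow> homogeneous V ds xs \<longrightarrow>
        f xs \<in> V' (sum_list ds + e) \<and>
        (\<forall>i<n. \<forall>y\<in>V (ds ! i). f (xs[i := xs ! i + y]) = f xs + f (xs[i := y])) \<and>
        (\<forall>i<n. \<forall>c. f (xs[i := s c (xs ! i)]) = s' c (f xs)))"

text \<open>
  In the identities below, the map \<open>m\<^sub>u\<close> of degree \<open>2 - u\<close> (and \<open>f\<^sub>i\<close> of degree \<open>1 - i\<close>) is moved past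
  the arguments to its left; this produces the second summand of each exponent (Koszul sign rule).
\<close>

definition ainf_algebra ::
  "('k::field \<Rightarrow> 'v::ab_group_add \<Rightarrow> 'v) \<Rightarrow> (int \<Rightarrow> 'v set) \<Rightarrow> (nat \<Rightarrow> 'v list \<Rightarrow> 'v) \<Rightarrow> bool" where
  "ainf_algebra s V m \<longleftrightarrow> graded_space s V \<and>
     (\<forall>n\<ge>1. graded_multilinear s V s V n (2 - int n) (m n)) \<and>
     (\<forall>n\<ge>1. \<forall>ds xs. length xs = n \<longrightarrow> homogeneous V ds xs \<longrightarrow>
        (\<Sum>(r, u, t) \<in> {(r, u, t). r + u + t = n \<and> u \<ge> 1}.
           s ((-1) powi (int (r + u * t) + (2 - int u) * sum_list (take r ds)))
             (m (r + 1 + t) (take r xs @ [m u (take u (drop r xs))] @ drop (r + u) xs))) = 0)"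

definition compositions :: "nat \<Rightarrow> nat list set" where
  "compositions n = {js. sum_list js = n \<and> (\<forall>j\<in>set js. j \<ge> 1)}"

definition ainf_morphism ::
  "('k::field \<Rightarrow> 'v::ab_group_add \<Rightarrow> 'v) \<Rightarrow> (int \<Rightarrow> 'v set) \<Rightarrow> (nat \<Rightarrow> 'v list \<Rightarrow> 'v) \<Rightarrow>
   ('k \<Rightarrow> 'w::ab_group_add \<Rightarrow> 'w) \<Rightarrow> (int \<Rightarrow> 'w set) \<Rightarrow> (nat \<Rightarrow> 'w list \<Rightarrow> 'w) \<Rightarrow>
   (nat \<Rightarrow> 'v list \<Rightarrow> 'w) \<Rightarrow> bool" where
  "ainf_morphism s V m s' V' m' f \<longleftrightarrow>
     (\<forall>n\<ge>1. graded_multilinear s V s' V' n (1 - int n) (f n)) \<and>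
     (\<forall>n\<ge>1. \<forall>ds xs. length xs = n \<longrightarrow> homogeneous V ds xs \<longrightarrow>
        (\<Sum>(r, u, t) \<in> {(r, u, t). r + u + t = n \<and> u \<ge> 1}.
           s' ((-1) powi (int (r + u * t) + (2 - int u) * sum_list (take r ds)))
             (f (r + 1 + t) (take r xs @ [m u (take u (drop r xs))] @ drop (r + u) xs)))
        = (\<Sum>js \<in> compositions n.
             let q = length js; start = (\<lambda>l. sum_list (take l js)) in
             s' ((-1) powi (int (\<Sum>l<q. (q - 1 - l) * (js ! l - 1))
                            + (\<Sum>l<q. (1 - int (js ! l)) * sum_list (take (start l) ds))))
               (m' q (map (\<lambda>l. f (js ! l) (take (js ! l) (drop (start l) xs))) [0..<q]))))"

text \<open>
  The last two conjuncts say that \<open>f\<^sub>1\<close> is injective, respectively surjective, on cohomology.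
\<close>

definition ainf_quasi_iso ::
  "('k::field \<Rightarrow> 'v::ab_group_add \<Rightarrow> 'v) \<Rightarrow> (int \<Rightarrow> 'v set) \<Rightarrow> (nat \<Rightarrow> 'v list \<Rightarrow> 'v) \<Rightarrow>
   ('k \<Rightarrow> 'w::ab_group_add \<Rightarrow> 'w) \<Rightarrow> (int \<Rightarrow> 'w set) \<Rightarrow> (nat \<Rightarrow> 'w list \<Rightarrow> 'w) \<Rightarrow>
   (nat \<Rightarrow> 'v list \<Rightarrow> 'w) \<Rightarrow> bool" where
  "ainf_quasi_iso s V m s' V' m' f \<longleftrightarrow> ainf_morphism s V m s' V' m' f \<and>
     (\<forall>d. \<forall>x\<in>V d. m 1 [x] = 0 \<longrightarrow> (\<exists>z\<in>V' (d - 1). f 1 [x] = m' 1 [z]) \<longrightarrow>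
        (\<exists>y\<in>V (d - 1). x = m 1 [y])) \<and>
     (\<forall>d. \<forall>y\<in>V' d. m' 1 [y] = 0 \<longrightarrow>
        (\<exists>x\<in>V d. m 1 [x] = 0 \<and> (\<exists>z\<in>V' (d - 1). y - f 1 [x] = m' 1 [z])))"

text \<open>
  Over a field, quasi-isomorphisms of A-infinity algebras are invertible up to homotopy, so the
  direction of the morphism is immaterial.
\<close>

definition ainf_quasi_isomorphic ::
  "('k::field \<Rightarrow> 'v::ab_group_add \<Rightarrow> 'v) \<Rightarrow> (int \<Rightarrow> 'v set) \<Rightarrow> (nat \<Rightarrow> 'v list \<Rightarrow> 'v) \<Rightarrow>
   ('k \<Rightarrow> 'w::ab_group_add \<Rightarrow> 'w) \<Rightarrow> (int \<Rightarrow> 'w set) \<Rightarrow> (nat \<Rightarrow> 'w list \<Rightarrow> 'w) \<Rightarrow> bool" where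
  "ainf_quasi_isomorphic s V m s' V' m' \<longleftrightarrow>
     (\<exists>f. ainf_quasi_iso s V m s' V' m' f) \<or> (\<exists>f. ainf_quasi_iso s' V' m' s V m f)"

text \<open>
  The graded dual of a graded space concentrated in degrees \<open>d \<ge> 1\<close> with basis \<open>X d\<close> in degree \<open>d\<close>.
\<close>

definition dual_space :: "(nat \<Rightarrow> 'b set) \<Rightarrow> int \<Rightarrow> ('b \<Rightarrow> 'k::zero) set" where
  "dual_space X d = (if d \<ge> 1 then {f. \<forall>x. f x \<noteq> 0 \<longrightarrow> x \<in> X (nat d)} else {\<lambda>_. 0})"


section \<open>Quivers and path algebras\<close>

text \<open>
  A quiver is a directed multigraph. A path is a pair of its starting vertex and its list of
  arrows, composed from left to right; \<open>(v, [])\<close> is the trivial path at \<open>v\<close>.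
\<close>

type_synonym ('v, 'e) qpath = "'v \<times> 'e list"

definition ptarget :: "('v, 'e) pre_digraph \<Rightarrow> ('v, 'e) qpath \<Rightarrow> 'v" where
  "ptarget Q x = last (pre_digraph.awalk_verts Q (fst x) (snd x))"

definition qpaths :: "('v, 'e) pre_digraph \<Rightarrow> ('v, 'e) qpath set" where
  "qpaths Q = {x. pre_digraph.awalk Q (fst x) (snd x) (ptarget Q x)}"

definition trivial_paths :: "('v, 'e) pre_digraph \<Rightarrow> ('v, 'e) qpath set" where
  "trivial_paths Q = {(v, []) | v. v \<in> verts Q}"

definition arrow_path :: "('v, 'e) pre_digraph \<Rightarrow> 'e \<Rightarrow> ('v, 'e) qpath" where
  "arrow_path Q e = (tail Q e, [e])"

definition path_prod :: "('v, 'e) qpath list \<Rightarrow> ('v, 'e) qpath" where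
  "path_prod xs = (fst (hd xs), concat (map snd xs))"

definition composable :: "('v, 'e) pre_digraph \<Rightarrow> ('v, 'e) qpath list \<Rightarrow> bool" where
  "composable Q xs \<longleftrightarrow> set xs \<subseteq> qpaths Q \<and>
     (\<forall>i. Suc i < length xs \<longrightarrow> ptarget Q (xs ! i) = fst (xs ! Suc i))"

definition subpath :: "('v, 'e) pre_digraph \<Rightarrow> ('v, 'e) qpath \<Rightarrow> ('v, 'e) qpath \<Rightarrow> bool" where
  "subpath Q y x \<longleftrightarrow> (\<exists>u v. composable Q [u, y, v] \<and> x = path_prod [u, y, v])"

definition left_factor :: "('v, 'e) pre_digraph \<Rightarrow> ('v, 'e) qpath \<Rightarrow> ('v, 'e) qpath \<Rightarrow> bool" where
  "left_factor Q y x \<longleftrightarrow> (\<exists>v. composable Q [y, v] \<and> x = path_prod [y, v])"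

definition right_factor :: "('v, 'e) pre_digraph \<Rightarrow> ('v, 'e) qpath \<Rightarrow> ('v, 'e) qpath \<Rightarrow> bool" where
  "right_factor Q y x \<longleftrightarrow> (\<exists>u. composable Q [u, y] \<and> x = path_prod [u, y])"

text \<open>
  In the product, the \<open>i\<close>-th summand is the factorisation of the path \<open>x\<close> after its first \<open>i\<close> arrows.
\<close>

definition path_algebra :: "('v, 'e) pre_digraph \<Rightarrow> (('v, 'e) qpath \<Rightarrow> 'k::field) ring" where
  "path_algebra Q =
     \<lparr> carrier = {f. finite {x. f x \<noteq> 0} \<and> {x. f x \<noteq> 0} \<subseteq> qpaths Q},
       monoid.mult = (\<lambda>f g x. \<Sum>i\<le>length (snd x).
                  f (fst x, take i (snd x)) *
                  g (ptarget Q (fst x, take i (snd x)), drop i (snd x))),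
       one = (\<lambda>x. if x \<in> trivial_paths Q then 1 else 0),
       zero = (\<lambda>_. 0),
       add = (\<lambda>f g x. f x + g x) \<rparr>"

definition arrow_ideal :: "('v, 'e) pre_digraph \<Rightarrow> (('v, 'e) qpath \<Rightarrow> 'k::field) set" where
  "arrow_ideal Q = genideal (path_algebra Q) {delta (arrow_path Q e) | e. e \<in> arcs Q}"

primrec arrow_ideal_pow :: "('v, 'e) pre_digraph \<Rightarrow> nat \<Rightarrow> (('v, 'e) qpath \<Rightarrow> 'k::field) set" where
  "arrow_ideal_pow Q 0 = carrier (path_algebra Q)"
| "arrow_ideal_pow Q (Suc n) = ideal_prod (path_algebra Q) (arrow_ideal_pow Q n) (arrow_ideal Q)"

definition admissible :: "('v, 'e) pre_digraph \<Rightarrow> (('v, 'e) qpath \<Rightarrow> 'k::field) set \<Rightarrow> bool" where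
  "admissible Q I \<longleftrightarrow> ideal I (path_algebra Q) \<and> I \<subseteq> arrow_ideal_pow Q 2 \<and>
     (\<exists>N\<ge>2. arrow_ideal_pow Q N \<subseteq> I)"


section \<open>Chains\<close>

text \<open>The ideal generated by the paths in \<open>W\<close>; only the paths in it matter.\<close>

definition path_ideal :: "('v, 'e) pre_digraph \<Rightarrow> ('v, 'e) qpath set \<Rightarrow> ('v, 'e) qpath set" where
  "path_ideal Q W = {x. \<exists>y\<in>W. subpath Q y x}"

definition nontip :: "('v, 'e) pre_digraph \<Rightarrow> ('v, 'e) qpath set \<Rightarrow> ('v, 'e) qpath set" where
  "nontip Q W = {x \<in> qpaths Q. \<not> (\<exists>y\<in>W. subpath Q y x)}"

definition uf_vertices :: "('v, 'e) pre_digraph \<Rightarrow> ('v, 'e) qpath set \<Rightarrow> ('v, 'e) qpath set" where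
  "uf_vertices Q W = trivial_paths Q \<union> arrow_path Q ` arcs Q \<union>
     {v. \<exists>x\<in>W. right_factor Q v x \<and> v \<noteq> x}"

definition uf_arrow ::
  "('v, 'e) pre_digraph \<Rightarrow> ('v, 'e) qpath set \<Rightarrow> ('v, 'e) qpath \<Rightarrow> ('v, 'e) qpath \<Rightarrow> bool" where
  "uf_arrow Q W u v \<longleftrightarrow>
     (u \<in> trivial_paths Q \<and> v \<in> arrow_path Q ` arcs Q \<and> fst v = fst u) \<or>
     (u \<in> uf_vertices Q W \<and> v \<in> uf_vertices Q W \<and> composable Q [u, v] \<and>
      path_prod [u, v] \<in> path_ideal Q W \<and>
      (\<forall>y. left_factor Q y (path_prod [u, v]) \<and> y \<noteq> path_prod [u, v] \<longrightarrow> y \<notin> path_ideal Q W))"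

text \<open>The \<open>i\<close>-chains; they are kept as sequences, and \<^const>\<open>path_prod\<close> gives the path of a chain.\<close>

definition chains :: "('v, 'e) pre_digraph \<Rightarrow> ('v, 'e) qpath set \<Rightarrow> nat \<Rightarrow> ('v, 'e) qpath list set" where
  "chains Q W i = {ws. length ws = i + 1 \<and> set ws \<subseteq> nontip Q W - trivial_paths Q \<and>
     (\<exists>e\<in>trivial_paths Q. uf_arrow Q W e (ws ! 0)) \<and>
     (\<forall>k<i. uf_arrow Q W (ws ! k) (ws ! Suc k))}"

text \<open>
  The part of positive degree of the dual of Tor. The dual basis element of a chain \<open>\<gamma>\<close> is
  \<open>delta \<gamma>\<close>.
\<close>

definition ext_space ::
  "('v, 'e) pre_digraph \<Rightarrow> ('v, 'e) qpath set \<Rightarrow> int \<Rightarrow> (('v, 'e) qpath list \<Rightarrow> 'k::field) set" where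
  "ext_space Q W = dual_space (\<lambda>n. chains Q W (n - 1))"


section \<open>The bar construction and its dual\<close>

text \<open>
  The coordinates, in the basis of nontips, of the class of \<open>f\<close> in the quotient of the path algebra
  by \<open>I\<close>.
\<close>

definition normal_form ::
  "('v, 'e) pre_digraph \<Rightarrow> (('v, 'e) qpath \<Rightarrow> 'k::field) set \<Rightarrow> ('v, 'e) qpath set \<Rightarrow>
   (('v, 'e) qpath \<Rightarrow> 'k) \<Rightarrow> ('v, 'e) qpath \<Rightarrow> 'k" where
  "normal_form Q I W f =
     (THE g. g \<in> carrier (path_algebra Q) \<and> {x. g x \<noteq> 0} \<subseteq> nontip Q W \<and>
             g \<in> a_r_coset (path_algebra Q) I f)"

definition bar_basis ::
  "('v, 'e) pre_digraph \<Rightarrow> ('v, 'e) qpath set \<Rightarrow> nat \<Rightarrow> ('v, 'e) qpath list set" where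
  "bar_basis Q W n = {xs. length xs = n \<and> set xs \<subseteq> nontip Q W - trivial_paths Q \<and> composable Q xs}"

definition bar_diff ::
  "('v, 'e) pre_digraph \<Rightarrow> (('v, 'e) qpath \<Rightarrow> 'k::field) set \<Rightarrow> ('v, 'e) qpath set \<Rightarrow>
   ('v, 'e) qpath list \<Rightarrow> ('v, 'e) qpath list \<Rightarrow> 'k" where
  "bar_diff Q I W xs =
     (\<Sum>i=1..<length xs.
        let g = normal_form Q I W (delta (path_prod [xs ! (i - 1), xs ! i])) in
        \<Sum>c | g c \<noteq> 0. fscale ((-1) ^ i * g c) (delta (take (i - 1) xs @ [c] @ drop (i + 1) xs)))"

definition bar_dual :: "('v, 'e) pre_digraph \<Rightarrow> ('v, 'e) qpath set \<Rightarrow> int \<Rightarrow>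
    (('v, 'e) qpath list \<Rightarrow> 'k::field) set" where
  "bar_dual Q W = dual_space (bar_basis Q W)"

text \<open>
  By the Koszul sign rule the differential of a functional \<open>f\<close> of degree \<open>p\<close> is
  \<open>- (-1)\<^sup>p f \<circ> d\<close>; on the basis element \<open>xs\<close> only \<open>p = length xs - 1\<close> contributes.
\<close>

definition bar_dual_diff ::
  "('v, 'e) pre_digraph \<Rightarrow> (('v, 'e) qpath \<Rightarrow> 'k::field) set \<Rightarrow> ('v, 'e) qpath set \<Rightarrow>
   (('v, 'e) qpath list \<Rightarrow> 'k) \<Rightarrow> ('v, 'e) qpath list \<Rightarrow> 'k" where
  "bar_dual_diff Q I W f xs =
     (if xs \<in> bar_basis Q W (length xs)
      then (-1) ^ length xs * (\<Sum>ys | bar_diff Q I W xs ys \<noteq> 0. bar_diff Q I W xs ys * f ys)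
      else 0)"

text \<open>
  The value of \<open>f \<otimes> g\<close> on \<open>x \<otimes> y\<close> is \<open>(-1)\<^sup>p f x * g y\<close> where \<open>p\<close> is the product of the degrees of
  \<open>g\<close> and \<open>x\<close>; here the degree of \<open>g\<close> has to be that of \<open>y\<close>.
\<close>

definition bar_dual_mult ::
  "('v, 'e) pre_digraph \<Rightarrow> ('v, 'e) qpath set \<Rightarrow> (('v, 'e) qpath list \<Rightarrow> 'k::field) \<Rightarrow>
   (('v, 'e) qpath list \<Rightarrow> 'k) \<Rightarrow> ('v, 'e) qpath list \<Rightarrow> 'k" where
  "bar_dual_mult Q W f g xs =
     (if xs \<in> bar_basis Q W (length xs)
      then \<Sum>i=1..<length xs. (-1) ^ ((length xs - i) * i) * f (take i xs) * g (drop i xs)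
      else 0)"

definition bar_dual_ops ::
  "('v, 'e) pre_digraph \<Rightarrow> (('v, 'e) qpath \<Rightarrow> 'k::field) set \<Rightarrow> ('v, 'e) qpath set \<Rightarrow>
   nat \<Rightarrow> (('v, 'e) qpath list \<Rightarrow> 'k) list \<Rightarrow> ('v, 'e) qpath list \<Rightarrow> 'k" where
  "bar_dual_ops Q I W n fs =
     (if n = 1 then bar_dual_diff Q I W (fs ! 0)
      else if n = 2 then bar_dual_mult Q W (fs ! 0) (fs ! 1)
      else (\<lambda>_. 0))"

definition canonical ::
  "('v, 'e) pre_digraph \<Rightarrow> (('v, 'e) qpath \<Rightarrow> 'k::field) set \<Rightarrow> ('v, 'e) qpath set \<Rightarrow>
   (nat \<Rightarrow> (('v, 'e) qpath list \<Rightarrow> 'k) list \<Rightarrow> ('v, 'e) qpath list \<Rightarrow> 'k) \<Rightarrow> bool" where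
  "canonical Q I W m \<longleftrightarrow>
     ainf_quasi_isomorphic fscale (ext_space Q W) m fscale (bar_dual Q W) (bar_dual_ops Q I W)"


section \<open>Toupie algebras\<close>

definition toupie_quiver :: "('v, 'e) pre_digraph \<Rightarrow> 'v \<Rightarrow> 'v \<Rightarrow> bool" where
  "toupie_quiver Q so si \<longleftrightarrow> fin_digraph Q \<and> so \<in> verts Q \<and> si \<in> verts Q \<and>
     (\<forall>v\<in>verts Q. in_degree Q v = 0 \<longleftrightarrow> v = so) \<and>
     (\<forall>v\<in>verts Q. out_degree Q v = 0 \<longleftrightarrow> v = si) \<and>
     (\<forall>v\<in>verts Q - {so, si}. in_degree Q v = 1 \<and> out_degree Q v = 1)"

definition branches :: "('v, 'e) pre_digraph \<Rightarrow> 'v \<Rightarrow> 'v \<Rightarrow> ('v, 'e) qpath set" where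
  "branches Q so si = {x \<in> qpaths Q. fst x = so \<and> ptarget Q x = si}"

text \<open>
  The non monomial relations, for a list \<open>B4\<close> of branches, pivot columns \<open>piv\<close> and coefficients
  \<open>cf\<close>. Rows and columns are numbered from 0. The coefficient of a branch \<open>b\<close> in the \<open>i\<close>-th relation
  is \<open>rho B4 piv cf i b\<close>.
\<close>

definition rho :: "('v, 'e) qpath list \<Rightarrow> (nat \<Rightarrow> nat) \<Rightarrow> (nat \<Rightarrow> nat \<Rightarrow> 'k::field) \<Rightarrow> nat \<Rightarrow>
    ('v, 'e) qpath \<Rightarrow> 'k" where
  "rho B4 piv cf i = delta (B4 ! piv i) +
     (\<Sum>j\<in>{piv i<..<length B4}. fscale (cf i j) (delta (B4 ! j)))"

definition nonmon_tips :: "('v, 'e) qpath list \<Rightarrow> nat \<Rightarrow> (nat \<Rightarrow> nat) \<Rightarrow> ('v, 'e) qpath set" where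
  "nonmon_tips B4 r piv = {B4 ! piv i | i. i < r}"

definition minimal_generating ::
  "('v, 'e) pre_digraph \<Rightarrow> (('v, 'e) qpath \<Rightarrow> 'k::field) set \<Rightarrow> (('v, 'e) qpath \<Rightarrow> 'k) set \<Rightarrow> bool" where
  "minimal_generating Q I G \<longleftrightarrow> G \<subseteq> carrier (path_algebra Q) \<and> genideal (path_algebra Q) G = I \<and>
     (\<forall>H. H \<subset> G \<longrightarrow> genideal (path_algebra Q) H \<noteq> I)"

text \<open>
  A toupie algebra with the chosen generators of its ideal: the \<open>r\<close> non monomial relations are in
  reduced row echelon form, \<open>B4\<close> lists exactly the branches involved in them, by non-increasing
  length, and these are disjoint from the branches containing monomial relations.
\<close>

definition toupie_algebra ::
  "('v, 'e) pre_digraph \<Rightarrow> 'v \<Rightarrow> 'v \<Rightarrow> (('v, 'e) qpath \<Rightarrow> 'k::field) set \<Rightarrow> ('v, 'e) qpath set \<Rightarrow>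
   ('v, 'e) qpath list \<Rightarrow> nat \<Rightarrow> (nat \<Rightarrow> nat) \<Rightarrow> (nat \<Rightarrow> nat \<Rightarrow> 'k) \<Rightarrow> bool" where
  "toupie_algebra Q so si I Gmon B4 r piv cf \<longleftrightarrow>
     toupie_quiver Q so si \<and> admissible Q I \<and>
     Gmon \<subseteq> qpaths Q \<and>
     minimal_generating Q I (delta ` Gmon \<union> rho B4 piv cf ` {..<r}) \<and>
     distinct B4 \<and> sorted_wrt (\<lambda>x y. length (snd x) \<ge> length (snd y)) B4 \<and>
     set B4 = {b \<in> branches Q so si. \<exists>i<r. rho B4 piv cf i b \<noteq> 0} \<and>
     (\<forall>b\<in>set B4. \<not> (\<exists>g\<in>Gmon. subpath Q g b)) \<and>
     strict_mono_on {..<r} piv \<and>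
     (\<forall>i<r. piv i < length B4) \<and>
     (\<forall>i<r. \<forall>i'<r. piv i < piv i' \<longrightarrow> cf i (piv i') = 0) \<and>
     (\<forall>i<r. \<exists>j\<in>{piv i<..<length B4}. cf i j \<noteq> 0)"

text \<open>Here \<open>rs\<close> is the list of the numbers \<open>r\<^sub>1, \<dots>, r\<^sub>n\<close>, so that \<open>r\<^sub>i\<close> is \<open>rs ! (i - 1)\<close>.\<close>

definition sign_exponent :: "nat list \<Rightarrow> nat" where
  "sign_exponent rs = (let n = length rs; r = (\<lambda>i. rs ! (i - 1)) in
     r 1 + (\<Sum>i=1..n. (n + i + 1) * r i) + (\<Sum>j=1..n. \<Sum>i=1..<j. r i * r j) + n * (n + 1) div 2)"

definition chain_product_case ::
  "('v, 'e) pre_digraph \<Rightarrow> ('v, 'e) qpath set \<Rightarrow> ('v, 'e) qpath set \<Rightarrow>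
   ('v, 'e) qpath list list \<Rightarrow> nat list \<Rightarrow> ('v, 'e) qpath list \<Rightarrow> bool" where
  "chain_product_case Q W tips gs rs g \<longleftrightarrow>
     gs \<noteq> [] \<and> list_all2 (\<lambda>\<gamma> r. \<gamma> \<in> chains Q W r) gs rs \<and>
     g \<in> chains Q W (sum_list rs + 1) \<and>
     composable Q (map path_prod gs) \<and> path_prod g = path_prod (map path_prod gs) \<and>
     \<not> (\<exists>t\<in>tips. subpath Q t (path_prod g))"

definition nonmon_branch_case ::
  "('v, 'e) pre_digraph \<Rightarrow> 'v \<Rightarrow> 'v \<Rightarrow> ('v, 'e) qpath list \<Rightarrow> nat \<Rightarrow> (nat \<Rightarrow> nat) \<Rightarrow>
   (nat \<Rightarrow> nat \<Rightarrow> 'k::field) \<Rightarrow> 'e list \<Rightarrow> bool" where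
  "nonmon_branch_case Q so si B4 r piv cf as \<longleftrightarrow>
     as \<noteq> [] \<and> (so, as) \<in> branches Q so si \<and> (\<exists>i<r. rho B4 piv cf i (so, as) \<noteq> 0)"

text \<open>The chain \<open>[w\<^sub>0|w\<^sub>1]\<close> with \<open>w\<^sub>0\<close> the first arrow of the path \<open>w\<^sub>0w\<^sub>1\<close>.\<close>

definition split_chain :: "('v, 'e) pre_digraph \<Rightarrow> ('v, 'e) qpath \<Rightarrow> ('v, 'e) qpath list" where
  "split_chain Q x = [arrow_path Q (hd (snd x)), (head Q (hd (snd x)), tl (snd x))]"

end

theory Submission
 imports Defs "HOL-Library.Poly_Mapping"
begin

text \<open>The minimal model is constructed dually: the free algebra on the chains carries an explicit
differential, and an explicit morphism of differential graded algebras leads from it to the cobar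
construction of the bar complex. That this morphism induces an isomorphism in cohomology follows from
a discrete Morse matching on bar cells, which merges the last letter of the longest prefix
that is a chain with the letter after it.\<close>

section \<open>Free algebras\<close>

text \<open>Terms of the squared differential do not cancel in visible pairs. On a fixed path,
  however, a chain is determined by its start and its degree. The sums of chain words of extremal
  degree are arranged in arrays that satisfy a transport equation and a curvature equation, and the
  square vanishes by formal identities in a ring. The morphism \<open>G\<close> solves
  \<open>DB (G \<gamma>) = ahom G (\<delta>T \<gamma>)\<close> degree by degree with the homotopy
  \<open>H\<close>, which contracts the cobar construction onto \<open>A\<close>. The only
  obstruction, for 1-chains, says that the relations hold in \<open>A\<close>. Non monomial
  relations stay harmless because the branches they involve run from source to sink and cannot be
  extended: a chain containing a tip is a 1-chain, and its differential is a combination of words of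
  arrows. For the quasi-isomorphism only the linear part of \<open>G\<close> counts: a signed chain,
  plus matched words if there is a tip. The signs come from iterated suspensions, corrected by a
  sign on each basis element: \<open>lbar\<close> is dictated by the Koszul sign of the product on
  the bar dual, \<open>lext\<close> by the exponent \<open>M\<close>.\<close>

datatype 'x fw = FW (fwl: "'x list")

text \<open>Lists are wrapped so that concatenation becomes an addition: convolution of finitely
  supported functions on \<open>fw\<close> is then the product of the free algebra.\<close>

instantiation fw :: (type) monoid_add
begin
definition zero_fw :: "'a fw" where "0 = FW []"
definition plus_fw :: "'a fw \<Rightarrow> 'a fw \<Rightarrow> 'a fw" where "u + v = FW (fwl u @ fwl v)"
instance by standard (auto simp: zero_fw_def plus_fw_def)
end

abbreviation lookup :: "('a \<Rightarrow>\<^sub>0 'b::zero) \<Rightarrow> 'a \<Rightarrow> 'b" where "lookup \<equiv> Poly_Mapping.lookup"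

abbreviation keys :: "('a \<Rightarrow>\<^sub>0 'b::zero) \<Rightarrow> 'a set" where "keys \<equiv> Poly_Mapping.keys"

type_synonym ('x, 'k) fa = "'x fw \<Rightarrow>\<^sub>0 'k"

definition mon :: "'x list \<Rightarrow> ('x, 'k::comm_ring_1) fa" where
 "mon xs = Poly_Mapping.single (FW xs) 1"

definition cst :: "'k::comm_ring_1 \<Rightarrow> ('x, 'k) fa" where
 "cst c = Poly_Mapping.single 0 c"

abbreviation coef :: "('x, 'k::comm_ring_1) fa \<Rightarrow> 'x list \<Rightarrow> 'k" where
 "coef p xs \<equiv> lookup p (FW xs)"

lemma fwl_zero [simp]: "fwl 0 = []" and fwl_plus [simp]: "fwl (u + v) = fwl u @ fwl v"
 by (auto simp: zero_fw_def plus_fw_def)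

lemma mon_append: "mon (xs @ ys) = mon xs * mon ys"
 by (simp add: mon_def mult_single plus_fw_def)

lemma mon_Nil [simp]: "mon [] = 1"
 by (simp add: mon_def flip: zero_fw_def)

lemma mon_Cons: "mon (x # xs) = mon [x] * mon xs"
 using mon_append[of "[x]" xs] by simp

lemma cst_mon: "cst c * mon xs = Poly_Mapping.single (FW xs) c"
 by (simp add: cst_def mon_def mult_single)

lemma mon_cst: "mon xs * cst c = Poly_Mapping.single (FW xs) c"
 by (simp add: cst_def mon_def mult_single)

lemma cf_mon: "coef (mon xs) ys = (if xs = ys then 1 else 0)"
 by (simp add: mon_def lookup_single when_def)

lemma keys_mon [simp]: "keys (mon xs :: ('x, 'k::comm_ring_1) fa) = {FW xs}"
 by (simp add: mon_def)

lemma cst_0 [simp]: "cst 0 = 0" and cst_1 [simp]: "cst 1 = 1"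
 by (simp_all add: cst_def)

lemma cst_minus: "cst (- c) = - cst c"
 by (simp add: cst_def single_uminus)

lemma cst_add: "cst (a + b) = cst a + cst b"
 by (simp add: cst_def single_add)

lemma cst_mult: "cst (a * b) = cst a * cst b"
 by (simp add: cst_def mult_single)

lemma cst_sign: "cst ((-1) ^ n) = (-1) ^ n"
 by (induction n) (simp_all add: cst_mult cst_minus)

lemma fa_sum:
 fixes p :: "('x, 'k::comm_ring_1) fa"
 shows "p = (\<Sum>w\<in>keys p. cst (lookup p w) * mon (fwl w))"
proof (rule poly_mapping_eqI)
 fix k
 show "lookup p k = lookup (\<Sum>w\<in>keys p. cst (lookup p w) * mon (fwl w)) k"
  by (simp add: lookup_sum cst_mon lookup_single when_def in_keys_iff sum.delta')
qed

text \<open>The \<open>mon\<close> case is limited to words occurring in \<open>p\<close>, so that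
  assumptions on the support of \<open>p\<close> can be used in the induction.\<close>

lemma fa_induct [consumes 0, case_names mon zero add scale]:
 fixes p :: "('x, 'k::comm_ring_1) fa"
 assumes "\<And>w. FW w \<in> keys p \<Longrightarrow> P (mon w)" "P 0"
  "\<And>a b. P a \<Longrightarrow> P b \<Longrightarrow> P (a + b)" "\<And>c a. P a \<Longrightarrow> P (cst c * a)"
 shows "P p"
proof -
 have "P (\<Sum>w\<in>A. cst (lookup p w) * mon (fwl w))" if "A \<subseteq> keys p" for A
  using finite_subset[OF that finite_keys] that
  by (induction A rule: finite_induct) (auto intro!: assms)
 from this[OF order_refl] show ?thesis using fa_sum[of p] by simp
qed

lemma cst_comm: "cst c * p = p * cst c"
proof (induction p rule: fa_induct)
 case (scale d a)
 have "cst c * (cst d * a) = cst (c * d) * a" by (simp add: cst_mult mult.assoc)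
 also have "\<dots> = cst (d * c) * a" by (simp add: mult.commute)
 also have "\<dots> = cst d * (cst c * a)" by (simp add: cst_mult mult.assoc)
 finally show ?case using scale by (simp add: mult.assoc)
qed (simp_all add: cst_mon mon_cst algebra_simps)

lemma cst_left: "p * (cst c * q) = cst c * (p * q)"
 by (metis cst_comm mult.assoc)

lemma lookup_cst: "lookup (cst c * p) w = c * lookup p w"
 unfolding cst_def by (simp flip: mult_map_scale_conv_mult add: Poly_Mapping.map.rep_eq when_def)

definition lin :: "('x list \<Rightarrow> ('y, 'k::comm_ring_1) fa) \<Rightarrow> ('x, 'k) fa \<Rightarrow> ('y, 'k) fa" where
 "lin f p = (\<Sum>w\<in>keys p. cst (lookup p w) * f (fwl w))"

lemma lin_superset:
 assumes "finite A" "keys p \<subseteq> A"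
 shows "lin f p = (\<Sum>w\<in>A. cst (lookup p w) * f (fwl w))"
 unfolding lin_def using assms by (intro sum.mono_neutral_left) (auto simp: in_keys_iff)

lemma lin_0 [simp]: "lin f 0 = 0"
 by (simp add: lin_def)

lemma lin_mon [simp]: "lin f (mon w) = f w"
 by (simp add: lin_def) (simp add: mon_def)

lemma lin_1: "lin f 1 = f []"
 using lin_mon[of f "[]"] by simp

lemma lin_add: "lin f (p + q) = lin f p + lin f q"
proof -
 let ?A = "keys p \<union> keys q"
 have "keys (p + q) \<subseteq> ?A" by (rule keys_add)
 then show ?thesis
  by (simp add: lin_superset[of ?A] lookup_add cst_add algebra_simps sum.distrib)
qed

lemma lin_cst: "lin f (cst c * p) = cst c * lin f p"
proof -
 have "keys (cst c * p) \<subseteq> keys p"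
  by (auto simp: in_keys_iff lookup_cst)
 then show ?thesis
  by (simp add: lin_superset[of "keys p"] lookup_cst cst_mult sum_distrib_left mult.assoc)
qed

lemma lin_minus: "lin f (- p) = - lin f p"
 using lin_cst[of f "-1" p] by (simp add: cst_minus)

lemma lin_diff: "lin f (p - q) = lin f p - lin f q"
 using lin_add[of f p "-q"] by (simp add: lin_minus)

lemma lin_sign: "lin f ((-1) ^ n * p) = (-1) ^ n * lin f p"
 by (metis lin_cst cst_sign)

lemma lin_sum: "lin f (\<Sum>i\<in>I. g i) = (\<Sum>i\<in>I. lin f (g i))"
 by (induction I rule: infinite_finite_induct) (simp_all add: lin_add)

lemmas lin_simps = lin_add lin_cst lin_minus lin_diff lin_sign lin_sum

lemma lin_cong:
 assumes "\<And>w. FW w \<in> keys p \<Longrightarrow> f w = g w"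
 shows "lin f p = lin g p"
 unfolding lin_def using assms by (intro sum.cong) auto

lemma lin_zero: "(\<And>w. FW w \<in> keys p \<Longrightarrow> f w = 0) \<Longrightarrow> lin f p = 0"
 unfolding lin_def by (intro sum.neutral) auto

lemma keys_lin:
 assumes "FW v \<in> keys (lin f p)"
 obtains w where "FW w \<in> keys p" "FW v \<in> keys (f w)"
proof -
 have "(\<Sum>w\<in>keys p. lookup p w * lookup (f (fwl w)) (FW v)) \<noteq> 0"
  using assms by (simp add: in_keys_iff lin_def lookup_sum lookup_cst)
 then obtain w where "w \<in> keys p" "lookup p w * lookup (f (fwl w)) (FW v) \<noteq> 0"
  by (meson sum.neutral)
 then show ?thesis using that[of "fwl w"] by (metis fw.collapse in_keys_iff mult_zero_right)
qed

lemma keys_sumD: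
 assumes "w \<in> keys (\<Sum>i\<in>I. g i)"
 shows "\<exists>i\<in>I. w \<in> keys (g i)"
proof (rule ccontr)
 assume "\<not> ?thesis"
 then show False using assms by (simp add: in_keys_iff lookup_sum)
qed

lemma keys_cst_mult: "keys (cst c * p) \<subseteq> keys p"
 by (auto simp: in_keys_iff lookup_cst)

lemma keys_sign_mult [simp]: "keys ((-1) ^ n * p) = keys (p :: ('x, 'k::comm_ring_1) fa)"
 by (cases "even n") (auto simp: in_keys_iff)

lemma keys_multD:
 assumes "FW w \<in> keys (p * q :: ('x, 'k::comm_ring_1) fa)"
 obtains u v where "FW u \<in> keys p" "FW v \<in> keys q" "w = u @ v"
proof -
 obtain a b where ab: "a \<in> keys p" "b \<in> keys q" "FW w = a + b"
  using keys_mult assms by blast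
 then have "w = fwl a @ fwl b" by (metis fw.sel fwl_plus)
 with ab show thesis using that[of "fwl a" "fwl b"] by simp
qed

lemma lookup_sign_mult: "lookup ((-1) ^ n * p) w = (-1) ^ n * lookup (p :: ('x, 'k::comm_ring_1) fa) w"
 by (metis lookup_cst cst_sign)

definition homog :: "('x \<Rightarrow> nat) \<Rightarrow> nat \<Rightarrow> ('x, 'k::comm_ring_1) fa \<Rightarrow> bool" where
 "homog p d a \<longleftrightarrow> (\<forall>w. FW w \<in> keys a \<longrightarrow> sum_list (map p w) = d)"

lemma homogD: "homog p d a \<Longrightarrow> FW w \<in> keys a \<Longrightarrow> sum_list (map p w) = d"
 by (simp add: homog_def)

lemma homog_mon [simp]: "homog p d (mon w :: ('x, 'k::comm_ring_1) fa) \<longleftrightarrow> sum_list (map p w) = d"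
 by (auto simp: homog_def)

lemma homog_mult:
 "homog p d a \<Longrightarrow> homog p e b \<Longrightarrow> homog p (d + e) (a * b)"
 unfolding homog_def by (metis keys_multD map_append sum_list_append)

lemma homog_prod_list:
 "(\<And>x. x \<in> set w \<Longrightarrow> homog q (p x) (\<phi> x)) \<Longrightarrow>
  homog q (sum_list (map p w)) (prod_list (map \<phi> w) :: ('x, 'k::comm_ring_1) fa)"
proof (induction w)
 case Nil
 then show ?case using homog_mon[of q 0 "[]"] by simp
qed (auto intro: homog_mult)

text \<open>The derivation of degree -1 with the values \<open>\<delta>\<close> on generators \<open>x\<close> of degree \<open>p x\<close>.\<close>

primrec derw :: "('x \<Rightarrow> nat) \<Rightarrow> ('x \<Rightarrow> ('x, 'k::comm_ring_1) fa) \<Rightarrow> 'x list \<Rightarrow> ('x, 'k) fa" where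
 "derw p \<delta> [] = 0"
| "derw p \<delta> (x # w) = \<delta> x * mon w + (-1) ^ p x * (mon [x] * derw p \<delta> w)"

definition der :: "('x \<Rightarrow> nat) \<Rightarrow> ('x \<Rightarrow> ('x, 'k::comm_ring_1) fa) \<Rightarrow> ('x, 'k) fa \<Rightarrow> ('x, 'k) fa" where
 "der p \<delta> = lin (derw p \<delta>)"

lemma sign_left: "p * ((-1) ^ n * q) = (-1) ^ n * (p * (q :: ('x, 'k::comm_ring_1) fa))"
 by (metis cst_left cst_sign)

lemma derw_append:
 "derw p \<delta> (u @ v) = derw p \<delta> u * mon v + (-1) ^ (sum_list (map p u)) * (mon u * derw p \<delta> v)"
proof (induction u)
 case (Cons x u)
 have "derw p \<delta> ((x # u) @ v) = \<delta> x * mon u * mon v + (-1) ^ p x * (mon [x] * (derw p \<delta> u * mon v +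
   (-1) ^ (sum_list (map p u)) * (mon u * derw p \<delta> v)))"
  using Cons by (simp add: mon_append mult.assoc)
 also have "\<dots> = derw p \<delta> (x # u) * mon v +
   (-1) ^ (sum_list (map p (x # u))) * (mon (x # u) * derw p \<delta> v)"
  by (simp add: mon_Cons[of x u] algebra_simps power_add sign_left[of "mon [x]"])
 finally show ?case .
qed simp

lemma der_mon [simp]: "der p \<delta> (mon w) = derw p \<delta> w"
 by (simp add: der_def)

lemma der_gen: "der p \<delta> (mon [x]) = \<delta> x"
 by simp

lemma der_0 [simp]: "der p \<delta> 0 = 0" and der_1 [simp]: "der p \<delta> 1 = 0"
 by (simp_all add: der_def lin_1)

lemma der_simps: "der p \<delta> (a + b) = der p \<delta> a + der p \<delta> b"
 "der p \<delta> (a - b) = der p \<delta> a - der p \<delta> b" "der p \<delta> (- a) = - der p \<delta> a"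
 "der p \<delta> ((-1) ^ n * a) = (-1) ^ n * der p \<delta> a" "der p \<delta> (cst c * a) = cst c * der p \<delta> a"
 "der p \<delta> (\<Sum>i\<in>I. g i) = (\<Sum>i\<in>I. der p \<delta> (g i))"
 by (simp_all add: der_def lin_simps)

text \<open>Only the degree of the left factor enters the sign, so \<open>b\<close> may be
  inhomogeneous. Linearity reduces both factors to words, where this is
  \<open>derw_append\<close>.\<close>

lemma der_mult:
 assumes "homog p d a"
 shows "der p \<delta> (a * b) = der p \<delta> a * b + (-1) ^ d * (a * der p \<delta> b)"
proof -
 have *: "der p \<delta> (mon u * b) = der p \<delta> (mon u) * b + (-1) ^ d * (mon u * der p \<delta> b)"
  if "sum_list (map p u) = d" for u
 proof (induction b rule: fa_induct)
  case (mon w)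
  then show ?case using that derw_append[of p \<delta> u w] by (simp flip: mon_append)
 next
  case (scale c b)
  have "der p \<delta> (mon u * (cst c * b)) = cst c * der p \<delta> (mon u * b)"
   by (simp add: cst_left[of "mon u"] der_simps)
  also have "\<dots> = der p \<delta> (mon u) * (cst c * b) + (-1) ^ d * (mon u * der p \<delta> (cst c * b))"
   unfolding scale by (simp add: distrib_left der_simps cst_left[of "mon u"]
     cst_left[of "derw p \<delta> u"] sign_left[of "cst c"])
  finally show ?case .
 qed (simp_all add: der_simps distrib_left)
 have "homog p d a \<Longrightarrow> der p \<delta> (a * b) = der p \<delta> a * b + (-1) ^ d * (a * der p \<delta> b)"
 proof (rule fa_induct[of a])
  fix w assume "homog p d a" "FW w \<in> keys a"
  then show "der p \<delta> (mon w * b) = der p \<delta> (mon w) * b + (-1) ^ d * (mon w * der p \<delta> b)"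
   using * by (simp add: homog_def)
 next
  fix c a
  assume IH: "der p \<delta> (a * b) = der p \<delta> a * b + (-1) ^ d * (a * der p \<delta> b)"
  have "der p \<delta> (cst c * a * b) = cst c * der p \<delta> (a * b)"
   by (simp add: der_simps mult.assoc)
  also have "\<dots> = der p \<delta> (cst c * a) * b + (-1) ^ d * (cst c * a * der p \<delta> b)"
   unfolding IH by (simp add: distrib_left der_simps mult.assoc sign_left[of "cst c"])
  finally show "der p \<delta> (cst c * a * b) = der p \<delta> (cst c * a) * b + (-1) ^ d * (cst c * a * der p \<delta> b)" .
 qed (simp_all add: der_simps distrib_left distrib_right add_ac)
 then show ?thesis using assms by blast
qed

text \<open>Adding 1 on the left instead of using truncated subtraction forces
  \<open>\<delta>\<close> to vanish on generators of degree 0.\<close>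

definition lowers :: "('x \<Rightarrow> nat) \<Rightarrow> ('x \<Rightarrow> ('x, 'k::comm_ring_1) fa) \<Rightarrow> bool" where
 "lowers p \<delta> \<longleftrightarrow> (\<forall>x w. FW w \<in> keys (\<delta> x) \<longrightarrow> sum_list (map p w) + 1 = p x)"

lemma lowers_homog: "lowers p \<delta> \<Longrightarrow> homog p (p x - 1) (\<delta> x)"
 unfolding lowers_def homog_def by (metis add_diff_cancel_right')

lemma lowers_0: "lowers p \<delta> \<Longrightarrow> p x = 0 \<Longrightarrow> \<delta> x = 0"
proof -
 assume a: "lowers p \<delta>" "p x = 0"
 then have "w \<notin> keys (\<delta> x)" for w
  unfolding lowers_def by (metis add_is_0 fw.collapse one_neq_zero)
 then show ?thesis by (metis keys_eq_empty ex_in_conv)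
qed

lemma derw_sq:
 assumes "lowers p \<delta>" and "\<And>x. x \<in> set w \<Longrightarrow> der p \<delta> (\<delta> x) = 0"
 shows "der p \<delta> (derw p \<delta> w) = 0"
 using assms(2)
proof (induction w)
 case (Cons x w)
 have 1: "der p \<delta> (\<delta> x * mon w) = (-1) ^ (p x - 1) * (\<delta> x * derw p \<delta> w)"
  using der_mult[OF lowers_homog[OF assms(1), of x], of \<delta> "mon w"] Cons by simp
 have 2: "der p \<delta> ((-1) ^ p x * (mon [x] * derw p \<delta> w)) = (-1) ^ p x * (\<delta> x * derw p \<delta> w)"
  using der_mult[of p "p x" "mon [x]" \<delta> "derw p \<delta> w"] Cons by (simp add: der_simps)
 have "(-1) ^ (p x - 1) * (\<delta> x * derw p \<delta> w) + (-1) ^ p x * (\<delta> x * derw p \<delta> w) = 0"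
  using lowers_0[OF assms(1), of x] by (cases "p x") auto
 then show ?case unfolding derw.simps der_simps(1) 1 2 .
qed simp

definition ahom :: "('x \<Rightarrow> ('y, 'k::comm_ring_1) fa) \<Rightarrow> ('x, 'k) fa \<Rightarrow> ('y, 'k) fa" where
 "ahom \<phi> = lin (\<lambda>w. prod_list (map \<phi> w))"

lemma ahom_mon [simp]: "ahom \<phi> (mon w) = prod_list (map \<phi> w)"
 by (simp add: ahom_def)

lemma ahom_simps: "ahom \<phi> 0 = 0" "ahom \<phi> (a + b) = ahom \<phi> a + ahom \<phi> b"
 "ahom \<phi> (a - b) = ahom \<phi> a - ahom \<phi> b" "ahom \<phi> (- a) = - ahom \<phi> a"
 "ahom \<phi> ((-1) ^ n * a) = (-1) ^ n * ahom \<phi> a" "ahom \<phi> (cst c * a) = cst c * ahom \<phi> a"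
 "ahom \<phi> (\<Sum>i\<in>I. g i) = (\<Sum>i\<in>I. ahom \<phi> (g i))"
 by (simp_all add: ahom_def lin_simps)

lemma ahom_mult: "ahom \<phi> (a * b) = ahom \<phi> a * ahom \<phi> b"
proof (induction a rule: fa_induct)
 case (mon u)
 show ?case
  by (induction b rule: fa_induct)
   (simp_all add: ahom_simps cst_left[of "mon u"] cst_left[of "prod_list (map \<phi> u)"]
    distrib_left flip: mon_append)
qed (simp_all add: ahom_simps distrib_right mult.assoc)

text \<open>A graded homomorphism that commutes with derivations on generators commutes with them.\<close>

lemma der_prod_list:
 assumes "\<And>x. x \<in> set w \<Longrightarrow> homog q (p x) (\<phi> x)"
  and "\<And>x. x \<in> set w \<Longrightarrow> der q \<epsilon> (\<phi> x) = ahom \<phi> (\<delta> x)"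
 shows "der q \<epsilon> (prod_list (map \<phi> w)) = ahom \<phi> (derw p \<delta> w)"
 using assms
proof (induction w)
 case (Cons x w)
 then show ?case
  using der_mult[of q "p x" "\<phi> x" \<epsilon> "prod_list (map \<phi> w)"]
  unfolding derw.simps ahom_simps(2) ahom_simps(5) by (simp add: ahom_mult)
qed (simp add: ahom_simps)

lemma der_ahom:
 assumes "\<And>w x. FW w \<in> keys a \<Longrightarrow> x \<in> set w \<Longrightarrow> homog q (p x) (\<phi> x)"
  and "\<And>w x. FW w \<in> keys a \<Longrightarrow> x \<in> set w \<Longrightarrow> der q \<epsilon> (\<phi> x) = ahom \<phi> (\<delta> x)"
 shows "der q \<epsilon> (ahom \<phi> a) = ahom \<phi> (der p \<delta> a)"
proof (rule fa_induct[of a "\<lambda>a. der q \<epsilon> (ahom \<phi> a) = ahom \<phi> (der p \<delta> a)"])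
 show "der q \<epsilon> (ahom \<phi> (mon w)) = ahom \<phi> (der p \<delta> (mon w))" if "FW w \<in> keys a" for w
  using der_prod_list[of w q p \<phi> \<epsilon> \<delta>] assms that by simp
qed (simp_all add: der_simps ahom_simps)

section \<open>Triangular arrays\<close>

text \<open>Infinite matrices whose product only sums over \<open>{k..l}\<close>, so all sums are
  finite and a product vanishes below the diagonal. The ring instance lets
  \<open>algebra_simps\<close> carry out the curvature computations.\<close>

datatype 'r tri = Tri (ent: "nat \<Rightarrow> nat \<Rightarrow> 'r")

instantiation tri :: (ring) ring
begin
definition zero_tri :: "'a tri" where "0 = Tri (\<lambda>k l. 0)"
definition plus_tri :: "'a tri \<Rightarrow> 'a tri \<Rightarrow> 'a tri" where "X + Y = Tri (\<lambda>k l. ent X k l + ent Y k l)"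
definition minus_tri :: "'a tri \<Rightarrow> 'a tri \<Rightarrow> 'a tri" where "X - Y = Tri (\<lambda>k l. ent X k l - ent Y k l)"
definition uminus_tri :: "'a tri \<Rightarrow> 'a tri" where "- X = Tri (\<lambda>k l. - ent X k l)"
definition times_tri :: "'a tri \<Rightarrow> 'a tri \<Rightarrow> 'a tri" where
 "X * Y = Tri (\<lambda>k l. \<Sum>j\<in>{k..l}. ent X k j * ent Y j l)"
instance
proof
 fix X Y Z :: "'a tri"
 have *: "(\<Sum>j=k..l. \<Sum>i=k..j. f i j) = (\<Sum>i=k..l. \<Sum>j=i..l. f i j)" for f :: "nat \<Rightarrow> nat \<Rightarrow> 'a" and k l
  by (subst (1 2) sum.Sigma; (intro sum.reindex_bij_witness[of _ "\<lambda>(i,j). (j,i)" "\<lambda>(i,j). (j,i)"])?) auto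
 have "ent (X * Y * Z) k l = ent (X * (Y * Z)) k l" for k l
  using *[of "\<lambda>i j. ent X k i * ent Y i j * ent Z j l" k l]
  by (simp add: times_tri_def sum_distrib_left sum_distrib_right mult.assoc)
 then show "X * Y * Z = X * (Y * Z)" by (intro tri.expand ext) 
qed (simp_all add: zero_tri_def plus_tri_def minus_tri_def uminus_tri_def times_tri_def
 algebra_simps sum.distrib)
end

lemma ent_simps [simp]: "ent 0 k l = 0" "ent (X + Y) k l = ent X k l + ent Y k l"
 "ent (X - Y) k l = ent X k l - ent Y k l" "ent (- X) k l = - ent X k l"
 by (simp_all add: zero_tri_def plus_tri_def minus_tri_def uminus_tri_def)

lemma ent_mult: "ent (X * Y) k l = (\<Sum>j\<in>{k..l}. ent X k j * ent Y j l)"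
 by (simp add: times_tri_def)

lemma tri_eqI: "(\<And>k l. ent X k l = ent Y k l) \<Longrightarrow> X = Y"
 by (intro tri.expand ext)

definition tshift :: "nat \<Rightarrow> 'r tri \<Rightarrow> 'r tri" where
 "tshift m X = Tri (\<lambda>k l. ent X (k + m) (l + m))"

text \<open>In effect right multiplication by the superdiagonal unit matrix: by
  \<open>mult_cshift\<close> it commutes with left factors, and by \<open>cshift_mult\<close> moving
  it past a right factor replaces that factor by its \<open>tshift 1\<close>.\<close>

definition cshift :: "'r::zero tri \<Rightarrow> 'r tri" where
 "cshift X = Tri (\<lambda>k l. if k < l then ent X k (l - 1) else 0)"

lemma tshift_mult: "tshift m (X * Y) = tshift m X * tshift m (Y :: 'r::ring tri)"
 by (rule tri_eqI) (simp add: tshift_def ent_mult sum.shift_bounds_cl_nat_ivl)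

lemma tshift_diff: "tshift m (X - Y) = tshift m X - tshift m (Y :: 'r::ring tri)"
 by (rule tri_eqI) (simp add: tshift_def)

lemma mult_cshift: "X * cshift Y = cshift (X * (Y :: 'r::ring tri))"
proof (rule tri_eqI)
 fix k l
 show "ent (X * cshift Y) k l = ent (cshift (X * Y)) k l"
 proof (cases "k < l")
  case True
  have "(\<Sum>j\<in>{k..l}. ent X k j * ent (cshift Y) j l) = (\<Sum>j\<in>{k..l - 1}. ent X k j * ent Y j (l - 1))"
   using True by (intro sum.mono_neutral_cong_right) (auto simp: cshift_def)
  then show ?thesis using True by (simp add: cshift_def ent_mult)
 qed (auto simp: cshift_def ent_mult)
qed

lemma cshift_mult: "cshift X * Y = cshift (X * tshift 1 (Y :: 'r::ring tri))"
proof (rule tri_eqI)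
 fix k l
 show "ent (cshift X * Y) k l = ent (cshift (X * tshift 1 Y)) k l"
 proof (cases "k < l")
  case True
  have "(\<Sum>j\<in>{k..l}. ent (cshift X) k j * ent Y j l) = (\<Sum>j\<in>{Suc k..Suc (l - 1)}. ent X k (j - 1) * ent Y j l)"
   using True by (intro sum.mono_neutral_cong_right) (auto simp: cshift_def)
  also have "\<dots> = (\<Sum>j\<in>{k..l - 1}. ent X k j * ent Y (Suc j) l)"
   by (simp only: sum.shift_bounds_cl_Suc_ivl diff_Suc_1)
  finally show ?thesis using True by (simp add: cshift_def ent_mult tshift_def)
 qed (auto simp: cshift_def ent_mult)
qed

lemma cshift_diff: "cshift (X - Y) = cshift X - cshift (Y :: 'r::ring tri)"
 by (rule tri_eqI) (simp add: cshift_def)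

lemma sum_parity_split:
 fixes f :: "nat \<Rightarrow> 'r::comm_monoid_add"
 shows "(\<Sum>d<2 * M. f d) = (\<Sum>m<M. f (2 * m)) + (\<Sum>m<M. f (2 * m + 1))"
 by (induction M) (simp_all add: algebra_simps)

lemma sum_parity_split_Suc:
 fixes f :: "nat \<Rightarrow> 'r::comm_monoid_add"
 shows "(\<Sum>d<2 * M + 1. f d) = (\<Sum>m\<le>M. f (2 * m)) + (\<Sum>m<M. f (2 * m + 1))"
 by (induction M) (simp_all add: algebra_simps)

section \<open>The combinatorics of chains on a path\<close>

text \<open>
 Positions on a path of length \<open>n\<close>: \<open>s x\<close> and \<open>e x\<close> are the start and the end of the first relation
 that starts at position \<open>x\<close> or later. An \<open>e x > n\<close> means that there is none.
\<close>

locale relation_ends =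
 fixes n :: nat and e s :: "nat \<Rightarrow> nat"
 assumes e_mono: "x \<le> y \<Longrightarrow> e x \<le> e y"
  and e_le: "x \<le> n \<Longrightarrow> e x \<le> Suc n"
  and e_gt: "x \<le> n \<Longrightarrow> x < e x"
  and e_out: "x > n \<Longrightarrow> e x = x"
  and s_lt: "e x \<le> n \<Longrightarrow> s x < e x"
  and e_eq_iff: "x \<le> y \<Longrightarrow> y \<le> Suc n \<Longrightarrow> e x = e y \<longleftrightarrow> y \<le> s x"
begin

abbreviation E :: "nat \<Rightarrow> nat \<Rightarrow> nat" where "E m x \<equiv> (e ^^ m) x"

text \<open>The end points of the links of the chain that starts with the arrow at \<open>y\<close>.\<close>

fun t :: "nat \<Rightarrow> nat \<Rightarrow> nat" where
 "t y 0 = y"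
| "t y (Suc 0) = Suc y"
| "t y (Suc (Suc k)) = e (t y k)"

text \<open>Existence of the chain of degree \<open>d\<close> from \<open>y\<close>. Link
  \<open>k + 1\<close> ends with the relation found from \<open>t y k\<close>; the condition says
  that this relation begins inside link \<open>k\<close>, so that link \<open>k + 1\<close> is a
  proper right factor of it.\<close>

definition val :: "nat \<Rightarrow> nat \<Rightarrow> bool" where
 "val y d \<longleftrightarrow> t y (Suc d) \<le> n \<and> (\<forall>k<d. s (t y k) < t y (Suc k))"

lemma e_ge: "x \<le> e x"
 by (cases "x \<le> n") (use e_gt e_out in \<open>force simp: not_le\<close>)+

lemma E_mono: "x \<le> y \<Longrightarrow> E m x \<le> E m y"
 by (induction m) (auto intro: e_mono)

lemma E_ge: "x \<le> E m x"
 by (induction m) (auto intro: order_trans e_ge)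

lemma E_E: "E k (E m x) = E (k + m) x"
 by (simp add: funpow_add)

lemma E_e: "E k (e x) = E (Suc k) x"
 by (simp only: funpow_Suc_right o_apply)

lemma E_mono_exp: "m \<le> k \<Longrightarrow> E m x \<le> E k x"
 using E_ge[of "E m x" "k - m"] by (simp add: E_E)

lemma E_1: "E (Suc 0) x = e x"
 by simp

lemma E_split: "m \<le> k \<Longrightarrow> E k x = E (k - m) (E m x)"
 by (simp add: E_E)

lemma E_lt: "E m x \<le> n \<Longrightarrow> E m x < E (Suc m) x"
 using e_gt by simp

lemma E_less_earlier:
 assumes "E k x < E k y" "m \<le> k" shows "E m x < E m y"
proof (rule ccontr)
 assume "\<not> ?thesis"
 then have "E (k - m) (E m y) \<le> E (k - m) (E m x)" by (intro E_mono[of "E m y" "E m x"]) simp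
 then show False using assms by (simp add: E_E)
qed

lemma t_even [simp]: "t y (2 * m) = E m y"
proof (induction m)
 case (Suc m) then show ?case by (metis t.simps(3) mult_Suc_right add_2_eq_Suc funpow.simps(2) o_apply)
qed simp

lemma t_odd [simp]: "t y (Suc (2 * m)) = E m (Suc y)"
proof (induction m)
 case (Suc m)
 have "t y (Suc (2 * Suc m)) = t y (Suc (Suc (Suc (2 * m))))" by simp
 then show ?case using Suc by (simp del: t_even)
qed simp

lemma t_mono_Suc: "y \<le> n \<Longrightarrow> t y k \<le> t y (Suc k)"
 by (induction y k rule: t.induct) (auto intro: e_mono simp: Suc_le_eq e_gt)

lemma t_mono: "y \<le> n \<Longrightarrow> k \<le> l \<Longrightarrow> t y k \<le> t y l"
 by (rule lift_Suc_mono_le[of "t y"]) (auto simp: t_mono_Suc)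

lemma val_le: "val y d \<Longrightarrow> y < n"
proof -
 assume v: "val y d"
 show ?thesis
 proof (cases "y \<le> n")
  case True
  then show ?thesis using t_mono[of y "Suc 0" "Suc d"] v by (simp add: val_def)
 next
  case False
  have "y \<le> t y (Suc d)"
   by (metis E_ge Suc_leD evenE odd_Suc_minus_one oddE t_even t_odd Suc_eq_plus1)
  then show ?thesis using v False by (simp add: val_def)
 qed
qed

text \<open>By \<open>e_eq_iff\<close> the condition of \<open>val\<close> at \<open>j\<close> says
  that \<open>e\<close> separates two consecutive end points, and their images are the end points
  two steps later.\<close>

lemma t_less: "val y d \<Longrightarrow> j < d \<Longrightarrow> t y (Suc (Suc j)) < t y (Suc (Suc (Suc j)))"
proof -
 assume v: "val y d" and j: "j < d"
 note y = val_le[OF v]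
 have "s (t y j) < t y (Suc j)" using v j by (simp add: val_def)
 moreover have "t y j \<le> t y (Suc j)" "t y (Suc j) \<le> n"
  using t_mono_Suc[of y j] t_mono[of y "Suc j" "Suc d"] y v j by (simp_all add: val_def)
 ultimately have "e (t y j) \<noteq> e (t y (Suc j))" using e_eq_iff by auto
 then show ?thesis using e_mono[OF \<open>t y j \<le> t y (Suc j)\<close>] by simp
qed

lemma t_gt: "y \<le> n \<Longrightarrow> y < t y (Suc k)"
 using t_mono[of y "Suc 0" "Suc k"] by simp

end

text \<open>
 The assumption below holds when the whole path is a chain. Under it, chains of even and odd degree
 starting at \<open>y\<close> are determined by the images under \<open>e\<close> of the arrow from \<open>y\<close> to \<open>y + 1\<close>.
\<close>

locale chain_path = relation_ends +
 assumes good: "E (Suc p) (Suc y) \<le> n \<Longrightarrow> s (E p (Suc y)) < E (Suc p) y"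
begin

text \<open>The conditions at even links say that \<open>E (Suc p)\<close> separates
  \<open>y\<close> and \<open>Suc y\<close>; separation after \<open>m\<close> steps implies it
  after fewer (\<open>E_less_earlier\<close>). The conditions at odd links are supplied by
  \<open>good\<close>.\<close>

lemma val_even: "val y (2 * m) \<longleftrightarrow> E m y < E m (Suc y) \<and> E m (Suc y) \<le> n"
proof
 assume v: "val y (2 * m)"
 note y = val_le[OF v]
 have le: "E m (Suc y) \<le> n" using v by (simp add: val_def)
 have "E m y < E m (Suc y)"
 proof (cases m)
  case (Suc p)
  have "s (E p y) < E p (Suc y)" using v Suc by (auto simp: val_def dest!: spec[of _ "2 * p"])
  moreover have "E p (Suc y) \<le> n" using le E_mono_exp[of p m "Suc y"] Suc by simp
  ultimately have "e (E p y) \<noteq> e (E p (Suc y))"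
   using e_eq_iff[of "E p y" "E p (Suc y)"] E_mono[of y "Suc y" p] by auto
  then show ?thesis using e_mono[OF E_mono[of y "Suc y" p]] Suc by simp
 qed simp
 then show "E m y < E m (Suc y) \<and> E m (Suc y) \<le> n" using le by simp
next
 assume r: "E m y < E m (Suc y) \<and> E m (Suc y) \<le> n"
 have "s (t y k) < t y (Suc k)" if "k < 2 * m" for k
 proof (cases "even k")
  case True
  then obtain p where p: "k = 2 * p" by (auto elim: evenE)
  have "E p (Suc y) \<le> n" "E (Suc p) y < E (Suc p) (Suc y)"
   using r that p E_mono_exp[of p m "Suc y"] E_less_earlier[of m y "Suc y" "Suc p"] by auto
  then show ?thesis using e_eq_iff[of "E p y" "E p (Suc y)"] E_mono[of y "Suc y" p] p by auto
 next
  case False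
  then obtain p where p: "k = Suc (2 * p)" by (auto elim: oddE)
  have "E (Suc p) (Suc y) \<le> n" using r that p E_mono_exp[of "Suc p" m "Suc y"] by simp
  then show ?thesis using good[of p y] p by simp
 qed
 then show "val y (2 * m)" using r by (simp add: val_def)
qed

lemma val_odd: "val y (Suc (2 * m)) \<longleftrightarrow> E (Suc m) y < E (Suc m) (Suc y) \<and> E (Suc m) y \<le> n"
proof
 assume v: "val y (Suc (2 * m))"
 note y = val_le[OF v]
 have le: "E (Suc m) y \<le> n" using v by (simp add: val_def)
 have "s (E m y) < E m (Suc y)" using v by (auto simp: val_def dest!: spec[of _ "2 * m"])
 moreover have "E m (Suc y) \<le> n"
  using t_mono[of y "Suc (2 * m)" "2 * Suc m"] le y unfolding t_even t_odd by simp
 ultimately have "e (E m y) \<noteq> e (E m (Suc y))"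
  using e_eq_iff[of "E m y" "E m (Suc y)"] E_mono[of y "Suc y" m] by auto
 then show "E (Suc m) y < E (Suc m) (Suc y) \<and> E (Suc m) y \<le> n"
  using e_mono[OF E_mono[of y "Suc y" m]] le by simp
next
 assume r: "E (Suc m) y < E (Suc m) (Suc y) \<and> E (Suc m) y \<le> n"
 then have y: "y \<le> n" using E_ge[of y "Suc m"] by simp
 have le: "E m (Suc y) \<le> n"
  using t_mono[of y "Suc (2 * m)" "2 * Suc m"] r y unfolding t_even t_odd by simp
 have "s (t y k) < t y (Suc k)" if "k < Suc (2 * m)" for k
 proof (cases "even k")
  case True
  then obtain p where p: "k = 2 * p" by (auto elim: evenE)
  have "E p (Suc y) \<le> n" "E (Suc p) y < E (Suc p) (Suc y)"
   using r le that p E_mono_exp[of p m "Suc y"] E_less_earlier[of "Suc m" y "Suc y" "Suc p"] by auto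
  then show ?thesis using e_eq_iff[of "E p y" "E p (Suc y)"] E_mono[of y "Suc y" p] p by auto
 next
  case False
  then obtain p where p: "k = Suc (2 * p)" by (auto elim: oddE)
  have "E (Suc p) (Suc y) \<le> n" using le that p E_mono_exp[of "Suc p" m "Suc y"] by simp
  then show ?thesis using good[of p y] p by simp
 qed
 then show "val y (Suc (2 * m))" using r unfolding val_def by (metis mult_Suc_right add_2_eq_Suc t_even)
qed

end

text \<open>
 \<open>C y d\<close> stands for the chain of degree \<open>d\<close> that starts at \<open>y\<close>, and \<open>Wd y z \<tau>\<close> is the sum of all
 factorisations of the path from \<open>y\<close> to \<open>z\<close> into chains of total degree \<open>\<tau>\<close>.
\<close>

locale chain_words = relation_ends +
 fixes C :: "nat \<Rightarrow> nat \<Rightarrow> 'r::ring_1"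
begin

function Wd :: "nat \<Rightarrow> nat \<Rightarrow> nat \<Rightarrow> 'r" where
 "Wd y z \<tau> = (if y = z then (if \<tau> = 0 then 1 else 0) else if y < z \<and> z \<le> n
   then (\<Sum>d\<le>\<tau>. C y d * Wd (t y (Suc d)) z (\<tau> - d)) else 0)"
 by auto
termination
 by (relation "measure (\<lambda>(y, z, \<tau>). z - y)") (use t_gt in \<open>force simp: diff_less_mono2\<close>)+

declare Wd.simps [simp del]

lemma Wd_same: "Wd y y \<tau> = (if \<tau> = 0 then 1 else 0)"
 by (simp add: Wd.simps)

lemma Wd_gt: "z < y \<Longrightarrow> Wd y z \<tau> = 0"
 by (simp add: Wd.simps)

end

text \<open>Chains that do not exist are represented by 0, so that sums over degrees need no side
  conditions. \<open>D_C\<close> lists the factorizations of a chain by their first factor.\<close>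

locale chain_differential = chain_path + chain_words +
 fixes D :: "'a \<Rightarrow> 'a"
 assumes C_0: "\<not> val y d \<Longrightarrow> C y d = 0"
  and D_add: "D (a + b) = D a + D b"
  and D_1: "D 1 = 0"
  and D_mult: "D (C y d * a) = D (C y d) * a + (-1) ^ d * (C y d * D a)"
  and D_C: "val y d \<Longrightarrow> D (C y d) =
   (\<Sum>d'<d. (-1) ^ d' * (C y d' * Wd (t y (Suc d')) (t y (Suc d)) (d - 1 - d')))"
begin

lemma C_even: "C y (2 * m) \<noteq> 0 \<Longrightarrow> E m y < E m (Suc y) \<and> E m (Suc y) \<le> n"
 using C_0 val_even by blast

lemma C_odd: "C y (Suc (2 * m)) \<noteq> 0 \<Longrightarrow> E (Suc m) y < E (Suc m) (Suc y) \<and> E (Suc m) y \<le> n"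
 using C_0 val_odd by blast

lemma D_0: "D 0 = 0"
 using D_add[of 0 0] by simp

lemma D_minus: "D (- a) = - D a"
 using D_add[of a "- a"] D_0 by (simp add: minus_unique)

lemma D_diff: "D (a - b) = D a - D b"
 using D_add[of a "- b"] D_minus by simp

lemma D_sum: "D (\<Sum>i\<in>I. f i) = (\<Sum>i\<in>I. D (f i))"
 by (induction I rule: infinite_finite_induct) (auto simp: D_0 D_add)

lemma le_Suc_E: "y \<le> n \<Longrightarrow> E m (Suc y) \<le> E (Suc m) y"
 using t_mono_Suc[of y "Suc (2 * m)"] t_even[of y "Suc m"] by simp

text \<open>A chain of degree \<open>2 * m\<close> from \<open>y\<close> ends at
  \<open>E m (Suc y)\<close>, one of degree \<open>2 * m + 1\<close> at \<open>E (Suc m) y\<close>: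
  degree costs length, so a short interval carries no words of high degree. The bounds are proved
  together because removing an even first chain leads from the first to either of them.\<close>

lemma Wd_vanish:
 shows "0 < M \<Longrightarrow> E M y \<le> n \<Longrightarrow> 2 * M \<le> \<tau> \<Longrightarrow> Wd y (E M y) \<tau> = 0"
  and "y \<le> x \<Longrightarrow> E M x \<le> n \<Longrightarrow> E M x < E (Suc M) y \<Longrightarrow> 2 * M < \<tau> \<Longrightarrow> Wd y (E M x) \<tau> = 0"
proof (induction "n - y" arbitrary: y M x \<tau> rule: less_induct)
 case less
 have IH1: "Wd y' (E M y') \<tau> = 0" if "y < y'" "0 < M" "E M y' \<le> n" "2 * M \<le> \<tau>" for y' M \<tau>
  using less(1)[of y' M \<tau>] that E_ge[of y' M] by simp
 have IH2: "Wd y' (E M x) \<tau> = 0"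
  if "y < y'" "y' \<le> x" "E M x \<le> n" "E M x < E (Suc M) y'" "2 * M < \<tau>" for y' M x \<tau>
  using less(2)[of y' x M \<tau>] that E_ge[of x M] by simp
 show 1: "Wd y (E M y) \<tau> = 0" if M: "0 < M" "E M y \<le> n" "2 * M \<le> \<tau>" for M \<tau>
 proof -
  define z where "z = E M y"
  have yn: "y \<le> n" using M E_ge[of y M] by simp
  have yz: "y < z" using E_lt[of 0 y] E_mono_exp[of 1 M y] M yn by (simp add: z_def)
  have zn: "z \<le> n" using M by (simp add: z_def)
  have "C y d * Wd (t y (Suc d)) z (\<tau> - d) = 0" if d: "d \<le> \<tau>" for d
  proof (rule ccontr)
   assume nz: "\<not> ?thesis"
   then have Cd: "C y d \<noteq> 0" and Wz: "Wd (t y (Suc d)) z (\<tau> - d) \<noteq> 0" by auto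
   have tz: "t y (Suc d) \<le> z" using Wz Wd_gt not_le by blast
   show False
   proof (cases "even d")
    case True
    then obtain m where m: "d = 2 * m" by (auto elim: evenE)
    let ?y = "E m (Suc y)"
    have nd: "E m y < ?y" and ty: "t y (Suc d) = ?y" using C_even[of y m] Cd m by auto
    have yy: "y < ?y" using E_ge[of "Suc y" m] by simp
    have mM: "m < M"
    proof (rule ccontr)
     assume "\<not> m < M"
     then have "z \<le> E m y" using E_mono_exp[of M m y] by (simp add: z_def)
     then show False using nd tz ty by simp
    qed
    show False
    \<comment> \<open>If \<open>E M\<close> identifies \<open>y\<close> and \<open>Suc y\<close>,
      the rest again ends at an iterate of its own start; otherwise it stops short of that iterate
      and the second bound applies.\<close>
    proof (cases "E M (Suc y) = z")
     case True
     then have "z = E (M - m) ?y" using mM E_split[of m M "Suc y"] by simp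
     moreover have "2 * (M - m) \<le> \<tau> - d" using M(3) m by linarith
     ultimately show False using IH1[of ?y "M - m" "\<tau> - d"] Wz ty yy mM zn by simp
    next
     case False
     then have "z < E M (Suc y)" using E_mono[of y "Suc y" M] by (simp add: z_def)
     moreover have "z = E (M - m - 1) (E (Suc m) y)" "E M (Suc y) = E (Suc (M - m - 1)) ?y"
      using mM E_split[of "Suc m" M y] E_split[of m M "Suc y"] by (simp_all add: z_def Suc_diff_Suc del: funpow.simps)
     moreover have "2 * (M - m - 1) < \<tau> - d" using M(3) m mM by linarith
     ultimately show False
      using IH2[of ?y "E (Suc m) y" "M - m - 1" "\<tau> - d"] yy le_Suc_E[OF yn, of m] zn Wz ty
      by simp
    qed
   next
    case False
    then obtain m where m: "d = Suc (2 * m)" by (auto elim: oddE)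
    let ?y = "E (Suc m) y"
    have ty: "t y (Suc d) = ?y" using m t_even[of y "Suc m"] by simp
    have yy: "y < ?y" using E_lt[of 0 y] E_mono_exp[of 1 "Suc m" y] yn by simp
    consider "M < Suc m" | "M = Suc m" | "Suc m < M" by linarith
    then show False
    proof cases
     case 1
     then have "E (Suc M) y \<le> ?y" by (intro E_mono_exp) simp
     then show False using E_lt[of M y] M tz ty by (simp add: z_def)
    next
     case 2
     then show False using Wz ty Wd_same[of z "\<tau> - d"] M m by (simp add: z_def split: if_splits)
    next
     case 3
     then have "z = E (M - Suc m) ?y" using E_split[of "Suc m" M y] by (simp add: z_def)
     moreover have "2 * (M - Suc m) \<le> \<tau> - d" using M(3) m by linarith
     ultimately show False using IH1[of ?y "M - Suc m" "\<tau> - d"] Wz ty yy 3 zn by simp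
    qed
   qed
  qed
  then have "Wd y z \<tau> = 0" using yz by (simp add: Wd.simps[of y])
  then show ?thesis by (simp add: z_def)
 qed
 show "Wd y (E M x) \<tau> = 0" if h: "y \<le> x" "E M x \<le> n" "E M x < E (Suc M) y" "2 * M < \<tau>" for M x \<tau>
 proof (cases "y = x")
  case True
  show ?thesis
  proof (cases M)
   case 0 then show ?thesis using True h by (simp add: Wd_same)
  next
   case (Suc m) then show ?thesis using 1[of M \<tau>] True h by simp
  qed
 next
  case False
  define z where "z = E M x"
  have yx: "y < x" and zn: "z \<le> n" using False h by (auto simp: z_def)
  have yz: "y < z" using yx E_ge[of x M] by (simp add: z_def)
  have yn: "y \<le> n" using yz zn by simp
  have "C y d * Wd (t y (Suc d)) z (\<tau> - d) = 0" if d: "d \<le> \<tau>" for d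
  proof (rule ccontr)
   assume nz: "\<not> ?thesis"
   then have Cd: "C y d \<noteq> 0" and Wz: "Wd (t y (Suc d)) z (\<tau> - d) \<noteq> 0" by auto
   have tz: "t y (Suc d) \<le> z" using Wz Wd_gt not_le by blast
   show False
   proof (cases "even d")
    case True
    then obtain m where m: "d = 2 * m" by (auto elim: evenE)
    let ?y = "E m (Suc y)"
    have nd: "E m y < ?y" and ty: "t y (Suc d) = ?y" using C_even[of y m] Cd m by auto
    have yy: "y < ?y" using E_ge[of "Suc y" m] by simp
    have mM: "m \<le> M"
    proof (rule ccontr)
     assume "\<not> m \<le> M"
     then have "E (Suc M) y \<le> E m y" by (intro E_mono_exp) simp
     then show False using nd tz ty h by (simp add: z_def)
    qed
    have "z = E (M - m) (E m x)" "E (Suc M) (Suc y) = E (Suc (M - m)) ?y"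
     using mM E_split[of m M x] E_split[of m "Suc M" "Suc y"] by (simp_all add: z_def Suc_diff_le del: funpow.simps)
    moreover have "E (Suc M) y \<le> E (Suc M) (Suc y)" by (rule E_mono) simp
    moreover have "?y \<le> E m x" using yx by (intro E_mono) simp
    moreover have "2 * (M - m) < \<tau> - d" using h(4) m mM by linarith
    ultimately show False
     using IH2[of ?y "E m x" "M - m" "\<tau> - d"] yy zn h(3) Wz ty by (simp add: z_def)
   next
    case False
    then obtain m where m: "d = Suc (2 * m)" by (auto elim: oddE)
    let ?y = "E (Suc m) y"
    have ty: "t y (Suc d) = ?y" using m t_even[of y "Suc m"] by simp
    have yy: "y < ?y" using E_lt[of 0 y] E_mono_exp[of 1 "Suc m" y] yn by simp
    have mM: "m < M"
    proof (rule ccontr)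
     assume "\<not> m < M"
     then have "E (Suc M) y \<le> ?y" by (intro E_mono_exp) simp
     then show False using tz ty h by (simp add: z_def)
    qed
    have "z = E (M - Suc m) (E (Suc m) x)" "E (Suc M) y = E (Suc (M - Suc m)) ?y"
     using mM E_split[of "Suc m" M x] E_split[of "Suc m" "Suc M" y] by (simp_all add: z_def Suc_diff_Suc del: funpow.simps)
    moreover have "?y \<le> E (Suc m) x" using yx by (intro E_mono) simp
    moreover have "2 * (M - Suc m) < \<tau> - d" using h(4) m mM by linarith
    ultimately show False
     using IH2[of ?y "E (Suc m) x" "M - Suc m" "\<tau> - d"] yy zn h(3) Wz ty by (simp add: z_def)
   qed
  qed
  then have "Wd y z \<tau> = 0" using yz by (simp add: Wd.simps[of y])
  then show ?thesis by (simp add: z_def)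
 qed
qed

end

section \<open>Parallel transport along the iterates of \<open>e\<close>\<close>

context chain_differential
begin

text \<open>
 \<open>Pf M y x\<close> is the sum of the words of even chains from \<open>y\<close> to \<open>E M x\<close> of total degree \<open>2 M\<close>.
 It behaves like a path from \<open>y\<close> to \<open>x\<close> transported along the map \<open>e\<close>: the arrays \<open>PP\<close> collecting
 all these sums are multiplicative, and the arrays \<open>QQ\<close> of words of odd degree are a connection for
 which the \<open>PP\<close> are parallel and whose curvature is given by the relations (\<open>D_PP\<close> and \<open>D_QQ\<close>).
\<close>

function Pf :: "nat \<Rightarrow> nat \<Rightarrow> nat \<Rightarrow> 'a" where
 "Pf M y x = (if y = x then (if M = 0 then 1 else 0) else if y < x
   then (\<Sum>m\<le>M. C y (2 * m) * Pf (M - m) (E m (Suc y)) (E m x)) else 0)"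
 by auto
termination
\<comment> \<open>A first letter of positive degree lowers \<open>M\<close>; for
  \<open>m = 0\<close> the start moves one step and \<open>x - y\<close> drops.\<close>
proof (relation "measures [\<lambda>(M, y, x). M, \<lambda>(M, y, x). x - y]")
 fix M y x m :: nat
 assume "\<not> y = x" "y < x" "m \<in> {..M}"
 then show "((M - m, E m (Suc y), E m x), M, y, x) \<in> measures [\<lambda>(M, y, x). M, \<lambda>(M, y, x). x - y]"
  by (cases "m = 0") auto
qed simp

declare Pf.simps [simp del]

text \<open>\<open>Suc (2 * M)\<close> is the largest degree that \<open>Wd_vanish\<close> admits
  between these end points.\<close>

abbreviation Q :: "nat \<Rightarrow> nat \<Rightarrow> 'a" where "Q M y \<equiv> Wd y (E (Suc M) y) (Suc (2 * M))"

lemma Pf_same: "Pf M y y = (if M = 0 then 1 else 0)"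
 by (simp add: Pf.simps)

lemma Pf_less: "y < x \<Longrightarrow> Pf M y x = (\<Sum>m\<le>M. C y (2 * m) * Pf (M - m) (E m (Suc y)) (E m x))"
 by (simp add: Pf.simps[of M y])

text \<open>The induction that follows the recursion of \<open>Pf\<close>.\<close>

lemma pair_induct [consumes 1, case_names same less]:
 assumes "y \<le> x" "\<And>M y. P M y y"
  "\<And>M y x. y < x \<Longrightarrow> (\<And>m. m \<le> M \<Longrightarrow> P (M - m) (E m (Suc y)) (E m x)) \<Longrightarrow> P M y x"
 shows "P M y x"
 using assms(1)
proof (induction M arbitrary: y x rule: less_induct)
 case (less M)
 note IH = less.IH
 show ?case using less.prems
 proof (induction "x - y" arbitrary: y rule: less_induct)
  case less
  show ?case
  proof (cases "y = x")
   case False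
   then have "y < x" using less.prems by simp
   show ?thesis
   proof (rule assms(3)[OF \<open>y < x\<close>])
    fix m assume "m \<le> M"
    show "P (M - m) (E m (Suc y)) (E m x)"
    proof (cases "m = 0")
     case True then show ?thesis using less.hyps[of "Suc y"] \<open>y < x\<close> by simp
    next
     case False
     then show ?thesis using IH[of "M - m"] \<open>m \<le> M\<close> \<open>y < x\<close> by (simp add: E_mono)
    qed
   qed
  qed (simp add: assms(2))
 qed
qed

text \<open>The degree is maximal here: an odd first chain would leave a rest above the bound of
  \<open>Wd_vanish\<close>. Only even letters remain, and the recursion of \<open>Wd\<close> becomes
  that of \<open>Pf\<close>.\<close>

lemma Wd_even:
 "y \<le> x \<Longrightarrow> E M x \<le> n \<Longrightarrow> E M x < E (Suc M) y \<Longrightarrow> Wd y (E M x) (2 * M) = Pf M y x"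
proof (induction "n - y" arbitrary: y x M rule: less_induct)
 case less
 show ?case
 proof (cases "y = x")
  case True
  then show ?thesis using Wd_vanish(1)[of M y "2 * M"] less.prems
   by (cases "M = 0") (simp_all add: Wd_same Pf_same)
 next
  case False
  then have yx: "y < x" using less.prems by simp
  have yz: "y < E M x" using yx E_ge[of x M] by simp
  have ev: "Wd (E m (Suc y)) (E M x) (2 * M - 2 * m) = Pf (M - m) (E m (Suc y)) (E m x)" if "m \<le> M" for m
  proof -
   have "E (Suc M) y \<le> E (Suc M) (Suc y)" by (rule E_mono) simp
   moreover have "E (Suc (M - m)) (E m (Suc y)) = E (Suc M) (Suc y)" "E (M - m) (E m x) = E M x"
    unfolding E_E using that by auto
   moreover have "n - E m (Suc y) < n - y" using yz less.prems(2) E_ge[of "Suc y" m] by simp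
   moreover have "E m (Suc y) \<le> E m x" using yx by (intro E_mono) simp
   moreover have "2 * M - 2 * m = 2 * (M - m)" by simp
   ultimately show ?thesis using less.hyps[of "E m (Suc y)" "E m x" "M - m"] less.prems
    by (metis order_less_le_trans)
  qed
  have od: "Wd (E (Suc m) y) (E M x) (2 * M - (2 * m + 1)) = 0" if "m < M" for m
  proof -
   have "E (Suc (M - Suc m)) (E (Suc m) y) = E (Suc M) y" "E (M - Suc m) (E (Suc m) x) = E M x"
    unfolding E_E using that by auto
   moreover have "E (Suc m) y \<le> E (Suc m) x" using yx by (intro E_mono) simp
   moreover have "2 * (M - Suc m) < 2 * M - (2 * m + 1)" using that by simp
   ultimately show ?thesis
    using Wd_vanish(2)[of "E (Suc m) y" "E (Suc m) x" "M - Suc m" "2 * M - (2 * m + 1)"] less.prems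
    by metis
  qed
  have "Wd y (E M x) (2 * M) = (\<Sum>d<2 * M + 1. C y d * Wd (t y (Suc d)) (E M x) (2 * M - d))"
   using yz less.prems(2) by (simp add: Wd.simps[of y] lessThan_Suc_atMost)
  also have "\<dots> = (\<Sum>m\<le>M. C y (2 * m) * Wd (E m (Suc y)) (E M x) (2 * M - 2 * m))
    + (\<Sum>m<M. C y (2 * m + 1) * Wd (E (Suc m) y) (E M x) (2 * M - (2 * m + 1)))"
   unfolding sum_parity_split_Suc by simp
  also have "\<dots> = (\<Sum>m\<le>M. C y (2 * m) * Pf (M - m) (E m (Suc y)) (E m x))"
   using ev od by simp
  finally show ?thesis using yx by (simp add: Pf_less)
 qed
qed

text \<open>An odd first chain that stops before the end leaves too much degree for the rest, so the
  only odd one is the chain covering the whole interval.\<close>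

lemma Q_expand:
 assumes "E (Suc M) y \<le> n"
 shows "Q M y = (\<Sum>m\<le>M. C y (2 * m) * Wd (E m (Suc y)) (E (Suc M) y) (Suc (2 * (M - m)))) + C y (2 * M + 1)"
proof -
 have yn: "y \<le> n" using assms E_ge[of y "Suc M"] by simp
 have yz: "y < E (Suc M) y" using E_lt[of 0 y] E_mono_exp[of 1 "Suc M" y] yn by simp
 have "Q M y = (\<Sum>d<2 * Suc M. C y d * Wd (t y (Suc d)) (E (Suc M) y) (Suc (2 * M) - d))"
  using yz assms by (simp add: Wd.simps[of y] lessThan_Suc_atMost)
 also have "\<dots> = (\<Sum>m<Suc M. C y (2 * m) * Wd (E m (Suc y)) (E (Suc M) y) (Suc (2 * M) - 2 * m))
   + (\<Sum>m<Suc M. C y (2 * m + 1) * Wd (E (Suc m) y) (E (Suc M) y) (Suc (2 * M) - (2 * m + 1)))"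
  unfolding sum_parity_split by simp
 also have "(\<Sum>m<Suc M. C y (2 * m + 1) * Wd (E (Suc m) y) (E (Suc M) y) (Suc (2 * M) - (2 * m + 1)))
   = C y (2 * M + 1)"
 proof -
  have "Wd (E (Suc m) y) (E (Suc M) y) (Suc (2 * M) - (2 * m + 1)) = 0" if "m < M" for m
  proof -
   have "E (M - m) (E (Suc m) y) = E (Suc M) y" unfolding E_E using that by simp
   then show ?thesis
    using Wd_vanish(1)[of "M - m" "E (Suc m) y" "Suc (2 * M) - (2 * m + 1)"] assms that by simp
  qed
  then show ?thesis by (simp add: Wd_same)
 qed
 also have "(\<Sum>m<Suc M. C y (2 * m) * Wd (E m (Suc y)) (E (Suc M) y) (Suc (2 * M) - 2 * m)) =
   (\<Sum>m\<le>M. C y (2 * m) * Wd (E m (Suc y)) (E (Suc M) y) (Suc (2 * (M - m))))"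
  by (intro sum.cong) (auto simp: Suc_diff_le diff_mult_distrib2)
 finally show ?thesis .
qed

text \<open>When \<open>E (Suc M)\<close> separates \<open>y\<close> and \<open>Suc y\<close>, an
  even first chain also leaves a rest above the degree bound, and the one-letter word is all that
  survives.\<close>

lemma Q_nondeg:
 assumes "E (Suc M) y \<le> n" "E (Suc M) y < E (Suc M) (Suc y)"
 shows "Q M y = C y (Suc (2 * M))"
proof -
 have "C y (2 * m) * Wd (E m (Suc y)) (E (Suc M) y) (Suc (2 * (M - m))) = 0" if m: "m \<le> M" for m
 proof -
  have "E (M - m) (E (Suc m) y) = E (Suc M) y" "E (Suc (M - m)) (E m (Suc y)) = E (Suc M) (Suc y)"
   unfolding E_E using m by auto
  moreover have "E m (Suc y) \<le> E (Suc m) y"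
   using assms(1) E_ge[of y "Suc M"] by (intro le_Suc_E) simp
  ultimately show ?thesis
   using Wd_vanish(2)[of "E m (Suc y)" "E (Suc m) y" "M - m" "Suc (2 * (M - m))"] assms
   by (simp del: funpow.simps)
 qed
 then show ?thesis using Q_expand[OF assms(1)] by simp
qed

text \<open>Without separation the one-letter word is absent, since its chain does not exist, and
  the rests are again of maximal degree.\<close>

lemma Q_deg:
 assumes "E (Suc M) y \<le> n" "E (Suc M) y = E (Suc M) (Suc y)"
 shows "Q M y = (\<Sum>m\<le>M. C y (2 * m) * Q (M - m) (E m (Suc y)))"
proof -
 have "C y (2 * M + 1) = 0" using C_odd[of y M] assms(2) by force
 moreover have "E (Suc (M - m)) (E m (Suc y)) = E (Suc M) y" if "m \<le> M" for m
  unfolding E_E assms(2) using that by simp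
 ultimately show ?thesis using Q_expand[OF assms(1)] by simp
qed

text \<open>Entry \<open>(k, l)\<close> holds the even words from \<open>E k y\<close> to
  \<open>E l x\<close>, of degree \<open>2 * (l - k)\<close>. With this indexing the array product
  concatenates words. In \<open>QQ\<close> the degree is one less and both ends come from the same
  position.\<close>

definition PP :: "nat \<Rightarrow> nat \<Rightarrow> 'a tri" where
 "PP y x = Tri (\<lambda>k l. if k \<le> l \<and> E l x \<le> n then Pf (l - k) (E k y) (E k x) else 0)"

definition QQ :: "nat \<Rightarrow> 'a tri" where
 "QQ x = Tri (\<lambda>k l. if k < l \<and> E l x \<le> n then Q (l - k - 1) (E k x) else 0)"

text \<open>The curvature: transport around the step from \<open>x\<close> to \<open>e x\<close>,
  with the column moved by one because \<open>E (l - 1) (e x)\<close> is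
  \<open>E l x\<close>.\<close>

definition RR :: "nat \<Rightarrow> 'a tri" where "RR x = cshift (PP x (e x))"

text \<open>The row of possible first letters. It turns the recursion of \<open>Pf\<close> into a
  product of arrays (\<open>PP_row\<close>), whose other factor is open to the induction
  hypothesis.\<close>

definition AA :: "nat \<Rightarrow> 'a tri" where "AA y = Tri (\<lambda>k l. if k = 0 then C y (2 * l) else 0)"

definition Dt :: "'a tri \<Rightarrow> 'a tri" where "Dt X = Tri (\<lambda>k l. D (ent X k l))"

lemma tshift_PP [simp]: "tshift k (PP y x) = PP (E k y) (E k x)"
 by (rule tri_eqI) (simp add: tshift_def PP_def E_E)

lemma tshift_QQ [simp]: "tshift k (QQ x) = QQ (E k x)"
proof (rule tri_eqI)
 fix i j
 have "E (Suc (j - Suc i)) (E (i + k) x) = E (Suc (j - Suc i)) (E i (E k x))" by (simp only: E_E)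
 then show "ent (tshift k (QQ x)) i j = ent (QQ (E k x)) i j" by (simp add: tshift_def QQ_def E_E)
qed

lemma tshift_RR [simp]: "tshift k (RR x) = RR (E k x)"
proof -
 have "tshift k (cshift X) = cshift (tshift k X)" for X :: "'a tri"
  by (rule tri_eqI) (auto simp: tshift_def cshift_def)
 then show ?thesis by (simp add: RR_def funpow_swap1)
qed

lemma ent_shift: "j \<le> M \<Longrightarrow> ent X j M = ent (tshift j X) 0 (M - j)"
 by (simp add: tshift_def)

lemma row_cong:
 "(\<And>j. j \<le> M \<Longrightarrow> ent X 0 j = ent X' 0 j) \<Longrightarrow> (\<And>j. j \<le> M \<Longrightarrow> ent Y j M = ent Y' j M) \<Longrightarrow>
  ent (X * Y) 0 M = ent (X' * Y') 0 M"
 unfolding ent_mult by (intro sum.cong) auto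

lemma PP_same_mult:
 "ent (PP y y * X) k l = (if k \<le> l \<and> E k y \<le> n then ent X k l else 0)"
 "ent (X * PP y y) k l = (if k \<le> l \<and> E l y \<le> n then ent X k l else 0)"
proof -
 have id: "ent (PP y y) k j = (if k = j \<and> E k y \<le> n then 1 else 0)" for k j
  by (auto simp: PP_def Pf_same)
 have "ent (PP y y * X) k l = (\<Sum>j=k..l. if k = j then (if E k y \<le> n then ent X j l else 0) else 0)"
  unfolding ent_mult by (intro sum.cong refl) (simp add: id)
 then show "ent (PP y y * X) k l = (if k \<le> l \<and> E k y \<le> n then ent X k l else 0)" by simp
 have "ent (X * PP y y) k l = (\<Sum>j=k..l. if j = l then (if E l y \<le> n then ent X k j else 0) else 0)"
  unfolding ent_mult by (intro sum.cong refl) (simp add: id)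
 then show "ent (X * PP y y) k l = (if k \<le> l \<and> E l y \<le> n then ent X k l else 0)" by simp
qed

lemma PP_id_left:
 assumes "y \<le> x" shows "PP y y * PP y x = PP y x" "PP y y * QQ y = QQ y"
proof -
 have le: "E k y \<le> n" if "k \<le> l" "E l x \<le> n" "y \<le> x" for k l y x
  using E_mono_exp[OF that(1), of x] E_mono[OF that(3), of k] that(2) by linarith
 show "PP y y * PP y x = PP y x"
 proof (rule tri_eqI)
  show "ent (PP y y * PP y x) k l = ent (PP y x) k l" for k l
   unfolding PP_same_mult using le[of k l x y] assms by (auto simp: PP_def)
 qed
 show "PP y y * QQ y = QQ y"
 proof (rule tri_eqI)
  show "ent (PP y y * QQ y) k l = ent (QQ y) k l" for k l
   unfolding PP_same_mult using le[of k l y y] by (auto simp: QQ_def)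
 qed
qed

lemma QQ_PP_id: "QQ y * PP y y = QQ y"
 by (rule tri_eqI) (auto simp: PP_same_mult QQ_def)

lemma PP_row: "y < x \<Longrightarrow> ent (PP y x) 0 M = ent (AA y * PP (Suc y) x) 0 M"
 by (simp add: ent_mult AA_def PP_def Pf_less atLeast0AtMost)

lemma PP_Suc: "ent (PP y (Suc y)) 0 M = C y (2 * M)"
proof -
 have "Pf M y (Suc y) = (\<Sum>m\<le>M. if m = M then C y (2 * m) else 0)"
  unfolding Pf_less[OF lessI] by (intro sum.cong) (auto simp: Pf_same)
 then show ?thesis using C_even[of y M] by (auto simp: PP_def)
qed

text \<open>\<open>tshift k\<close> brings row \<open>k\<close> to row 0, and all arrays in use are
  mapped by it to arrays of the same kind, so computing the first row is enough.\<close>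

lemma tri_eq_rowsI:
 assumes "\<And>k M. ent (tshift k X) 0 M = ent (tshift k Y) 0 M" "\<And>k l. l < k \<Longrightarrow> ent X k l = ent Y k l"
 shows "X = Y"
proof (rule tri_eqI)
 show "ent X k l = ent Y k l" for k l
  using assms(2)[of l k] assms(1)[of k "l - k"] by (cases "l < k") (auto simp: tshift_def)
qed

text \<open>\<open>PP_row\<close> peels off the first letter, associativity moves it aside, and the
  induction hypothesis is applied to each entry of the remaining column.\<close>

lemma PP_mult_row:
 "y \<le> x \<Longrightarrow> x \<le> z \<Longrightarrow> ent (PP y x * PP x z) 0 M = ent (PP y z) 0 M"
proof (induction M y x arbitrary: z rule: pair_induct)
 case (same M y)
 then show ?case by (simp add: PP_id_left)
next
 case (less M y x)
 have "ent (PP y x * PP x z) 0 M = ent (AA y * PP (Suc y) x * PP x z) 0 M"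
  using less by (intro row_cong PP_row) auto
 also have "\<dots> = ent (AA y * (PP (Suc y) x * PP x z)) 0 M" by (simp add: mult.assoc)
 also have "\<dots> = ent (AA y * PP (Suc y) z) 0 M"
 proof (rule row_cong)
  fix j assume j: "j \<le> M"
  have "ent (PP (E j (Suc y)) (E j x) * PP (E j x) (E j z)) 0 (M - j) = ent (PP (E j (Suc y)) (E j z)) 0 (M - j)"
   using less j by (intro less.IH) (auto intro: E_mono)
  then show "ent (PP (Suc y) x * PP x z) j M = ent (PP (Suc y) z) j M"
   by (simp add: ent_shift[OF j] tshift_mult)
 qed simp
 also have "\<dots> = ent (PP y z) 0 M" using less by (simp add: PP_row)
 finally show ?case .
qed

lemma PP_mult:
 assumes "y \<le> x" "x \<le> z" shows "PP y x * PP x z = PP y z"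
proof (rule tri_eq_rowsI)
 show "ent (tshift k (PP y x * PP x z)) 0 M = ent (tshift k (PP y z)) 0 M" for k M
  using PP_mult_row assms by (simp add: tshift_mult E_mono)
qed (simp add: ent_mult PP_def)

text \<open>A first letter of degree \<open>2 * M\<close> would need \<open>E M\<close> to separate
  \<open>y\<close> and \<open>Suc y\<close>; any smaller one leaves the same degenerate
  situation.\<close>

lemma Pf_deg: "y \<le> x \<Longrightarrow> 0 < M \<Longrightarrow> E M y = E M x \<Longrightarrow> Pf M y x = 0"
proof (induction M y x rule: pair_induct)
 case (less M y x)
 have sq: "E M (Suc y) = E M x" "E M y = E M (Suc y)"
  using E_mono[of y "Suc y" M] E_mono[of "Suc y" x M] less by auto
 have "C y (2 * m) * Pf (M - m) (E m (Suc y)) (E m x) = 0" if m: "m \<le> M" for m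
 proof (cases "m = M")
  case True then show ?thesis using C_even[of y M] sq by force
 next
  case False
  have "E (M - m) (E m (Suc y)) = E (M - m) (E m x)" unfolding E_E using m sq by simp
  then show ?thesis using less.IH[OF m] m False by simp
 qed
 then show ?case using less by (simp add: Pf_less)
qed (simp add: Pf_same)

lemma ent_QQ: "E (Suc M) x \<le> n \<Longrightarrow> ent (QQ x) 0 (Suc M) = Q M x"
 by (simp add: QQ_def)

lemma QQ_row:
 assumes "E (Suc M) y = E (Suc M) (Suc y)"
 shows "ent (QQ y) 0 (Suc M) = ent (AA y * QQ (Suc y)) 0 (Suc M)"
proof (cases "E (Suc M) y \<le> n")
 case True
 have "ent (AA y * QQ (Suc y)) 0 (Suc M) = (\<Sum>j\<le>M. C y (2 * j) * Q (M - j) (E j (Suc y)))"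
  using True assms by (simp add: ent_mult AA_def atLeast0AtMost QQ_def)
 then show ?thesis using Q_deg[OF True assms] ent_QQ[OF True] by simp
next
 case False
 then show ?thesis using assms by (simp add: ent_mult QQ_def)
qed

text \<open>Positions that \<open>E (Suc K)\<close> identifies have the same odd words up to
  transport. This handles the degenerate case of the curvature equation.\<close>

lemma QQ_PP_QQ:
 "y \<le> x \<Longrightarrow> E (Suc K) y = E (Suc K) x \<Longrightarrow> ent (QQ y) 0 (Suc K) = ent (PP y x * QQ x) 0 (Suc K)"
proof (induction K y x rule: pair_induct)
 case (same K y) then show ?case by (simp add: PP_id_left(2)[OF order_refl])
next
 case (less K y x)
 have sq: "E (Suc K) (Suc y) = E (Suc K) x" "E (Suc K) y = E (Suc K) (Suc y)"
  using E_mono[of y "Suc y" "Suc K"] E_mono[of "Suc y" x "Suc K"] less.hyps less.prems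
  by (auto simp del: funpow.simps)
 have "ent (QQ y) 0 (Suc K) = ent (AA y * QQ (Suc y)) 0 (Suc K)" by (rule QQ_row[OF sq(2)])
 also have "\<dots> = ent (AA y * (PP (Suc y) x * QQ x)) 0 (Suc K)"
 proof (rule row_cong)
  fix j assume j: "j \<le> Suc K"
  show "ent (QQ (Suc y)) j (Suc K) = ent (PP (Suc y) x * QQ x) j (Suc K)"
  proof (cases "j = Suc K")
   case True then show ?thesis by (simp add: ent_mult QQ_def)
  next
   case False
   then have j': "j \<le> K" using j by simp
   have "E (Suc (K - j)) (E j (Suc y)) = E (Suc (K - j)) (E j x)" unfolding E_E using j' sq by simp
   then have "ent (QQ (E j (Suc y))) 0 (Suc (K - j)) = ent (PP (E j (Suc y)) (E j x) * QQ (E j x)) 0 (Suc (K - j))"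
    by (rule less.IH[OF j'])
   then show ?thesis using j' by (simp add: ent_shift[OF j] tshift_mult Suc_diff_le)
  qed
 qed simp
 also have "\<dots> = ent (AA y * PP (Suc y) x * QQ x) 0 (Suc K)" by (simp add: mult.assoc)
 also have "\<dots> = ent (PP y x * QQ x) 0 (Suc K)"
  using less by (intro row_cong PP_row[symmetric]) auto
 finally show ?case .
qed

lemma ent_PP_QQ:
 assumes "E M (Suc y) \<le> n"
 shows "ent (PP y (Suc y) * QQ (Suc y)) 0 M = (\<Sum>j<M. C y (2 * j) * Q (M - Suc j) (E j (Suc y)))"
proof -
 have "ent (PP y (Suc y) * QQ (Suc y)) 0 M = (\<Sum>j\<in>{0..M}. C y (2 * j) * ent (QQ (Suc y)) j M)"
  by (simp add: ent_mult PP_Suc)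
 also have "\<dots> = (\<Sum>j<M. C y (2 * j) * Q (M - Suc j) (E j (Suc y)))"
  using assms by (intro sum.mono_neutral_cong_right) (auto simp: QQ_def)
 finally show ?thesis .
qed

lemma ent_QQ_mult:
 assumes "E M y \<le> n"
 shows "ent (QQ y * X) 0 M = (\<Sum>i<M. Q i y * ent X (Suc i) M)"
proof -
 have "ent (QQ y * X) 0 M = (\<Sum>j\<in>{0..M}. ent (QQ y) 0 j * ent X j M)" by (simp add: ent_mult)
 also have "\<dots> = (\<Sum>j\<in>Suc ` {..<M}. ent (QQ y) 0 j * ent X j M)"
  by (intro sum.mono_neutral_right) (auto simp: QQ_def image_iff gr0_conv_Suc Suc_le_eq)
 also have "\<dots> = (\<Sum>i<M. Q i y * ent X (Suc i) M)"
 proof (subst sum.reindex; simp del: funpow.simps)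
  show "(\<Sum>i<M. ent (QQ y) 0 (Suc i) * ent X (Suc i) M) = (\<Sum>i<M. Q i y * ent X (Suc i) M)"
  proof (rule sum.cong)
   fix i assume "i \<in> {..<M}"
   then have "E (Suc i) y \<le> n" using assms E_mono_exp[of "Suc i" M y] by simp
   then show "ent (QQ y) 0 (Suc i) * ent X (Suc i) M = Q i y * ent X (Suc i) M" by (simp add: ent_QQ)
  qed simp
 qed
 finally show ?thesis .
qed

text \<open>The terms of \<open>D_C\<close> are sorted by the parity of the first factor: an even
  one is followed by a word counted by \<open>Q\<close>, an odd one is itself \<open>Q m y\<close>
  by \<open>Q_nondeg\<close> and is followed by even words.\<close>

lemma D_C_even:
 assumes "E M (Suc y) \<le> n"
 shows "D (C y (2 * M)) = ent (PP y (Suc y) * QQ (Suc y) - QQ y * PP y (Suc y)) 0 M"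
proof -
 let ?x = "Suc y"
 have My: "E M y \<le> n" using assms E_mono[of y ?x M] by simp
 have rhs: "ent (PP y ?x * QQ ?x - QQ y * PP y ?x) 0 M =
  (\<Sum>j<M. C y (2 * j) * Q (M - Suc j) (E j ?x)) -
  (\<Sum>i<M. Q i y * Pf (M - Suc i) (E (Suc i) y) (E (Suc i) ?x))"
  using assms by (simp add: ent_PP_QQ ent_QQ_mult[OF My]) (simp add: PP_def)
 show ?thesis
 proof (cases "E M y < E M ?x")
  case True
  have v: "val y (2 * M)" using True assms val_even by simp
  have "D (C y (2 * M)) = (\<Sum>d'<2 * M. (-1) ^ d' * (C y d' * Wd (t y (Suc d')) (E M ?x) (2 * M - 1 - d')))"
   using D_C[OF v] by simp
  also have "\<dots> = (\<Sum>m<M. C y (2 * m) * Wd (E m ?x) (E M ?x) (2 * M - 1 - 2 * m)) -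
    (\<Sum>m<M. C y (2 * m + 1) * Wd (E (Suc m) y) (E M ?x) (2 * M - 1 - (2 * m + 1)))"
   unfolding sum_parity_split by (simp add: sum_negf)
  also have "(\<Sum>m<M. C y (2 * m) * Wd (E m ?x) (E M ?x) (2 * M - 1 - 2 * m)) =
   (\<Sum>j<M. C y (2 * j) * Q (M - Suc j) (E j ?x))"
  proof (rule sum.cong)
   fix m assume "m \<in> {..<M}"
   then have "E (Suc (M - Suc m)) (E m ?x) = E M ?x" "2 * M - 1 - 2 * m = Suc (2 * (M - Suc m))"
    unfolding E_E by auto
   then show "C y (2 * m) * Wd (E m ?x) (E M ?x) (2 * M - 1 - 2 * m) =
    C y (2 * m) * Q (M - Suc m) (E m ?x)" by (simp only:)
  qed simp
  also have "(\<Sum>m<M. C y (2 * m + 1) * Wd (E (Suc m) y) (E M ?x) (2 * M - 1 - (2 * m + 1))) =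
   (\<Sum>i<M. Q i y * Pf (M - Suc i) (E (Suc i) y) (E (Suc i) ?x))"
  proof (rule sum.cong)
   fix m assume "m \<in> {..<M}"
   then have m: "m < M" by simp
   have 1: "E (M - Suc m) (E (Suc m) ?x) = E M ?x" "E (Suc (M - Suc m)) (E (Suc m) y) = E (Suc M) y"
    "2 * M - 1 - (2 * m + 1) = 2 * (M - Suc m)" unfolding E_E using m by auto
   \<comment> \<open>These are the end point of the chain and the next term of the sequence
     \<open>t\<close>; the strictness is what \<open>Wd_even\<close> needs for the rest.\<close>
   have "E M ?x < E (Suc M) y"
    using t_less[OF v, of "2 * M - 1"] m t_even[of y "Suc M"] t_odd[of y M] by (cases M) auto
   then have "Wd (E (Suc m) y) (E M ?x) (2 * M - 1 - (2 * m + 1)) = Pf (M - Suc m) (E (Suc m) y) (E (Suc m) ?x)"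
    using Wd_even[of "E (Suc m) y" "E (Suc m) ?x" "M - Suc m"] 1 assms E_mono[of y ?x "Suc m"]
    by (simp del: funpow.simps)
   moreover have "Q m y = C y (Suc (2 * m))"
    using E_less_earlier[OF True, of "Suc m"] m E_mono_exp[of "Suc m" M y] My by (intro Q_nondeg) auto
   ultimately show "C y (2 * m + 1) * Wd (E (Suc m) y) (E M ?x) (2 * M - 1 - (2 * m + 1)) =
     Q m y * Pf (M - Suc m) (E (Suc m) y) (E (Suc m) ?x)" by (simp only: Suc_eq_plus1)
  qed simp
  finally show ?thesis by (simp only: rhs)
 next
  case False
  \<comment> \<open>The chain does not exist, so the left side is 0; on the right each of the two
    products collapses to \<open>Q K y\<close>.\<close>
  then have eq: "E M y = E M ?x" using E_mono[of y ?x M] by simp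
  then obtain K where K: "M = Suc K" by (cases M) auto
  have "C y (2 * M) = 0" using C_even[of y M] eq by force
  moreover have "(\<Sum>j<M. C y (2 * j) * Q (M - Suc j) (E j ?x)) = Q K y"
   using Q_deg[of K y] eq My K by (simp add: lessThan_Suc_atMost)
  moreover have "(\<Sum>i<M. Q i y * Pf (M - Suc i) (E (Suc i) y) (E (Suc i) ?x)) = Q K y"
  proof -
   have "Pf (M - Suc i) (E (Suc i) y) (E (Suc i) ?x) = 0" if "i < K" for i
   proof (rule Pf_deg)
    show "E (M - Suc i) (E (Suc i) y) = E (M - Suc i) (E (Suc i) ?x)"
     unfolding E_E using that K eq by simp
   qed (use that K E_mono[of y ?x "Suc i"] in auto)
   then show ?thesis using eq unfolding K by (simp add: Pf_same)
  qed
  ultimately show ?thesis by (simp only: rhs D_0 diff_self)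
 qed
qed

lemma C_even_mult: "D (C y (2 * m) * a) = D (C y (2 * m)) * a + C y (2 * m) * D a"
 using D_mult[of y "2 * m" a] by simp

text \<open>The induction step shared by the transport and the curvature equation: differentiate the
  first letter by \<open>D_C_even\<close> and the rest by induction.\<close>

lemma D_AA_row:
 assumes "\<And>m. m \<le> M \<Longrightarrow> E m (Suc y) \<le> n" "\<And>m. m \<le> M \<Longrightarrow> D (ent X m M) = ent X' m M"
 shows "D (ent (AA y * X) 0 M) =
  ent ((PP y (Suc y) * QQ (Suc y) - QQ y * PP y (Suc y)) * X + PP y (Suc y) * X') 0 M"
proof -
 have "D (ent (AA y * X) 0 M) = (\<Sum>m\<in>{0..M}. D (C y (2 * m) * ent X m M))"
  by (simp add: ent_mult AA_def D_sum)
 also have "\<dots> = (\<Sum>m\<in>{0..M}. ent (PP y (Suc y) * QQ (Suc y) - QQ y * PP y (Suc y)) 0 m * ent X m M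
   + ent (PP y (Suc y)) 0 m * ent X' m M)"
  using assms by (intro sum.cong refl) (simp add: C_even_mult PP_Suc D_C_even del: ent_simps)
 finally show ?thesis by (simp only: ent_mult ent_simps(2) sum.distrib)
qed

lemma D_PP_row:
 "y \<le> x \<Longrightarrow> D (ent (PP y x) 0 M) = ent (PP y x * QQ x - QQ y * PP y x) 0 M"
proof (induction M y x rule: pair_induct)
 case (same M y)
 then show ?case by (simp add: PP_id_left(2)[OF order_refl] QQ_PP_id) (simp add: PP_def Pf_same D_1 D_0)
next
 case (less M y x)
 show ?case
 proof (cases "E M x \<le> n")
  case True
  have "ent (PP y x) 0 M = ent (AA y * PP (Suc y) x) 0 M" using less by (simp add: PP_row)
  moreover have "D (ent (AA y * PP (Suc y) x) 0 M) =
   ent ((PP y (Suc y) * QQ (Suc y) - QQ y * PP y (Suc y)) * PP (Suc y) x +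
     PP y (Suc y) * (PP (Suc y) x * QQ x - QQ (Suc y) * PP (Suc y) x)) 0 M"
  proof (rule D_AA_row)
   fix m assume m: "m \<le> M"
   have "E m (Suc y) \<le> E m x" using less by (intro E_mono) simp
   then show "E m (Suc y) \<le> n" using E_mono_exp[OF m, of x] True by simp
   show "D (ent (PP (Suc y) x) m M) = ent (PP (Suc y) x * QQ x - QQ (Suc y) * PP (Suc y) x) m M"
    using less.IH[OF m] by (simp add: ent_shift[OF m] tshift_mult tshift_diff del: ent_simps)
  qed
  moreover have "(PP y (Suc y) * QQ (Suc y) - QQ y * PP y (Suc y)) * PP (Suc y) x +
     PP y (Suc y) * (PP (Suc y) x * QQ x - QQ (Suc y) * PP (Suc y) x)
    = PP y (Suc y) * PP (Suc y) x * QQ x - QQ y * (PP y (Suc y) * PP (Suc y) x)"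
   by (simp add: algebra_simps)
  ultimately show ?thesis using PP_mult[of y "Suc y" x] less by simp
 next
  case False
  then show ?thesis by (simp add: ent_mult PP_def QQ_def D_0)
 qed
qed

lemma D_PP:
 assumes "y \<le> x" shows "Dt (PP y x) = PP y x * QQ x - QQ y * PP y x"
proof (rule tri_eq_rowsI)
 fix k M
 have "D (ent (tshift k (PP y x)) 0 M) = ent (tshift k (PP y x * QQ x - QQ y * PP y x)) 0 M"
  using D_PP_row[of "E k y" "E k x" M] assms
  by (simp only: tshift_diff tshift_mult tshift_PP tshift_QQ E_mono)
 then show "ent (tshift k (Dt (PP y x))) 0 M = ent (tshift k (PP y x * QQ x - QQ y * PP y x)) 0 M"
  by (simp only: tshift_def Dt_def tri.sel)
qed (simp add: Dt_def ent_mult PP_def D_0)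

text \<open>For an existing odd chain the even first factors of \<open>D_C\<close> assemble to
  \<open>RR\<close> and the odd ones to the square of \<open>QQ\<close>. Otherwise
  \<open>QQ_row\<close> moves the start to \<open>Suc x\<close>, and the two sides are compared by
  transport.\<close>

lemma D_QQ_row: "D (ent (QQ x) 0 L) = ent (RR x - QQ x * QQ x) 0 L"
proof (induction "n - x" arbitrary: x L rule: less_induct)
 case less
 show ?case
 proof (cases "\<exists>M. L = Suc M \<and> E (Suc M) x \<le> n")
  case False
  then show ?thesis
   by (cases L) (auto simp: RR_def cshift_def PP_def QQ_def ent_mult D_0 E_e E_1 simp del: funpow.simps)
 next
  case True
  then obtain M where L: "L = Suc M" and z: "E (Suc M) x \<le> n" by blast
  have xn: "x \<le> n" using z E_ge[of x "Suc M"] by simp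
  have x1: "Suc x \<le> e x" using e_gt[OF xn] by simp
  have RR: "ent (RR x) 0 L = Pf M x (e x)"
   using z by (simp add: RR_def cshift_def PP_def L E_e E_1 del: funpow.simps)
  have QQQ: "ent (QQ x * QQ x) 0 L = (\<Sum>i<M. Q i x * Q (M - Suc i) (E (Suc i) x))"
  proof -
   have "ent (QQ x * QQ x) 0 L = (\<Sum>i<L. Q i x * ent (QQ x) (Suc i) L)"
    using z unfolding L by (rule ent_QQ_mult)
   also have "\<dots> = (\<Sum>i<M. Q i x * Q (M - Suc i) (E (Suc i) x))"
    using z unfolding L by (simp add: QQ_def del: funpow.simps)
   finally show ?thesis .
  qed
  show ?thesis
  proof (cases "E L x < E L (Suc x)")
   case True
   have v: "val x (2 * M + 1)" using True z L val_odd by simp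
   have QC: "ent (QQ x) 0 L = C x (2 * M + 1)"
    using Q_nondeg[OF z] True z L by (simp add: ent_QQ del: funpow.simps)
   have "D (C x (2 * M + 1)) = (\<Sum>d'<2 * M + 1. (-1) ^ d' * (C x d' * Wd (t x (Suc d')) (E L x) (2 * M - d')))"
    using D_C[OF v] t_even[of x "Suc M"] unfolding L by simp
   also have "\<dots> = (\<Sum>m\<le>M. C x (2 * m) * Wd (E m (Suc x)) (E L x) (2 * M - 2 * m)) -
     (\<Sum>m<M. C x (2 * m + 1) * Wd (E (Suc m) x) (E L x) (2 * M - (2 * m + 1)))"
    unfolding sum_parity_split_Suc by (simp add: sum_negf)
   also have "(\<Sum>m\<le>M. C x (2 * m) * Wd (E m (Suc x)) (E L x) (2 * M - 2 * m)) =
    (\<Sum>m\<le>M. C x (2 * m) * Pf (M - m) (E m (Suc x)) (E m (e x)))"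
   proof (rule sum.cong)
    fix m assume "m \<in> {..M}"
    then have m: "m \<le> M" by simp
    have 1: "E (M - m) (E m (e x)) = E L x" "E (Suc (M - m)) (E m (Suc x)) = E L (Suc x)"
     "2 * M - 2 * m = 2 * (M - m)" unfolding E_e L E_E using m by (auto simp: Suc_diff_le)
    have "Wd (E m (Suc x)) (E L x) (2 * M - 2 * m) = Pf (M - m) (E m (Suc x)) (E m (e x))"
     using Wd_even[of "E m (Suc x)" "E m (e x)" "M - m"] 1 z L True E_mono[OF x1, of m]
     by (simp del: funpow.simps)
    then show "C x (2 * m) * Wd (E m (Suc x)) (E L x) (2 * M - 2 * m) =
      C x (2 * m) * Pf (M - m) (E m (Suc x)) (E m (e x))" by simp
   qed simp
   also have "\<dots> = ent (RR x) 0 L" using x1 RR by (simp add: Pf_less)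
   also have "(\<Sum>m<M. C x (2 * m + 1) * Wd (E (Suc m) x) (E L x) (2 * M - (2 * m + 1))) =
    ent (QQ x * QQ x) 0 L" unfolding QQQ
   proof (rule sum.cong)
    fix m assume "m \<in> {..<M}"
    then have m: "m < M" by simp
    have "E (Suc (M - Suc m)) (E (Suc m) x) = E L x" "2 * M - (2 * m + 1) = Suc (2 * (M - Suc m))"
     unfolding L E_E using m by auto
    moreover have "Q m x = C x (Suc (2 * m))"
     using E_less_earlier[OF True, of "Suc m"] m E_mono_exp[of "Suc m" "Suc M" x] z L
     by (intro Q_nondeg) auto
    ultimately show "C x (2 * m + 1) * Wd (E (Suc m) x) (E L x) (2 * M - (2 * m + 1)) =
     Q m x * Q (M - Suc m) (E (Suc m) x)" by (simp only: Suc_eq_plus1)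
   qed simp
   finally show ?thesis by (simp only: QC ent_simps)
  next
   case False
   then have eq: "E L x = E L (Suc x)" using E_mono[of x "Suc x" L] by simp
   have "ent (QQ x) 0 L = ent (AA x * QQ (Suc x)) 0 L" unfolding L using eq L by (intro QQ_row) simp
   moreover have "D (ent (AA x * QQ (Suc x)) 0 L) =
    ent ((PP x (Suc x) * QQ (Suc x) - QQ x * PP x (Suc x)) * QQ (Suc x)
     + PP x (Suc x) * (RR (Suc x) - QQ (Suc x) * QQ (Suc x))) 0 L"
   proof (rule D_AA_row)
    fix m assume m: "m \<le> L"
    show "E m (Suc x) \<le> n" using E_mono_exp[OF m, of "Suc x"] eq z L by simp
    then have "n - E m (Suc x) < n - x" using E_ge[of "Suc x" m] by simp
    from less[OF this, of "L - m"]
    show "D (ent (QQ (Suc x)) m L) = ent (RR (Suc x) - QQ (Suc x) * QQ (Suc x)) m L"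
     by (simp add: ent_shift[OF m] tshift_mult tshift_diff del: ent_simps)
   qed
   moreover have "(PP x (Suc x) * QQ (Suc x) - QQ x * PP x (Suc x)) * QQ (Suc x)
     + PP x (Suc x) * (RR (Suc x) - QQ (Suc x) * QQ (Suc x)) =
     PP x (Suc x) * RR (Suc x) - QQ x * (PP x (Suc x) * QQ (Suc x))"
    by (simp add: algebra_simps)
   moreover have "ent (QQ x * (PP x (Suc x) * QQ (Suc x))) 0 L = ent (QQ x * QQ x) 0 L"
   proof -
    have "ent (QQ x * X) 0 L = (\<Sum>i<L. Q i x * ent X (Suc i) L)" for X
     using ent_QQ_mult z L by blast
    moreover have "ent (PP x (Suc x) * QQ (Suc x)) (Suc i) L = ent (QQ x) (Suc i) L" if i: "i < L" for i
    proof (cases "Suc i = L")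
     case True then show ?thesis by (simp add: ent_mult QQ_def)
    next
     case False
     then obtain K where K: "L - Suc i = Suc K" using i by (cases "L - Suc i") auto
     have "E (Suc K) (E (Suc i) x) = E (Suc K) (E (Suc i) (Suc x))"
      unfolding K[symmetric] E_E using eq that by simp
     then have "ent (QQ (E (Suc i) x)) 0 (Suc K) =
       ent (PP (E (Suc i) x) (E (Suc i) (Suc x)) * QQ (E (Suc i) (Suc x))) 0 (Suc K)"
      by (intro QQ_PP_QQ E_mono) simp_all
     then show ?thesis using that K
      by (simp add: ent_shift[of "Suc i" L] tshift_mult del: funpow.simps)
    qed
    ultimately show ?thesis by simp
   qed
   \<comment> \<open>The curvatures at \<open>x\<close> and \<open>Suc x\<close> differ by transport
     from \<open>e x\<close> to \<open>e (Suc x)\<close>. As \<open>E M\<close> identifies these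
     positions, \<open>Pf_deg\<close> leaves only its trivial part.\<close>
   moreover have "ent (PP x (Suc x) * RR (Suc x)) 0 L = ent (RR x) 0 L"
   proof -
    have x2: "Suc x \<le> e (Suc x)" by (rule e_ge)
    have "PP x (Suc x) * RR (Suc x) = cshift (PP x (e (Suc x)))"
     unfolding RR_def mult_cshift using x2 by (simp add: PP_mult)
    also have "ent \<dots> 0 L = Pf M x (e (Suc x))"
     using eq z by (simp add: cshift_def L PP_def E_e E_1 del: funpow.simps)
    also have "\<dots> = ent (PP x (e x) * PP (e x) (e (Suc x))) 0 M"
     using PP_mult[of x "e x" "e (Suc x)"] e_ge[of x] e_mono[of x "Suc x"] eq z L
     by (simp add: PP_def E_e E_1 del: funpow.simps)
    also have "\<dots> = (\<Sum>j\<in>{0..M}. if j = M then Pf M x (e x) else 0)"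
     unfolding ent_mult
    proof (intro sum.cong refl)
     fix j assume "j \<in> {0..M}"
     then have j: "j \<le> M" by simp
     have 1: "E (M - j) (E j (e x)) = E L x" "E (M - j) (E j (e (Suc x))) = E L x"
      unfolding E_E E_e using j eq L by (auto simp: Suc_diff_le)
     show "ent (PP x (e x)) 0 j * ent (PP (e x) (e (Suc x))) j M = (if j = M then Pf M x (e x) else 0)"
     proof (cases "j = M")
      case True
      then show ?thesis using 1 z L eq by (simp add: PP_def E_e E_1 Pf_same del: funpow.simps)
     next
      case False
      have "Pf (M - j) (E j (e x)) (E j (e (Suc x))) = 0"
       using 1 False j by (intro Pf_deg) (auto intro!: E_mono e_mono)
      then show ?thesis using False by (simp add: PP_def)
     qed
    qed
    finally show ?thesis using RR by simp
   qed
   ultimately show ?thesis by (simp only: ent_simps)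
  qed
 qed
qed

lemma D_QQ: "Dt (QQ x) = RR x - QQ x * QQ x"
proof (rule tri_eq_rowsI)
 fix k M
 have "D (ent (tshift k (QQ x)) 0 M) = ent (tshift k (RR x - QQ x * QQ x)) 0 M"
  using D_QQ_row[of "E k x" M] by (simp only: tshift_diff tshift_mult tshift_QQ tshift_RR)
 then show "ent (tshift k (Dt (QQ x))) 0 M = ent (tshift k (RR x - QQ x * QQ x)) 0 M"
  by (simp only: tshift_def Dt_def tri.sel)
qed (simp add: Dt_def ent_mult QQ_def RR_def cshift_def D_0)

lemma C_mult_sign: "C y d * ((-1) ^ k * a) = (-1) ^ k * (C y d * a)"
 by (cases "even k") simp_all

lemma D_Wd_mult: "D (Wd y z \<tau> * a) = D (Wd y z \<tau>) * a + (-1) ^ \<tau> * (Wd y z \<tau> * D a)"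
proof (induction y z \<tau> rule: Wd.induct)
 case (1 y z \<tau>)
 consider "y = z" | "y \<noteq> z" "y < z" "z \<le> n" | "y \<noteq> z" "\<not> (y < z \<and> z \<le> n)" by blast
 then show ?case
 proof cases
  case 2
  let ?f = "\<lambda>d. Wd (t y (Suc d)) z (\<tau> - d)"
  have W: "Wd y z \<tau> = (\<Sum>d\<le>\<tau>. C y d * ?f d)" using 2 by (simp add: Wd.simps[of y])
  have "D (C y d * ?f d * a) = D (C y d * ?f d) * a + (-1) ^ \<tau> * (C y d * ?f d * D a)"
   if "d \<le> \<tau>" for d
  proof -
   have IH: "D (?f d * a) = D (?f d) * a + (-1) ^ (\<tau> - d) * (?f d * D a)"
    using 1[OF 2(1)] 2 that by simp
   have "(-1) ^ d * (-1) ^ (\<tau> - d) = ((-1) ^ \<tau> :: 'a)" using that by (simp flip: power_add)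
   then show ?thesis
    by (simp add: D_mult mult.assoc IH distrib_left C_mult_sign[of y d "\<tau> - d"] D_mult[of y d "?f d"] distrib_right)
     (simp flip: mult.assoc)
  qed
  then show ?thesis
   by (simp add: W sum_distrib_right sum_distrib_left D_sum sum.distrib flip: sum_distrib_left)
 next
  case 3
  then have "Wd y z \<tau> = 0" by (subst Wd.simps) auto
  then show ?thesis by (simp add: D_0)
 qed (simp add: Wd_same D_0 D_1)
qed

lemma D_Pf_mult: "D (Pf M y x * a) = D (Pf M y x) * a + Pf M y x * D a"
proof (cases "y \<le> x")
 case True
 then show ?thesis
 proof (induction M y x arbitrary: a rule: pair_induct)
  case (less M y x)
  then have "D (C y (2 * m) * Pf (M - m) (E m (Suc y)) (E m x) * a) =
    D (C y (2 * m) * Pf (M - m) (E m (Suc y)) (E m x)) * a + C y (2 * m) * Pf (M - m) (E m (Suc y)) (E m x) * D a"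
   if "m \<le> M" for m
   using that by (simp add: mult.assoc C_even_mult distrib_left distrib_right)
  then show ?case using less
   by (simp add: Pf_less sum_distrib_right D_sum sum.distrib)
 qed (simp add: Pf_same D_1 D_0)
qed (simp add: Pf.simps D_0)

lemma Dt_diff: "Dt (X - Y) = Dt X - Dt Y"
 by (rule tri_eqI) (simp add: Dt_def D_diff)

lemma Dt_cshift: "Dt (cshift X) = cshift (Dt X)"
 by (rule tri_eqI) (simp add: Dt_def cshift_def D_0)

lemma Dt_PP_mult: "Dt (PP y x * X) = Dt (PP y x) * X + PP y x * Dt X"
proof (rule tri_eqI)
 have "D (ent (PP y x) k j * b) = D (ent (PP y x) k j) * b + ent (PP y x) k j * D b" for k j b
  by (simp add: PP_def D_Pf_mult D_0)
 then show "ent (Dt (PP y x * X)) k l = ent (Dt (PP y x) * X + PP y x * Dt X) k l" for k l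
  by (simp add: Dt_def ent_mult D_sum sum.distrib)
qed

lemma Dt_QQ_mult: "Dt (QQ x * X) = Dt (QQ x) * X - QQ x * Dt X"
proof (rule tri_eqI)
 have "D (ent (QQ x) k j * b) = D (ent (QQ x) k j) * b - ent (QQ x) k j * D b" for k j b
  by (simp add: QQ_def D_Wd_mult D_0)
 then show "ent (Dt (QQ x * X)) k l = ent (Dt (QQ x) * X - QQ x * Dt X) k l" for k l
  by (simp add: Dt_def ent_mult D_sum sum_subtractf)
qed

text \<open>Both sides are \<open>cshift (PP y (e x))\<close>: going from \<open>y\<close> to
  \<open>e x\<close> through \<open>x\<close> or through \<open>e y\<close>.\<close>

lemma PP_RR: "y \<le> x \<Longrightarrow> PP y x * RR x = RR y * PP y x"
 unfolding RR_def mult_cshift cshift_mult using tshift_PP[of 1 y x]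
 by (simp add: PP_mult e_ge e_mono)

text \<open>Inserting the transport and curvature equations, every term with \<open>QQ\<close>
  cancels; the curvature terms cancel by \<open>PP_RR\<close>.\<close>

lemma Dt_Dt_PP: assumes "y \<le> x" shows "Dt (Dt (PP y x)) = 0"
proof -
 have "Dt (Dt (PP y x)) = (PP y x * QQ x - QQ y * PP y x) * QQ x + PP y x * (RR x - QQ x * QQ x)
   - ((RR y - QQ y * QQ y) * PP y x - QQ y * (PP y x * QQ x - QQ y * PP y x))"
  by (simp add: D_PP[OF assms] D_QQ Dt_diff Dt_PP_mult Dt_QQ_mult)
 also have "\<dots> = PP y x * RR x - RR y * PP y x" by (simp add: algebra_simps)
 finally show ?thesis using PP_RR[OF assms] by simp
qed

text \<open>The Bianchi identity: \<open>RR\<close> is covariantly constant, being a shifted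
  transport array.\<close>

lemma Dt_Dt_QQ: "Dt (Dt (QQ x)) = 0"
proof -
 have "Dt (RR x) = cshift (PP x (e x) * QQ (e x) - QQ x * PP x (e x))"
  by (simp add: RR_def Dt_cshift D_PP e_ge)
 also have "\<dots> = RR x * QQ x - QQ x * RR x"
  unfolding RR_def mult_cshift cshift_mult cshift_diff using tshift_QQ[of 1 x] by simp
 finally have "Dt (Dt (QQ x)) = RR x * QQ x - QQ x * RR x
   - ((RR x - QQ x * QQ x) * QQ x - QQ x * (RR x - QQ x * QQ x))"
  by (simp add: D_QQ Dt_diff Dt_QQ_mult)
 then show ?thesis by (simp add: algebra_simps)
qed

text \<open>Every existing generator is an entry of \<open>PP y (Suc y)\<close> or of
  \<open>QQ y\<close>, depending on the parity of its degree.\<close>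

theorem D_D_C: "D (D (C y d)) = 0"
proof (cases "val y d")
 case v: True
 show ?thesis
 proof (cases "even d")
  case True
  then obtain m where m: "d = 2 * m" by (auto elim: evenE)
  have "ent (Dt (Dt (PP y (Suc y)))) 0 m = D (D (C y d))" by (simp add: Dt_def PP_Suc m)
  then show ?thesis using Dt_Dt_PP[of y "Suc y"] by simp
 next
  case False
  then obtain m where m: "d = Suc (2 * m)" by (auto elim: oddE)
  then have "ent (QQ y) 0 (Suc m) = C y d"
   using v val_odd Q_nondeg[of m y] by (simp add: ent_QQ del: funpow.simps)
  then have "ent (Dt (Dt (QQ y))) 0 (Suc m) = D (D (C y d))" by (simp add: Dt_def)
  then show ?thesis using Dt_Dt_QQ[of y] by simp
 qed
qed (simp add: C_0 D_0)

end

section \<open>Paths in a quiver\<close>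

context wf_digraph
begin

text \<open>Primitive recursive forms of \<open>awalk\<close> and of the last vertex, which behave
  well under concatenation.\<close>

fun walk :: "'a \<Rightarrow> 'b list \<Rightarrow> bool" where
 "walk u [] \<longleftrightarrow> u \<in> verts G"
| "walk u (a # as) \<longleftrightarrow> a \<in> arcs G \<and> tail G a = u \<and> walk (head G a) as"

fun tgt :: "'a \<Rightarrow> 'b list \<Rightarrow> 'a" where
 "tgt u [] = u"
| "tgt u (a # as) = tgt (head G a) as"

lemma ptarget_tgt: "ptarget G x = tgt (fst x) (snd x)"
proof -
 have "last (awalk_verts u as) = tgt u as" for u as
 proof (induction as arbitrary: u)
  case (Cons a as)
  have "awalk_verts (head G a) as \<noteq> []" by (cases as) simp_all
  then show ?case using Cons by simp
 qed simp
 then show ?thesis by (simp add: ptarget_def)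
qed

lemma walk_verts: "walk u as \<Longrightarrow> u \<in> verts G" "walk u as \<Longrightarrow> tgt u as \<in> verts G"
 by (induction u as rule: walk.induct) auto

lemma qpaths_walk: "x \<in> qpaths G \<longleftrightarrow> walk (fst x) (snd x)"
proof -
 have "awalk u as (tgt u as) \<longleftrightarrow> walk u as" for u as
 proof (induction as arbitrary: u)
  case (Cons a as)
  show ?case using Cons[of "head G a"] wellformed(2)[of a] by (auto simp: awalk_def)
 qed (simp add: awalk_def)
 then show ?thesis by (simp add: qpaths_def ptarget_tgt)
qed

lemma tgt_append [simp]: "tgt u (as @ bs) = tgt (tgt u as) bs"
 by (induction u as rule: tgt.induct) auto

lemma walk_append: "walk u (as @ bs) \<longleftrightarrow> walk u as \<and> walk (tgt u as) bs"
 by (induction u as rule: walk.induct) (auto dest: walk_verts)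

lemma composable_pair:
 "composable G [x, y] \<longleftrightarrow> x \<in> qpaths G \<and> y \<in> qpaths G \<and> ptarget G x = fst y"
 by (auto simp: composable_def less_Suc_eq)

lemma composable_Nil: "composable G []"
 by (simp add: composable_def)

lemma composable_single: "composable G [x] \<longleftrightarrow> x \<in> qpaths G"
 by (auto simp: composable_def)

lemma composable_Cons2:
 "composable G (x # y # zs) \<longleftrightarrow> x \<in> qpaths G \<and> ptarget G x = fst y \<and> composable G (y # zs)"
 unfolding composable_def by (auto simp: nth_Cons split: nat.splits)

lemma composable_append_walk:
 "composable G xs \<Longrightarrow> xs \<noteq> [] \<Longrightarrow> path_prod xs \<in> qpaths G \<and> ptarget G (path_prod xs) = ptarget G (last xs)"
proof (induction xs)
 case (Cons x xs)
 show ?case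
 proof (cases xs)
  case Nil then show ?thesis using Cons by (simp add: path_prod_def composable_single)
 next
  case (Cons y ys)
  then have c: "x \<in> qpaths G" "ptarget G x = fst y" "composable G xs" using Cons.prems by (simp_all add: composable_Cons2)
  have "path_prod (x # xs) = (fst x, snd x @ snd (path_prod xs))" by (simp add: path_prod_def)
  moreover have "fst (path_prod xs) = fst y" using Cons by (simp add: path_prod_def)
  ultimately show ?thesis using Cons.IH c Cons
   by (simp add: qpaths_walk walk_append ptarget_tgt)
 qed
qed simp

lemma composable_append:
 "xs \<noteq> [] \<Longrightarrow> ys \<noteq> [] \<Longrightarrow> composable G (xs @ ys) \<longleftrightarrow>
  composable G xs \<and> composable G ys \<and> ptarget G (last xs) = fst (hd ys)"
proof (induction xs)
 case (Cons x xs)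
 then show ?case
  by (cases xs; cases ys) (auto simp: composable_Cons2 composable_single)
qed simp

lemma path_prod_Cons: "xs \<noteq> [] \<Longrightarrow> path_prod (x # xs) = (fst x, snd x @ snd (path_prod xs))"
 by (simp add: path_prod_def)

lemma path_prod_pair: "path_prod [x, y] = (fst x, snd x @ snd y)"
 by (simp add: path_prod_def)

lemma path_prod_single [simp]: "path_prod [x] = x"
 by (simp add: path_prod_def)

lemma subpath_iff: "subpath G y x \<longleftrightarrow> x \<in> qpaths G \<and>
  (\<exists>as bs. snd x = as @ snd y @ bs \<and> tgt (fst x) as = fst y)"
proof
 assume "subpath G y x"
 then obtain u v where uv: "composable G [u, y, v]" "x = path_prod [u, y, v]" by (auto simp: subpath_def)
 then show "x \<in> qpaths G \<and> (\<exists>as bs. snd x = as @ snd y @ bs \<and> tgt (fst x) as = fst y)"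
  using composable_append_walk[of "[u, y, v]"]
  by (auto simp: path_prod_def composable_Cons2 ptarget_tgt)
next
 assume "x \<in> qpaths G \<and> (\<exists>as bs. snd x = as @ snd y @ bs \<and> tgt (fst x) as = fst y)"
 then obtain as bs where x: "x \<in> qpaths G" "snd x = as @ snd y @ bs" "tgt (fst x) as = fst y" by blast
 have "composable G [(fst x, as), y, (ptarget G y, bs)]"
  using x by (simp add: composable_Cons2 composable_single qpaths_walk ptarget_tgt walk_append)
 moreover have "x = path_prod [(fst x, as), y, (ptarget G y, bs)]"
  using x by (simp add: path_prod_def prod_eq_iff)
 ultimately show "subpath G y x" unfolding subpath_def by blast
qed

lemma subpath_qpaths: "subpath G y x \<Longrightarrow> y \<in> qpaths G" "subpath G y x \<Longrightarrow> x \<in> qpaths G"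
 by (auto simp: subpath_iff qpaths_walk walk_append)

lemma subpath_refl: "x \<in> qpaths G \<Longrightarrow> subpath G x x"
 unfolding subpath_iff by (intro conjI exI[of _ "[]"]) auto

lemma subpath_trans: "subpath G x y \<Longrightarrow> subpath G y z \<Longrightarrow> subpath G x z"
proof -
 assume "subpath G x y" "subpath G y z"
 then obtain as bs cs ds where "snd y = as @ snd x @ bs" "tgt (fst y) as = fst x" "z \<in> qpaths G"
  "snd z = cs @ snd y @ ds" "tgt (fst z) cs = fst y" by (auto simp: subpath_iff)
 then show ?thesis unfolding subpath_iff by (intro conjI exI[of _ "cs @ as"] exI[of _ "bs @ ds"]) auto
qed

lemma left_factor_iff: "left_factor G y x \<longleftrightarrow> x \<in> qpaths G \<and> fst y = fst x \<and> (\<exists>bs. snd x = snd y @ bs)"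
proof
 assume "left_factor G y x"
 then obtain v where "composable G [y, v]" "x = path_prod [y, v]" by (auto simp: left_factor_def)
 then show "x \<in> qpaths G \<and> fst y = fst x \<and> (\<exists>bs. snd x = snd y @ bs)"
  using composable_append_walk[of "[y, v]"] by (auto simp: path_prod_pair)
next
 assume "x \<in> qpaths G \<and> fst y = fst x \<and> (\<exists>bs. snd x = snd y @ bs)"
 then obtain bs where x: "x \<in> qpaths G" "fst y = fst x" "snd x = snd y @ bs" by blast
 then have "composable G [y, (ptarget G y, bs)]" "x = path_prod [y, (ptarget G y, bs)]"
  by (auto simp: composable_pair qpaths_walk walk_append ptarget_tgt path_prod_pair prod_eq_iff)
 then show "left_factor G y x" unfolding left_factor_def by blast
qed

lemma right_factor_iff:
 "right_factor G y x \<longleftrightarrow> x \<in> qpaths G \<and> (\<exists>as. snd x = as @ snd y \<and> fst y = tgt (fst x) as)"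
proof
 assume "right_factor G y x"
 then obtain u where "composable G [u, y]" "x = path_prod [u, y]" by (auto simp: right_factor_def)
 then show "x \<in> qpaths G \<and> (\<exists>as. snd x = as @ snd y \<and> fst y = tgt (fst x) as)"
  using composable_append_walk[of "[u, y]"] by (auto simp: path_prod_pair composable_pair ptarget_tgt)
next
 assume "x \<in> qpaths G \<and> (\<exists>as. snd x = as @ snd y \<and> fst y = tgt (fst x) as)"
 then obtain as where x: "x \<in> qpaths G" "snd x = as @ snd y" "fst y = tgt (fst x) as" by blast
 then have "composable G [(fst x, as), y]" "x = path_prod [(fst x, as), y]"
  by (auto simp: composable_pair qpaths_walk walk_append ptarget_tgt path_prod_pair prod_eq_iff)
 then show "right_factor G y x" unfolding right_factor_def by blast
qed

lemma trivial_paths_iff: "x \<in> qpaths G \<Longrightarrow> x \<in> trivial_paths G \<longleftrightarrow> snd x = []"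
 by (cases x) (auto simp: trivial_paths_def qpaths_walk)

lemma trivial_paths_qpaths: "trivial_paths G \<subseteq> qpaths G"
 by (auto simp: trivial_paths_def qpaths_walk)

lemma arrow_path_qpaths: "a \<in> arcs G \<Longrightarrow> arrow_path G a \<in> qpaths G"
 by (simp add: arrow_path_def qpaths_walk)

lemma arrow_path_iff: "x \<in> qpaths G \<Longrightarrow> x \<in> arrow_path G ` arcs G \<longleftrightarrow> length (snd x) = 1"
 by (cases x) (auto simp: arrow_path_def qpaths_walk length_Suc_conv image_iff)

text \<open>The part of the path \<open>x\<close> between the positions \<open>i\<close> and \<open>j\<close>.\<close>

definition sp :: "('a, 'b) qpath \<Rightarrow> nat \<Rightarrow> nat \<Rightarrow> ('a, 'b) qpath" where
 "sp x i j = (tgt (fst x) (take i (snd x)), drop i (take j (snd x)))"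

lemma take_take_drop: "i \<le> j \<Longrightarrow> take j as = take i as @ drop i (take j as)"
 by (metis append_take_drop_id min_def take_take)

lemma sp_qpaths:
 assumes "x \<in> qpaths G" "i \<le> j" shows "sp x i j \<in> qpaths G"
proof -
 have "walk (fst x) (take j (snd x) @ drop j (snd x))" using assms by (simp add: qpaths_walk)
 then have "walk (fst x) (take i (snd x) @ drop i (take j (snd x)))"
  using assms(2) take_take_drop by (metis walk_append)
 then show ?thesis by (simp add: sp_def qpaths_walk walk_append)
qed

lemma ptarget_sp: "i \<le> j \<Longrightarrow> ptarget G (sp x i j) = fst (sp x j k)"
 by (simp add: ptarget_tgt sp_def) (metis take_take_drop tgt_append)

lemma length_sp: "j \<le> length (snd x) \<Longrightarrow> length (snd (sp x i j)) = j - i"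
 by (simp add: sp_def)

lemma sp_all: "sp x 0 (length (snd x)) = x"
 by (simp add: sp_def)

lemma sp_join: "i \<le> j \<Longrightarrow> j \<le> k \<Longrightarrow> (fst (sp x i j), snd (sp x i j) @ snd (sp x j k)) = sp x i k"
proof -
 assume h: "i \<le> j" "j \<le> k"
 have "drop i (take k as) = drop i (take j as) @ drop j (take k as)" for as :: "'b list"
 proof (cases "j \<le> length as")
  case True
  then show ?thesis using h by (subst take_take_drop[OF h(2)]) (simp add: drop_append min_def)
 next
  case False then show ?thesis using h by simp
 qed
 then show ?thesis by (simp add: sp_def)
qed

lemma sp_inject: "sp x i j = sp x i k \<Longrightarrow> j \<le> length (snd x) \<Longrightarrow> k \<le> length (snd x) \<Longrightarrow> i \<le> j \<Longrightarrow> i \<le> k \<Longrightarrow> j = k"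
 using length_sp[of j x i] length_sp[of k x i] by simp

lemma sp_sp: "i \<le> k \<Longrightarrow> k \<le> l \<Longrightarrow> l \<le> j \<Longrightarrow> sp (sp x i j) (k - i) (l - i) = sp x k l"
proof -
 assume h: "i \<le> k" "k \<le> l" "l \<le> j"
 have 1: "take (l - i) (drop i (take j as)) = drop i (take l as)" if "i \<le> l" "l \<le> j" for l :: nat and as :: "'b list"
  using that by (simp add: take_drop min_def)
 have "take i (snd x) @ drop i (take k (snd x)) = take k (snd x)" using take_take_drop[OF h(1)] by metis
 then have "tgt (tgt (fst x) (take i (snd x))) (drop i (take k (snd x))) = tgt (fst x) (take k (snd x))"
  by (metis tgt_append)
 then show ?thesis using h 1[of l "snd x"] 1[of k "snd x"] by (simp add: sp_def)
qed

lemma subpath_sp_iff: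
 assumes "x \<in> qpaths G" "i \<le> j" "j \<le> length (snd x)"
 shows "subpath G y (sp x i j) \<longleftrightarrow> (\<exists>k l. i \<le> k \<and> k \<le> l \<and> l \<le> j \<and> y = sp x k l)"
proof
 assume "subpath G y (sp x i j)"
 then obtain as bs where y: "snd (sp x i j) = as @ snd y @ bs" "tgt (fst (sp x i j)) as = fst y"
  by (auto simp: subpath_iff)
 let ?k = "length as" and ?l = "length as + length (snd y)"
 have "y = sp (sp x i j) ?k ?l" using y by (simp add: sp_def[of "sp x i j"] prod_eq_iff)
 moreover have "i + ?l \<le> j" using y(1) length_sp[OF assms(3), of i] assms(2) by simp
 ultimately have "y = sp x (i + ?k) (i + ?l)" using sp_sp[of i "i + ?k" "i + ?l" j x] by simp
 then show "\<exists>k l. i \<le> k \<and> k \<le> l \<and> l \<le> j \<and> y = sp x k l" using \<open>i + ?l \<le> j\<close>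
  by (intro exI[of _ "i + ?k"] exI[of _ "i + ?l"]) simp
next
 assume "\<exists>k l. i \<le> k \<and> k \<le> l \<and> l \<le> j \<and> y = sp x k l"
 then obtain k l where h: "i \<le> k" "k \<le> l" "l \<le> j" "y = sp x k l" by blast
 have "snd (sp x i j) = snd (sp x i k) @ snd y @ snd (sp x l j)"
  using sp_join[of i k j x] sp_join[of k l j x] h by (auto simp: prod_eq_iff)
 moreover have "tgt (fst (sp x i j)) (snd (sp x i k)) = fst y"
  using ptarget_sp[of i k x l] h by (simp add: ptarget_tgt sp_def)
 ultimately show "subpath G y (sp x i j)"
  unfolding subpath_iff using sp_qpaths[OF assms(1,2)] by blast
qed

end

section \<open>Tips and the arrows of the Uf-graph\<close>

locale tip_quiver = wf_digraph G for G :: "('v, 'e) pre_digraph" +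
 fixes W :: "('v, 'e) qpath set"
 assumes W_qpaths: "W \<subseteq> qpaths G"
  and W_length: "x \<in> W \<Longrightarrow> 2 \<le> length (snd x)"
  and W_antichain: "x \<in> W \<Longrightarrow> y \<in> W \<Longrightarrow> subpath G x y \<Longrightarrow> x = y"
begin

abbreviation NT :: "('v, 'e) qpath set" where "NT \<equiv> nontip G W - trivial_paths G"

lemma NT_qpaths: "x \<in> NT \<Longrightarrow> x \<in> qpaths G"
 by (simp add: nontip_def)

lemma NT_nonempty: "x \<in> NT \<Longrightarrow> snd x \<noteq> []"
 using trivial_paths_iff[of x] by (auto simp: nontip_def)

lemma nontip_subpath: "x \<in> nontip G W \<Longrightarrow> subpath G y x \<Longrightarrow> y \<in> nontip G W"
 unfolding nontip_def using subpath_qpaths subpath_trans by blast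

lemma path_ideal_iff: "x \<in> qpaths G \<Longrightarrow> x \<in> path_ideal G W \<longleftrightarrow> x \<notin> nontip G W"
 by (auto simp: path_ideal_def nontip_def)

lemma path_ideal_length: "x \<in> path_ideal G W \<Longrightarrow> 2 \<le> length (snd x)"
 unfolding path_ideal_def subpath_iff using W_length by fastforce

lemma arrow_nontip: "a \<in> arcs G \<Longrightarrow> arrow_path G a \<in> NT"
 using path_ideal_length[of "arrow_path G a"] path_ideal_iff[OF arrow_path_qpaths[of a]]
  trivial_paths_iff[OF arrow_path_qpaths[of a]]
 by (auto simp: arrow_path_def)

text \<open>A tip inside a proper right factor of a tip contradicts the antichain condition; trivial
  paths and arrows are too short to contain a tip.\<close>

lemma uf_vertices_nontip: "v \<in> uf_vertices G W \<Longrightarrow> v \<in> nontip G W"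
proof -
 assume "v \<in> uf_vertices G W"
 then consider "v \<in> trivial_paths G" | "v \<in> arrow_path G ` arcs G"
  | x where "x \<in> W" "right_factor G v x" "v \<noteq> x" by (auto simp: uf_vertices_def)
 then show ?thesis
 proof cases
  case 1
  then have "v \<in> qpaths G" "snd v = []" using trivial_paths_qpaths trivial_paths_iff by blast+
  then show ?thesis using path_ideal_iff[of v] path_ideal_length[of v] by auto
 next
  case 2 then show ?thesis using arrow_nontip by blast
 next
  case 3
  then have sub: "subpath G v x" unfolding right_factor_iff subpath_iff by force
  have "\<not> subpath G y v" if "y \<in> W" for y
  proof
   assume yv: "subpath G y v"
   then have "y = x" using subpath_trans[OF yv sub] W_antichain that 3 by blast
   then have "length (snd x) \<le> length (snd v)" using yv by (auto simp: subpath_iff)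
   moreover obtain as where "snd x = as @ snd v" "fst v = tgt (fst x) as"
    using 3(2) by (auto simp: right_factor_iff)
   ultimately show False using 3(3) by (auto simp: prod_eq_iff)
  qed
  then show ?thesis using subpath_qpaths(1)[OF sub] by (auto simp: nontip_def)
 qed
qed

text \<open>The second alternative of \<open>uf_arrow\<close> is void here: the product with a
  trivial path is \<open>v\<close> itself, a vertex and hence a nontip.\<close>

lemma uf_arrow_trivial:
 assumes "e \<in> trivial_paths G"
 shows "uf_arrow G W e v \<longleftrightarrow> v \<in> arrow_path G ` arcs G \<and> fst v = fst e"
proof -
 have e: "snd e = []" using assms trivial_paths_qpaths trivial_paths_iff by blast
 have False if h: "v \<in> uf_vertices G W" "composable G [e, v]" "path_prod [e, v] \<in> path_ideal G W"
 proof -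
  have "path_prod [e, v] = v" using h(2) e
   by (auto simp: path_prod_pair composable_pair prod_eq_iff ptarget_tgt)
  then show False using h uf_vertices_nontip path_ideal_iff by (auto simp: composable_pair)
 qed
 then show ?thesis using assms by (auto simp: uf_arrow_def)
qed

lemma uf_arrow_nontrivial:
 assumes "u \<notin> trivial_paths G"
 shows "uf_arrow G W u v \<longleftrightarrow> u \<in> uf_vertices G W \<and> v \<in> uf_vertices G W \<and> composable G [u, v] \<and>
   path_prod [u, v] \<in> path_ideal G W \<and>
   (\<forall>y. left_factor G y (path_prod [u, v]) \<and> y \<noteq> path_prod [u, v] \<longrightarrow> y \<notin> path_ideal G W)"
 using assms by (simp add: uf_arrow_def)

lemma chainsD:
 assumes "ws \<in> chains G W d"
 shows "length ws = Suc d" "set ws \<subseteq> NT" "ws ! 0 \<in> arrow_path G ` arcs G" "composable G ws"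
  "k < d \<Longrightarrow> uf_arrow G W (ws ! k) (ws ! Suc k)"
proof -
 show l: "length ws = Suc d" and s: "set ws \<subseteq> NT" using assms by (auto simp: chains_def)
 show "ws ! 0 \<in> arrow_path G ` arcs G" using assms uf_arrow_trivial by (auto simp: chains_def)
 show u: "uf_arrow G W (ws ! k) (ws ! Suc k)" if "k < d" for k using assms that by (auto simp: chains_def)
 have "ptarget G (ws ! k) = fst (ws ! Suc k)" if "Suc k < length ws" for k
 proof -
  have "ws ! k \<in> set ws" using that by simp
  then have "ws ! k \<in> NT" using s by blast
  then show ?thesis using u[of k] that l uf_arrow_nontrivial[of "ws ! k" "ws ! Suc k"]
   by (auto simp: composable_pair)
 qed
 then show "composable G ws" using s NT_qpaths unfolding composable_def by blast
qed

end

text \<open>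
 In what follows \<open>x\<close> is a fixed path; its subpaths are the intervals between positions.
\<close>

locale path_in_quiver = tip_quiver +
 fixes x :: "('a, 'b) qpath"
 assumes x: "x \<in> qpaths G"
begin

abbreviation N :: nat where "N \<equiv> length (snd x)"

definition rel :: "nat \<Rightarrow> nat \<Rightarrow> bool" where
 "rel i j \<longleftrightarrow> i \<le> j \<and> j \<le> N \<and> sp x i j \<in> W"

definition has :: "nat \<Rightarrow> bool" where "has p \<longleftrightarrow> (\<exists>i\<ge>p. \<exists>j. rel i j)"

definition rs :: "nat \<Rightarrow> nat" where
 "rs p = (if has p then LEAST i. p \<le> i \<and> (\<exists>j. rel i j) else if p \<le> N then Suc N else p)"

text \<open>The end of a relation with given start is unique by \<open>rel_nested\<close>, so
  \<open>SOME\<close> involves no choice. The default values \<open>Suc N\<close> and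
  \<open>p\<close> are those that the axioms of \<open>relation_ends\<close> require.\<close>

definition re :: "nat \<Rightarrow> nat" where
 "re p = (if has p then SOME j. rel (rs p) j else if p \<le> N then Suc N else p)"

lemma rel_length: "rel i j \<Longrightarrow> i + 2 \<le> j"
 using W_length[of "sp x i j"] length_sp[of j x i] by (simp add: rel_def)

lemma rel_nested: "rel i j \<Longrightarrow> rel k l \<Longrightarrow> k \<le> i \<Longrightarrow> j \<le> l \<Longrightarrow> i = k \<and> j = l"
proof -
 assume h: "rel i j" "rel k l" "k \<le> i" "j \<le> l"
 have "subpath G (sp x i j) (sp x k l)"
  using h subpath_sp_iff[OF x, of k l "sp x i j"] by (auto simp: rel_def)
 then have "sp x i j = sp x k l" using W_antichain h by (auto simp: rel_def)
 then have "j - i = l - k" using length_sp[of j x i] length_sp[of l x k] h by (simp add: rel_def)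
 then show ?thesis using h by (auto simp: rel_def)
qed

lemma has_rs: "has p \<Longrightarrow> p \<le> rs p \<and> rel (rs p) (re p)"
proof -
 assume h: "has p"
 have 1: "p \<le> rs p \<and> (\<exists>j. rel (rs p) j)"
  using LeastI_ex[of "\<lambda>i. p \<le> i \<and> (\<exists>j. rel i j)"] h by (auto simp: rs_def has_def)
 then have "rel (rs p) (SOME j. rel (rs p) j)" by (metis someI_ex)
 then show ?thesis using 1 h by (simp add: re_def)
qed

lemma rs_least: "p \<le> i \<Longrightarrow> rel i j \<Longrightarrow> rs p \<le> i"
 using Least_le[of "\<lambda>i. p \<le> i \<and> (\<exists>j. rel i j)" i] by (auto simp: rs_def has_def)

lemma has_mono: "p \<le> q \<Longrightarrow> has q \<Longrightarrow> has p"
 by (meson has_def order_trans)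

lemma has_le: "has p \<Longrightarrow> p \<le> N" "has p \<Longrightarrow> re p \<le> N"
 using has_rs[of p] by (auto simp: rel_def)

text \<open>The relation that starts first also ends first, because nested relations
  coincide.\<close>

lemma re_least: "p \<le> i \<Longrightarrow> rel i j \<Longrightarrow> re p \<le> j"
proof (rule ccontr)
 assume h: "p \<le> i" "rel i j" "\<not> re p \<le> j"
 then have hp: "has p" by (auto simp: has_def)
 have "rs p \<le> i" by (rule rs_least[OF h(1,2)])
 then show False using rel_nested[OF h(2), of "rs p" "re p"] has_rs[OF hp] h(3) by simp
qed

lemma re_le_has: "re p \<le> N \<Longrightarrow> has p"
 by (auto simp: re_def split: if_splits)

lemma re_le_iff: "re p \<le> q \<and> q \<le> N \<longleftrightarrow> q \<le> N \<and> (\<exists>i j. p \<le> i \<and> rel i j \<and> j \<le> q)"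
proof
 assume "re p \<le> q \<and> q \<le> N"
 then show "q \<le> N \<and> (\<exists>i j. p \<le> i \<and> rel i j \<and> j \<le> q)"
  using has_rs[OF re_le_has[of p]] by force
next
 assume "q \<le> N \<and> (\<exists>i j. p \<le> i \<and> rel i j \<and> j \<le> q)"
 then show "re p \<le> q \<and> q \<le> N" using re_least by force
qed

lemma not_has: "\<not> has p \<Longrightarrow> re p = (if p \<le> N then Suc N else p)" "\<not> has p \<Longrightarrow> rs p = (if p \<le> N then Suc N else p)"
 by (simp_all add: re_def rs_def)

lemma rs_mono: "p \<le> q \<Longrightarrow> q \<le> Suc N \<Longrightarrow> rs p \<le> rs q"
proof (cases "has q")
 case True
 moreover assume "p \<le> q"
 ultimately show ?thesis using has_rs[of q] rs_least[of p "rs q" "re q"] by simp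
next
 case False
 moreover assume "p \<le> q" "q \<le> Suc N"
 moreover have "has p \<Longrightarrow> rs p \<le> N" using has_rs[of p] by (simp add: rel_def)
 ultimately show ?thesis using not_has[of p] not_has[of q] by (cases "has p") auto
qed

sublocale relation_ends N re rs
proof
 fix p q :: nat assume pq: "p \<le> q"
 show "re p \<le> re q"
 proof (cases "has q")
  case True
  then show ?thesis using has_rs[of q] re_least[of p "rs q" "re q"] pq by simp
 next
  case False
  then show ?thesis using not_has(1)[of p] not_has(1)[of q] has_le(2)[of p] pq
   by (cases "has p") auto
 qed
 assume q: "q \<le> Suc N"
 show "re p = re q \<longleftrightarrow> q \<le> rs p"
 proof (cases "has p")
  case hp: True
  show ?thesis
  proof (cases "has q")
   case hq: True
   show ?thesis
   proof
    assume "re p = re q"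
    then have "rs p = rs q"
     using rel_nested[of "rs q" "re q" "rs p" "re p"] has_rs[OF hp] has_rs[OF hq] rs_mono[OF pq q] by simp
    then show "q \<le> rs p" using has_rs[OF hq] by simp
   next
    assume "q \<le> rs p"
    then have "rs q = rs p" using rs_least[of q "rs p" "re p"] has_rs[OF hp] rs_mono[OF pq q] by simp
    then show "re p = re q" using hp hq by (simp add: re_def)
   qed
  next
   case hq: False
   have "\<not> q \<le> rs p" using hq has_rs[OF hp] by (auto simp: has_def)
   moreover have "re p \<noteq> re q" using has_le(2)[OF hp] not_has(1)[OF hq] by (auto split: if_splits)
   ultimately show ?thesis by simp
  qed
 next
  case hp: False
  then have "\<not> has q" using pq has_mono by blast
  then show ?thesis using hp not_has[of p] not_has[of q] pq q by auto
 qed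
next
 fix p :: nat
 show "p \<le> N \<Longrightarrow> re p \<le> Suc N" using has_le(2)[of p] not_has(1)[of p] by (cases "has p") auto
 show "p \<le> N \<Longrightarrow> p < re p"
  using has_rs[of p] rel_length[of "rs p" "re p"] not_has(1)[of p] by (cases "has p") auto
 show "N < p \<Longrightarrow> re p = p" using has_le(1)[of p] not_has(1)[of p] by (cases "has p") auto
 show "re p \<le> N \<Longrightarrow> rs p < re p"
  using has_rs[OF re_le_has[of p]] rel_length[of "rs p" "re p"] by simp
qed

lemma t_shift: "E p (t y j) = t y (j + 2 * p)"
proof (induction p)
 case (Suc p)
 have "t y (j + 2 * Suc p) = re (t y (j + 2 * p))" by (simp del: t_even t_odd)
 then show ?case using Suc by simp
qed simp

text \<open>The position \<open>y\<close> lies in some link of the whole chain. Applying iterates of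
  \<open>re\<close> moves two links at a time, so the required inequality is squeezed between two
  end points for which the whole chain provides it.\<close>

lemma chain_path_whole:
 assumes v: "val 0 r" and N: "t 0 (Suc r) = N"
 shows "chain_path N re rs"
proof
 fix p y :: nat assume le: "E (Suc p) (Suc y) \<le> N"
 have yN: "y < N" using E_ge[of "Suc y" "Suc p"] le by simp
 \<comment> \<open>The link of the whole chain that contains the arrow from \<open>y\<close> to
   \<open>Suc y\<close>.\<close>
 define k where "k = (GREATEST k. k \<le> r \<and> t 0 k \<le> y)"
 have k: "k \<le> r \<and> t 0 k \<le> y" unfolding k_def
  by (rule GreatestI_nat[of _ 0 r]) auto
 have kmax: "k' \<le> k" if "k' \<le> r" "t 0 k' \<le> y" for k' unfolding k_def
  by (rule Greatest_le_nat[of _ _ r]) (use that in auto)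
 have k1: "y < t 0 (Suc k)"
 proof (cases "k = r")
  case True then show ?thesis using N yN by simp
 next
  case False
  then show ?thesis using kmax[of "Suc k"] k by (cases "t 0 (Suc k) \<le> y") auto
 qed
 \<comment> \<open>The end of link \<open>k\<close> moved by \<open>E p\<close>, see
   \<open>t_shift\<close>.\<close>
 define j where "j = Suc k + 2 * p"
 have hi: "E p (Suc y) \<le> t 0 j" using E_mono[of "Suc y" "t 0 (Suc k)" p] k1 t_shift[of p 0 "Suc k"] by (simp add: j_def)
 have lo: "t 0 (Suc j) \<le> E (Suc p) y"
  using E_mono[of "t 0 k" y "Suc p"] k t_shift[of "Suc p" 0 k] by (simp add: j_def)
 show "rs (E p (Suc y)) < E (Suc p) y"
 proof (cases "j < r")
  case True
  then have "rs (t 0 j) < t 0 (Suc j)" using v by (simp add: val_def)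
  moreover have "t 0 j \<le> N" using t_mono[of 0 j "Suc r"] N True by simp
  ultimately show ?thesis using rs_mono[OF hi] lo by simp
 next
  \<comment> \<open>The chain has no condition at \<open>j\<close>, but then
    \<open>E (Suc p) y\<close> is already at or beyond the end of the path.\<close>
  case False
  then have "N \<le> E (Suc p) y" using t_mono[of 0 "Suc r" "Suc j"] N lo by simp
  moreover have "rs (E p (Suc y)) < E (Suc p) (Suc y)" using s_lt[of "E p (Suc y)"] le by simp
  ultimately show ?thesis using le by simp
 qed
qed

lemma t_strict: "val y d \<Longrightarrow> k \<le> d \<Longrightarrow> t y k < t y (Suc k)"
proof -
 assume v: "val y d" and k: "k \<le> d"
 consider "k = 0" | "k = Suc 0" | j where "k = Suc (Suc j)" by (metis not0_implies_Suc)
 then show ?thesis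
 proof cases
  case 2
  have "t y (Suc k) \<le> N" using t_mono[of y "Suc k" "Suc d"] k v val_le[OF v] by (simp add: val_def)
  then have "has y" using 2 re_le_has by simp
  then show ?thesis using 2 has_rs[of y] rel_length[of "rs y" "re y"] by simp
 next
  case 3 then show ?thesis using t_less[OF v, of j] k by simp
 qed simp
qed

text \<open>The positional form of a composable list with product \<open>sp x y z\<close>
  (\<open>pieces_iff\<close>), meaningful for the empty list as well.\<close>

fun pieces :: "nat \<Rightarrow> ('a, 'b) qpath list \<Rightarrow> nat \<Rightarrow> bool" where
 "pieces y [] z \<longleftrightarrow> y = z"
| "pieces y (w # ws) z \<longleftrightarrow> (\<exists>m. y \<le> m \<and> m \<le> z \<and> w = sp x y m \<and> pieces m ws z)"

lemma pieces_le: "pieces y ws z \<Longrightarrow> y \<le> z"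
proof (cases ws)
 case (Cons w vs)
 assume "pieces y ws z"
 then obtain m where "y \<le> m" "m \<le> z" using Cons by auto
 then show ?thesis by simp
qed simp

lemma sp_split:
 assumes "y \<le> z" "z \<le> N" "(fst w, snd w @ bs) = sp x y z"
 shows "y + length (snd w) \<le> z" "w = sp x y (y + length (snd w))"
  "sp x (y + length (snd w)) z = (ptarget G w, bs)"
proof -
 let ?s = "sp x y z" and ?m = "length (snd w)"
 have l: "?m + length bs = z - y" using assms(3) length_sp[OF assms(2), of y] by (metis length_append snd_conv)
 then show 1: "y + ?m \<le> z" using assms(1) by simp
 have "w = sp ?s 0 ?m" using assms(3) by (simp add: sp_def[of ?s] prod_eq_iff) (metis append_eq_conv_conj snd_conv fst_conv)
 then show w: "w = sp x y (y + ?m)" using sp_sp[of y y "y + ?m" z x] 1 by simp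
 have "(ptarget G w, bs) = sp ?s ?m (z - y)"
  using assms(3) l by (simp add: sp_def[of ?s] prod_eq_iff ptarget_tgt)
   (metis append_eq_conv_conj length_append order_refl snd_conv take_all fst_conv)
 then show "sp x (y + ?m) z = (ptarget G w, bs)" using sp_sp[of y "y + ?m" z z x] 1 by simp
qed

lemma pieces_iff:
 assumes "y \<le> z" "z \<le> N" "ws \<noteq> []"
 shows "pieces y ws z \<longleftrightarrow> composable G ws \<and> path_prod ws = sp x y z"
 using assms
proof (induction ws arbitrary: y)
 case (Cons w ws)
 show ?case
 proof (cases ws)
  case Nil
  then show ?thesis using Cons.prems sp_qpaths[OF x] by (auto simp: composable_single)
 next
  case Cons2: (Cons v vs)
  have ne: "ws \<noteq> []" using Cons2 by simp
  show ?thesis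
  proof
   assume "pieces y (w # ws) z"
   then obtain m where m: "y \<le> m" "m \<le> z" "w = sp x y m" "pieces m ws z" by auto
   then have c: "composable G ws" "path_prod ws = sp x m z" using Cons.IH[of m] Cons.prems ne by auto
   have "fst v = fst (path_prod ws)" using Cons2 by (simp add: path_prod_def)
   then have "ptarget G w = fst v" using m c ptarget_sp[of y m x z] by simp
   then have "composable G (w # ws)"
    using m(1,3) c Cons2 sp_qpaths[OF x m(1)] by (simp add: composable_Cons2)
   moreover have "path_prod (w # ws) = sp x y z"
    using path_prod_Cons[OF ne, of w] c m sp_join[of y m z x] by simp
   ultimately show "composable G (w # ws) \<and> path_prod (w # ws) = sp x y z" by simp
  next
   assume h: "composable G (w # ws) \<and> path_prod (w # ws) = sp x y z"
   let ?m = "y + length (snd w)"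
   note s = sp_split[of y z w "snd (path_prod ws)"]
   have 1: "(fst w, snd w @ snd (path_prod ws)) = sp x y z" using h path_prod_Cons[OF ne, of w] by simp
   have "fst (path_prod ws) = fst v" using Cons2 by (simp add: path_prod_def)
   then have "path_prod ws = sp x ?m z"
    using s(3)[OF Cons.prems(1,2) 1] h Cons2 by (simp add: composable_Cons2 prod_eq_iff)
   then have "pieces ?m ws z"
    using Cons.IH[of ?m] s(1)[OF Cons.prems(1,2) 1] Cons.prems ne h Cons2 by (simp add: composable_Cons2)
   then show "pieces y (w # ws) z"
    using s(1,2)[OF Cons.prems(1,2) 1] by (auto intro!: exI[of _ ?m])
  qed
 qed
qed simp

lemma pieces_nth:
 "pieces y ws z \<longleftrightarrow> (\<exists>c. c 0 = y \<and> c (length ws) = z \<and>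
   (\<forall>i<length ws. c i \<le> c (Suc i) \<and> ws ! i = sp x (c i) (c (Suc i))))"
proof (induction ws arbitrary: y)
 case (Cons w ws)
 show ?case
 proof
  assume "pieces y (w # ws) z"
  then obtain m where m: "y \<le> m" "m \<le> z" "w = sp x y m" "pieces m ws z" by auto
  then obtain c where c: "c 0 = m" "c (length ws) = z"
   "\<forall>i<length ws. c i \<le> c (Suc i) \<and> ws ! i = sp x (c i) (c (Suc i))" using Cons by blast
  show "\<exists>c. c 0 = y \<and> c (length (w # ws)) = z \<and>
   (\<forall>i<length (w # ws). c i \<le> c (Suc i) \<and> (w # ws) ! i = sp x (c i) (c (Suc i)))"
   using m c by (intro exI[of _ "case_nat y c"]) (auto simp: less_Suc_eq_0_disj)
 next
  assume "\<exists>c. c 0 = y \<and> c (length (w # ws)) = z \<and>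
   (\<forall>i<length (w # ws). c i \<le> c (Suc i) \<and> (w # ws) ! i = sp x (c i) (c (Suc i)))"
  then obtain c where c: "c 0 = y" "c (length (w # ws)) = z"
   "\<forall>i<length (w # ws). c i \<le> c (Suc i) \<and> (w # ws) ! i = sp x (c i) (c (Suc i))" by blast
  have "pieces (c 1) ws z" using Cons[of "c 1"] c by (auto intro!: exI[of _ "\<lambda>i. c (Suc i)"])
  moreover have "y \<le> c 1 \<and> w = sp x y (c 1)" using c(1) c(3)[rule_format, of 0] by simp
  ultimately show "pieces y (w # ws) z" using pieces_le by (auto intro!: exI[of _ "c 1"])
 qed
qed auto

lemma sp_nontip_iff: "y \<le> z \<Longrightarrow> z \<le> N \<Longrightarrow> sp x y z \<in> nontip G W \<longleftrightarrow> z < re y"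
proof -
 assume h: "y \<le> z" "z \<le> N"
 have "(\<exists>v\<in>W. subpath G v (sp x y z)) \<longleftrightarrow> (\<exists>i j. y \<le> i \<and> rel i j \<and> j \<le> z)"
  unfolding subpath_sp_iff[OF x h] rel_def using h by (auto; meson order_trans)
 then show ?thesis using re_le_iff[of y z] h sp_qpaths[OF x h(1)] by (auto simp: nontip_def)
qed

lemma sp_NT_iff: "y \<le> z \<Longrightarrow> z \<le> N \<Longrightarrow> sp x y z \<in> NT \<longleftrightarrow> y < z \<and> z < re y"
 using sp_nontip_iff[of y z] trivial_paths_iff[OF sp_qpaths[OF x, of y z]] length_sp[of z x y]
  length_0_conv[of "snd (sp x y z)"] by auto

lemma sp_prod: "a \<le> b \<Longrightarrow> b \<le> c \<Longrightarrow> path_prod [sp x a b, sp x b c] = sp x a c"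
 by (simp add: path_prod_pair sp_join)

text \<open>A product that contains a tip reaches at least \<open>re a\<close>, and minimality of an
  arrow of the Uf-graph forbids going further. The tip does not fit into the second vertex, a
  nontip, so it starts before \<open>b\<close>.\<close>

lemma uf_arrow_spD:
 assumes "a < b" "b \<le> c" "c \<le> N" "uf_arrow G W (sp x a b) (sp x b c)" "sp x b c \<in> NT"
 shows "c = re a" "rs a < b"
proof -
 have nt: "sp x a b \<notin> trivial_paths G"
  using trivial_paths_iff[OF sp_qpaths[OF x, of a b]] length_sp[of b x a] assms by auto
 have ac: "a \<le> c" using assms by simp
 have u: "sp x a c \<in> path_ideal G W"
  "\<And>y. left_factor G y (sp x a c) \<Longrightarrow> y \<noteq> sp x a c \<Longrightarrow> y \<notin> path_ideal G W"
  using assms uf_arrow_nontrivial[OF nt] sp_prod[of a b c] by auto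
 have le: "re a \<le> c" using u(1) path_ideal_iff[OF sp_qpaths[OF x ac]] sp_nontip_iff[OF ac assms(3)] by simp
 show "c = re a"
 proof (rule ccontr)
  assume "c \<noteq> re a"
  then have lt: "re a < c" using le by simp
  have a1: "a \<le> re a" by (rule e_ge)
  have j: "sp x a c = (fst (sp x a (re a)), snd (sp x a (re a)) @ snd (sp x (re a) c))"
   using sp_join[OF a1 le, of x] by simp
  then have "left_factor G (sp x a (re a)) (sp x a c)"
   unfolding left_factor_iff using sp_qpaths[OF x ac] by simp
  moreover have "sp x a (re a) \<noteq> sp x a c" using sp_inject[of x a "re a" c] lt assms a1 by auto
  moreover have "sp x a (re a) \<in> path_ideal G W"
   using path_ideal_iff[OF sp_qpaths[OF x a1]] sp_nontip_iff[OF a1] lt assms by simp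
  ultimately show False using u(2) by blast
 qed
 moreover have "c < re b" using sp_NT_iff[of b c] assms by simp
 ultimately show "rs a < b" using e_eq_iff[of a b] assms by auto
qed

text \<open>Because the tip ending at \<open>re a\<close> starts before \<open>b\<close>, the second
  vertex is a proper right factor of it; shorter left factors of the product end before
  \<open>re a\<close> and contain no tip.\<close>

lemma uf_arrow_spI:
 assumes "a < b" "b < re a" "re a \<le> N" "rs a < b" "sp x a b \<in> uf_vertices G W"
 shows "uf_arrow G W (sp x a b) (sp x b (re a))" "sp x b (re a) \<in> uf_vertices G W" "sp x b (re a) \<in> NT"
proof -
 have nt: "sp x a b \<notin> trivial_paths G"
  using trivial_paths_iff[OF sp_qpaths[OF x, of a b]] length_sp[of b x a] assms by auto
 have ac: "a \<le> re a" "a \<le> b" "b \<le> re a" using assms by auto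
 have r: "a \<le> rs a" "rel (rs a) (re a)" using has_rs[OF re_le_has[OF assms(3)]] by auto
 have "re a < re b" using e_eq_iff[of a b] e_mono[of a b] assms by auto
 then show "sp x b (re a) \<in> NT" using sp_NT_iff[of b "re a"] assms by simp
 have rj: "rs a \<le> b" "rs a \<le> re a" using assms by auto
 have "right_factor G (sp x b (re a)) (sp x (rs a) (re a))"
  unfolding right_factor_iff
  using sp_qpaths[OF x rj(2)] sp_join[OF rj(1) ac(3), of x] ptarget_sp[OF rj(1), of x "re a"]
  by (intro conjI exI[of _ "snd (sp x (rs a) b)"]) (auto simp: prod_eq_iff ptarget_tgt sp_def)
 moreover have "sp x b (re a) \<noteq> sp x (rs a) (re a)"
  using length_sp[OF assms(3), of b] length_sp[OF assms(3), of "rs a"] assms by auto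
 ultimately show v: "sp x b (re a) \<in> uf_vertices G W" using r(2) by (auto simp: uf_vertices_def rel_def)
 have "sp x a (re a) \<in> path_ideal G W"
  using path_ideal_iff[OF sp_qpaths[OF x ac(1)]] sp_nontip_iff[OF ac(1)] assms by simp
 moreover have "y \<notin> path_ideal G W" if y: "left_factor G y (sp x a (re a))" "y \<noteq> sp x a (re a)" for y
 proof -
  obtain bs where bs: "fst y = fst (sp x a (re a))" "snd (sp x a (re a)) = snd y @ bs"
   using y(1) by (auto simp: left_factor_iff)
  then have yy: "(fst y, snd y @ bs) = sp x a (re a)" by (simp add: prod_eq_iff)
  let ?m = "a + length (snd y)"
  note s = sp_split[OF ac(1) assms(3) yy]
  have "?m \<noteq> re a" using s(2) y(2) by metis
  then have "?m < re a" using s(1) by simp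
  then have "sp x a ?m \<in> nontip G W" using sp_nontip_iff[of a ?m] s(1) assms by simp
  then show ?thesis using s(2) path_ideal_iff[OF sp_qpaths[OF x, of a ?m]] by simp
 qed
 ultimately show "uf_arrow G W (sp x a b) (sp x b (re a))"
  using uf_arrow_nontrivial[OF nt] v assms sp_prod[OF ac(2,3)] sp_qpaths[OF x ac(2)] sp_qpaths[OF x ac(3)]
   ptarget_sp[OF ac(2), of x "re a"] by (simp add: composable_pair)
qed

definition gl :: "nat \<Rightarrow> nat \<Rightarrow> ('a, 'b) qpath list" where
 "gl y d = map (\<lambda>k. sp x (t y k) (t y (Suc k))) [0..<Suc d]"

lemma length_gl [simp]: "length (gl y d) = Suc d"
 by (simp add: gl_def)

lemma nth_gl: "k \<le> d \<Longrightarrow> gl y d ! k = sp x (t y k) (t y (Suc k))"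
 unfolding gl_def by (subst nth_map) (auto simp del: upt_Suc)

lemma pieces_gl:
 assumes "val y d" shows "pieces y (gl y d) (t y (Suc d))"
 unfolding pieces_nth using t_strict[OF assms]
 by (intro exI[of _ "t y"]) (auto simp: nth_gl less_imp_le simp del: t_even t_odd)

lemma gl_chain:
 assumes v: "val y d" shows "gl y d \<in> chains G W d"
proof -
 have tN: "t y (Suc k) \<le> N" if "k \<le> d" for k
  using t_mono[of y "Suc k" "Suc d"] val_le[OF v] v that by (simp add: val_def)
 have arr: "sp x y (Suc y) \<in> arrow_path G ` arcs G"
  using arrow_path_iff[OF sp_qpaths[OF x, of y "Suc y"]] length_sp[of "Suc y" x y] val_le[OF v] by simp
 have *: "sp x (t y k) (t y (Suc k)) \<in> uf_vertices G W \<and> sp x (t y k) (t y (Suc k)) \<in> NT \<and>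
   (0 < k \<longrightarrow> uf_arrow G W (sp x (t y (k - 1)) (t y k)) (sp x (t y k) (t y (Suc k))))" if "k \<le> d" for k
  using that
 proof (induction k)
  case 0 then show ?case using arr arrow_nontip by (auto simp: uf_vertices_def)
 next
  case (Suc k)
  have 1: "t y k < t y (Suc k)" "t y (Suc k) < t y (Suc (Suc k))" "t y (Suc (Suc k)) \<le> N"
   "rs (t y k) < t y (Suc k)"
   using t_strict[OF v, of k] t_strict[OF v, of "Suc k"] tN[of "Suc k"] Suc.prems v by (auto simp: val_def)
  show ?case using uf_arrow_spI[of "t y k" "t y (Suc k)"] 1 Suc by (simp del: t_even t_odd)
 qed
 have "set (gl y d) \<subseteq> NT"
  unfolding gl_def using * by (auto simp del: upt_Suc t_even t_odd)
 moreover have "uf_arrow G W (gl y d ! k) (gl y d ! Suc k)" if "k < d" for k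
  using *[of "Suc k"] that by (simp add: nth_gl del: t_even t_odd)
 moreover have "\<exists>e\<in>trivial_paths G. uf_arrow G W e (gl y d ! 0)"
 proof -
  have "fst (sp x y (Suc y)) \<in> verts G" using sp_qpaths[OF x, of y "Suc y"] walk_verts by (auto simp: qpaths_walk)
  then have "(fst (sp x y (Suc y)), []) \<in> trivial_paths G" by (auto simp: trivial_paths_def)
  then show ?thesis using uf_arrow_trivial arr by (intro bexI[of _ "(fst (sp x y (Suc y)), [])"]) (auto simp: nth_gl)
 qed
 ultimately show ?thesis by (simp add: chains_def)
qed

text \<open>The first letter is an arrow and every further one is forced by
  \<open>uf_arrow_spD\<close>. Hence a chain on the path is determined by its start and its
  degree.\<close>

lemma chain_gl:
 assumes c: "ws \<in> chains G W d" and p: "pieces y ws z" and z: "z \<le> N"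
 shows "val y d \<and> ws = gl y d \<and> z = t y (Suc d)"
proof -
 note cD = chainsD[OF c]
 obtain c where c: "c 0 = y" "c (length ws) = z"
  "\<And>i. i < length ws \<Longrightarrow> c i \<le> c (Suc i) \<and> ws ! i = sp x (c i) (c (Suc i))"
  using p unfolding pieces_nth by blast
 have cz: "c i \<le> z" if "i \<le> length ws" for i
  using that
 proof (induction rule: inc_induct)
  case (step i) then show ?case using c(3)[of i] by simp
 qed (simp add: c)
 have NT: "ws ! i \<in> NT" if "i \<le> d" for i
 proof -
  have "ws ! i \<in> set ws" using cD(1) that by simp
  then show ?thesis using cD(2) by blast
 qed
 have lt: "c i < c (Suc i)" "c (Suc i) < re (c i)" if "i \<le> d" for i
  using sp_NT_iff[of "c i" "c (Suc i)"] c(3)[of i] cz[of "Suc i"] cD(1) NT[of i] that z by auto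
 have c1: "c 1 = Suc y"
 proof -
  have "length (snd (ws ! 0)) = 1" using cD(3) by (auto simp: arrow_path_def)
  then show ?thesis using c(1) c(3)[of 0] cD(1) length_sp[of "c 1" x "c 0"] cz[of 1] z by auto
 qed
 have cs: "c (Suc (Suc k)) = re (c k) \<and> rs (c k) < c (Suc k)" if "k < d" for k
  using uf_arrow_spD[of "c k" "c (Suc k)" "c (Suc (Suc k))"] cD(5)[OF that] c(3)[of k] c(3)[of "Suc k"]
   NT[of "Suc k"] cz[of "Suc (Suc k)"] z cD(1) lt[of k] that by auto
 have ct: "i \<le> Suc d \<Longrightarrow> c i = t y i" for i
 proof (induction i rule: less_induct)
  case (less i)
  consider "i = 0" | "i = Suc 0" | k where "i = Suc (Suc k)" by (metis not0_implies_Suc)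
  then show ?case by cases (use less c1 c(1) cs in auto)
 qed
 have "ws = gl y d"
  using cD(1) c(3) ct by (intro nth_equalityI) (auto simp: nth_gl less_Suc_eq_le simp del: t_even t_odd)
 moreover have "z = t y (Suc d)" using c(2) cD(1) ct[of "Suc d"] by simp
 moreover have "rs (t y k) < t y (Suc k)" if "k < d" for k
  using cs[OF that] ct[of k] ct[of "Suc k"] that by (simp del: t_even t_odd)
 then have "val y d" unfolding val_def using \<open>z = t y (Suc d)\<close> z by simp
 ultimately show ?thesis by blast
qed

end

section \<open>Toupie algebras and their normal forms\<close>

lemma delta_eq [simp]: "delta x y = (if y = x then 1 else 0)"
 by (simp add: delta_def)

lemma delta_inject: "(delta x :: 'b \<Rightarrow> 'k::zero_neq_one) = delta y \<longleftrightarrow> x = y"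
 by (auto simp: fun_eq_iff split: if_splits)

context wf_digraph
begin

lemma carrier_path_algebra:
 "f \<in> carrier (path_algebra G) \<longleftrightarrow> finite {x. f x \<noteq> 0} \<and> {x. f x \<noteq> 0} \<subseteq> qpaths G"
 by (simp add: path_algebra_def)

lemma path_algebra_simps [simp]:
 "(f \<otimes>\<^bsub>path_algebra G\<^esub> g) x = (\<Sum>i\<le>length (snd x). f (fst x, take i (snd x)) *
   g (tgt (fst x) (take i (snd x)), drop i (snd x)))"
 "f \<oplus>\<^bsub>path_algebra G\<^esub> g = (\<lambda>x. f x + g x)"
 "\<zero>\<^bsub>path_algebra G\<^esub> = (\<lambda>x. 0)"
 by (simp_all add: path_algebra_def ptarget_tgt)

lemma delta_carrier: "x \<in> qpaths G \<Longrightarrow> (delta x :: _ \<Rightarrow> 'k::field) \<in> carrier (path_algebra G)"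
 by (auto simp: carrier_path_algebra)

lemma delta_mult:
 assumes "composable G [u, v]"
 shows "delta u \<otimes>\<^bsub>path_algebra G\<^esub> delta v = (delta (path_prod [u, v]) :: _ \<Rightarrow> 'k::field)"
proof
 fix x
 have uv: "tgt (fst u) (snd u) = fst v" using assms by (simp add: composable_pair ptarget_tgt)
 have *: "(delta u (fst x, take i (snd x)) * delta v (tgt (fst x) (take i (snd x)), drop i (snd x)) :: 'k) =
  (if i = length (snd u) then (if x = path_prod [u, v] then 1 else 0) else 0)" if "i \<le> length (snd x)" for i
 proof (cases "(fst x, take i (snd x)) = u \<and> (tgt (fst x) (take i (snd x)), drop i (snd x)) = v")
  case True
  then have t: "fst x = fst u" "take i (snd x) = snd u" "drop i (snd x) = snd v" by auto
  have "snd x = snd u @ snd v" unfolding t(2,3)[symmetric] by simp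
  then have "x = path_prod [u, v]" using t(1) by (simp add: path_prod_pair prod_eq_iff)
  moreover have "i = length (snd u)" unfolding t(2)[symmetric] using that by simp
  ultimately have "x = path_prod [u, v]" "i = length (snd u)" by auto
  then show ?thesis using True by simp
 next
  case False
  then have "\<not> (x = path_prod [u, v] \<and> i = length (snd u))"
   using uv by (auto simp: path_prod_pair prod_eq_iff)
  then show ?thesis using False by auto
 qed
 have "(delta u \<otimes>\<^bsub>path_algebra G\<^esub> delta v) x =
  (\<Sum>i\<le>length (snd x). if i = length (snd u) then (if x = path_prod [u, v] then 1 else 0) else (0 :: 'k))"
  unfolding path_algebra_simps by (intro sum.cong refl *) simp
 also have "\<dots> = delta (path_prod [u, v]) x" by (auto simp: path_prod_pair)
 finally show "(delta u \<otimes>\<^bsub>path_algebra G\<^esub> delta v) x = (delta (path_prod [u, v]) x :: 'k)" .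
qed

lemma path_algebra_idealI:
 fixes S :: "(('a, 'b) qpath \<Rightarrow> 'k::field) set"
 assumes "ring (path_algebra G :: (('a, 'b) qpath \<Rightarrow> 'k) ring)" "S \<subseteq> carrier (path_algebra G)"
  and "(\<lambda>_. 0) \<in> S" "\<And>f g. f \<in> S \<Longrightarrow> g \<in> S \<Longrightarrow> (\<lambda>x. f x + g x) \<in> S"
  "\<And>f. f \<in> S \<Longrightarrow> (\<lambda>x. - f x) \<in> S"
  "\<And>f a. f \<in> S \<Longrightarrow> a \<in> carrier (path_algebra G) \<Longrightarrow> a \<otimes>\<^bsub>path_algebra G\<^esub> f \<in> S"
  "\<And>f a. f \<in> S \<Longrightarrow> a \<in> carrier (path_algebra G) \<Longrightarrow> f \<otimes>\<^bsub>path_algebra G\<^esub> a \<in> S"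
 shows "ideal S (path_algebra G)"
proof (rule idealI[OF assms(1)])
 interpret R: ring "path_algebra G :: (('a, 'b) qpath \<Rightarrow> 'k) ring" by fact
 have "a_inv (path_algebra G) f \<in> S" if f: "f \<in> S" for f
 proof -
  have "a_inv (path_algebra G) f = (\<lambda>x. - f x)"
   using f assms(2) assms(5)[OF f] by (intro R.minus_equality) auto
  then show ?thesis using assms(5)[OF f] by simp
 qed
 then show "subgroup S (add_monoid (path_algebra G))"
  using assms(2,3,4) by (intro subgroup.intro) (auto simp: a_inv_def)
qed (use assms in auto)

end

locale toupie =
 fixes Q :: "('v, 'e) pre_digraph" and so si :: 'v
  and I :: "(('v, 'e) qpath \<Rightarrow> 'k::field) set"
  and Gmon W :: "('v, 'e) qpath set" and B4 :: "('v, 'e) qpath list"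
  and r :: nat and piv :: "nat \<Rightarrow> nat" and cf :: "nat \<Rightarrow> nat \<Rightarrow> 'k"
 assumes toupie: "toupie_algebra Q so si I Gmon B4 r piv cf"
  and W_eq: "W = Gmon \<union> nonmon_tips B4 r piv"

sublocale toupie \<subseteq> fin_digraph Q
 using toupie by (simp add: toupie_algebra_def toupie_quiver_def)

context toupie
begin

abbreviation (input) R :: "(('v, 'e) qpath \<Rightarrow> 'k) ring" where "R \<equiv> path_algebra Q"

abbreviation \<rho> :: "nat \<Rightarrow> ('v, 'e) qpath \<Rightarrow> 'k" where "\<rho> \<equiv> rho B4 piv cf"

abbreviation tip :: "nat \<Rightarrow> ('v, 'e) qpath" where "tip i \<equiv> B4 ! piv i"

lemma toupieD:
 "toupie_quiver Q so si" "admissible Q I" "Gmon \<subseteq> qpaths Q"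
 "minimal_generating Q I (delta ` Gmon \<union> \<rho> ` {..<r})" "distinct B4"
 "set B4 = {b \<in> branches Q so si. \<exists>i<r. \<rho> i b \<noteq> 0}"
 "\<And>b g. b \<in> set B4 \<Longrightarrow> g \<in> Gmon \<Longrightarrow> \<not> subpath Q g b"
 "strict_mono_on {..<r} piv" "\<And>i. i < r \<Longrightarrow> piv i < length B4"
 "\<And>i i'. i < r \<Longrightarrow> i' < r \<Longrightarrow> piv i < piv i' \<Longrightarrow> cf i (piv i') = 0"
 using toupie by (auto simp: toupie_algebra_def)

lemma I_ideal: "ideal I R"
 using toupieD(2) by (simp add: admissible_def)

sublocale R: ring R
 using I_ideal by (simp add: ideal_def)

lemma I_gen: "I = genideal R (delta ` Gmon \<union> \<rho> ` {..<r})"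
 and gen_carrier: "delta ` Gmon \<union> \<rho> ` {..<r} \<subseteq> carrier R"
 using toupieD(4) by (auto simp: minimal_generating_def)

lemma I_carrier: "f \<in> I \<Longrightarrow> f \<in> carrier R"
 using I_ideal by (meson additive_subgroup.a_Hcarr ideal_def)

lemma gen_I: "delta ` Gmon \<union> \<rho> ` {..<r} \<subseteq> I"
 using R.genideal_self[OF gen_carrier] I_gen by simp

lemma a_inv_eq: "f \<in> carrier R \<Longrightarrow> a_inv R f = (\<lambda>x. - f x)"
proof (rule R.minus_equality)
 assume "f \<in> carrier R"
 then show "(\<lambda>x. - f x) \<in> carrier R" by (simp add: carrier_path_algebra)
qed auto

lemma I_diff: "f \<in> I \<Longrightarrow> g \<in> I \<Longrightarrow> (\<lambda>x. f x - g x) \<in> I"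
proof -
 assume fg: "f \<in> I" "g \<in> I"
 interpret J: ideal I R by (rule I_ideal)
 have "f \<oplus>\<^bsub>R\<^esub> (a_inv R g) \<in> I" using fg J.a_closed J.a_inv_closed by simp
 then show ?thesis using a_inv_eq[OF I_carrier[OF fg(2)]] by simp
qed

text \<open>Admissibility enters only through the following lemma.\<close>

lemma I_short:
 assumes "f \<in> I" "length (snd x) < 2" shows "f x = 0"
proof -
 define J :: "(('v, 'e) qpath \<Rightarrow> 'k) set" where "J = {f \<in> carrier R. \<forall>v. f (v, []) = 0}"
 have "ideal J R"
 proof (rule path_algebra_idealI[OF R.ring_axioms])
  fix f a assume f: "f \<in> J" and a: "a \<in> carrier R"
  have "a \<otimes>\<^bsub>R\<^esub> f \<in> carrier R" "f \<otimes>\<^bsub>R\<^esub> a \<in> carrier R" using f a by (auto simp: J_def)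
  then show "a \<otimes>\<^bsub>R\<^esub> f \<in> J" "f \<otimes>\<^bsub>R\<^esub> a \<in> J" using f by (auto simp: J_def)
 next
  fix f g assume "f \<in> J" "g \<in> J"
  then show "(\<lambda>x. f x + g x) \<in> J" using R.a_closed[of f g] by (simp add: J_def)
 next
  fix f assume "f \<in> J"
  then show "(\<lambda>x. - f x) \<in> J" by (simp add: J_def carrier_path_algebra)
 qed (auto simp: J_def carrier_path_algebra)
 moreover have "delta (arrow_path Q e) \<in> J" if "e \<in> arcs Q" for e
  using delta_carrier[OF arrow_path_qpaths[OF that]] by (auto simp: J_def arrow_path_def)
 ultimately have AJ: "arrow_ideal Q \<subseteq> J"
  unfolding arrow_ideal_def by (intro R.genideal_minimal) auto
 have 1: "f (v, []) = 0" if "f \<in> arrow_ideal_pow Q (Suc 0)" for f :: "('v, 'e) qpath \<Rightarrow> 'k" and v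
  using that unfolding arrow_ideal_pow.simps
  by (induction rule: ideal_prod.induct) (use AJ in \<open>auto simp: J_def\<close>)
 have "\<forall>x. length (snd x) < 2 \<longrightarrow> f x = 0" if "f \<in> arrow_ideal_pow Q (Suc (Suc 0))"
  for f :: "('v, 'e) qpath \<Rightarrow> 'k"
  using that unfolding arrow_ideal_pow.simps(2)[of Q "Suc 0"]
 proof (induction rule: ideal_prod.induct)
  case (prod i j)
  have j0: "j (v, []) = 0" for v using prod(2) AJ by (auto simp: J_def)
  show ?case
  proof (intro allI impI)
   fix x :: "('v, 'e) qpath" assume "length (snd x) < 2"
   then have "snd x = [] \<or> (\<exists>a. snd x = [a])" by (cases "snd x"; cases "tl (snd x)") auto
   then show "(i \<otimes>\<^bsub>R\<^esub> j) x = 0" using j0 1[OF prod(1)] by auto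
  qed
 qed auto
 moreover have "f \<in> arrow_ideal_pow Q (Suc (Suc 0))"
  using assms(1) toupieD(2) by (auto simp: admissible_def numeral_2_eq_2)
 ultimately show ?thesis using assms(2) by blast
qed

lemma \<rho>_eval: "i < r \<Longrightarrow> j < length B4 \<Longrightarrow> \<rho> i (B4 ! j) = (if j = piv i then 1 else if piv i < j then cf i j else 0)"
proof -
 assume i: "i < r" and j: "j < length B4"
 have "\<rho> i (B4 ! j) = delta (tip i) (B4 ! j) + (\<Sum>k\<in>{piv i<..<length B4}. cf i k * delta (B4 ! k) (B4 ! j))"
 proof -
  have "(\<Sum>k\<in>A. fscale (cf i k) (delta (B4 ! k))) b = (\<Sum>k\<in>A. cf i k * delta (B4 ! k) b)" for A b
   by (induction A rule: infinite_finite_induct) (simp_all add: fscale_def)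
  then show ?thesis by (simp add: rho_def)
 qed
 also have "(\<Sum>k\<in>{piv i<..<length B4}. cf i k * delta (B4 ! k) (B4 ! j)) =
   (\<Sum>k\<in>{piv i<..<length B4}. if k = j then cf i j else 0)"
  using j toupieD(5) by (intro sum.cong) (auto simp: nth_eq_iff_index_eq)
 also have "\<dots> = (if piv i < j then cf i j else 0)" using j by simp
 also have "delta (tip i) (B4 ! j) = (if j = piv i then 1 else (0::'k))"
  using j toupieD(9)[OF i] toupieD(5) by (auto simp: nth_eq_iff_index_eq)
 finally show ?thesis by simp
qed

lemma piv_less: "i < r \<Longrightarrow> i' < r \<Longrightarrow> i < i' \<Longrightarrow> piv i < piv i'"
 using toupieD(8) by (auto simp: strict_mono_on_def)

lemma piv_inj: "i < r \<Longrightarrow> i' < r \<Longrightarrow> piv i = piv i' \<Longrightarrow> i = i'"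
 by (metis less_irrefl linorder_neqE_nat piv_less)

lemma tip_inj: "i < r \<Longrightarrow> i' < r \<Longrightarrow> tip i = tip i' \<Longrightarrow> i = i'"
 using toupieD(5,9) piv_inj by (auto simp: nth_eq_iff_index_eq)

text \<open>This is reducedness of the echelon form: evaluating at the tips reads off coefficients
  with respect to the relations.\<close>

lemma \<rho>_tip: "i < r \<Longrightarrow> i' < r \<Longrightarrow> \<rho> i (tip i') = (if i = i' then 1 else 0)"
 using \<rho>_eval[of i "piv i'"] toupieD(9)[of i'] toupieD(10)[of i i'] piv_inj[of i i'] by auto

lemma \<rho>_B4: "\<rho> i b \<noteq> 0 \<Longrightarrow> i < r \<Longrightarrow> b \<in> set B4"
proof (rule ccontr)
 assume h: "\<rho> i b \<noteq> 0" "i < r" "b \<notin> set B4"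
 have "(\<Sum>k\<in>A. fscale (cf i k) (delta (B4 ! k))) b = (\<Sum>k\<in>A. cf i k * delta (B4 ! k) b)" for A
  by (induction A rule: infinite_finite_induct) (simp_all add: fscale_def)
 moreover have "(\<Sum>k\<in>{piv i<..<length B4}. cf i k * delta (B4 ! k) b) = 0"
  using h(3) by (intro sum.neutral) auto
 moreover have "b \<noteq> tip i" using h toupieD(9) by auto
 ultimately show False using h(1) by (simp add: rho_def)
qed

lemma tip_B4: "i < r \<Longrightarrow> tip i \<in> set B4"
 using toupieD(9) by simp

lemma B4_branch: "b \<in> set B4 \<Longrightarrow> b \<in> qpaths Q \<and> fst b = so \<and> ptarget Q b = si"
 using toupieD(6) by (auto simp: branches_def)

lemma B4_length: "b \<in> set B4 \<Longrightarrow> 2 \<le> length (snd b)"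
proof -
 assume "b \<in> set B4"
 then obtain i where "i < r" "\<rho> i b \<noteq> 0" using toupieD(6) by auto
 then show ?thesis using I_short[of "\<rho> i" b] gen_I by force
qed

lemma no_arc_into_source: "a \<in> arcs Q \<Longrightarrow> head Q a \<noteq> so"
proof
 assume a: "a \<in> arcs Q" "head Q a = so"
 have "in_degree Q so = 0" using toupieD(1) by (simp add: toupie_quiver_def)
 then have "in_arcs Q so = {}" by (simp add: in_degree_def finite_in_arcs)
 then show False using a by (auto simp: in_arcs_def)
qed

lemma no_arc_from_sink: "a \<in> arcs Q \<Longrightarrow> tail Q a \<noteq> si"
proof
 assume a: "a \<in> arcs Q" "tail Q a = si"
 have "out_degree Q si = 0" using toupieD(1) by (simp add: toupie_quiver_def)
 then have "out_arcs Q si = {}" by (simp add: out_degree_def finite_out_arcs)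
 then show False using a by (auto simp: out_arcs_def)
qed

lemma walk_to_source: "walk u as \<Longrightarrow> tgt u as = so \<Longrightarrow> as = []"
proof (induction u as rule: walk.induct)
 case (2 u a as)
 then show ?case using no_arc_into_source by (cases as) auto
qed simp

lemma walk_from_sink: "walk si as \<Longrightarrow> as = []"
 using no_arc_from_sink by (cases as) auto

text \<open>A branch starts at the source, which no arrow enters, and ends at the sink, which no
  arrow leaves. This keeps the non monomial relations apart from everything longer.\<close>

lemma B4_maximal: "b \<in> set B4 \<Longrightarrow> subpath Q b x \<Longrightarrow> x = b"
proof -
 assume b: "b \<in> set B4" and "subpath Q b x"
 then obtain as bs where x: "x \<in> qpaths Q" "snd x = as @ snd b @ bs" "tgt (fst x) as = fst b"
  by (auto simp: subpath_iff)
 then have w: "walk (fst x) as" "walk (ptarget Q b) bs" by (auto simp: qpaths_walk walk_append ptarget_tgt)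
 have "as = []" using walk_to_source[OF w(1)] x(3) B4_branch[OF b] by simp
 moreover have "bs = []" using w(2) B4_branch[OF b] walk_from_sink by simp
 ultimately show ?thesis using x by (simp add: prod_eq_iff)
qed

definition mono_free :: "('v, 'e) qpath \<Rightarrow> bool" where
 "mono_free x \<longleftrightarrow> x \<in> qpaths Q \<and> (\<forall>g\<in>Gmon. \<not> subpath Q g x)"

lemma mono_free_subpath: "mono_free x \<Longrightarrow> subpath Q y x \<Longrightarrow> mono_free y"
 unfolding mono_free_def using subpath_trans subpath_qpaths by blast

text \<open>The elements with such an expansion form an ideal that contains the generators. On
  monomial-free paths they are supported on branches in \<open>B4\<close>, which are maximal, so
  multiplication by \<open>a\<close> merely scales them by the value of \<open>a\<close> at the
  trivial path of the source or of the sink.\<close>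

lemma I_form:
 assumes "f \<in> I"
 shows "\<exists>c. \<forall>x. mono_free x \<longrightarrow> f x = (\<Sum>i<r. c i * \<rho> i x)"
proof -
 define L where "L = {f \<in> carrier R. \<exists>c. \<forall>x. mono_free x \<longrightarrow> f x = (\<Sum>i<r. c i * \<rho> i x)}"
 have "ideal L R"
 proof (rule path_algebra_idealI[OF R.ring_axioms])
  show "(\<lambda>_. 0) \<in> L" by (auto simp: L_def carrier_path_algebra intro!: exI[of _ "\<lambda>_. 0"])
  fix f assume f: "f \<in> L"
  then obtain c where c: "\<And>x. mono_free x \<Longrightarrow> f x = (\<Sum>i<r. c i * \<rho> i x)" by (auto simp: L_def)
  show "(\<lambda>x. - f x) \<in> L" using f c
   by (auto simp: L_def carrier_path_algebra sum_negf intro!: exI[of _ "\<lambda>i. - c i"])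
  show "(\<lambda>x. f x + g x) \<in> L" if g: "g \<in> L" for g
  proof -
   obtain c' where c': "\<And>x. mono_free x \<Longrightarrow> g x = (\<Sum>i<r. c' i * \<rho> i x)" using g by (auto simp: L_def)
   then show ?thesis using f g c R.a_closed[of f g]
    by (auto simp: L_def sum.distrib distrib_right intro!: exI[of _ "\<lambda>i. c i + c' i"])
  qed
  fix a assume a: "a \<in> carrier R"
  have f0: "f y = 0" if "y \<notin> set B4" "mono_free y" for y
  proof -
   have "\<rho> i y = 0" if "i < r" for i using \<rho>_B4[of i y] that \<open>y \<notin> set B4\<close> by blast
   then show ?thesis using c[OF that(2)] by simp
  qed
  show "a \<otimes>\<^bsub>R\<^esub> f \<in> L"
  proof -
   have *: "(a \<otimes>\<^bsub>R\<^esub> f) x = (\<Sum>i<r. (a (so, []) * c i) * \<rho> i x)" if x: "mono_free x" for x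
   proof -
    have "a (fst x, take i (snd x)) * f (tgt (fst x) (take i (snd x)), drop i (snd x)) =
     (if i = 0 then a (so, []) * f x else 0)" if "i \<le> length (snd x)" for i
    proof -
     let ?y = "(tgt (fst x) (take i (snd x)), drop i (snd x))"
     have "snd x = take i (snd x) @ snd ?y @ []" "tgt (fst x) (take i (snd x)) = fst ?y" by simp_all
     then have sub: "subpath Q ?y x" using x unfolding subpath_iff mono_free_def by blast
     have my: "mono_free ?y" by (rule mono_free_subpath[OF x sub])
     show ?thesis
     proof (cases "?y \<in> set B4")
      case True
      then have "x = ?y" by (rule B4_maximal[OF _ sub])
      then have "length (snd x) = length (snd ?y)" by (rule arg_cong)
      then have "i = 0" using B4_length[OF True] by simp
      moreover have "(so, snd x) = x" using B4_branch[OF True] \<open>i = 0\<close> by (auto simp: prod_eq_iff)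
      ultimately show ?thesis by (metis drop0 fst_conv snd_conv take0 tgt.simps(1))
     next
      case False
      then show ?thesis using f0[OF False my] by (cases "i = 0") auto
     qed
    qed
    then have "(a \<otimes>\<^bsub>R\<^esub> f) x = a (so, []) * f x" by simp
    then show ?thesis using c[OF x] by (simp add: sum_distrib_left mult.assoc)
   qed
   have "a \<otimes>\<^bsub>R\<^esub> f \<in> carrier R" using R.m_closed[OF a] f by (simp only: L_def mem_Collect_eq)
   then show ?thesis unfolding L_def
    by (intro CollectI conjI exI[of _ "\<lambda>i. a (so, []) * c i"] allI impI *)
  qed
  show "f \<otimes>\<^bsub>R\<^esub> a \<in> L"
  proof -
   have *: "(f \<otimes>\<^bsub>R\<^esub> a) x = (\<Sum>i<r. (a (si, []) * c i) * \<rho> i x)" if x: "mono_free x" for x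
   proof -
    have "f (fst x, take i (snd x)) * a (tgt (fst x) (take i (snd x)), drop i (snd x)) =
     (if i = length (snd x) then a (si, []) * f x else 0)" if "i \<le> length (snd x)" for i
    proof -
     let ?y = "(fst x, take i (snd x))"
     have "snd x = [] @ snd ?y @ drop i (snd x)" "tgt (fst x) [] = fst ?y" by simp_all
     then have sub: "subpath Q ?y x" using x unfolding subpath_iff mono_free_def by blast
     have my: "mono_free ?y" by (rule mono_free_subpath[OF x sub])
     show ?thesis
     proof (cases "?y \<in> set B4")
      case True
      then have xy: "x = ?y" by (rule B4_maximal[OF _ sub])
      then have "length (snd x) = length (snd ?y)" by (rule arg_cong)
      then have "i = length (snd x)" using that by simp
      moreover have "tgt (fst x) (snd x) = si"
       using B4_branch[OF True] \<open>i = length (snd x)\<close> by (auto simp: ptarget_tgt)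
      ultimately show ?thesis by (simp add: mult.commute)
     next
      case False
      then show ?thesis using f0[OF False my] by (cases "i = length (snd x)") auto
     qed
    qed
    then have "(f \<otimes>\<^bsub>R\<^esub> a) x = a (si, []) * f x" by simp
    then show ?thesis using c[OF x] by (simp add: sum_distrib_left mult.assoc)
   qed
   have "f \<otimes>\<^bsub>R\<^esub> a \<in> carrier R" using R.m_closed[OF _ a] f by (simp only: L_def mem_Collect_eq)
   then show ?thesis unfolding L_def
    by (intro CollectI conjI exI[of _ "\<lambda>i. a (si, []) * c i"] allI impI *)
  qed
 qed (auto simp: L_def)
 moreover have "delta ` Gmon \<union> \<rho> ` {..<r} \<subseteq> L"
 proof -
  have "delta g \<in> L" if g: "g \<in> Gmon" for g
  proof -
   have *: "delta g x = (\<Sum>i<r. 0 * \<rho> i x)" if "mono_free x" for x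
    using that g subpath_refl[of g] by (auto simp: mono_free_def)
   have "delta g \<in> carrier R" using g toupieD(3) by (intro delta_carrier) blast
   then show ?thesis unfolding L_def by (intro CollectI conjI exI[of _ "\<lambda>_. 0"] allI impI *)
  qed
  moreover have "\<rho> i \<in> L" if i: "i < r" for i
  proof -
   have *: "\<rho> i x = (\<Sum>j<r. delta i j * \<rho> j x)" for x
   proof -
    have "(\<Sum>j<r. delta i j * \<rho> j x) = (\<Sum>j<r. if j = i then \<rho> i x else 0)" by (intro sum.cong) auto
    then show ?thesis using i by simp
   qed
   have "\<rho> i \<in> carrier R" using i gen_carrier by blast
   then show ?thesis unfolding L_def by (intro CollectI conjI exI[of _ "delta i"] allI impI *)
  qed
  ultimately show ?thesis by auto
 qed
 ultimately have "I \<subseteq> L" unfolding I_gen by (intro R.genideal_minimal)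
 then show ?thesis using assms by (auto simp: L_def)
qed

lemma tips_def: "nonmon_tips B4 r piv = tip ` {..<r}"
 by (auto simp: nonmon_tips_def)

lemma W_cases: "x \<in> W \<Longrightarrow> (x \<in> Gmon \<Longrightarrow> P) \<Longrightarrow> (\<And>i. i < r \<Longrightarrow> x = tip i \<Longrightarrow> P) \<Longrightarrow> P"
 by (auto simp: W_eq tips_def)

text \<open>Otherwise \<open>delta h\<close> would lie in the ideal of the remaining generators and
  could be dropped, against minimality.\<close>

lemma Gmon_antichain:
 assumes g: "g \<in> Gmon" "h \<in> Gmon" "subpath Q g h" shows "g = h"
proof (rule ccontr)
 assume ne: "g \<noteq> h"
 let ?G = "delta ` Gmon \<union> \<rho> ` {..<r}"
 let ?H = "?G - {delta h}"
 have Hc: "?H \<subseteq> carrier R" using gen_carrier by blast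
 interpret H: ideal "genideal R ?H" R using R.genideal_ideal[OF Hc] .
 obtain u v where uv: "composable Q [u, g, v]" "h = path_prod [u, g, v]" using g(3) by (auto simp: subpath_def)
 have c: "composable Q [u, g]" "composable Q [g, v]" "u \<in> qpaths Q" "v \<in> qpaths Q" using uv(1)
  by (auto simp: composable_Cons2 composable_pair composable_single)
 have ug: "composable Q [path_prod [u, g], v]"
  using c composable_append_walk[OF c(1)] by (simp add: composable_pair)
 have "delta g \<in> ?H" using g ne by (auto simp: delta_inject)
 then have "delta g \<in> genideal R ?H" using R.genideal_self[OF Hc] by blast
 then have "delta u \<otimes>\<^bsub>R\<^esub> delta g \<otimes>\<^bsub>R\<^esub> delta v \<in> genideal R ?H"
  by (rule H.I_r_closed[OF H.I_l_closed[OF _ delta_carrier[OF c(3)]] delta_carrier[OF c(4)]])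
 also have "delta u \<otimes>\<^bsub>R\<^esub> delta g \<otimes>\<^bsub>R\<^esub> delta v = delta h"
  unfolding delta_mult[OF c(1)] delta_mult[OF ug] uv(2) by (simp add: path_prod_def)
 finally have dh: "delta h \<in> genideal R ?H" .
 have "?G \<subseteq> insert (delta h) ?H" by (subst insert_Diff_single) (rule subset_insertI)
 also have "\<dots> \<subseteq> genideal R ?H" by (rule insert_subsetI[OF dh R.genideal_self[OF Hc]])
 finally have "?G \<subseteq> genideal R ?H" .
 then have "I \<subseteq> genideal R ?H" unfolding I_gen by (intro R.genideal_minimal H.ideal_axioms)
 moreover have "genideal R ?H \<subseteq> I" using gen_I by (intro R.genideal_minimal I_ideal) blast
 ultimately have "genideal R ?H = I" by (rule antisym[rotated])
 moreover have "delta h \<in> ?G" using g(2) by (intro UnI1 imageI)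
 then have "?H \<subset> ?G" by (intro psubsetI Diff_subset) (metis Diff_iff singletonI)
 ultimately show False using toupieD(4) unfolding minimal_generating_def by metis
qed

end

sublocale toupie \<subseteq> tip_quiver Q W
proof
 show "W \<subseteq> qpaths Q"
 proof
  fix x assume "x \<in> W"
  then show "x \<in> qpaths Q"
   by (rule W_cases) (use toupieD(3) tip_B4 B4_branch in blast)+
 qed
 show "2 \<le> length (snd x)" if "x \<in> W" for x
  using that
 proof (rule W_cases)
  assume "x \<in> Gmon"
  then show ?thesis using I_short[of "delta x" x] gen_I by force
 qed (use tip_B4 B4_length in auto)
 show "x = y" if xy: "x \<in> W" "y \<in> W" "subpath Q x y" for x y
  using xy(1)
 proof (rule W_cases)
  assume x: "x \<in> Gmon"
  show ?thesis using xy(2)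
   by (rule W_cases) (use Gmon_antichain x xy(3) toupieD(7) tip_B4 in auto)
 next
  fix i assume "i < r" "x = tip i"
  then show ?thesis using B4_maximal[of x y] tip_B4 xy(3) by simp
 qed
qed

context toupie
begin

lemma nontip_mono_free: "x \<in> nontip Q W \<Longrightarrow> mono_free x"
 by (auto simp: nontip_def mono_free_def W_eq)

lemma mono_free_cases:
 assumes "mono_free x"
 obtains "x \<in> nontip Q W" | i where "i < r" "x = tip i"
proof (cases "x \<in> nontip Q W")
 case False
 then obtain y where y: "y \<in> W" "subpath Q y x" using assms by (auto simp: nontip_def mono_free_def)
 from y(1) show ?thesis
 proof (rule W_cases)
  assume "y \<in> Gmon" then show ?thesis using y assms by (auto simp: mono_free_def)
 next
  fix i assume "i < r" "y = tip i"
  then show ?thesis using that(2) B4_maximal[of y x] y tip_B4 by simp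
 qed
qed (use that in blast)

lemma tip_not_nontip: "i < r \<Longrightarrow> tip i \<notin> nontip Q W"
proof -
 assume i: "i < r"
 then have "subpath Q (tip i) (tip i)" using B4_branch[OF tip_B4[OF i]] by (intro subpath_refl) simp
 then show ?thesis using i unfolding nontip_def W_eq tips_def by blast
qed

lemma zero_I: "(\<lambda>x. 0) \<in> I"
 using additive_subgroup.zero_closed[OF ideal.axioms(1)[OF I_ideal]] by simp

text \<open>Nontips are monomial free, so \<open>I_form\<close> applies; the coefficients are the
  values at the tips, where the element vanishes. This independence modulo \<open>I\<close> is the
  uniqueness of normal forms.\<close>

lemma I_nontip:
 assumes "f \<in> I" "{x. f x \<noteq> 0} \<subseteq> nontip Q W" shows "f = (\<lambda>_. 0)"
proof
 fix x
 obtain c where c: "\<And>x. mono_free x \<Longrightarrow> f x = (\<Sum>i<r. c i * \<rho> i x)" using I_form[OF assms(1)] by blast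
 have c0: "c i = 0" if i: "i < r" for i
 proof -
  have mf: "mono_free (tip i)"
   using toupieD(7)[OF tip_B4[OF i]] B4_branch[OF tip_B4[OF i]] by (auto simp: mono_free_def)
  have "f (tip i) = 0" using assms(2) tip_not_nontip[OF i] by blast
  moreover have "f (tip i) = (\<Sum>j<r. if j = i then c i else 0)"
   unfolding c[OF mf] using i by (intro sum.cong) (auto simp: \<rho>_tip)
  ultimately show ?thesis using i by simp
 qed
 show "f x = 0"
 proof (cases "f x = 0")
  case False
  then have "mono_free x" using assms(2) nontip_mono_free by blast
  then show ?thesis using c c0 by simp
 qed
qed

lemma normal_formI:
 assumes "h \<in> carrier R" "{x. h x \<noteq> 0} \<subseteq> nontip Q W" "(\<lambda>x. h x - f x) \<in> I"
 shows "normal_form Q I W f = h"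
 unfolding normal_form_def
proof (rule the_equality)
 have "h = (\<lambda>x. h x - f x) \<oplus>\<^bsub>R\<^esub> f" by simp
 then show "h \<in> carrier R \<and> {x. h x \<noteq> 0} \<subseteq> nontip Q W \<and> h \<in> a_r_coset R I f"
  using assms unfolding a_r_coset_def' by blast
next
 fix g assume g: "g \<in> carrier R \<and> {x. g x \<noteq> 0} \<subseteq> nontip Q W \<and> g \<in> a_r_coset R I f"
 then obtain i where i: "i \<in> I" "g = (\<lambda>x. i x + f x)" by (auto simp: a_r_coset_def')
 have "(\<lambda>x. i x - (h x - f x)) \<in> I" by (rule I_diff[OF i(1) assms(3)])
 also have "(\<lambda>x. i x - (h x - f x)) = (\<lambda>x. g x - h x)" using i(2) by auto
 finally have "(\<lambda>x. g x - h x) \<in> I" .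
 moreover have "{x. g x - h x \<noteq> 0} \<subseteq> {x. g x \<noteq> 0} \<union> {x. h x \<noteq> 0}" by auto
 then have "{x. g x - h x \<noteq> 0} \<subseteq> nontip Q W" using g assms(2) by blast
 ultimately have "(\<lambda>x. g x - h x) = (\<lambda>_. 0)" by (rule I_nontip)
 then show "g = h" by (metis eq_iff_diff_eq_0 ext)
qed

lemma normal_form_nontip:
 assumes "x \<in> nontip Q W" shows "normal_form Q I W (delta x) = delta x"
proof (rule normal_formI)
 show "delta x \<in> carrier R" using assms by (intro delta_carrier) (simp add: nontip_def)
 show "{y. delta x y \<noteq> (0 :: 'k)} \<subseteq> nontip Q W" using assms by auto
 show "(\<lambda>y. delta x y - delta x y) \<in> I" using zero_I by simp
qed

text \<open>By reducedness no other tip occurs in \<open>\<rho> i\<close>, so a tip is brought to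
  normal form by a single subtraction.\<close>

lemma \<rho>_nontip: "i < r \<Longrightarrow> \<rho> i b \<noteq> 0 \<Longrightarrow> b \<noteq> tip i \<Longrightarrow> b \<in> nontip Q W"
proof -
 assume h: "i < r" "\<rho> i b \<noteq> 0" "b \<noteq> tip i"
 have b: "b \<in> set B4" using \<rho>_B4 h by blast
 then have "mono_free b" using toupieD(7) B4_branch by (auto simp: mono_free_def)
 then show ?thesis
 proof (cases rule: mono_free_cases)
  case (2 j) then show ?thesis using \<rho>_tip[of i j] h by (auto split: if_splits)
 qed
qed

lemma normal_form_tip:
 assumes "i < r"
 shows "normal_form Q I W (delta (tip i)) = (\<lambda>b. delta (tip i) b - \<rho> i b)"
proof (rule normal_formI)
 have \<rho>I: "\<rho> i \<in> I" using gen_I assms by blast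
 have "{b. \<rho> i b \<noteq> 0} \<subseteq> set B4" using \<rho>_B4 assms by blast
 then have fin: "finite {b. \<rho> i b \<noteq> 0}" by (rule finite_subset) simp
 have *: "{b. delta (tip i) b - \<rho> i b \<noteq> 0} \<subseteq> {b. \<rho> i b \<noteq> 0} - {tip i}"
  using \<rho>_tip[OF assms assms] by auto
 show n: "{b. delta (tip i) b - \<rho> i b \<noteq> 0} \<subseteq> nontip Q W" using * \<rho>_nontip[OF assms] by blast
 show "(\<lambda>b. delta (tip i) b - \<rho> i b) \<in> carrier R"
  unfolding carrier_path_algebra
 proof
  show "finite {b. delta (tip i) b - \<rho> i b \<noteq> 0}" using * fin by (meson finite_Diff finite_subset)
  show "{b. delta (tip i) b - \<rho> i b \<noteq> 0} \<subseteq> qpaths Q" using n unfolding nontip_def by blast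
 qed
 have "(\<lambda>b. 0 - \<rho> i b) \<in> I" by (rule I_diff[OF zero_I \<rho>I])
 then show "(\<lambda>b. delta (tip i) b - \<rho> i b - delta (tip i) b) \<in> I" by simp
qed

lemma normal_form_mono:
 assumes x: "x \<in> qpaths Q" "\<not> mono_free x" shows "normal_form Q I W (delta x) = (\<lambda>_. 0)"
proof (rule normal_formI)
 obtain g where g: "g \<in> Gmon" "subpath Q g x" using x by (auto simp: mono_free_def)
 obtain u v where uv: "composable Q [u, g, v]" "x = path_prod [u, g, v]" using g(2) by (auto simp: subpath_def)
 have c: "composable Q [u, g]" "u \<in> qpaths Q" "v \<in> qpaths Q" using uv(1)
  by (auto simp: composable_Cons2 composable_pair composable_single)
 have ug: "composable Q [path_prod [u, g], v]"
  using uv(1) c composable_append_walk[OF c(1)] by (auto simp: composable_pair composable_Cons2)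
 interpret J: ideal I R by (rule I_ideal)
 have "delta g \<in> I" using gen_I g(1) by (metis UnCI imageI subsetD)
 then have "delta u \<otimes>\<^bsub>R\<^esub> delta g \<otimes>\<^bsub>R\<^esub> delta v \<in> I"
  by (rule J.I_r_closed[OF J.I_l_closed[OF _ delta_carrier[OF c(2)]] delta_carrier[OF c(3)]])
 also have "delta u \<otimes>\<^bsub>R\<^esub> delta g \<otimes>\<^bsub>R\<^esub> delta v = delta x"
  unfolding delta_mult[OF c(1)] delta_mult[OF ug] uv(2) by (simp add: path_prod_def)
 finally show "(\<lambda>b. 0 - delta x b) \<in> I" by (rule I_diff[OF zero_I])
qed (auto simp: carrier_path_algebra)

end

section \<open>The differential dual to the higher products\<close>

lemma cf_mon_mult: "coef (mon [g] * q) gs = (case gs of [] \<Rightarrow> 0 | g' # gs' \<Rightarrow> if g = g' then coef q gs' else 0)"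
 by (induction q rule: fa_induct)
  (auto simp: cf_mon lookup_add distrib_left cst_left[of "mon [g]"] lookup_cst simp flip: mon_Cons split: list.splits)

lemma derw_zero: "(\<And>g. g \<in> set w \<Longrightarrow> \<delta> g = 0) \<Longrightarrow> derw p \<delta> w = 0"
 by (induction w) auto

abbreviation deg :: "'x list \<Rightarrow> nat" where "deg g \<equiv> length g - Suc 0"

context toupie
begin

abbreviation tips :: "('v, 'e) qpath set" where "tips \<equiv> nonmon_tips B4 r piv"

definition decs :: "('v, 'e) qpath list \<Rightarrow> ('v, 'e) qpath list list set" where
 "decs \<gamma> = {gs. \<exists>rs. chain_product_case Q W tips gs rs \<gamma>}"

definition arrows :: "('v, 'e) qpath \<Rightarrow> ('v, 'e) qpath list list" where
 "arrows b = map (\<lambda>a. [arrow_path Q a]) (snd b)"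

text \<open>The products of the theorem read backwards: up to suspension signs, the coefficient of a
  word is that of the dual of \<open>\<gamma>\<close> in the product of the duals of its letters.
  The sign by the degree of the first factor is the one of \<open>D_C\<close>. At most one of the
  two sums is nonzero, since a chain containing a tip has no \<open>decs\<close>.\<close>

definition \<delta>T :: "('v, 'e) qpath list \<Rightarrow> (('v, 'e) qpath list, 'k) fa" where
 "\<delta>T \<gamma> = (\<Sum>gs\<in>decs \<gamma>. (-1) ^ deg (hd gs) * mon gs) +
   (\<Sum>i\<in>{i. i < r \<and> \<gamma> = split_chain Q (tip i)}. \<Sum>b\<in>set B4. cst (\<rho> i b) * mon (arrows b))"

lemma path_prod_split_chain: "b \<in> set B4 \<Longrightarrow> path_prod (split_chain Q b) = b"
proof -
 assume b: "b \<in> set B4"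
 then obtain a as where "snd b = a # as" using B4_length[OF b] by (cases "snd b") auto
 then show ?thesis using B4_branch[OF b]
  by (auto simp: split_chain_def path_prod_def arrow_path_def qpaths_walk prod_eq_iff)
qed

lemma chain_length: "g \<in> chains Q W d \<Longrightarrow> length g = Suc d"
 by (rule chainsD)

lemma chain_qpath: "g \<in> chains Q W d \<Longrightarrow> path_prod g \<in> qpaths Q"
 using chainsD(1,4)[of g d] composable_append_walk[of g] by (cases g) auto

end

section \<open>Factorizations into chains along a fixed path\<close>

locale toupie_path = toupie +
 fixes x :: "('a, 'b) qpath"
 assumes xq: "x \<in> qpaths Q"
begin

sublocale path_in_quiver Q W x
 by unfold_locales (rule xq)

definition gen :: "nat \<Rightarrow> nat \<Rightarrow> (('a, 'b) qpath list, 'c) fa" where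
 "gen y d = (if val y d then mon [gl y d] else 0)"

sublocale chain_words N re rs gen ..

fun decomp :: "nat \<Rightarrow> ('a, 'b) qpath list list \<Rightarrow> nat \<Rightarrow> nat \<Rightarrow> bool" where
 "decomp y [] z \<tau> \<longleftrightarrow> y = z \<and> \<tau> = 0"
| "decomp y (g # gs) z \<tau> \<longleftrightarrow>
  (\<exists>d\<le>\<tau>. val y d \<and> g = gl y d \<and> t y (Suc d) \<le> z \<and> decomp (t y (Suc d)) gs z (\<tau> - d))"

lemma cf_gen_mult:
 "coef (gen y d * q) gs = (case gs of [] \<Rightarrow> 0 | g # gs' \<Rightarrow> if val y d \<and> g = gl y d then coef q gs' else 0)"
 by (auto simp: gen_def cf_mon_mult split: list.splits)

lemma sum_gen:
 assumes "\<And>d. d \<le> \<tau> \<Longrightarrow> val y d \<Longrightarrow> coef (q d) gs = (if P d then 1 else 0)"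
 shows "(\<Sum>d\<le>\<tau>. c d * coef (gen y d * q d) (g # gs)) =
   (if \<exists>d\<le>\<tau>. val y d \<and> g = gl y d \<and> P d then c (deg g) else 0)"
proof -
 have "c d * coef (gen y d * q d) (g # gs) =
  (if d = deg g then (if val y d \<and> g = gl y d \<and> P d then c (deg g) else 0) else 0)" if "d \<le> \<tau>" for d
  using assms[OF that] by (auto simp: cf_gen_mult)
 then have "(\<Sum>d\<le>\<tau>. c d * coef (gen y d * q d) (g # gs)) =
  (\<Sum>d\<le>\<tau>. if d = deg g then (if val y d \<and> g = gl y d \<and> P d then c (deg g) else 0) else 0)"
  by (intro sum.cong) auto
 also have "\<dots> = (if \<exists>d\<le>\<tau>. val y d \<and> g = gl y d \<and> P d then c (deg g) else 0)"
  by (auto simp: sum.delta)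
 finally show ?thesis .
qed

text \<open>Each word arises only once, because the length of its first letter fixes the degree
  \<open>d\<close> in the recursion and thereby the next start.\<close>

lemma Wd_cf: "y \<le> z \<Longrightarrow> z \<le> N \<Longrightarrow> coef (Wd y z \<tau>) gs = (if decomp y gs z \<tau> then 1 else 0)"
proof (induction y z \<tau> arbitrary: gs rule: Wd.induct)
 case (1 y z \<tau>)
 show ?case
 proof (cases "y = z")
  case True
  have "\<not> decomp y (g # gs') y \<tau>" for g gs'
   using t_gt[of y] 1(3) True by (auto simp: not_le simp del: t_even t_odd)
  then show ?thesis using True
   by (cases gs) (auto simp: Wd_same cf_mon simp flip: mon_Nil)
 next
  case False
  then have yz: "y < z" using 1(2) by simp
  have W: "Wd y z \<tau> = (\<Sum>d\<le>\<tau>. gen y d * Wd (t y (Suc d)) z (\<tau> - d))"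
   using yz 1(3) by (simp add: Wd.simps[of y])
  show ?thesis
  proof (cases gs)
   case Nil
   then show ?thesis using yz by (simp add: W lookup_sum cf_gen_mult)
  next
   case (Cons g gs')
   have "coef (Wd (t y (Suc d)) z (\<tau> - d)) gs' =
    (if t y (Suc d) \<le> z \<and> decomp (t y (Suc d)) gs' z (\<tau> - d) then 1 else 0)" if "d \<le> \<tau>" for d
    using 1(1)[OF False, of d gs'] yz 1(3) that Wd_gt[of z "t y (Suc d)" "\<tau> - d"]
    by (cases "t y (Suc d) \<le> z") (auto simp del: t_even t_odd)
   from sum_gen[of \<tau> y "\<lambda>d. Wd (t y (Suc d)) z (\<tau> - d)" gs' _ "\<lambda>_. 1" g, OF this]
   show ?thesis unfolding W Cons by (simp add: lookup_sum)
  qed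
 qed
qed

lemma decomp_iff:
 "y \<le> z \<Longrightarrow> z \<le> N \<Longrightarrow> decomp y gs z \<tau> \<longleftrightarrow>
  (\<exists>rs. list_all2 (\<lambda>\<gamma> r. \<gamma> \<in> chains Q W r) gs rs \<and> sum_list rs = \<tau>) \<and> pieces y (map path_prod gs) z"
proof (induction gs arbitrary: y \<tau>)
 case (Cons g gs)
 show ?case
 proof
  assume "decomp y (g # gs) z \<tau>"
  then obtain d where d: "d \<le> \<tau>" "val y d" "g = gl y d" "t y (Suc d) \<le> z" "decomp (t y (Suc d)) gs z (\<tau> - d)"
   by auto
  have yt: "y \<le> t y (Suc d)" using pieces_le[OF pieces_gl[OF d(2)]] .
  obtain rs where rs: "list_all2 (\<lambda>\<gamma> r. \<gamma> \<in> chains Q W r) gs rs" "sum_list rs = \<tau> - d"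
   "pieces (t y (Suc d)) (map path_prod gs) z" using Cons.IH[of "t y (Suc d)"] d(4,5) Cons.prems by auto
  have "path_prod g = sp x y (t y (Suc d))"
   using pieces_iff[of y "t y (Suc d)" g] pieces_gl[OF d(2)] yt d Cons.prems(2) by (auto simp: gl_def)
  then have "pieces y (map path_prod (g # gs)) z" using yt d(4) rs(3) by (auto intro!: exI[of _ "t y (Suc d)"])
  moreover have "list_all2 (\<lambda>\<gamma> r. \<gamma> \<in> chains Q W r) (g # gs) (d # rs)" "sum_list (d # rs) = \<tau>"
   using rs d gl_chain[OF d(2)] by auto
  ultimately show "(\<exists>rs. list_all2 (\<lambda>\<gamma> r. \<gamma> \<in> chains Q W r) (g # gs) rs \<and> sum_list rs = \<tau>) \<and>
    pieces y (map path_prod (g # gs)) z" by blast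
 next
  assume "(\<exists>rs. list_all2 (\<lambda>\<gamma> r. \<gamma> \<in> chains Q W r) (g # gs) rs \<and> sum_list rs = \<tau>) \<and>
    pieces y (map path_prod (g # gs)) z"
  then obtain d rs m where h: "g \<in> chains Q W d" "list_all2 (\<lambda>\<gamma> r. \<gamma> \<in> chains Q W r) gs rs"
   "d + sum_list rs = \<tau>" "y \<le> m" "m \<le> z" "path_prod g = sp x y m" "pieces m (map path_prod gs) z"
   by (auto simp: list_all2_Cons1)
  have "g \<noteq> []" using chainsD(1)[OF h(1)] by auto
  then have "pieces y g m" using pieces_iff[of y m g] h Cons.prems chainsD(4)[OF h(1)] by auto
  then have g: "val y d" "g = gl y d" "m = t y (Suc d)" using chain_gl[OF h(1)] h Cons.prems by auto
  have "decomp m gs z (\<tau> - d)" using Cons.IH[of m "\<tau> - d"] h Cons.prems by auto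
  then show "decomp y (g # gs) z \<tau>" using g h by (auto intro!: exI[of _ d] simp del: t_even t_odd)
 qed
qed auto

text \<open>Translates the factorizations of the theorem into positions. No tip occurs on the path,
  so that condition of \<open>chain_product_case\<close> is automatic.\<close>

lemma decs_gl:
 assumes v: "val y d" and nt: "\<And>b. b \<in> tips \<Longrightarrow> \<not> subpath Q b x"
 shows "gs \<in> decs (gl y d) \<longleftrightarrow> gs \<noteq> [] \<and> 0 < d \<and> decomp y gs (t y (Suc d)) (d - 1)"
proof -
 let ?z = "t y (Suc d)"
 have yz: "y \<le> ?z" "?z \<le> N" using pieces_le[OF pieces_gl[OF v]] v by (auto simp: val_def)
 have gl: "path_prod (gl y d) = sp x y ?z"
  using pieces_iff[of y ?z "gl y d"] pieces_gl[OF v] yz by (auto simp: gl_def)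
 have sub: "subpath Q (sp x y ?z) x"
  using subpath_sp_iff[OF x, of 0 N "sp x y ?z"] yz by (auto simp: sp_all)
 then have nt': "\<not> (\<exists>b\<in>tips. subpath Q b (path_prod (gl y d)))" using nt subpath_trans gl by metis
 have cd: "gl y d \<in> chains Q W (sum_list rs + 1) \<longleftrightarrow> d = sum_list rs + 1" for rs
  using gl_chain[OF v] chain_length[of "gl y d"] by auto
 show ?thesis
 proof (cases "gs = []")
  case False
  then have "map path_prod gs \<noteq> []" by simp
  note p = pieces_iff[OF yz this]
  have "gs \<in> decs (gl y d) \<longleftrightarrow> (\<exists>rs. chain_product_case Q W tips gs rs (gl y d))" by (simp add: decs_def)
  also have "\<dots> \<longleftrightarrow> (\<exists>rs. list_all2 (\<lambda>\<gamma> r. \<gamma> \<in> chains Q W r) gs rs \<and> d = sum_list rs + 1) \<and>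
    pieces y (map path_prod gs) ?z"
   unfolding chain_product_case_def cd p using False nt' gl by (auto simp del: t_even t_odd)
  also have "\<dots> \<longleftrightarrow> 0 < d \<and> decomp y gs ?z (d - 1)"
   unfolding decomp_iff[OF yz] by (cases d) (auto simp del: t_even t_odd t.simps)
  finally show ?thesis using False by blast
 qed (simp add: decs_def chain_product_case_def)
qed

lemma finite_decs_gl:
 assumes v: "val y d" and nt: "\<And>b. b \<in> tips \<Longrightarrow> \<not> subpath Q b x"
 shows "finite (decs (gl y d))"
proof (rule finite_subset)
 have yz: "y \<le> t y (Suc d)" "t y (Suc d) \<le> N" using pieces_le[OF pieces_gl[OF v]] v by (auto simp: val_def)
 show "decs (gl y d) \<subseteq> fwl ` keys (Wd y (t y (Suc d)) (d - 1))"
 proof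
  fix gs assume "gs \<in> decs (gl y d)"
  then have "coef (Wd y (t y (Suc d)) (d - 1)) gs = 1" using decs_gl[OF v nt] Wd_cf[OF yz] by auto
  then have "FW gs \<in> keys (Wd y (t y (Suc d)) (d - 1))" by (simp add: in_keys_iff)
  then show "gs \<in> fwl ` keys (Wd y (t y (Suc d)) (d - 1))" by (metis fw.sel imageI)
 qed
qed simp

text \<open>This is the assumption \<open>D_C\<close> of \<open>chain_differential\<close> for the
  actual differential.\<close>

lemma \<delta>T_gl:
 assumes v: "val y d" and nt: "\<And>b. b \<in> tips \<Longrightarrow> \<not> subpath Q b x"
 shows "\<delta>T (gl y d) =
  (\<Sum>d'<d. (-1) ^ d' * (gen y d' * Wd (t y (Suc d')) (t y (Suc d)) (d - 1 - d')))"
proof (rule poly_mapping_eqI)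
 fix w :: "('a, 'b) qpath list fw"
 obtain gs where w: "w = FW gs" by (cases w)
 let ?z = "t y (Suc d)"
 have yz: "y \<le> ?z" "?z \<le> N" using pieces_le[OF pieces_gl[OF v]] v by (auto simp: val_def)
 have gl: "path_prod (gl y d) = sp x y ?z"
  using pieces_iff[of y ?z "gl y d"] pieces_gl[OF v] yz by (auto simp: gl_def)
 have sub: "subpath Q (sp x y ?z) x"
  using subpath_sp_iff[OF x, of 0 N "sp x y ?z"] yz by (auto simp: sp_all)
 have "gl y d \<noteq> split_chain Q (tip i)" if "i < r" for i
 proof
  assume "gl y d = split_chain Q (tip i)"
  then have "subpath Q (tip i) x" using gl sub path_prod_split_chain[OF tip_B4[OF that]] by simp
  then show False using nt[of "tip i"] that by (auto simp: tips_def)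
 qed
 then have none: "{i. i < r \<and> gl y d = split_chain Q (tip i)} = {}" by auto
 have lhs: "lookup (\<delta>T (gl y d)) w = (if gs \<in> decs (gl y d) then (-1) ^ deg (hd gs) else 0)"
 proof -
  have "lookup (\<delta>T (gl y d)) w = (\<Sum>hs\<in>decs (gl y d). if hs = gs then (-1) ^ deg (hd gs) else 0)"
   unfolding \<delta>T_def none w by (simp add: lookup_sum lookup_sign_mult cf_mon) (intro sum.cong, auto)
  then show ?thesis using finite_decs_gl[OF v nt] by (simp add: sum.delta)
 qed
 show "lookup (\<delta>T (gl y d)) w =
  lookup (\<Sum>d'<d. (-1) ^ d' * (gen y d' * Wd (t y (Suc d')) ?z (d - 1 - d'))) w"
 proof (cases "gs = [] \<or> d = 0")
  case True
  then have "gs \<notin> decs (gl y d)" using decs_gl[OF v nt, of gs] by blast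
  then show ?thesis unfolding lhs using True
   by (auto simp: lookup_sum lookup_sign_mult w cf_gen_mult)
 next
  case False
  then obtain g gs' where gs: "gs = g # gs'" by (cases gs) auto
  have d: "{..<d} = {..d - 1}" using False by auto
  have "coef (Wd (t y (Suc d')) ?z (d - 1 - d')) gs' =
    (if t y (Suc d') \<le> ?z \<and> decomp (t y (Suc d')) gs' ?z (d - 1 - d') then 1 else 0)" for d'
   using Wd_cf[of "t y (Suc d')" ?z] yz(2) Wd_gt[of ?z "t y (Suc d')"]
   by (cases "t y (Suc d') \<le> ?z") (auto simp del: t_even t_odd)
  note S = sum_gen[of "d - 1" y "\<lambda>d'. Wd (t y (Suc d')) ?z (d - 1 - d')" gs' _ "\<lambda>d'. (-1) ^ d'" g, OF this]
  have "g # gs' \<in> decs (gl y d) \<longleftrightarrow> (\<exists>d'\<le>d - 1. val y d' \<and> g = gl y d' \<and> t y (Suc d') \<le> ?z \<and>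
    decomp (t y (Suc d')) gs' ?z (d - 1 - d'))"
   using decs_gl[OF v nt, of "g # gs'"] False by simp
  then show ?thesis unfolding lhs[unfolded w gs] w gs d lookup_sum lookup_sign_mult S by (simp only: list.sel)
 qed
qed

lemma chain_whole:
 assumes c: "\<gamma> \<in> chains Q W d" and p: "path_prod \<gamma> = x"
 shows "val 0 d" "\<gamma> = gl 0 d" "t 0 (Suc d) = N"
proof -
 have "\<gamma> \<noteq> []" using chainsD(1)[OF c] by auto
 then have "pieces 0 \<gamma> N" using pieces_iff[of 0 N \<gamma>] chainsD(4)[OF c] p by (simp add: sp_all)
 then show "val 0 d" "\<gamma> = gl 0 d" "t 0 (Suc d) = N" using chain_gl[OF c] by auto
qed

end

context toupie
begin

lemma chain_universe:
 assumes "\<gamma> \<in> chains Q W d"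
 shows "toupie_path Q so si I Gmon W B4 r piv cf (path_prod \<gamma>)"
 using chain_qpath[OF assms] by unfold_locales

lemma decs_chain: "gs \<in> decs \<gamma> \<Longrightarrow> \<exists>d. \<gamma> \<in> chains Q W d" "gs \<in> decs \<gamma> \<Longrightarrow> b \<in> tips \<Longrightarrow> \<not> subpath Q b (path_prod \<gamma>)"
 by (auto simp: decs_def chain_product_case_def)

lemma finite_decs: "finite (decs \<gamma>)"
proof (cases "decs \<gamma> = {}")
 case False
 then obtain gs where gs: "gs \<in> decs \<gamma>" by auto
 then obtain d where c: "\<gamma> \<in> chains Q W d" using decs_chain by blast
 interpret toupie_path Q so si I Gmon W B4 r piv cf "path_prod \<gamma>" by (rule chain_universe[OF c])
 show ?thesis using finite_decs_gl[OF chain_whole(1)[OF c refl]] decs_chain(2)[OF gs] chain_whole(2)[OF c refl] by simp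
qed simp

lemma cf_\<delta>T: "coef (\<delta>T \<gamma>) gs = (if gs \<in> decs \<gamma> then (-1) ^ deg (hd gs) else 0) +
  (\<Sum>i\<in>{i. i < r \<and> \<gamma> = split_chain Q (tip i)}. \<Sum>b\<in>set B4. if gs = arrows b then \<rho> i b else 0)"
proof -
 have "coef (\<Sum>hs\<in>decs \<gamma>. (-1) ^ deg (hd hs) * mon hs) gs =
   (\<Sum>hs\<in>decs \<gamma>. if hs = gs then (-1) ^ deg (hd gs) else 0)"
  by (simp add: lookup_sum lookup_sign_mult cf_mon) (intro sum.cong, auto)
 also have "\<dots> = (if gs \<in> decs \<gamma> then (-1) ^ deg (hd gs) else 0)" by (simp add: finite_decs sum.delta)
 finally show ?thesis
  unfolding \<delta>T_def lookup_add lookup_sum[of _ "{i. _ i}"] lookup_sum[of _ "set B4"] lookup_cst cf_mon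
  by (intro arg_cong2[where f = "(+)"] sum.cong) auto
qed

lemma decs_deg: "gs \<in> decs \<gamma> \<Longrightarrow> sum_list (map deg gs) + 1 = deg \<gamma>"
proof -
 assume "gs \<in> decs \<gamma>"
 then obtain rs where rs: "list_all2 (\<lambda>\<gamma> r. \<gamma> \<in> chains Q W r) gs rs" "\<gamma> \<in> chains Q W (sum_list rs + 1)"
  by (auto simp: decs_def chain_product_case_def)
 have "map deg gs = rs" using rs(1) by (induction rule: list_all2_induct) (auto dest: chain_length)
 then show ?thesis using chain_length[OF rs(2)] by simp
qed

lemma lowers_\<delta>T: "lowers deg \<delta>T"
 unfolding lowers_def
proof (intro allI impI)
 fix \<gamma> gs assume "FW gs \<in> keys (\<delta>T \<gamma>)"
 then have "coef (\<delta>T \<gamma>) gs \<noteq> 0" by (simp add: in_keys_iff)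
 have "gs \<in> decs \<gamma> \<or> (\<exists>i b. \<gamma> = split_chain Q (tip i) \<and> gs = arrows b)"
 proof (rule ccontr)
  assume n: "\<not> ?thesis"
  then have "(\<Sum>i\<in>{i. i < r \<and> \<gamma> = split_chain Q (tip i)}. \<Sum>b\<in>set B4. if gs = arrows b then \<rho> i b else 0) = 0"
   by (intro sum.neutral ballI) (auto intro!: sum.neutral)
  then show False using \<open>coef (\<delta>T \<gamma>) gs \<noteq> 0\<close> n unfolding cf_\<delta>T by simp
 qed
 then consider "gs \<in> decs \<gamma>" | i b where "\<gamma> = split_chain Q (tip i)" "gs = arrows b" by blast
 then show "sum_list (map deg gs) + 1 = deg \<gamma>"
 proof cases
  case 1 then show ?thesis by (rule decs_deg)
 next
  case 2
  have "sum_list (map deg (arrows b)) = 0" by (simp add: arrows_def)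
  then show ?thesis using 2 by (simp add: split_chain_def)
 qed
qed

lemma \<delta>T_arrow: "\<delta>T [a] = 0"
 by (rule lowers_0[OF lowers_\<delta>T]) simp

theorem \<delta>T_sq: "der deg \<delta>T (\<delta>T \<gamma>) = 0"
proof (cases "decs \<gamma> = {}")
 \<comment> \<open>Only words of arrows remain in \<open>\<delta>T \<gamma>\<close>, and the
   derivation kills arrows for degree reasons.\<close>
 case True
 have "derw deg \<delta>T (arrows b) = 0" for b
  by (rule derw_zero) (auto simp: arrows_def \<delta>T_arrow)
 then show ?thesis by (simp add: \<delta>T_def True der_simps)
next
 case False
 then obtain gs where gs: "gs \<in> decs \<gamma>" by auto
 then obtain d where c: "\<gamma> \<in> chains Q W d" using decs_chain by blast
 define x where "x = path_prod \<gamma>"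
 interpret toupie_path Q so si I Gmon W B4 r piv cf x unfolding x_def by (rule chain_universe[OF c])
 note w = chain_whole[OF c x_def[symmetric]]
 have nt: "\<not> subpath Q b x" if "b \<in> tips" for b using decs_chain(2)[OF gs that] by (simp add: x_def)
 interpret chain_path N re rs by (rule chain_path_whole[OF w(1,3)])
 \<comment> \<open>A chain with a factorization contains no tip, so all chains along its path have
   the purely combinatorial differential.\<close>
 interpret chain_differential N re rs gen "der deg \<delta>T"
 proof
  fix y d and a :: "(('v, 'e) qpath list, 'k) fa"
  have "homog deg d (gen y d)" by (auto simp: gen_def homog_def)
  then show "der deg \<delta>T (gen y d * a) = der deg \<delta>T (gen y d) * a + (-1) ^ d * (gen y d * der deg \<delta>T a)"
   by (rule der_mult)
  assume v: "val y d"
  then have "gen y d = mon [gl y d]" by (simp add: gen_def)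
  then have "der deg \<delta>T (gen y d) = \<delta>T (gl y d)" by (simp only: der_gen)
  then show "der deg \<delta>T (gen y d) =
   (\<Sum>d'<d. (-1) ^ d' * (gen y d' * Wd (t y (Suc d')) (t y (Suc d)) (d - 1 - d')))"
   by (simp only: \<delta>T_gl[OF v nt])
 qed (auto simp: gen_def der_simps)
 have "der deg \<delta>T (der deg \<delta>T (gen 0 d)) = 0" by (rule D_D_C)
 moreover have "gen 0 d = mon [\<gamma>]" using w by (simp add: gen_def)
 ultimately show ?thesis by (simp only: der_gen)
qed

end

section \<open>The cobar construction of the bar construction\<close>

text \<open>
 Words of bar words \<open>[x\<^sub>1|\<dots>|x\<^sub>n]\<close> over an associative algebra with basis \<open>'a\<close> and structure
 constants \<open>mul\<close>. The contraction of this free algebra onto the original algebra moves the last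
 separator: \<open>b\<close> and \<open>c\<close> append a letter as a new block or to the last block, and \<open>m\<close> multiplies the
 last letter.
\<close>

locale bar_words =
 fixes mul :: "'a \<Rightarrow> 'a \<Rightarrow> 'a \<Rightarrow>\<^sub>0 'k::comm_ring_1"
 assumes assoc: "(\<Sum>u\<in>keys (mul x y). lookup (mul x y) u * lookup (mul u z) v) =
   (\<Sum>u\<in>keys (mul y z). lookup (mul y z) u * lookup (mul x u) v)"
begin

text \<open>The linear extension of \<open>F\<close> evaluated at the product of \<open>x\<close>
  and \<open>y\<close>.\<close>

definition MS :: "'a \<Rightarrow> 'a \<Rightarrow> ('a \<Rightarrow> ('a list, 'k) fa) \<Rightarrow> ('a list, 'k) fa" where
 "MS x y F = (\<Sum>z\<in>keys (mul x y). cst (lookup (mul x y) z) * F z)"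

lemma MS_linear:
 "MS x y (\<lambda>z. F z + F' z) = MS x y F + MS x y F'" "MS x y (\<lambda>z. F z - F' z) = MS x y F - MS x y F'"
 "MS x y (\<lambda>z. - F z) = - MS x y F" "MS x y (\<lambda>z. 0) = 0"
 "MS x y (\<lambda>z. p * F z) = p * MS x y F" "MS x y (\<lambda>z. F z * p) = MS x y F * p"
 by (simp_all add: MS_def sum.distrib sum_subtractf sum_negf distrib_left right_diff_distrib
   sum_distrib_left sum_distrib_right mult.assoc cst_left[of p])

lemma MS_lin: "lin f (MS x y F) = MS x y (\<lambda>z. lin f (F z))"
 by (simp add: MS_def lin_simps)

lemma MS_der: "der p \<delta> (MS x y F) = MS x y (\<lambda>z. der p \<delta> (F z))"
 by (simp add: MS_def der_simps)

lemma MS_assoc: "MS x y (\<lambda>u. MS u z F) = MS y z (\<lambda>u. MS x u F)"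
proof -
 define K where "K = (\<Union>u\<in>keys (mul x y). keys (mul u z)) \<union> (\<Union>u\<in>keys (mul y z). keys (mul x u))"
 have K: "finite K" by (auto simp: K_def)
 have ext: "MS u w F = (\<Sum>v\<in>K. cst (lookup (mul u w) v) * F v)" if "keys (mul u w) \<subseteq> K" for u w
  unfolding MS_def using that K by (intro sum.mono_neutral_left) (auto simp: in_keys_iff)
 have "MS x y (\<lambda>u. MS u z F) = (\<Sum>u\<in>keys (mul x y). cst (lookup (mul x y) u) * (\<Sum>v\<in>K. cst (lookup (mul u z) v) * F v))"
  unfolding MS_def[of x y] by (intro sum.cong refl) (subst ext, auto simp: K_def)
 also have "\<dots> = (\<Sum>v\<in>K. cst (\<Sum>u\<in>keys (mul x y). lookup (mul x y) u * lookup (mul u z) v) * F v)"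
 proof -
  have s: "cst (\<Sum>i\<in>I. g i) = (\<Sum>i\<in>I. cst (g i))" for I :: "'a set" and g :: "'a \<Rightarrow> 'k"
   by (induction I rule: infinite_finite_induct) (simp_all add: cst_add)
  show ?thesis by (simp add: sum_distrib_left s sum_distrib_right cst_mult mult.assoc sum.swap[of _ K])
 qed
 also have "\<dots> = (\<Sum>v\<in>K. cst (\<Sum>u\<in>keys (mul y z). lookup (mul y z) u * lookup (mul x u) v) * F v)"
  by (simp only: assoc)
 also have "\<dots> = (\<Sum>u\<in>keys (mul y z). cst (lookup (mul y z) u) * (\<Sum>v\<in>K. cst (lookup (mul x u) v) * F v))"
 proof -
  have s: "cst (\<Sum>i\<in>I. g i) = (\<Sum>i\<in>I. cst (g i))" for I :: "'a set" and g :: "'a \<Rightarrow> 'k"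
   by (induction I rule: infinite_finite_induct) (simp_all add: cst_add)
  show ?thesis by (simp add: sum_distrib_left s sum_distrib_right cst_mult mult.assoc sum.swap[of _ K])
 qed
 also have "\<dots> = MS y z (\<lambda>u. MS x u F)"
  unfolding MS_def[of y z] by (intro sum.cong refl) (subst ext, auto simp: K_def)
 finally show ?thesis .
qed

definition mg :: "nat \<Rightarrow> 'a list \<Rightarrow> ('a list, 'k) fa" where
 "mg i Y = MS (Y ! (i - 1)) (Y ! i) (\<lambda>z. mon [take (i - 1) Y @ [z] @ drop (i + 1) Y])"

definition \<delta>B :: "'a list \<Rightarrow> ('a list, 'k) fa" where
 "\<delta>B Y = (\<Sum>i=1..<length Y. (-1) ^ i * (mon [take i Y, drop i Y] - mg i Y))"

abbreviation wdeg :: "'a list list \<Rightarrow> nat" where "wdeg U \<equiv> sum_list (map deg U)"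

abbreviation DB :: "('a list, 'k) fa \<Rightarrow> ('a list, 'k) fa" where "DB \<equiv> der deg \<delta>B"

definition cx :: "'a \<Rightarrow> ('a list, 'k) fa \<Rightarrow> ('a list, 'k) fa" where
 "cx x = lin (\<lambda>U. if U = [] then 0 else mon (butlast U @ [last U @ [x]]))"

definition mx :: "'a \<Rightarrow> ('a list, 'k) fa \<Rightarrow> ('a list, 'k) fa" where
 "mx x = lin (\<lambda>U. if U = [] \<or> last U = [] then 0
   else MS (last (last U)) x (\<lambda>z. mon (butlast U @ [butlast (last U) @ [z]])))"

text \<open>\<open>cx\<close> and \<open>mx\<close> act on the last block and its last letter; their
  rules are uniform only where these exist.\<close>

definition NE :: "('a list, 'k) fa \<Rightarrow> bool" where
 "NE p \<longleftrightarrow> (\<forall>w. FW w \<in> keys p \<longrightarrow> w \<noteq> [] \<and> [] \<notin> set w)"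

lemma NE_simps:
 "NE 0" "NE p \<Longrightarrow> NE q \<Longrightarrow> NE (p + q)" "NE p \<Longrightarrow> NE q \<Longrightarrow> NE (p - q)" "NE p \<Longrightarrow> NE (- p)" "NE p \<Longrightarrow> NE (cst c * p)"
 "NE p \<Longrightarrow> NE ((-1) ^ n * p)" "(\<And>i. i \<in> I \<Longrightarrow> NE (f i)) \<Longrightarrow> NE (\<Sum>i\<in>I. f i)"
 "NE (mon w) \<longleftrightarrow> w \<noteq> [] \<and> [] \<notin> set w"
proof -
 show "NE p \<Longrightarrow> NE q \<Longrightarrow> NE (p + q)" using keys_add[of p q] by (auto simp: NE_def)
 show "NE (p - q)" if pq: "NE p" "NE q"
  unfolding NE_def in_keys_iff lookup_minus
 proof (intro allI impI)
  fix w assume "coef p w - coef q w \<noteq> 0"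
  then have "FW w \<in> keys p \<or> FW w \<in> keys q" by (auto simp: in_keys_iff)
  then show "w \<noteq> [] \<and> [] \<notin> set w" using pq unfolding NE_def by blast
 qed
 show "NE p \<Longrightarrow> NE (cst c * p)" using keys_cst_mult[of c p] by (auto simp: NE_def)
 show "NE p \<Longrightarrow> NE ((-1) ^ n * p)" by (simp add: NE_def)
 show "NE (\<Sum>i\<in>I. f i)" if f: "\<And>i. i \<in> I \<Longrightarrow> NE (f i)" unfolding NE_def
 proof (intro allI impI)
  fix w assume "FW w \<in> keys (\<Sum>i\<in>I. f i)"
  then obtain i where "i \<in> I" "FW w \<in> keys (f i)" using keys_sumD[of "FW w" f I] by auto
  then show "w \<noteq> [] \<and> [] \<notin> set w" using f[of i] unfolding NE_def by blast
 qed
qed (auto simp: NE_def in_keys_iff)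

lemma NE_MS: "(\<And>z. z \<in> keys (mul x y) \<Longrightarrow> NE (F z)) \<Longrightarrow> NE (MS x y F)"
 by (auto simp: MS_def intro!: NE_simps)

lemma NE_mult_mon: "NE p \<Longrightarrow> [] \<notin> set w \<Longrightarrow> NE (p * mon w)" "NE p \<Longrightarrow> [] \<notin> set w \<Longrightarrow> NE (mon w * p)"
proof -
 assume p: "NE p" and w: "[] \<notin> set w"
 show "NE (p * mon w)" unfolding NE_def
 proof (intro allI impI)
  fix v assume "FW v \<in> keys (p * mon w)"
  then show "v \<noteq> [] \<and> [] \<notin> set v" by (rule keys_multD) (use p w in \<open>auto simp: NE_def\<close>)
 qed
 show "NE (mon w * p)" unfolding NE_def
 proof (intro allI impI)
  fix v assume "FW v \<in> keys (mon w * p)"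
  then show "v \<noteq> [] \<and> [] \<notin> set v" by (rule keys_multD) (use p w in \<open>auto simp: NE_def\<close>)
 qed
qed

lemma NE_\<delta>B: "NE (\<delta>B Y)"
 unfolding \<delta>B_def mg_def by (intro NE_simps(7,6,3) NE_MS) (auto simp: NE_simps(8))

lemma NE_derw: "[] \<notin> set U \<Longrightarrow> NE (derw deg \<delta>B U)"
proof (induction U)
 case (Cons Y U)
 then show ?case unfolding derw.simps
  by (intro NE_simps(2,6) NE_mult_mon NE_\<delta>B) auto
qed (simp add: NE_simps)

lemma NE_induct [consumes 1, case_names word zero add scale]:
 assumes "NE p" "\<And>V Y. [] \<notin> set V \<Longrightarrow> Y \<noteq> [] \<Longrightarrow> FW (V @ [Y]) \<in> keys p \<Longrightarrow> P (mon (V @ [Y]))" "P 0"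
  "\<And>a b. P a \<Longrightarrow> P b \<Longrightarrow> P (a + b)" "\<And>c a. P a \<Longrightarrow> P (cst c * a)"
 shows "P p"
proof (rule fa_induct[of p P])
 fix w assume w: "FW w \<in> keys p"
 note ne = assms(1)[unfolded NE_def, rule_format, OF w]
 then obtain V Y where "w = V @ [Y]" by (metis rev_exhaust)
 then show "P (mon w)" using assms(2)[of V Y] w ne by auto
qed (use assms in auto)

lemma cx_linear: "cx x 0 = 0" "cx x (p + q) = cx x p + cx x q" "cx x (p - q) = cx x p - cx x q" "cx x (- p) = - cx x p"
  "cx x (cst c * p) = cst c * cx x p" "cx x ((-1) ^ n * p) = (-1) ^ n * cx x p"
  "cx x (\<Sum>i\<in>I. f i) = (\<Sum>i\<in>I. cx x (f i))" "cx x (MS y z F) = MS y z (\<lambda>u. cx x (F u))"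
 by (simp_all add: cx_def lin_simps MS_lin)

lemma mx_linear: "mx x 0 = 0" "mx x (p + q) = mx x p + mx x q" "mx x (p - q) = mx x p - mx x q" "mx x (- p) = - mx x p"
  "mx x (cst c * p) = cst c * mx x p" "mx x ((-1) ^ n * p) = (-1) ^ n * mx x p"
  "mx x (\<Sum>i\<in>I. f i) = (\<Sum>i\<in>I. mx x (f i))" "mx x (MS y z F) = MS y z (\<lambda>u. mx x (F u))"
 by (simp_all add: mx_def lin_simps MS_lin)

lemma cx_word [simp]: "cx x (mon (V @ [Y])) = mon (V @ [Y @ [x]])"
 by (simp add: cx_def)

lemma cx_short [simp]: "cx x (mon [Y]) = mon [Y @ [x]]" "cx x (mon (V @ [Z, Y])) = mon (V @ [Z, Y @ [x]])"
 using cx_word[of x "[]" Y] cx_word[of x "V @ [Z]" Y] by simp_all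

lemma mx_word [simp]: "mx x (mon (V @ [Y @ [y]])) = MS y x (\<lambda>z. mon (V @ [Y @ [z]]))"
 by (simp add: mx_def)

lemma mx_single [simp]: "mx x (mon (V @ [[y]])) = MS y x (\<lambda>z. mon (V @ [[z]]))"
 using mx_word[of x V "[]" y] by simp

lemma cx_mult: "NE q \<Longrightarrow> cx x (mon V * q) = mon V * cx x q"
proof (induction q rule: NE_induct)
 case (word V' Y)
 then show ?case using cx_word[of x "V @ V'" Y] by (simp flip: mon_append del: cx_word) (simp flip: mon_append)
qed (simp_all add: cx_linear distrib_left cst_left[of "mon V"])

lemma mx_mult: "NE q \<Longrightarrow> mx x (mon V * q) = mon V * mx x q"
proof (induction q rule: NE_induct)
 case (word V' Y)
 then obtain Y' y where "Y = Y' @ [y]" by (metis rev_exhaust)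
 then show ?case using mx_word[of x "V @ V'" Y' y]
  by (simp flip: mon_append MS_linear(5))
qed (simp_all add: mx_linear distrib_left cst_left[of "mon V"])

lemma cx_right: "NE q \<or> q = 1 \<Longrightarrow> cx x (q * mon [Y]) = q * mon [Y @ [x]]"
proof (elim disjE)
 assume "NE q"
 then show ?thesis
  by (induction q rule: NE_induct)
   (simp_all add: cx_linear distrib_right mult.assoc flip: mon_append)
next
 assume "q = 1" then show ?thesis using cx_word[of x "[]" Y] by simp
qed

lemma mx_right: "mx x (q * mon [Y @ [y]]) = MS y x (\<lambda>z. q * mon [Y @ [z]])"
 by (induction q rule: fa_induct)
  (simp_all add: mx_linear distrib_right mult.assoc MS_linear(1,4) cst_left MS_linear(5) flip: mon_append)

lemma mx_right1: "mx x (q * mon [[y]]) = MS y x (\<lambda>z. q * mon [[z]])"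
 using mx_right[of x q "[]" y] by simp

lemma mx_cx: "NE q \<Longrightarrow> mx x (cx y q) = MS y x (\<lambda>z. cx z q)"
 by (induction q rule: NE_induct)
  (simp_all add: cx_linear mx_linear MS_linear(1,4,5))

lemma mx_mx: "NE q \<Longrightarrow> mx x (mx y q) = MS y x (\<lambda>z. mx z q)"
proof (induction q rule: NE_induct)
 case (word V Y)
 then obtain Y' u where "Y = Y' @ [u]" by (metis rev_exhaust)
 then show ?case by (simp add: mx_linear MS_assoc)
qed (simp_all add: mx_linear MS_linear(1,4,5))

lemma \<delta>B_single [simp]: "\<delta>B [x] = 0" and \<delta>B_Nil [simp]: "\<delta>B [] = 0"
 by (simp_all add: \<delta>B_def)

text \<open>Only the last separator involves \<open>x\<close>; at all others \<open>x\<close> is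
  carried along at the end. Together with \<open>D_cx\<close> and \<open>D_mx\<close> this makes
  induction on the number of letters possible.\<close>

lemma \<delta>B_snoc:
 assumes "Y \<noteq> []"
 shows "\<delta>B (Y @ [x]) = cx x (\<delta>B Y) - (-1) ^ deg Y * (mon [Y, [x]] - mx x (mon [Y]))"
proof -
 let ?n = "length Y"
 have n: "1 \<le> ?n" using assms by (cases Y) auto
 obtain Y' y where Y: "Y = Y' @ [y]" using assms by (metis rev_exhaust)
 have "\<delta>B (Y @ [x]) = (\<Sum>i=1..<Suc ?n. (-1) ^ i * (mon [take i (Y @ [x]), drop i (Y @ [x])] - mg i (Y @ [x])))"
  by (simp add: \<delta>B_def)
 also have "\<dots> = (\<Sum>i=1..<?n. (-1) ^ i * (mon [take i (Y @ [x]), drop i (Y @ [x])] - mg i (Y @ [x])))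
   + (-1) ^ ?n * (mon [take ?n (Y @ [x]), drop ?n (Y @ [x])] - mg ?n (Y @ [x]))"
  using n by (intro sum.atLeastLessThan_Suc) simp
 also have "mon [take ?n (Y @ [x]), drop ?n (Y @ [x])] - mg ?n (Y @ [x]) = mon [Y, [x]] - mx x (mon [Y])"
  using mx_word[of x "[]" Y' y] by (simp add: mg_def Y nth_append)
 also have "(\<Sum>i=1..<?n. (-1) ^ i * (mon [take i (Y @ [x]), drop i (Y @ [x])] - mg i (Y @ [x]))) = cx x (\<delta>B Y)"
  unfolding \<delta>B_def cx_linear(7)
 proof (rule sum.cong)
  fix i assume "i \<in> {1..<?n}"
  then have i: "1 \<le> i" "i < ?n" by auto
  have "mon [take i (Y @ [x]), drop i (Y @ [x])] = cx x (mon [take i Y, drop i Y])"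
   using cx_word[of x "[take i Y]" "drop i Y"] i by simp
  moreover have "mg i (Y @ [x]) = cx x (mg i Y)"
  proof -
   have "i - 1 < length Y" using i by simp
   then show ?thesis using i by (simp add: mg_def cx_linear nth_append)
  qed
  ultimately show "(-1) ^ i * (mon [take i (Y @ [x]), drop i (Y @ [x])] - mg i (Y @ [x])) =
   cx x ((-1) ^ i * (mon [take i Y, drop i Y] - mg i Y))" by (simp add: cx_linear)
 qed simp
 finally have "\<delta>B (Y @ [x]) = cx x (\<delta>B Y) + (-1) ^ ?n * (mon [Y, [x]] - mx x (mon [Y]))" .
 moreover have "(-1) ^ ?n = - ((-1) ^ deg Y :: ('a list, 'k) fa)" using n by (cases ?n) simp_all
 ultimately show ?thesis by simp
qed

lemma lowers_\<delta>B: "lowers deg \<delta>B"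
 unfolding lowers_def
proof (intro allI impI)
 fix Y w assume "FW w \<in> keys (\<delta>B Y)"
 from keys_sumD[OF this[unfolded \<delta>B_def]]
 obtain i where i: "i \<in> {1..<length Y}" "FW w \<in> keys ((-1) ^ i * (mon [take i Y, drop i Y] - mg i Y))" ..
 then have "coef (mon [take i Y, drop i Y] - mg i Y) w \<noteq> 0" by (simp add: in_keys_iff)
 then have "w = [take i Y, drop i Y] \<or> coef (mg i Y) w \<noteq> 0" by (auto simp: lookup_minus cf_mon split: if_splits)
 then show "wdeg w + 1 = deg Y"
 proof
  assume "coef (mg i Y) w \<noteq> 0"
  then have "(\<Sum>z\<in>keys (mul (Y ! (i - 1)) (Y ! i)). lookup (mul (Y ! (i - 1)) (Y ! i)) z *
   coef (mon [take (i - 1) Y @ [z] @ drop (i + 1) Y]) w) \<noteq> 0" by (simp add: mg_def MS_def lookup_sum lookup_cst)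
  then obtain z where "coef (mon [take (i - 1) Y @ [z] @ drop (i + 1) Y] :: ('a list, 'k) fa) w \<noteq> 0"
   by (metis (no_types, lifting) mult_zero_right sum.neutral)
  then have "w = [take (i - 1) Y @ [z] @ drop (i + 1) Y]" by (auto simp: cf_mon split: if_splits)
  then show ?thesis using i by auto
 qed (use i in auto)
qed

lemma homog_derw: "homog deg (wdeg U - 1) (derw deg \<delta>B U)" "wdeg U = 0 \<Longrightarrow> derw deg \<delta>B U = 0"
proof -
 have *: "\<forall>w. FW w \<in> keys (derw deg \<delta>B U) \<longrightarrow> wdeg w + 1 = wdeg U"
 proof (induction U)
  case (Cons Y U)
  show ?case
  proof (intro allI impI)
   fix w assume "FW w \<in> keys (derw deg \<delta>B (Y # U))"
   then have "FW w \<in> keys (\<delta>B Y * mon U) \<or> FW w \<in> keys (mon [Y] * derw deg \<delta>B U)"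
    unfolding derw.simps using keys_add by fastforce
   then show "wdeg w + 1 = wdeg (Y # U)"
   proof
    assume "FW w \<in> keys (\<delta>B Y * mon U)"
    then obtain u v where "FW u \<in> keys (\<delta>B Y)" "FW v \<in> keys (mon U :: ('a list, 'k) fa)" "w = u @ v" by (rule keys_multD)
    then show ?thesis using lowers_\<delta>B unfolding lowers_def by force
   next
    assume "FW w \<in> keys (mon [Y] * derw deg \<delta>B U)"
    then obtain u v where "FW u \<in> keys (mon [Y] :: ('a list, 'k) fa)" "FW v \<in> keys (derw deg \<delta>B U)" "w = u @ v" by (rule keys_multD)
    then show ?thesis using Cons.IH by auto
   qed
  qed
 qed simp
 then show "homog deg (wdeg U - 1) (derw deg \<delta>B U)" unfolding homog_def by force
 assume "wdeg U = 0"
 then have "coef (derw deg \<delta>B U) w = 0" for w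
  using *[rule_format, of w] by (metis in_keys_iff add_is_0 one_neq_zero)
 then show "derw deg \<delta>B U = 0" by (intro poly_mapping_eqI) (metis fw.exhaust lookup_zero)
qed

lemma derw_single: "derw deg \<delta>B (V @ [[x]]) = derw deg \<delta>B V * mon [[x]]"
 by (simp add: derw_append)

lemma D_cx_word:
 assumes "[] \<notin> set V" "Y \<noteq> []"
 shows "derw deg \<delta>B (V @ [Y @ [x]]) = cx x (derw deg \<delta>B (V @ [Y]))
   - (-1) ^ wdeg (V @ [Y]) * (mon (V @ [Y, [x]]) - mx x (mon (V @ [Y])))"
proof -
 have "derw deg \<delta>B (V @ [Y @ [x]]) = derw deg \<delta>B V * mon [Y @ [x]] + (-1) ^ wdeg V * (mon V * \<delta>B (Y @ [x]))"
  by (simp add: derw_append)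
 also have "derw deg \<delta>B V * mon [Y @ [x]] = cx x (derw deg \<delta>B V * mon [Y])"
  using NE_derw[OF assms(1)] by (simp add: cx_right)
 also have "mon V * \<delta>B (Y @ [x]) = cx x (mon V * \<delta>B Y) - (-1) ^ deg Y * (mon (V @ [Y, [x]]) - mx x (mon (V @ [Y])))"
  using assms mx_mult[of "mon [Y]" x V] cx_mult[OF NE_\<delta>B, of x V Y]
  by (simp add: \<delta>B_snoc right_diff_distrib sign_left[of "mon V"] NE_simps(8) mon_append[of V "[Y, [x]]"] mon_append[of V "[Y]"])
 finally show ?thesis
  by (simp add: derw_append[of deg \<delta>B V "[Y]"] cx_linear power_add right_diff_distrib mult.assoc)
qed

lemma D_cx: "NE q \<Longrightarrow> homog deg d q \<Longrightarrow> DB (cx x q) = cx x (DB q) - (-1) ^ d * (q * mon [[x]] - mx x q)"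
proof -
 assume q: "NE q" and d: "homog deg d q"
 from q show ?thesis
 proof (rule NE_induct)
  fix V Y assume h: "[] \<notin> set V" "Y \<noteq> []" "FW (V @ [Y]) \<in> keys q"
  then have "wdeg (V @ [Y]) = d" using d homogD by blast
  then show "DB (cx x (mon (V @ [Y]))) = cx x (DB (mon (V @ [Y]))) - (-1) ^ d * (mon (V @ [Y]) * mon [[x]] - mx x (mon (V @ [Y])))"
   using D_cx_word[OF h(1,2), of x] by (simp flip: mon_append)
 next
  fix c a assume "DB (cx x a) = cx x (DB a) - (-1) ^ d * (a * mon [[x]] - mx x a)"
  then show "DB (cx x (cst c * a)) = cx x (DB (cst c * a)) - (-1) ^ d * (cst c * a * mon [[x]] - mx x (cst c * a))"
   by (simp add: der_simps cx_linear mx_linear mult.assoc right_diff_distrib sign_left[of "cst c"])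
 next
  fix a b :: "('a list, 'k) fa"
  assume "DB (cx x a) = cx x (DB a) - (-1) ^ d * (a * mon [[x]] - mx x a)"
   "DB (cx x b) = cx x (DB b) - (-1) ^ d * (b * mon [[x]] - mx x b)"
  then show "DB (cx x (a + b)) = cx x (DB (a + b)) - (-1) ^ d * ((a + b) * mon [[x]] - mx x (a + b))"
   by (simp add: der_simps cx_linear mx_linear algebra_simps)
 qed (simp add: cx_linear mx_linear)
qed

lemma D_mx: "NE q \<Longrightarrow> DB (mx x q) = mx x (DB q)"
proof (induction q rule: NE_induct)
 case (word V Y)
 then obtain Y' y where Y: "Y = Y' @ [y]" by (metis rev_exhaust)
 show ?case
 proof (cases "Y' = []")
  case True
  then show ?thesis by (simp add: Y MS_der derw_single mx_right1)
 next
  case False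
  note D = D_cx_word[OF word(1) False]
  have 1: "NE (derw deg \<delta>B (V @ [Y']))" "NE (mon (V @ [Y']))"
   using word(1) False by (auto intro!: NE_derw simp: NE_simps(8))
  have 2: "mx x (mon (V @ [Y', [y]])) = MS y x (\<lambda>z. mon (V @ [Y', [z]]))"
   using mx_single[of x "V @ [Y']" y] by simp
  show ?thesis
   by (simp add: Y MS_der D mx_linear mx_cx[OF 1(1)] mx_mx[OF 1(2)] 2 MS_linear(1,2,5))
 qed
qed (simp_all add: der_simps mx_linear)

text \<open>Words are passed in reversed order so that the last block can be matched. A one-letter
  last block is joined to its predecessor; if that is a single letter too, the two are also
  multiplied and the process continues with the shorter word.\<close>

fun hr :: "'a list list \<Rightarrow> ('a list, 'k) fa" where
 "hr ([x] # [y] # V) = - ((-1) ^ wdeg V * mon (rev V @ [[y, x]]))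
   + (\<Sum>z\<in>keys (mul y x). cst (lookup (mul y x) z) * hr ([z] # V))"
| "hr ([x] # (y # y' # Y) # V) = - ((-1) ^ wdeg ((y # y' # Y) # V) * mon (rev V @ [(y # y' # Y) @ [x]]))"
| "hr _ = 0"

fun pr :: "'a list list \<Rightarrow> ('a list, 'k) fa" where
 "pr [[x]] = mon [[x]]"
| "pr ([x] # [y] # V) = (\<Sum>z\<in>keys (mul y x). cst (lookup (mul y x) z) * pr ([z] # V))"
| "pr _ = 0"

definition H :: "('a list, 'k) fa \<Rightarrow> ('a list, 'k) fa" where "H = lin (\<lambda>U. hr (rev U))"

definition P :: "('a list, 'k) fa \<Rightarrow> ('a list, 'k) fa" where "P = lin (\<lambda>U. pr (rev U))"

lemma H_linear: "H 0 = 0" "H (p + q) = H p + H q" "H (p - q) = H p - H q" "H (- p) = - H p"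
  "H (cst c * p) = cst c * H p" "H ((-1) ^ n * p) = (-1) ^ n * H p"
  "H (\<Sum>i\<in>I. f i) = (\<Sum>i\<in>I. H (f i))" "H (MS y z F) = MS y z (\<lambda>u. H (F u))"
 by (simp_all add: H_def lin_simps MS_lin)

lemma P_linear: "P 0 = 0" "P (p + q) = P p + P q" "P (p - q) = P p - P q" "P (- p) = - P p"
  "P (cst c * p) = cst c * P p" "P ((-1) ^ n * p) = (-1) ^ n * P p"
  "P (\<Sum>i\<in>I. f i) = (\<Sum>i\<in>I. P (f i))" "P (MS y z F) = MS y z (\<lambda>u. P (F u))"
 by (simp_all add: P_def lin_simps MS_lin)

lemma H_mon: "H (mon U) = hr (rev U)" and P_mon: "P (mon U) = pr (rev U)"
 by (simp_all add: H_def P_def)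

lemma HP_long: "Y \<noteq> [] \<Longrightarrow> H (mon (V @ [Y @ [x]])) = 0" "Y \<noteq> [] \<Longrightarrow> P (mon (V @ [Y @ [x]])) = 0"
proof -
 assume "Y \<noteq> []"
 then obtain a b bs where "Y @ [x] = a # b # bs" by (cases Y; cases "tl Y") auto
 then show "H (mon (V @ [Y @ [x]])) = 0" "P (mon (V @ [Y @ [x]])) = 0" by (simp_all add: H_mon P_mon)
qed

lemma H_cx: "NE q \<Longrightarrow> H (cx x q) = 0" and P_cx: "NE q \<Longrightarrow> P (cx x q) = 0"
 by (induction q rule: NE_induct) (simp_all add: cx_linear H_linear P_linear HP_long)

text \<open>One step of the recursion, free of the case distinction on the length of
  \<open>Y\<close>: for a longer \<open>Y\<close> the term \<open>H (mx x _)\<close> is 0 by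
  \<open>HP_long\<close>.\<close>

lemma HP_b_word:
 assumes "Y \<noteq> []"
 shows "H (mon (V @ [Y, [x]])) = - ((-1) ^ wdeg (V @ [Y]) * cx x (mon (V @ [Y]))) + H (mx x (mon (V @ [Y])))"
  "P (mon (V @ [Y, [x]])) = P (mx x (mon (V @ [Y])))"
proof -
 consider y where "Y = [y]" | y y' Z where "Y = y # y' # Z" using assms by (cases Y; cases "tl Y") auto
 then have "H (mon (V @ [Y, [x]])) = - ((-1) ^ wdeg (V @ [Y]) * cx x (mon (V @ [Y]))) + H (mx x (mon (V @ [Y]))) \<and>
  P (mon (V @ [Y, [x]])) = P (mx x (mon (V @ [Y])))"
 proof cases
  case 1
  then show ?thesis by (simp add: H_mon P_mon H_linear P_linear MS_def sum_list_rev flip: rev_map)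
 next
  case 2
  define Y' u where "Y' = butlast Y" and "u = last Y"
  have Y: "Y = Y' @ [u]" "Y' \<noteq> []" using 2 by (simp_all add: Y'_def u_def)
  have "H (mx x (mon (V @ [Y]))) = 0" "P (mx x (mon (V @ [Y]))) = 0"
   using Y by (simp_all add: H_linear P_linear HP_long MS_linear(4))
  then show ?thesis using 2 by (simp add: H_mon P_mon sum_list_rev add_ac flip: rev_map)
 qed
 then show "H (mon (V @ [Y, [x]])) = - ((-1) ^ wdeg (V @ [Y]) * cx x (mon (V @ [Y]))) + H (mx x (mon (V @ [Y])))"
  "P (mon (V @ [Y, [x]])) = P (mx x (mon (V @ [Y])))" by blast+
qed

lemma H_b: "NE q \<Longrightarrow> homog deg d q \<Longrightarrow> H (q * mon [[x]]) = - ((-1) ^ d * cx x q) + H (mx x q)"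
proof -
 assume q: "NE q" and d: "homog deg d q"
 from q show ?thesis
 proof (rule NE_induct)
  fix V Y assume h: "[] \<notin> set V" "Y \<noteq> []" "FW (V @ [Y]) \<in> keys q"
  then have "wdeg (V @ [Y]) = d" using d homogD by blast
  then show "H (mon (V @ [Y]) * mon [[x]]) = - ((-1) ^ d * cx x (mon (V @ [Y]))) + H (mx x (mon (V @ [Y])))"
   using HP_b_word(1)[OF h(2), of V x] by (simp flip: mon_append)
 next
  fix c a assume "H (a * mon [[x]]) = - ((-1) ^ d * cx x a) + H (mx x a)"
  then show "H (cst c * a * mon [[x]]) = - ((-1) ^ d * cx x (cst c * a)) + H (mx x (cst c * a))"
   by (simp add: cx_linear mx_linear H_linear mult.assoc right_diff_distrib distrib_left sign_left[of "cst c"])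
 qed (simp_all add: cx_linear mx_linear H_linear distrib_right distrib_left)
qed

text \<open>Induction on the number of letters, with the last letter split off as a letter of the
  last block or as a block of its own.\<close>

lemma contraction_word:
 assumes "[] \<notin> set U" "U \<noteq> []"
 shows "DB (H (mon U)) + H (derw deg \<delta>B U) = mon U - P (mon U)"
 using assms
proof (induction "length (concat U)" arbitrary: U rule: less_induct)
 case less
 obtain V Y where U: "U = V @ [Y]" using less.prems by (metis rev_exhaust)
 obtain Y' x where Y: "Y = Y' @ [x]" using less.prems U by (metis in_set_conv_decomp rev_exhaust)
 have V: "[] \<notin> set V" using less.prems U by simp
 show ?case
 proof (cases "Y' = []")
  \<comment> \<open>\<open>H\<close> kills the word and everything obtained by \<open>cx\<close>.
    The new separator in front of the last letter is the only term that counts, and \<open>H\<close>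
    removes it again.\<close>
  case False
  let ?q = "mon (V @ [Y']) :: ('a list, 'k) fa" and ?s = "(-1) ^ wdeg (V @ [Y']) :: ('a list, 'k) fa"
  have q: "NE ?q" "homog deg (wdeg (V @ [Y'])) ?q" using V False by (simp_all add: NE_simps(8))
  have "H (derw deg \<delta>B U) = - (?s * (H (?q * mon [[x]]) - H (mx x ?q)))"
   using D_cx_word[OF V False, of x] H_cx[OF NE_derw[of "V @ [Y']"], of x] V False
   by (simp add: U Y H_linear flip: mon_append)
  also have "\<dots> = ?s * (?s * cx x ?q)" unfolding H_b[OF q] by simp
  also have "\<dots> = mon U" by (simp add: U Y flip: mult.assoc power_add)
  finally show ?thesis using HP_long[OF False, of V x] by (simp add: U Y)
 next
  case True
  show ?thesis
  proof (cases "V = []")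
   case True
   then show ?thesis using \<open>Y' = []\<close> by (simp add: U Y H_mon P_mon H_linear(1))
  next
   case False
   let ?q = "mon V :: ('a list, 'k) fa" and ?s = "(-1) ^ wdeg V :: ('a list, 'k) fa"
   have q: "NE ?q" "homog deg (wdeg V) ?q" using V False by (simp_all add: NE_simps(8))
   have Dq: "NE (DB ?q)" "homog deg (wdeg V - 1) (DB ?q)" using NE_derw[OF V] homog_derw by simp_all
   have Um: "mon U = ?q * mon [[x]]" using True by (simp add: U Y mon_append)
   have "derw deg \<delta>B U = DB ?q * mon [[x]]" using True by (simp add: U Y derw_single)
   then have "H (derw deg \<delta>B U) = - ((-1) ^ (wdeg V - 1) * cx x (DB ?q)) + H (mx x (DB ?q))"
    using H_b[OF Dq] by simp
   also have "\<dots> = ?s * cx x (DB ?q) + H (mx x (DB ?q))"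
    using homog_derw(2)[of V] by (cases "wdeg V") (simp_all add: cx_linear)
   finally have 1: "H (derw deg \<delta>B U) = ?s * cx x (DB ?q) + H (DB (mx x ?q))" using D_mx[OF q(1)] by simp
   have "DB (H (mon U)) = - (?s * DB (cx x ?q)) + DB (H (mx x ?q))"
    unfolding Um H_b[OF q] by (simp only: der_simps)
   also have "?s * DB (cx x ?q) = ?s * cx x (DB ?q) - ?s * (?s * (mon U - mx x ?q))"
    unfolding D_cx[OF q] Um by (simp add: right_diff_distrib)
   also have "?s * (?s * (mon U - mx x ?q)) = mon U - mx x ?q"
    by (simp flip: mult.assoc power_add)
   finally have 2: "DB (H (mon U)) = - (?s * cx x (DB ?q)) + (mon U - mx x ?q) + DB (H (mx x ?q))" by simp
   \<comment> \<open>After the \<open>cx\<close> terms cancel, the claim for the word is the claim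
     for \<open>mx x ?q\<close>, whose words have one letter less.\<close>
   have 3: "DB (H (mx x ?q)) + H (DB (mx x ?q)) = mx x ?q - P (mx x ?q)"
   proof -
    obtain V' Z where Vz: "V = V' @ [Z]" using False by (metis rev_exhaust)
    obtain Z' y where Z: "Z = Z' @ [y]" using V Vz by (metis in_set_conv_decomp rev_exhaust)
    have IH: "DB (H (mon (V' @ [Z' @ [z]]))) + H (derw deg \<delta>B (V' @ [Z' @ [z]])) =
     mon (V' @ [Z' @ [z]]) - P (mon (V' @ [Z' @ [z]]))" for z
     using less.hyps[of "V' @ [Z' @ [z]]"] V True by (simp add: U Y Vz Z)
    have m: "mx x ?q = MS y x (\<lambda>z. mon (V' @ [Z' @ [z]]))" by (simp add: Vz Z)
    show ?thesis unfolding m by (simp add: H_linear P_linear MS_der IH flip: MS_linear(1,2))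
   qed
   have 4: "P (mon U) = P (mx x ?q)"
   proof -
    obtain V' Z where Vz: "V = V' @ [Z]" using False by (metis rev_exhaust)
    then have "Z \<noteq> []" using V by auto
    from HP_b_word(2)[OF this, of V' x] show ?thesis using Vz True by (simp add: U Y)
   qed
   have "DB (H (mon U)) + H (derw deg \<delta>B U) = mon U - mx x ?q + (DB (H (mx x ?q)) + H (DB (mx x ?q)))"
    unfolding 1 2 by simp
   then show ?thesis unfolding 3 4 by simp
  qed
 qed
qed

theorem contraction: "NE q \<Longrightarrow> DB (H q) + H (DB q) = q - P q"
proof (induction q rule: NE_induct)
 case (word V Y)
 then have "[] \<notin> set (V @ [Y])" by auto
 from contraction_word[OF this] show ?case by simp
next
 case (add a b)
 have "DB (H (a + b)) + H (DB (a + b)) = (DB (H a) + H (DB a)) + (DB (H b) + H (DB b))"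
  by (simp add: der_simps H_linear)
 then show ?case unfolding add by (simp add: P_linear)
next
 case (scale c a)
 have "DB (H (cst c * a)) + H (DB (cst c * a)) = cst c * (DB (H a) + H (DB a))"
  by (simp add: der_simps H_linear distrib_left)
 then show ?case unfolding scale by (simp add: P_linear right_diff_distrib)
qed (simp add: H_linear P_linear)

lemma pr_long: "Y \<in> set L \<Longrightarrow> 2 \<le> length Y \<Longrightarrow> pr L = 0"
 by (induction L rule: pr.induct) auto

text \<open>Positive degree means a block with at least two letters, and \<open>P\<close> only sees
  words of one-letter blocks.\<close>

lemma P_positive:
 assumes "homog deg d q" "0 < d" shows "P q = 0"
proof -
 have "pr (rev U) = 0" if "FW U \<in> keys q" for U
 proof -
  have "\<exists>Y\<in>set U. deg Y \<noteq> 0"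
  proof (rule ccontr)
   assume "\<not> ?thesis"
   then have "map deg U = map (\<lambda>_. 0) U" by simp
   then have "wdeg U = 0" by (simp only: sum_list_0)
   then show False using homogD[OF assms(1) that] assms(2) by simp
  qed
  then obtain Y where "Y \<in> set U" "deg Y \<noteq> 0" by blast
  then show ?thesis using pr_long[of Y "rev U"] by simp
 qed
 then show ?thesis unfolding P_def by (intro lin_zero)
qed

text \<open>The set \<open>K\<close> has to be closed only under multiplying the last two letters,
  the one product formed by \<open>hr\<close>. It will be the set of composable words between two
  vertices.\<close>

lemma keys_hr:
 assumes K: "\<And>us y x z. us @ [y, x] \<in> K \<Longrightarrow> z \<in> keys (mul y x) \<Longrightarrow> us @ [z] \<in> K"
 shows "[] \<notin> set L \<Longrightarrow> concat (rev L) \<in> K \<Longrightarrow> FW w \<in> keys (hr L) \<Longrightarrow>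
  w \<noteq> [] \<and> [] \<notin> set w \<and> wdeg w = Suc (wdeg L) \<and> concat w \<in> K"
proof (induction L rule: hr.induct)
 case (1 x y V)
 let ?a = "- ((-1) ^ wdeg V * mon (rev V @ [[y, x]])) :: ('a list, 'k) fa"
 let ?b = "\<Sum>z\<in>keys (mul y x). cst (lookup (mul y x) z) * hr ([z] # V)"
 have "FW w \<in> keys ?a \<union> keys ?b" using 1(4) keys_add[of ?a ?b] unfolding hr.simps by (rule rev_subsetD)
 then show ?case
 proof
  assume "FW w \<in> keys ?a"
  then have "w = rev V @ [[y, x]]" by (simp add: in_keys_iff lookup_sign_mult cf_mon split: if_splits)
  then show ?thesis using 1(2,3) by (simp add: sum_list_rev flip: rev_map)
 next
  assume "FW w \<in> keys ?b"
  then obtain z where z: "z \<in> keys (mul y x)" "FW w \<in> keys (cst (lookup (mul y x) z) * hr ([z] # V))"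
   using keys_sumD[of "FW w"] by auto
  have "FW w \<in> keys (hr ([z] # V))" using z(2) keys_cst_mult by (rule rev_subsetD)
  then show ?thesis using 1(1)[OF z(1)] 1(2,3) K[OF _ z(1), of "concat (rev V)"] by simp
 qed
next
 case (2 x y y' Y V)
 have "w = rev V @ [(y # y' # Y) @ [x]]" using 2(3)
  by (simp add: in_keys_iff lookup_sign_mult cf_mon split: if_splits)
 moreover have "wdeg w = Suc (wdeg ([x] # (y # y' # Y) # V))"
  using calculation by (simp add: sum_list_rev flip: rev_map)
 moreover have "concat w = concat (rev ([x] # (y # y' # Y) # V))" using calculation(1) by simp
 ultimately show ?case using 2(1,2) by (simp del: concat.simps rev.simps)
qed simp_all

end

section \<open>The one-block part of the homotopy\<close>

context bar_words
begin

lemma coef_hr_two_blocks: "coef (hr (v # (y # y' # Y') # V @ [Y])) [Z] = 0"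
proof -
 consider x where "v = [x]" | "v = []" | x x' v' where "v = x # x' # v'" by (cases v; cases "tl v") auto
 then show ?thesis by cases (simp_all add: cf_mon lookup_sign_mult)
qed

text \<open>A result with a single block arises only if everything after \<open>Y\<close> has been
  multiplied into one letter before the last separator is removed. The product is what
  \<open>pr\<close> computes.\<close>

lemma coef_hr_single:
 "Y \<noteq> [] \<Longrightarrow> coef (hr (L @ [Y])) [Z] = (if Z \<noteq> [] \<and> butlast Z = Y then - ((-1) ^ deg Y * coef (pr L) [[last Z]]) else 0)"
proof (induction L rule: pr.induct)
 case (1 x)
 consider y where "Y = [y]" | y y' Y' where "Y = y # y' # Y'" by (cases Y; cases "tl Y") (use 1 in auto)
 then show ?case
 proof cases
  case 1
  have "coef (hr [[x], [y]]) [Z] = - (if [[y, x]] = [Z] then 1 else 0)"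
   by (simp add: cf_mon lookup_sum lookup_cst)
  also have "\<dots> = (if Z \<noteq> [] \<and> butlast Z = [y] then - (if [[x]] = [[last Z]] then 1 else 0) else 0)"
   by (cases Z rule: rev_cases) auto
  finally show ?thesis unfolding 1 by (simp add: cf_mon)
 next
  case 2
  have "coef (hr [[x], Y]) [Z] = - ((-1) ^ deg Y * (if [Y @ [x]] = [Z] then 1 else 0))"
   unfolding 2 by (simp add: cf_mon lookup_sign_mult)
  also have "\<dots> = (if Z \<noteq> [] \<and> butlast Z = Y then - ((-1) ^ deg Y * (if [[x]] = [[last Z]] then 1 else 0)) else 0)"
   by (cases Z rule: rev_cases) auto
  finally show ?thesis by (simp add: cf_mon)
 qed
next
 case (2 x y V)
 have "coef (hr (([x] # [y] # V) @ [Y])) [Z] =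
  (\<Sum>z\<in>keys (mul y x). lookup (mul y x) z * coef (hr (([z] # V) @ [Y])) [Z])"
  by (simp add: cf_mon lookup_sum lookup_cst lookup_sign_mult lookup_minus)
 also have "\<dots> = (\<Sum>z\<in>keys (mul y x). lookup (mul y x) z *
   (if Z \<noteq> [] \<and> butlast Z = Y then - ((-1) ^ deg Y * coef (pr ([z] # V)) [[last Z]]) else 0))"
  using 2 by (intro sum.cong) auto
 also have "\<dots> = (if Z \<noteq> [] \<and> butlast Z = Y then - ((-1) ^ deg Y * coef (pr ([x] # [y] # V)) [[last Z]]) else 0)"
  by (simp add: lookup_sum lookup_cst sum_distrib_left sum_negf mult.left_commute)
 finally show ?case .
next
 case ("3_1")
 show ?case by simp
qed (simp_all add: cf_mon lookup_sign_mult coef_hr_two_blocks)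

lemma coef_H_single:
 "Y \<noteq> [] \<Longrightarrow> coef (H (mon (Y # V))) [Z] = (if Z \<noteq> [] \<and> butlast Z = Y then - ((-1) ^ deg Y * coef (P (mon V)) [[last Z]]) else 0)"
 unfolding H_mon P_mon using coef_hr_single[of Y "rev V" Z] by simp

lemma keys_hr_last: "FW w \<in> keys (hr L) \<Longrightarrow> w \<noteq> [] \<and> 2 \<le> length (last w)"
proof (induction L rule: hr.induct)
 case (1 x y V)
 let ?a = "- ((-1) ^ wdeg V * mon (rev V @ [[y, x]])) :: ('a list, 'k) fa"
 let ?b = "\<Sum>z\<in>keys (mul y x). cst (lookup (mul y x) z) * hr ([z] # V)"
 have "FW w \<in> keys ?a \<union> keys ?b" using 1(2) keys_add[of ?a ?b] unfolding hr.simps by (rule rev_subsetD)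
 then show ?case
 proof
  assume "FW w \<in> keys ?a"
  then have "w = rev V @ [[y, x]]" by (simp add: in_keys_iff lookup_sign_mult cf_mon split: if_splits)
  then show ?thesis by simp
 next
  assume "FW w \<in> keys ?b"
  then obtain z where z: "z \<in> keys (mul y x)" "FW w \<in> keys (cst (lookup (mul y x) z) * hr ([z] # V))"
   using keys_sumD[of "FW w"] by auto
  have "FW w \<in> keys (hr ([z] # V))" using z(2) keys_cst_mult by (rule rev_subsetD)
  then show ?thesis using 1(1)[OF z(1)] by simp
 qed
next
 case (2 x y y' Y V)
 have "w = rev V @ [(y # y' # Y) @ [x]]" using 2
  by (simp add: in_keys_iff lookup_sign_mult cf_mon split: if_splits)
 then show ?case by simp
qed simp_all

lemma keys_H:
 assumes "FW w \<in> keys (H q)"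
 obtains U where "FW U \<in> keys q" "FW w \<in> keys (hr (rev U))"
 using assms unfolding H_def by (rule keys_lin) blast

end

section \<open>The bar construction of a toupie algebra\<close>

context toupie
begin

text \<open>The normal form without reference to \<open>I\<close>, by cases on tips;
  \<open>lookup_nf\<close> identifies it with \<open>normal_form\<close>. The sum over
  \<open>i\<close> has at most one term.\<close>

definition nf :: "('v, 'e) qpath \<Rightarrow> (('v, 'e) qpath \<Rightarrow>\<^sub>0 'k)" where
 "nf z = (if z \<in> NT then Poly_Mapping.single z 1
   else (\<Sum>i | i < r \<and> tip i = z. \<Sum>b\<in>set B4 - {z}. Poly_Mapping.single b (- \<rho> i b)))"

definition mul :: "('v, 'e) qpath \<Rightarrow> ('v, 'e) qpath \<Rightarrow> (('v, 'e) qpath \<Rightarrow>\<^sub>0 'k)" where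
 "mul x y = (if x \<in> NT \<and> y \<in> NT \<and> composable Q [x, y] then nf (path_prod [x, y]) else 0)"

lemma nf_NT: "z \<in> NT \<Longrightarrow> nf z = Poly_Mapping.single z 1"
 by (simp add: nf_def)

lemma tip_not_NT: "i < r \<Longrightarrow> tip i \<notin> NT"
 using tip_not_nontip by blast

lemma nf_tip: "i < r \<Longrightarrow> nf (tip i) = (\<Sum>b\<in>set B4 - {tip i}. Poly_Mapping.single b (- \<rho> i b))"
proof -
 assume i: "i < r"
 then have "{j. j < r \<and> tip j = tip i} = {i}" using tip_inj by auto
 then show ?thesis by (simp only: nf_def if_not_P[OF tip_not_NT[OF i]]) simp
qed

lemma nf_0: "z \<notin> NT \<Longrightarrow> z \<notin> tips \<Longrightarrow> nf z = 0"
proof -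
 assume z: "z \<notin> NT" "z \<notin> tips"
 then have "{i. i < r \<and> tip i = z} = {}" by (auto simp: tips_def)
 then show ?thesis by (simp only: nf_def if_not_P[OF z(1)] sum.empty)
qed

lemma lookup_nf_tip: "i < r \<Longrightarrow> lookup (nf (tip i)) b = delta (tip i) b - \<rho> i b"
proof -
 assume i: "i < r"
 have "lookup (nf (tip i)) b = (\<Sum>c\<in>set B4 - {tip i}. if c = b then - \<rho> i b else 0)"
  by (simp add: nf_tip[OF i] lookup_sum lookup_single when_def)
 also have "\<dots> = (if b \<in> set B4 - {tip i} then - \<rho> i b else 0)" by simp
 also have "\<dots> = delta (tip i) b - \<rho> i b"
  using \<rho>_B4[of i b] i \<rho>_tip[OF i i] by auto
 finally show ?thesis .
qed

lemma NT_or_tip: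
 assumes "z \<in> qpaths Q" "snd z \<noteq> []"
 obtains "z \<in> NT" | i where "i < r" "z = tip i" | "z \<notin> NT" "z \<notin> tips" "\<not> mono_free z"
proof -
 show thesis
 proof (cases "mono_free z")
  case True
  then show ?thesis
  proof (rule mono_free_cases)
   assume "z \<in> nontip Q W"
   then show ?thesis using that(1) assms trivial_paths_iff[OF assms(1)] by blast
  qed (rule that(2))
 next
  case False
  have "z \<notin> NT" using False nontip_mono_free by blast
  moreover have "z \<notin> tips"
  proof
   assume "z \<in> tips"
   then obtain i where i: "i < r" "z = tip i" by (auto simp: tips_def)
   have "mono_free (tip i)" unfolding mono_free_def
    using toupieD(7)[OF tip_B4[OF i(1)]] B4_branch[OF tip_B4[OF i(1)]] by blast
   then show False using False i by simp
  qed
  ultimately show ?thesis using that(3) False by blast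
 qed
qed

lemma lookup_nf: "z \<in> qpaths Q \<Longrightarrow> snd z \<noteq> [] \<Longrightarrow> lookup (nf z) = normal_form Q I W (delta z)"
proof -
 assume z: "z \<in> qpaths Q" "snd z \<noteq> []"
 from z show ?thesis
 proof (rule NT_or_tip)
  assume n: "z \<in> NT"
  then have "normal_form Q I W (delta z) = delta z" by (intro normal_form_nontip) blast
  then show ?thesis using n by (auto simp: nf_NT lookup_single when_def)
 next
  fix i assume i: "i < r" "z = tip i"
  show ?thesis unfolding i(2) normal_form_tip[OF i(1)] by (rule ext) (rule lookup_nf_tip[OF i(1)])
 next
  assume h: "z \<notin> NT" "z \<notin> tips" "\<not> mono_free z"
  show ?thesis by (rule ext) (simp only: normal_form_mono[OF z(1) h(3)] nf_0[OF h(1,2)] lookup_zero)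
 qed
qed

lemma \<rho>_NT: "i < r \<Longrightarrow> \<rho> i b \<noteq> 0 \<Longrightarrow> b \<noteq> tip i \<Longrightarrow> b \<in> NT"
proof -
 assume h: "i < r" "\<rho> i b \<noteq> 0" "b \<noteq> tip i"
 have b: "b \<in> set B4" using \<rho>_B4 h by blast
 have "snd b \<noteq> []" using B4_length[OF b] by auto
 then show ?thesis using \<rho>_nontip[OF h] trivial_paths_iff[of b] B4_branch[OF b] by blast
qed

lemma keys_nf:
 assumes "y \<in> keys (nf z)"
 shows "y \<in> NT" "fst y = fst z" "ptarget Q y = ptarget Q z"
proof -
 have "y \<in> NT \<and> fst y = fst z \<and> ptarget Q y = ptarget Q z"
 proof (cases "z \<in> NT")
  case True
  then show ?thesis using assms by (simp add: nf_NT)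
 next
  case False
  have "z \<in> tips"
  proof (rule ccontr)
   assume "z \<notin> tips" then show False using assms nf_0[OF False] by simp
  qed
  then obtain i where i: "i < r" "z = tip i" by (auto simp: tips_def)
  have l: "delta (tip i) y - \<rho> i y \<noteq> 0" using assms unfolding i(2) in_keys_iff lookup_nf_tip[OF i(1)] .
  have "y \<noteq> tip i" using l \<rho>_tip[OF i(1) i(1)] by auto
  then have "\<rho> i y \<noteq> 0" using l by auto
  then show ?thesis using \<rho>_NT[OF i(1) _ \<open>y \<noteq> tip i\<close>] B4_branch[OF \<rho>_B4[OF _ i(1)]] B4_branch[OF tip_B4[OF i(1)]] i(2)
   by simp
 qed
 then show "y \<in> NT" "fst y = fst z" "ptarget Q y = ptarget Q z" by blast+
qed

lemma keys_mul:
 assumes "z \<in> keys (mul x y)"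
 shows "x \<in> NT" "y \<in> NT" "z \<in> NT" "composable Q [x, y]" "fst z = fst x" "ptarget Q z = ptarget Q y"
proof -
 have c: "x \<in> NT" "y \<in> NT" "composable Q [x, y]" "z \<in> keys (nf (path_prod [x, y]))"
  using assms by (auto simp: mul_def split: if_splits)
 then show "x \<in> NT" "y \<in> NT" "composable Q [x, y]" by blast+
 show "z \<in> NT" using keys_nf[OF c(4)] by blast
 show "fst z = fst x" using keys_nf(2)[OF c(4)] by (simp add: path_prod_pair)
 show "ptarget Q z = ptarget Q y"
  using keys_nf(3)[OF c(4)] composable_append_walk[OF c(3)] by simp
qed

lemma B4_left: "b \<in> set B4 \<Longrightarrow> z \<in> NT \<Longrightarrow> composable Q [b, z] \<Longrightarrow> False"
 using B4_branch[of b] walk_from_sink[of "snd z"] NT_nonempty[of z] by (auto simp: composable_pair qpaths_walk)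

lemma B4_right: "b \<in> set B4 \<Longrightarrow> z \<in> NT \<Longrightarrow> composable Q [z, b] \<Longrightarrow> False"
 using B4_branch[of b] walk_to_source[of "fst z" "snd z"] NT_nonempty[of z]
 by (auto simp: composable_pair qpaths_walk ptarget_tgt)

text \<open>If \<open>xy\<close> is a tip, it is a branch and no nontip can follow; if a monomial
  relation kills \<open>xy\<close>, it kills \<open>xyz\<close>; otherwise \<open>xy\<close> is its
  own normal form. Thus reducing early does no harm, and associativity follows with
  \<open>nf_right\<close>.\<close>

lemma nf_left:
 assumes x: "x \<in> NT" "y \<in> NT" "z \<in> NT" "composable Q [x, y, z]"
 shows "(\<Sum>u\<in>keys (nf (path_prod [x, y])). lookup (nf (path_prod [x, y])) u * lookup (mul u z) v) =
   lookup (nf (path_prod [x, y, z])) v"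
proof -
 have c: "composable Q [x, y]" "composable Q [path_prod [x, y], z]"
  using x(4) composable_append_walk[of "[x, y]"] by (auto simp: composable_Cons2 composable_single composable_pair)
 have e: "path_prod [path_prod [x, y], z] = path_prod [x, y, z]" by (simp add: path_prod_def)
 have q: "path_prod [x, y] \<in> qpaths Q" "snd (path_prod [x, y]) \<noteq> []"
  using composable_append_walk[OF c(1)] NT_nonempty[OF x(1)] by (auto simp: path_prod_pair)
 have sub: "subpath Q (path_prod [x, y]) (path_prod [x, y, z])"
  unfolding subpath_iff using composable_append_walk[OF x(4)]
  by (intro conjI exI[of _ "[]"] exI[of _ "snd z"]) (simp_all add: path_prod_def)
 from q show ?thesis
 proof (rule NT_or_tip)
  assume n: "path_prod [x, y] \<in> NT"
  then show ?thesis using x(3) c(2) by (simp add: nf_NT mul_def e)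
 next
  fix i assume i: "i < r" "path_prod [x, y] = tip i"
  show ?thesis using B4_left[OF tip_B4[OF i(1)] x(3)] c(2) i(2) by simp
 next
  assume n: "path_prod [x, y] \<notin> NT" "path_prod [x, y] \<notin> tips" "\<not> mono_free (path_prod [x, y])"
  have "path_prod [x, y, z] \<notin> NT" using n(3) mono_free_subpath[OF nontip_mono_free sub] by blast
  moreover have "path_prod [x, y, z] \<notin> tips"
  proof
   assume "path_prod [x, y, z] \<in> tips"
   then obtain i where i: "i < r" "path_prod [x, y, z] = tip i" by (auto simp: tips_def)
   have "mono_free (tip i)" unfolding mono_free_def
    using toupieD(7)[OF tip_B4[OF i(1)]] B4_branch[OF tip_B4[OF i(1)]] by blast
   then show False using n(3) mono_free_subpath[OF _ sub] i(2) by simp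
  qed
  ultimately show ?thesis using n by (simp add: nf_0)
 qed
qed

lemma nf_right:
 assumes x: "x \<in> NT" "y \<in> NT" "z \<in> NT" "composable Q [x, y, z]"
 shows "(\<Sum>u\<in>keys (nf (path_prod [y, z])). lookup (nf (path_prod [y, z])) u * lookup (mul x u) v) =
   lookup (nf (path_prod [x, y, z])) v"
proof -
 have c: "composable Q [y, z]" "composable Q [x, path_prod [y, z]]"
  using x(4) composable_append_walk[of "[y, z]"]
  by (auto simp: composable_Cons2 composable_single composable_pair path_prod_pair)
 have e: "path_prod [x, path_prod [y, z]] = path_prod [x, y, z]" by (simp add: path_prod_def)
 have q: "path_prod [y, z] \<in> qpaths Q" "snd (path_prod [y, z]) \<noteq> []"
  using composable_append_walk[OF c(1)] NT_nonempty[OF x(2)] by (auto simp: path_prod_pair)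
 have sub: "subpath Q (path_prod [y, z]) (path_prod [x, y, z])"
  unfolding subpath_iff using composable_append_walk[OF x(4)] c(2)
  by (intro conjI exI[of _ "snd x"] exI[of _ "[]"]) (simp_all add: path_prod_def composable_pair ptarget_tgt)
 from q show ?thesis
 proof (rule NT_or_tip)
  assume n: "path_prod [y, z] \<in> NT"
  then show ?thesis using x(1) c(2) by (simp add: nf_NT mul_def e)
 next
  fix i assume i: "i < r" "path_prod [y, z] = tip i"
  show ?thesis using B4_right[OF tip_B4[OF i(1)] x(1)] c(2) i(2) by simp
 next
  assume n: "path_prod [y, z] \<notin> NT" "path_prod [y, z] \<notin> tips" "\<not> mono_free (path_prod [y, z])"
  have "path_prod [x, y, z] \<notin> NT" using n(3) mono_free_subpath[OF nontip_mono_free sub] by blast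
  moreover have "path_prod [x, y, z] \<notin> tips"
  proof
   assume "path_prod [x, y, z] \<in> tips"
   then obtain i where i: "i < r" "path_prod [x, y, z] = tip i" by (auto simp: tips_def)
   have "mono_free (tip i)" unfolding mono_free_def
    using toupieD(7)[OF tip_B4[OF i(1)]] B4_branch[OF tip_B4[OF i(1)]] by blast
   then show False using n(3) mono_free_subpath[OF _ sub] i(2) by simp
  qed
  ultimately show ?thesis using n by (simp add: nf_0)
 qed
qed

lemma mul_assoc: "(\<Sum>u\<in>keys (mul x y). lookup (mul x y) u * lookup (mul u z) v) =
   (\<Sum>u\<in>keys (mul y z). lookup (mul y z) u * lookup (mul x u) v)"
proof (cases "x \<in> NT \<and> y \<in> NT \<and> z \<in> NT \<and> composable Q [x, y, z]")
 case True
 then have h: "x \<in> NT" "y \<in> NT" "z \<in> NT" "composable Q [x, y, z]" by blast+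
 have "composable Q [x, y]" "composable Q [y, z]"
  using h(4) by (auto simp: composable_Cons2 composable_single)
 then have m: "mul x y = nf (path_prod [x, y])" "mul y z = nf (path_prod [y, z])"
  using h(1,2,3) by (simp_all add: mul_def)
 show ?thesis unfolding m nf_left[OF h] nf_right[OF h] ..
next
 case False
 have "lookup (mul x y) u * lookup (mul u z) v = 0" for u
 proof (rule ccontr)
  assume "lookup (mul x y) u * lookup (mul u z) v \<noteq> 0"
  then have "u \<in> keys (mul x y)" "v \<in> keys (mul u z)" by (auto simp: in_keys_iff)
  note k = keys_mul[OF this(1)] keys_mul[OF this(2)]
  show False using False k by (auto simp: composable_Cons2 composable_pair composable_single)
 qed
 moreover have "lookup (mul y z) u * lookup (mul x u) v = 0" for u
 proof (rule ccontr)
  assume "lookup (mul y z) u * lookup (mul x u) v \<noteq> 0"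
  then have "u \<in> keys (mul y z)" "v \<in> keys (mul x u)" by (auto simp: in_keys_iff)
  note k = keys_mul[OF this(1)] keys_mul[OF this(2)]
  show False using False k by (auto simp: composable_Cons2 composable_pair composable_single)
 qed
 ultimately show ?thesis by (simp only: sum.neutral_const)
qed

end

sublocale toupie \<subseteq> bar_words mul
 by unfold_locales (rule mul_assoc)

context toupie
begin

text \<open>Induction by multiplying the last two letters. When their product is a tip nothing can
  precede them, so a reduction happens only at the very end.\<close>

lemma P_singles:
 assumes "xs \<noteq> []" "set xs \<subseteq> NT" "composable Q xs"
 shows "P (mon (map (\<lambda>x. [x]) xs)) = (\<Sum>z\<in>keys (nf (path_prod xs)). cst (lookup (nf (path_prod xs)) z) * mon [[z]])"
 using assms
proof (induction "length xs" arbitrary: xs rule: less_induct)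
 case less
 consider x where "xs = [x]" | us y x where "xs = us @ [y, x]"
  using less.prems(1) by (cases xs rule: rev_cases; cases "butlast xs" rule: rev_cases) auto
 then show ?case
 proof cases
  case 1
  then have "x \<in> NT" using less.prems(2) by simp
  then have "nf x = Poly_Mapping.single x 1" by (rule nf_NT)
  then show ?thesis by (simp add: 1 P_mon)
 next
  case 2
  let ?F = "\<lambda>z. \<Sum>v\<in>keys (nf z). cst (lookup (nf z) v) * mon [[v]]"
  have yx: "y \<in> NT" "x \<in> NT" "composable Q [y, x]" and us: "set us \<subseteq> NT"
   using less.prems composable_append[of us "[y, x]"] by (auto simp: 2 split: if_splits) (cases us; simp)+
  have m: "mul y x = nf (path_prod [y, x])" using yx by (simp add: mul_def)
  have "P (mon (map (\<lambda>x. [x]) xs)) = (\<Sum>z\<in>keys (mul y x). cst (lookup (mul y x) z) * P (mon (map (\<lambda>x. [x]) (us @ [z]))))"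
   by (simp add: 2 P_mon flip: rev_map)
  also have "\<dots> = (\<Sum>z\<in>keys (mul y x). cst (lookup (mul y x) z) * ?F (path_prod (us @ [z])))"
  proof (intro sum.cong refl arg_cong2[where f = "(*)"])
   fix z assume z: "z \<in> keys (mul y x)"
   note k = keys_mul[OF z]
   have "composable Q (us @ [z])"
    using less.prems(3) k NT_qpaths[OF k(3)]
    by (cases "us = []") (simp_all add: 2 composable_append composable_single composable_pair)
   then show "P (mon (map (\<lambda>x. [x]) (us @ [z]))) = ?F (path_prod (us @ [z]))"
    using less.hyps[of "us @ [z]"] us k(3) by (simp add: 2)
  qed
  also have "\<dots> = ?F (path_prod xs)"
  proof (cases "us = []")
   case True
   have "?F z = mon [[z]]" if "z \<in> keys (mul y x)" for z
    using keys_mul(3)[OF that] by (simp add: nf_NT)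
   then show ?thesis by (simp add: 2 True m)
  next
   case False
   define p where "p = path_prod us"
   have cu: "composable Q us" and "ptarget Q (last us) = fst y"
    using less.prems(3) False by (simp_all add: 2 composable_append)
   have p: "p \<in> qpaths Q" "ptarget Q p = fst y" unfolding p_def
    using composable_append_walk[OF cu False] \<open>ptarget Q (last us) = fst y\<close> by auto
   obtain u us' where u: "us = u # us'" using False by (cases us) auto
   have p0: "snd p \<noteq> []" using us NT_nonempty[of u] by (simp add: p_def u path_prod_def)
   have jj: "path_prod (us @ [z]) = (fst p, snd p @ snd z)" for z
    by (simp add: p_def u path_prod_def)
   have j: "path_prod xs = (fst p, snd p @ snd (path_prod [y, x]))"
    by (simp add: p_def u 2 path_prod_def)
   have yxq: "path_prod [y, x] \<in> qpaths Q" "snd (path_prod [y, x]) \<noteq> []"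
    using composable_append_walk[OF yx(3)] NT_nonempty[OF yx(1)] by (auto simp: path_prod_pair)
   have xsq: "path_prod xs \<in> qpaths Q" using composable_append_walk[OF less.prems(3,1)] by blast
   have sub: "subpath Q (path_prod [y, x]) (path_prod xs)" unfolding subpath_iff using xsq p(2)
    by (intro conjI exI[of _ "snd p"] exI[of _ "[]"]) (simp_all add: j ptarget_tgt path_prod_pair)
   from yxq show ?thesis
   proof (rule NT_or_tip)
    assume "path_prod [y, x] \<in> NT"
    then show ?thesis by (simp add: m nf_NT j jj)
   next
    fix i assume i: "i < r" "path_prod [y, x] = tip i"
    have "path_prod xs = tip i" using B4_maximal[OF tip_B4[OF i(1)]] sub i(2) by simp
    then show ?thesis using j i(2) p0 by (simp add: prod_eq_iff)
   next
    assume n: "path_prod [y, x] \<notin> NT" "path_prod [y, x] \<notin> tips" "\<not> mono_free (path_prod [y, x])"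
    have "path_prod xs \<notin> NT" using n(3) mono_free_subpath[OF nontip_mono_free sub] by blast
    moreover have "path_prod xs \<notin> tips"
    proof
     assume "path_prod xs \<in> tips"
     then obtain i where i: "i < r" "path_prod xs = tip i" by (auto simp: tips_def)
     have "mono_free (tip i)" unfolding mono_free_def
      using toupieD(7)[OF tip_B4[OF i(1)]] B4_branch[OF tip_B4[OF i(1)]] by blast
     then show False using n(3) mono_free_subpath[OF _ sub] i(2) by simp
    qed
    ultimately show ?thesis using n by (simp add: nf_0 m)
   qed
  qed
  finally show ?thesis .
 qed
qed

end

context toupie_path
begin

lemma arrows_sp_Cons: "y < N \<Longrightarrow> y < z \<Longrightarrow> arrows (sp x y z) = gl y 0 # arrows (sp x (Suc y) z)"
proof -
 assume y: "y < N" "y < z"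
 have w: "walk (fst x) (snd x)" using xq by (simp add: qpaths_walk)
 have d: "drop y (snd x) = snd x ! y # drop (Suc y) (snd x)" using y by (simp add: Cons_nth_drop_Suc)
 have "walk (tgt (fst x) (take y (snd x))) (drop y (snd x))"
  using w walk_append[of "fst x" "take y (snd x)" "drop y (snd x)"] by simp
 then have "tail Q (snd x ! y) = tgt (fst x) (take y (snd x))" unfolding d by simp
 moreover have "drop y (take z (snd x)) = snd x ! y # drop (Suc y) (take z (snd x))"
  using y by (metis Cons_nth_drop_Suc length_take min_less_iff_conj nth_take)
 moreover have "drop y (take (Suc y) (snd x)) = [snd x ! y]"
  using y by (simp add: take_Suc_conv_app_nth)
 ultimately show ?thesis by (simp add: arrows_def gl_def sp_def arrow_path_def)
qed

lemma decomp_0: "y \<le> z \<Longrightarrow> z \<le> N \<Longrightarrow> decomp y gs z 0 \<longleftrightarrow> gs = arrows (sp x y z)"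
proof (induction "z - y" arbitrary: y gs)
 case 0
 then have yz: "z = y" by simp
 have "arrows (sp x y z) = []" by (simp add: yz sp_def arrows_def)
 moreover have "\<not> decomp y (g # gs') z 0" for g gs' using 0 yz by auto
 ultimately show ?case using yz by (cases gs) auto
next
 case (Suc k)
 then have yz: "y < z" "y < N" by auto
 have IH: "decomp (Suc y) gs' z 0 \<longleftrightarrow> gs' = arrows (sp x (Suc y) z)" for gs'
  using Suc(1)[of "Suc y"] Suc(2,3,4) by simp
 have "val y 0" using yz by (simp add: val_def)
 then show ?case unfolding arrows_sp_Cons[OF yz(2,1)] using yz by (cases gs) (auto simp: IH)
qed

text \<open>A first factor of degree one less than \<open>\<gamma>\<close> leaves total degree 0,
  hence arrows only, and the chain of degree \<open>d\<close> from the start is unique.\<close>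

lemma decs_arrows:
 assumes c: "\<gamma> \<in> chains Q W (Suc d)" and p: "path_prod \<gamma> = x"
  and nt: "\<And>b. b \<in> tips \<Longrightarrow> \<not> subpath Q b x" and g: "deg g = d"
 shows "g # gs \<in> decs \<gamma> \<longleftrightarrow> g = butlast \<gamma> \<and> gs = arrows (last \<gamma>)"
proof -
 note w = chain_whole[OF c p]
 have y: "t 0 (Suc d) \<le> N" using t_strict[OF w(1), of "Suc d"] w(3) by simp
 have v: "val 0 d" using w(1) y by (auto simp: val_def simp del: t_even t_odd t.simps)
 have "gl 0 (Suc d) = gl 0 d @ [sp x (t 0 (Suc d)) (t 0 (Suc (Suc d)))]" by (simp add: gl_def)
 then have l: "last \<gamma> = sp x (t 0 (Suc d)) N" "butlast \<gamma> = gl 0 d"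
  by (simp_all only: w(2) w(3) last_snoc butlast_snoc)
 have "g # gs \<in> decs \<gamma> \<longleftrightarrow> decomp 0 (g # gs) N d"
  using decs_gl[OF w(1) nt, of "g # gs"] w(2,3) by simp
 also have "\<dots> \<longleftrightarrow> g = gl 0 d \<and> decomp (t 0 (Suc d)) gs N 0"
  using v y g by (auto simp del: t_even t_odd t.simps)
 finally show ?thesis unfolding decomp_0[OF y le_refl] l .
qed

text \<open>By the antichain condition a tip contains no other tip.\<close>

lemma tip_rel: "b \<in> tips \<Longrightarrow> x = b \<Longrightarrow> rel i j \<longleftrightarrow> i = 0 \<and> j = N"
proof -
 assume b: "b \<in> tips" "x = b"
 then have "x \<in> W" by (simp add: W_eq)
 then have r0: "rel 0 N" by (simp add: rel_def sp_all)
 show ?thesis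
 proof
  assume ij: "rel i j"
  then show "i = 0 \<and> j = N" using rel_nested[OF ij r0] by (auto simp: rel_def)
 qed (use r0 in simp)
qed

lemma tip_ends:
 assumes "b \<in> tips" "x = b"
 shows "re 0 = N" "rs 0 = 0" "0 < p \<Longrightarrow> N < re p \<or> re p = p"
proof -
 note R = tip_rel[OF assms]
 have h: "has 0" unfolding has_def using R[of 0 N] by blast
 show "re 0 = N" "rs 0 = 0" using has_rs[OF h] R by auto
 assume "0 < p"
 then have "\<not> has p" using R by (auto simp: has_def)
 then show "N < re p \<or> re p = p" using not_has(1) by auto
qed

lemma split_chain_gl: "2 \<le> N \<Longrightarrow> t 0 2 = N \<Longrightarrow> split_chain Q x = gl 0 1"
proof -
 assume N: "2 \<le> N" "t 0 2 = N"
 then obtain a as where a: "snd x = a # as" "as \<noteq> []" by (cases "snd x"; cases "tl (snd x)") auto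
 have "tail Q a = fst x" using xq a by (simp add: qpaths_walk)
 then show ?thesis using N(2) a by (simp add: split_chain_def gl_def sp_def arrow_path_def numeral_2_eq_2)
qed

end

context toupie
begin

lemma tips_B4: "b \<in> tips \<Longrightarrow> b \<in> set B4"
 using tip_B4 by (auto simp: tips_def)

text \<open>A tip cannot be extended, so the path of the chain is the tip. Its only relation is used
  up by the second letter, and there is no relation for a third.\<close>

lemma chain_tip:
 assumes c: "\<gamma> \<in> chains Q W d" and b: "b \<in> tips" "subpath Q b (path_prod \<gamma>)"
 shows "d = 1" "\<gamma> = split_chain Q b"
proof -
 define x where "x = path_prod \<gamma>"
 interpret toupie_path Q so si I Gmon W B4 r piv cf x unfolding x_def by (rule chain_universe[OF c])
 have xb: "x = b" using B4_maximal[OF tips_B4[OF b(1)] b(2)] by (simp add: x_def)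
 have N: "2 \<le> N" using B4_length[OF tips_B4[OF b(1)]] xb by simp
 note w = chain_whole[OF c x_def[symmetric]]
 have t2: "t 0 2 = N" using tip_ends(1)[OF b(1) xb] by (simp add: numeral_2_eq_2 del: t_even t_odd)
 have "d \<noteq> 0"
 proof
  assume "d = 0" then show False using w(3) N by simp
 qed
 moreover have "\<not> 2 \<le> d"
 proof
  assume d: "2 \<le> d"
  have "t 0 3 = re 1" by (simp add: numeral_3_eq_3)
  moreover have "t 0 2 < t 0 3" using t_strict[OF w(1) d] by (simp only: Suc_numeral semiring_norm)
  moreover have "t 0 3 \<le> t 0 (Suc d)" using t_mono[of 0 3 "Suc d"] d by simp
  ultimately show False using t2 w(3) tip_ends(3)[OF b(1) xb, of 1] N by auto
 qed
 ultimately show "d = 1" by simp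
 then show "\<gamma> = split_chain Q b" using w(2) split_chain_gl[OF N t2] xb by simp
qed

lemma split_chain_chain:
 assumes b: "b \<in> tips" shows "split_chain Q b \<in> chains Q W 1"
proof -
 have "b \<in> qpaths Q" using B4_branch[OF tips_B4[OF b]] by blast
 then interpret toupie_path Q so si I Gmon W B4 r piv cf b by unfold_locales
 have N: "2 \<le> N" using B4_length[OF tips_B4[OF b]] by simp
 note e = tip_ends[OF b refl]
 have t2: "t 0 2 = N" using e(1) by (simp add: numeral_2_eq_2 del: t_even t_odd)
 have "val 0 1" unfolding val_def using t2 e(2) by (simp add: numeral_2_eq_2 del: t_even t_odd)
 from gl_chain[OF this] show ?thesis using split_chain_gl[OF N t2] by simp
qed

end

section \<open>The morphism to the cobar construction of the bar construction\<close>

context bar_words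
begin

lemma P_long: "Y \<in> set V \<Longrightarrow> 2 \<le> length Y \<Longrightarrow> P (mon V) = 0"
 unfolding P_mon by (rule pr_long[of Y]) simp_all

lemma coef_lin: "coef (lin f p) v = (\<Sum>w\<in>keys p. lookup p w * coef (f (fwl w)) v)"
 by (simp add: lin_def lookup_sum lookup_cst)

text \<open>A word of \<open>q\<close> with several blocks ends in a long one, which cannot be
  multiplied out with \<open>V\<close>. A one-block word gets the product of \<open>V\<close>
  appended as a letter.\<close>

lemma coef_H_mult:
 assumes q: "\<And>U. FW U \<in> keys q \<Longrightarrow> U \<noteq> [] \<and> [] \<notin> set U \<and> wdeg U = d \<and> (tl U = [] \<or> 2 \<le> length (last U))"
 shows "coef (H (q * mon V)) [Z] =
  (if Z = [] then 0 else - ((-1) ^ d * (coef q [butlast Z] * coef (P (mon V)) [[last Z]])))"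
proof -
 define c where "c = (if Z = [] then 0 else - ((-1) ^ d * coef (P (mon V)) [[last Z]]))"
 have "H (q * mon V) = lin (\<lambda>U. H (mon (U @ V))) q"
  by (rule fa_induct[of q "\<lambda>q. H (q * mon V) = lin (\<lambda>U. H (mon (U @ V))) q"])
   (simp_all add: H_linear lin_simps distrib_right mult.assoc mon_append)
 then have "coef (H (q * mon V)) [Z] = (\<Sum>w\<in>keys q. lookup q w * coef (H (mon (fwl w @ V))) [Z])"
  by (simp only: coef_lin)
 also have "\<dots> = (\<Sum>w\<in>keys q. lookup q w * (if fwl w = [butlast Z] then c else 0))"
 proof (intro sum.cong refl arg_cong2[where f = "(*)"])
  fix w assume "w \<in> keys q"
  then have u: "FW (fwl w) \<in> keys q" by simp
  obtain Y V' where w: "fwl w = Y # V'" using q[OF u] by (cases "fwl w") auto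
  have Y: "Y \<noteq> []" and V': "V' = [] \<or> 2 \<le> length (last V')" and d: "deg Y + wdeg V' = d"
   using q[OF u] by (auto simp: w split: if_splits)
  show "coef (H (mon (fwl w @ V))) [Z] = (if fwl w = [butlast Z] then c else 0)"
  proof (cases "V' = []")
   case True
   then show ?thesis using coef_H_single[OF Y, of V Z] d Y by (auto simp: w c_def)
  next
   case False
   then have "last V' \<in> set (V' @ V)" "2 \<le> length (last V')" using V' by auto
   then have "P (mon (V' @ V)) = 0" by (rule P_long)
   then show ?thesis using coef_H_single[OF Y, of "V' @ V" Z] False by (simp add: w)
  qed
 qed
 also have "\<dots> = (\<Sum>w\<in>keys q. if w = FW [butlast Z] then coef q [butlast Z] * c else 0)"
 proof (intro sum.cong refl)
  fix w show "lookup q w * (if fwl w = [butlast Z] then c else 0) = (if w = FW [butlast Z] then coef q [butlast Z] * c else 0)"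
   by (cases w) simp
 qed
 also have "\<dots> = coef q [butlast Z] * c"
  by (auto simp: in_keys_iff)
 finally show ?thesis by (simp add: c_def)
qed

lemma coef_H_zero:
 assumes "\<And>U. FW U \<in> keys q \<Longrightarrow> \<exists>Y V. U = Y # V \<and> Y \<noteq> [] \<and> (\<exists>B\<in>set V. 2 \<le> length B)"
 shows "coef (H q) [Z] = 0"
proof -
 have "coef (hr (rev U)) [Z] = 0" if "FW U \<in> keys q" for U
 proof -
  obtain Y V B where U: "U = Y # V" "Y \<noteq> []" and B: "B \<in> set V" "2 \<le> length B" using assms[OF \<open>FW U \<in> keys q\<close>] by auto
  show ?thesis using coef_H_single[OF U(2), of V Z] P_long[OF B] by (simp add: U(1) H_mon)
 qed
 then show ?thesis unfolding H_def coef_lin by (intro sum.neutral ballI) simp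
qed

end

context toupie
begin

lemma arrows_composable:
 "walk u as \<Longrightarrow> composable Q (map (arrow_path Q) as) \<and> (as \<noteq> [] \<longrightarrow> path_prod (map (arrow_path Q) as) = (u, as))"
proof (induction as arbitrary: u)
 case (Cons a as)
 have a: "arrow_path Q a \<in> qpaths Q" "ptarget Q (arrow_path Q a) = head Q a"
  using Cons.prems arrow_path_qpaths[of a] by (simp_all add: ptarget_tgt) (simp add: arrow_path_def)
 have IH: "composable Q (map (arrow_path Q) as)" "as \<noteq> [] \<Longrightarrow> path_prod (map (arrow_path Q) as) = (head Q a, as)"
  using Cons.IH[of "head Q a"] Cons.prems by simp_all
 have au: "arrow_path Q a = (u, [a])" using Cons.prems by (simp add: arrow_path_def)
 show ?case
 proof (cases "as = []")
  case True
  then show ?thesis using a(1) au by (simp add: composable_single)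
 next
  case False
  then obtain b bs where as: "as = b # bs" by (cases as) auto
  have "fst (arrow_path Q b) = head Q a" using Cons.prems by (simp add: as arrow_path_def)
  then have "composable Q (map (arrow_path Q) (a # as))"
   using a IH(1) by (simp add: as composable_Cons2)
  moreover have "path_prod (map (arrow_path Q) (a # as)) = (u, a # as)"
   using IH(2)[OF False] False by (simp add: path_prod_Cons au)
  ultimately show ?thesis by blast
 qed
qed (simp add: composable_Nil)

lemma arrows_eq: "arrows b = map (\<lambda>x. [x]) (map (arrow_path Q) (snd b))"
 by (simp add: arrows_def)

lemma arrows_path: "map path_prod (arrows b) = map (arrow_path Q) (snd b)"
 by (simp add: arrows_def)

lemma arrow_chain: "a \<in> arcs Q \<Longrightarrow> [arrow_path Q a] \<in> chains Q W 0"
proof -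
 assume a: "a \<in> arcs Q"
 have "(tail Q a, []) \<in> trivial_paths Q" using a by (auto simp: trivial_paths_def)
 moreover have "uf_arrow Q W (tail Q a, []) (arrow_path Q a)"
  unfolding uf_arrow_trivial[OF calculation] using a by (simp add: arrow_path_def)
 ultimately show ?thesis using arrow_nontip[OF a] unfolding chains_def by auto
qed

lemma walk_arcs: "walk u as \<Longrightarrow> set as \<subseteq> arcs Q"
 by (induction as arbitrary: u) auto

lemma chain_NT: "\<gamma> \<in> chains Q W d \<Longrightarrow> x \<in> set \<gamma> \<Longrightarrow> x \<in> NT"
 using chainsD(2) by blast

lemma chain_ends:
 assumes "\<gamma> \<in> chains Q W d"
 shows "\<gamma> \<noteq> []" "fst (path_prod \<gamma>) = fst (hd \<gamma>)" "ptarget Q (path_prod \<gamma>) = ptarget Q (last \<gamma>)"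
proof -
 show "\<gamma> \<noteq> []" using chainsD(1)[OF assms] by auto
 then show "fst (path_prod \<gamma>) = fst (hd \<gamma>)" "ptarget Q (path_prod \<gamma>) = ptarget Q (last \<gamma>)"
  using composable_append_walk[OF chainsD(4)[OF assms]] by (auto simp: path_prod_def)
qed

lemma decs_letters: "gs \<in> decs \<gamma> \<Longrightarrow> g \<in> set gs \<Longrightarrow> \<exists>e. g \<in> chains Q W e"
proof -
 have "list_all2 (\<lambda>\<gamma> r. \<gamma> \<in> chains Q W r) hs rs \<Longrightarrow> g \<in> set hs \<Longrightarrow> \<exists>e. g \<in> chains Q W e" for hs rs
  by (induction rule: list_all2_induct) auto
 then show "gs \<in> decs \<gamma> \<Longrightarrow> g \<in> set gs \<Longrightarrow> ?thesis" unfolding decs_def chain_product_case_def by blast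
qed

lemma keys_\<delta>T:
 assumes "FW gs \<in> keys (\<delta>T \<gamma>)"
 obtains "gs \<in> decs \<gamma>" | i b where "i < r" "\<gamma> = split_chain Q (tip i)" "b \<in> set B4" "\<rho> i b \<noteq> 0" "gs = arrows b"
proof -
 have "gs \<in> decs \<gamma> \<or> (\<exists>i b. i < r \<and> \<gamma> = split_chain Q (tip i) \<and> b \<in> set B4 \<and> \<rho> i b \<noteq> 0 \<and> gs = arrows b)"
 proof (rule ccontr)
  assume n: "\<not> ?thesis"
  then have "(\<Sum>i\<in>{i. i < r \<and> \<gamma> = split_chain Q (tip i)}. \<Sum>b\<in>set B4. if gs = arrows b then \<rho> i b else 0) = 0"
   by (intro sum.neutral ballI) (auto intro!: sum.neutral)
  then show False using assms n unfolding in_keys_iff cf_\<delta>T by simp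
 qed
 then show ?thesis using that by blast
qed

lemma \<delta>T_word:
 assumes c: "\<gamma> \<in> chains Q W d" and gs: "FW gs \<in> keys (\<delta>T \<gamma>)"
 shows "gs \<noteq> []" "\<And>g. g \<in> set gs \<Longrightarrow> \<exists>e<d. g \<in> chains Q W e" "composable Q (map path_prod gs)"
  "fst (path_prod (hd gs)) = fst (path_prod \<gamma>)" "ptarget Q (path_prod (last gs)) = ptarget Q (path_prod \<gamma>)"
proof -
 have "gs \<noteq> [] \<and> (\<forall>g\<in>set gs. \<exists>e. g \<in> chains Q W e) \<and> composable Q (map path_prod gs) \<and>
  path_prod (map path_prod gs) = path_prod \<gamma>"
  if h: "gs \<in> decs \<gamma>"
 proof -
  obtain rs where rs: "chain_product_case Q W tips gs rs \<gamma>" using h by (auto simp: decs_def)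
  have "\<forall>g\<in>set gs. \<exists>e. g \<in> chains Q W e" using decs_letters[OF h] by blast
  then show ?thesis using rs by (auto simp: chain_product_case_def)
 qed
 moreover have "gs \<noteq> [] \<and> (\<forall>g\<in>set gs. \<exists>e. g \<in> chains Q W e) \<and> composable Q (map path_prod gs) \<and>
  fst (path_prod (map path_prod gs)) = fst (path_prod \<gamma>) \<and>
  ptarget Q (path_prod (map path_prod gs)) = ptarget Q (path_prod \<gamma>)"
  if b: "i < r" "\<gamma> = split_chain Q (tip i)" "b \<in> set B4" "gs = arrows b" for i b
 proof -
  have w: "walk (fst b) (snd b)" and n: "snd b \<noteq> []"
   using B4_branch[OF b(3)] B4_length[OF b(3)] by (auto simp: qpaths_walk)
  have p: "path_prod \<gamma> = tip i" using b path_prod_split_chain[OF tip_B4[OF b(1)]] by simp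
  have m: "map path_prod gs = map (arrow_path Q) (snd b)" unfolding b(4) by (rule arrows_path)
  have "\<forall>g\<in>set gs. \<exists>e. g \<in> chains Q W e"
   unfolding b(4) arrows_def using walk_arcs[OF w] arrow_chain by auto
  moreover have "gs \<noteq> []" using n by (simp add: b(4) arrows_def)
  moreover have "composable Q (map (arrow_path Q) (snd b))" "path_prod (map (arrow_path Q) (snd b)) = b"
   using arrows_composable[OF w] n by simp_all
  ultimately show ?thesis
   using B4_branch[OF b(3)] B4_branch[OF tip_B4[OF b(1)]] unfolding m p by simp
 qed
 ultimately have *: "gs \<noteq> [] \<and> (\<forall>g\<in>set gs. \<exists>e. g \<in> chains Q W e) \<and> composable Q (map path_prod gs) \<and>
  fst (path_prod (map path_prod gs)) = fst (path_prod \<gamma>) \<and>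
  ptarget Q (path_prod (map path_prod gs)) = ptarget Q (path_prod \<gamma>)"
  by (cases rule: keys_\<delta>T[OF gs]) simp_all
 then show n: "gs \<noteq> []" and cm: "composable Q (map path_prod gs)" by blast+
 show "fst (path_prod (hd gs)) = fst (path_prod \<gamma>)" using * n by (simp add: path_prod_def hd_map)
 show "ptarget Q (path_prod (last gs)) = ptarget Q (path_prod \<gamma>)"
  using * n composable_append_walk[OF cm] by (simp add: last_map)
 fix g assume g: "g \<in> set gs"
 then obtain e where e: "g \<in> chains Q W e" using * by blast
 have "sum_list (map deg gs) + 1 = deg \<gamma>" using lowers_\<delta>T gs unfolding lowers_def by blast
 moreover have "deg g \<le> sum_list (map deg gs)" using g by (intro member_le_sum_list) auto
 ultimately have "e < d" using chain_length[OF e] chain_length[OF c] by simp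
 then show "\<exists>e<d. g \<in> chains Q W e" using e by blast
qed

definition words :: "'v \<Rightarrow> 'v \<Rightarrow> ('v, 'e) qpath list set" where
 "words u v = {xs. xs \<noteq> [] \<and> set xs \<subseteq> NT \<and> composable Q xs \<and> fst (hd xs) = u \<and> ptarget Q (last xs) = v}"

lemma words_append: "xs \<in> words u v \<Longrightarrow> ys \<in> words v w \<Longrightarrow> xs @ ys \<in> words u w"
 by (auto simp: words_def composable_append)

lemma words_mul: "us @ [y, x] \<in> words u v \<Longrightarrow> z \<in> keys (mul y x) \<Longrightarrow> us @ [z] \<in> words u v"
proof -
 assume w: "us @ [y, x] \<in> words u v" and z: "z \<in> keys (mul y x)"
 note k = keys_mul[OF z]
 have "z \<in> qpaths Q" using NT_qpaths[OF k(3)] .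
 then show ?thesis using w k
  by (cases "us = []") (simp_all add: words_def composable_append composable_single composable_pair)
qed

text \<open>The bookkeeping that passes through both products and \<open>H\<close>: end points,
  degree, nonempty blocks, composable letters.\<close>

definition good :: "'v \<Rightarrow> 'v \<Rightarrow> nat \<Rightarrow> ('v, 'e) qpath list list \<Rightarrow> bool" where
 "good u v d w \<longleftrightarrow> w \<noteq> [] \<and> [] \<notin> set w \<and> wdeg w = d \<and> concat w \<in> words u v"

lemma good_append: "good u v d w \<Longrightarrow> good v v' d' w' \<Longrightarrow> good u v' (d + d') (w @ w')"
 by (auto simp: good_def intro: words_append)

lemma good_H: "(\<And>w. FW w \<in> keys q \<Longrightarrow> good u v d w) \<Longrightarrow> FW w \<in> keys (H q) \<Longrightarrow> good u v (Suc d) w"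
proof -
 assume q: "\<And>w. FW w \<in> keys q \<Longrightarrow> good u v d w" and w: "FW w \<in> keys (H q)"
 obtain U where U: "FW U \<in> keys q" "FW w \<in> keys (hr (rev U))" using w by (rule keys_H)
 note g = q[OF U(1)]
 have "w \<noteq> [] \<and> [] \<notin> set w \<and> wdeg w = Suc (wdeg (rev U)) \<and> concat w \<in> words u v"
  by (rule keys_hr[OF words_mul _ _ U(2)]) (use g in \<open>auto simp: good_def\<close>)
 then show ?thesis using g by (simp add: good_def sum_list_rev flip: rev_map)
qed

text \<open>\<open>G\<close> calls itself through \<open>ahom\<close> on chains of lower degree. The
  stage \<open>n\<close> is final for all chains of degree at most \<open>n\<close>, and
  \<open>G_Suc\<close> is the recursion aimed at.\<close>

primrec G_upto :: "nat \<Rightarrow> ('v, 'e) qpath list \<Rightarrow> (('v, 'e) qpath list, 'k) fa" where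
 "G_upto 0 \<gamma> = mon [\<gamma>]"
| "G_upto (Suc n) \<gamma> = (if deg \<gamma> \<le> n then G_upto n \<gamma> else H (ahom (G_upto n) (\<delta>T \<gamma>)))"

definition G :: "('v, 'e) qpath list \<Rightarrow> (('v, 'e) qpath list, 'k) fa" where
 "G \<gamma> = G_upto (deg \<gamma>) \<gamma>"

lemma G_upto: "deg \<gamma> \<le> n \<Longrightarrow> G_upto n \<gamma> = G \<gamma>"
proof (induction n)
 case (Suc n)
 show ?case
 proof (cases "deg \<gamma> \<le> n")
  case False
  then have "deg \<gamma> = Suc n" using Suc.prems by simp
  then show ?thesis by (simp only: G_def)
 qed (use Suc in simp)
qed (simp add: G_def)

lemma G_0: "deg \<gamma> = 0 \<Longrightarrow> G \<gamma> = mon [\<gamma>]"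
 by (simp add: G_def)

lemma G_Suc: "0 < deg \<gamma> \<Longrightarrow> G \<gamma> = H (ahom G (\<delta>T \<gamma>))"
proof -
 assume "0 < deg \<gamma>"
 then obtain n where n: "deg \<gamma> = Suc n" by (metis gr0_implies_Suc)
 have "ahom (G_upto n) (\<delta>T \<gamma>) = ahom G (\<delta>T \<gamma>)" unfolding ahom_def
 proof (rule lin_cong)
  fix w assume "FW w \<in> keys (\<delta>T \<gamma>)"
  then have s: "sum_list (map deg w) + 1 = deg \<gamma>" using lowers_\<delta>T unfolding lowers_def by blast
  have "deg g \<le> n" if "g \<in> set w" for g
  proof -
   have "deg g \<le> sum_list (map deg w)" using that by (intro member_le_sum_list) auto
   then show ?thesis using s n by simp
  qed
  then have "map (G_upto n) w = map G w" by (intro map_cong refl G_upto)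
  then show "prod_list (map (G_upto n) w) = prod_list (map G w)" by (rule arg_cong)
 qed
 then show ?thesis by (simp add: G_def[of \<gamma>] n)
qed

lemma good_prod_list:
 assumes "gs \<noteq> []" "composable Q (map path_prod gs)"
  "\<And>g w. g \<in> set gs \<Longrightarrow> FW w \<in> keys (G g) \<Longrightarrow> good (fst (path_prod g)) (ptarget Q (path_prod g)) (deg g) w"
  "FW w \<in> keys (prod_list (map G gs))"
 shows "good (fst (path_prod (hd gs))) (ptarget Q (path_prod (last gs))) (sum_list (map deg gs)) w"
 using assms
proof (induction gs arbitrary: w)
 case (Cons g gs)
 show ?case
 proof (cases "gs = []")
  case True
  then show ?thesis using Cons.prems(3)[of g w] Cons.prems(4) by simp
 next
  case False
  then obtain h hs where gs: "gs = h # hs" by (cases gs) auto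
  have "FW w \<in> keys (G g * prod_list (map G gs))" using Cons.prems(4) by simp
  then obtain u v where uv: "FW u \<in> keys (G g)" "FW v \<in> keys (prod_list (map G gs))" "w = u @ v"
   by (rule keys_multD)
  have c: "composable Q (map path_prod gs)" "ptarget Q (path_prod g) = fst (path_prod (hd gs))"
   using Cons.prems(2) by (simp_all add: gs composable_Cons2)
  have "good (fst (path_prod (hd gs))) (ptarget Q (path_prod (last gs))) (sum_list (map deg gs)) v"
   using False c(1) Cons.prems(3) uv(2) by (intro Cons.IH) auto
  moreover have "good (fst (path_prod g)) (ptarget Q (path_prod g)) (deg g) u"
   using Cons.prems(3) uv(1) by simp
  ultimately show ?thesis using good_append False c(2) uv(3) by fastforce
 qed
qed simp

lemma good_ahom:
 assumes c: "\<gamma> \<in> chains Q W d"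
  and IH: "\<And>e g w. e < d \<Longrightarrow> g \<in> chains Q W e \<Longrightarrow> FW w \<in> keys (G g) \<Longrightarrow>
   good (fst (path_prod g)) (ptarget Q (path_prod g)) e w"
  and w: "FW w \<in> keys (ahom G (\<delta>T \<gamma>))"
 shows "good (fst (path_prod \<gamma>)) (ptarget Q (path_prod \<gamma>)) (d - 1) w"
proof -
 obtain gs where gs: "FW gs \<in> keys (\<delta>T \<gamma>)" "FW w \<in> keys (prod_list (map G gs))"
  using w unfolding ahom_def by (rule keys_lin)
 note t = \<delta>T_word[OF c gs(1)]
 have "good (fst (path_prod (hd gs))) (ptarget Q (path_prod (last gs))) (sum_list (map deg gs)) w"
 proof (rule good_prod_list[OF t(1,3) _ gs(2)])
  fix g w assume g: "g \<in> set gs" and w: "FW w \<in> keys (G g)"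
  obtain e where e: "e < d" "g \<in> chains Q W e" using t(2)[OF g] by blast
  show "good (fst (path_prod g)) (ptarget Q (path_prod g)) (deg g) w"
   using IH[OF e w] chain_length[OF e(2)] by simp
 qed
 moreover have "sum_list (map deg gs) = d - 1"
  using lowers_\<delta>T gs(1) chain_length[OF c] unfolding lowers_def by fastforce
 ultimately show ?thesis by (simp only: t(4,5))
qed

lemma G_good: "\<gamma> \<in> chains Q W d \<Longrightarrow> FW w \<in> keys (G \<gamma>) \<Longrightarrow> good (fst (path_prod \<gamma>)) (ptarget Q (path_prod \<gamma>)) d w"
proof (induction d arbitrary: \<gamma> w rule: less_induct)
 case (less d)
 note c = less.prems(1)
 show ?case
 proof (cases "d = 0")
  case True
  then have "w = [\<gamma>]" using less.prems chain_length[OF c] by (simp add: G_0)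
  then show ?thesis using chainsD(2,4)[OF c] chain_ends[OF c] chain_length[OF c] True by (simp add: good_def words_def)
 next
  case False
  then have p: "0 < deg \<gamma>" using chain_length[OF c] by simp
  have w: "FW w \<in> keys (H (ahom G (\<delta>T \<gamma>)))" using less.prems(2) unfolding G_Suc[OF p] .
  have "good (fst (path_prod \<gamma>)) (ptarget Q (path_prod \<gamma>)) (Suc (d - 1)) w"
   by (rule good_H[OF good_ahom[OF c less.IH] w])
  then show ?thesis using False by simp
 qed
qed

lemma homog_G: "\<gamma> \<in> chains Q W d \<Longrightarrow> homog deg (deg \<gamma>) (G \<gamma>)"
proof -
 assume c: "\<gamma> \<in> chains Q W d"
 show ?thesis unfolding homog_def using G_good[OF c] chain_length[OF c] by (simp add: good_def)
qed

lemma P_arrows: "b \<in> qpaths Q \<Longrightarrow> snd b \<noteq> [] \<Longrightarrow>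
 P (mon (arrows b)) = (\<Sum>z\<in>keys (nf b). cst (lookup (nf b) z) * mon [[z]])"
proof -
 assume b: "b \<in> qpaths Q" "snd b \<noteq> []"
 then have w: "walk (fst b) (snd b)" by (simp add: qpaths_walk)
 have "set (map (arrow_path Q) (snd b)) \<subseteq> NT" using walk_arcs[OF w] arrow_nontip by auto
 moreover have "map (arrow_path Q) (snd b) \<noteq> []" "composable Q (map (arrow_path Q) (snd b))"
  and p: "path_prod (map (arrow_path Q) (snd b)) = b"
  using arrows_composable[OF w] b(2) by simp_all
 ultimately show ?thesis using P_singles[of "map (arrow_path Q) (snd b)"] unfolding arrows_eq p by blast
qed

lemma G_arrows: "(\<And>g. g \<in> set gs \<Longrightarrow> deg g = 0) \<Longrightarrow> prod_list (map G gs) = mon gs"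
 by (induction gs) (simp_all add: G_0 flip: mon_Cons)

lemma chain0_arrow: "g \<in> chains Q W 0 \<Longrightarrow> \<exists>a\<in>arcs Q. g = [arrow_path Q a]"
 using chainsD(1,3)[of g 0] by (cases g) auto

lemma chains0_arrows:
 assumes "\<And>g. g \<in> set gs \<Longrightarrow> g \<in> chains Q W 0"
 shows "\<exists>as. gs = map (\<lambda>a. [arrow_path Q a]) as"
 using assms
proof (induction gs)
 case (Cons g gs)
 obtain a where "g = [arrow_path Q a]" using chain0_arrow[of g] Cons.prems by auto
 moreover obtain as where "gs = map (\<lambda>a. [arrow_path Q a]) as" using Cons by auto
 ultimately have "g # gs = map (\<lambda>a. [arrow_path Q a]) (a # as)" by simp
 then show ?case by (rule exI)
qed simp

text \<open>\<open>P\<close> sends a word of arrows to its product in \<open>A\<close>, so this says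
  that the relation of a 1-chain holds there: a monomial path reduces to 0, and
  \<open>nf (tip i)\<close> is minus the rest of \<open>\<rho> i\<close>.\<close>

lemma P_\<delta>T_1:
 assumes c: "\<gamma> \<in> chains Q W 1"
 shows "P (ahom G (\<delta>T \<gamma>)) = 0"
proof -
 have A: "P (prod_list (map G gs)) = 0" if gs: "gs \<in> decs \<gamma>" for gs
 proof -
  have d0: "sum_list (map deg gs) = 0" using decs_deg[OF gs] chain_length[OF c] by simp
  obtain rs where rs: "chain_product_case Q W tips gs rs \<gamma>" using gs by (auto simp: decs_def)
  have g0: "deg g = 0 \<and> g \<in> chains Q W 0" if "g \<in> set gs" for g
  proof -
   have "deg g \<le> sum_list (map deg gs)" using that by (intro member_le_sum_list) auto
   then have "deg g = 0" using d0 by simp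
   moreover obtain e where e: "g \<in> chains Q W e"
    using decs_letters[OF gs \<open>g \<in> set gs\<close>] by blast
   ultimately show ?thesis using chain_length[OF e] e by auto
  qed
  obtain as where as: "gs = map (\<lambda>a. [arrow_path Q a]) as" using chains0_arrows[of gs] g0 by blast
  define xs where "xs = map (arrow_path Q) as"
  have gx: "gs = map (\<lambda>x. [x]) xs" "map path_prod gs = xs" by (simp_all add: as xs_def)
  have xs: "xs \<noteq> []" "composable Q xs" "path_prod xs = path_prod \<gamma>"
   using rs gx(2) by (auto simp: chain_product_case_def)
  have "set xs \<subseteq> NT"
  proof
   fix x assume "x \<in> set xs"
   then have "[x] \<in> set gs" by (auto simp: gx(1))
   then show "x \<in> NT" using g0 chain_NT[of "[x]" 0 x] by simp
  qed
  moreover have "nf (path_prod \<gamma>) = 0"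
  proof (rule nf_0)
   obtain u v where uv: "\<gamma> = [u, v]" using chain_length[OF c] by (auto simp: length_Suc_conv)
   have "uf_arrow Q W u v" using chainsD(5)[OF c, of 0] by (simp add: uv)
   moreover have "u \<notin> trivial_paths Q" using chain_NT[OF c, of u] by (simp add: uv)
   ultimately have "path_prod \<gamma> \<in> path_ideal Q W" using uf_arrow_nontrivial uv by simp
   then show "path_prod \<gamma> \<notin> NT" using path_ideal_iff[OF chain_qpath[OF c]] by blast
   have "\<not> (\<exists>t\<in>tips. subpath Q t (path_prod \<gamma>))" using rs unfolding chain_product_case_def by blast
   then show "path_prod \<gamma> \<notin> tips" using subpath_refl[OF chain_qpath[OF c]] by blast
  qed
  ultimately have "P (mon gs) = 0" using P_singles[OF xs(1) _ xs(2)] by (simp add: gx(1) xs(3))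
  then show ?thesis using G_arrows[of gs] g0 by simp
 qed
 have B: "(\<Sum>b\<in>set B4. cst (\<rho> i b) * P (mon (arrows b))) = 0" if i: "i < r" for i
 proof (rule poly_mapping_eqI)
  fix w :: "('v, 'e) qpath list fw"
  let ?c = "\<lambda>z :: ('v, 'e) qpath. coef (mon [[z]]) (fwl w) :: 'k"
  have "lookup (\<Sum>b\<in>set B4. cst (\<rho> i b) * P (mon (arrows b))) w =
    (\<Sum>b\<in>set B4. \<rho> i b * (if b = tip i then - (\<Sum>b\<in>set B4 - {tip i}. \<rho> i b * ?c b) else ?c b))"
   unfolding lookup_sum lookup_cst
  proof (rule sum.cong[OF refl])
   fix b assume b: "b \<in> set B4"
   have q: "b \<in> qpaths Q" "snd b \<noteq> []" using B4_branch[OF b] B4_length[OF b] by auto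
   have "\<rho> i b * lookup (\<Sum>z\<in>keys (nf b). cst (lookup (nf b) z) * mon [[z]]) w =
    \<rho> i b * (\<Sum>z\<in>keys (nf b). lookup (nf b) z * ?c z)" by (simp add: lookup_sum lookup_cst)
   also have "\<dots> = \<rho> i b * (if b = tip i then - (\<Sum>b\<in>set B4 - {tip i}. \<rho> i b * ?c b) else ?c b)"
   proof (cases "b = tip i")
    case True
    have "keys (nf (tip i)) \<subseteq> set B4 - {tip i}"
    proof
     fix z assume "z \<in> keys (nf (tip i))"
     then have "delta (tip i) z - \<rho> i z \<noteq> 0" unfolding in_keys_iff lookup_nf_tip[OF i] .
     then show "z \<in> set B4 - {tip i}" using \<rho>_B4[of i z] i \<rho>_tip[OF i i] by (auto split: if_splits)
    qed
    then have "(\<Sum>z\<in>keys (nf (tip i)). lookup (nf (tip i)) z * ?c z) =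
      (\<Sum>z\<in>set B4 - {tip i}. lookup (nf (tip i)) z * ?c z)"
     by (intro sum.mono_neutral_left) (auto simp: in_keys_iff)
    also have "\<dots> = - (\<Sum>z\<in>set B4 - {tip i}. \<rho> i z * ?c z)"
     unfolding sum_negf[symmetric] by (intro sum.cong) (auto simp: lookup_nf_tip[OF i])
    finally show ?thesis by (simp add: True)
   next
    case False
    then show ?thesis
    proof (cases "\<rho> i b = 0")
     case False
     then have "nf b = Poly_Mapping.single b 1" using \<rho>_NT[OF i False \<open>b \<noteq> tip i\<close>] nf_NT by blast
     then show ?thesis using \<open>b \<noteq> tip i\<close> by simp
    qed simp
   qed
   finally show "\<rho> i b * lookup (P (mon (arrows b))) w =
    \<rho> i b * (if b = tip i then - (\<Sum>b\<in>set B4 - {tip i}. \<rho> i b * ?c b) else ?c b)"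
    unfolding P_arrows[OF q] .
  qed
  also have "\<dots> = - (\<Sum>b\<in>set B4 - {tip i}. \<rho> i b * ?c b) + (\<Sum>b\<in>set B4 - {tip i}. \<rho> i b * ?c b)"
   using \<rho>_tip[OF i i] by (subst sum.remove[OF _ tip_B4[OF i]]) (auto intro!: sum.cong)
  finally show "lookup (\<Sum>b\<in>set B4. cst (\<rho> i b) * P (mon (arrows b))) w = lookup 0 w" by simp
 qed
 have C: "prod_list (map G (arrows b)) = mon (arrows b)" for b
  by (rule G_arrows) (auto simp: arrows_def)
 show ?thesis unfolding \<delta>T_def
  by (simp add: ahom_simps P_linear A B C)
qed

text \<open>By \<open>contraction\<close>, \<open>H\<close> inverts \<open>DB\<close> on
  \<open>q = ahom G (\<delta>T \<gamma>)\<close> once \<open>DB q = 0\<close> and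
  \<open>P q = 0\<close>. The first follows from \<open>\<delta>T_sq\<close> and the induction
  hypothesis, the second from the degree, or from \<open>P_\<delta>T_1\<close> if
  \<open>d = 1\<close>.\<close>

theorem DB_G: "\<gamma> \<in> chains Q W d \<Longrightarrow> DB (G \<gamma>) = ahom G (\<delta>T \<gamma>)"
proof (induction d arbitrary: \<gamma> rule: less_induct)
 case (less d)
 note c = less.prems
 note l = chain_length[OF c]
 show ?case
 proof (cases "d = 0")
  case True
  then have l1: "deg \<gamma> = 0" using l by simp
  then have "\<delta>T \<gamma> = 0" using lowers_0[OF lowers_\<delta>T] by blast
  moreover have "\<delta>B \<gamma> = 0" using l True by (auto simp: length_Suc_conv)
  ultimately show ?thesis using l1 by (simp add: G_0 ahom_simps)
 next
  case False
  let ?q = "ahom G (\<delta>T \<gamma>)"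
  have good: "good (fst (path_prod \<gamma>)) (ptarget Q (path_prod \<gamma>)) (d - 1) w" if "FW w \<in> keys ?q" for w
   using good_ahom[OF c G_good that] .
  have NE: "NE ?q" using good by (simp add: NE_def good_def)
  have "DB ?q = ahom G (der deg \<delta>T (\<delta>T \<gamma>))"
  proof (rule der_ahom)
   fix w g assume w: "FW w \<in> keys (\<delta>T \<gamma>)" and g: "g \<in> set w"
   obtain e where e: "e < d" "g \<in> chains Q W e" using \<delta>T_word(2)[OF c w g] by blast
   show "homog deg (deg g) (G g)" using homog_G[OF e(2)] .
   show "DB (G g) = ahom G (\<delta>T g)" using less.IH[OF e] .
  qed
  then have D0: "DB ?q = 0" by (simp add: \<delta>T_sq ahom_simps)
  have "P ?q = 0"
  proof (cases "d = 1")
   case True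
   then show ?thesis using P_\<delta>T_1 c by simp
  next
   case d: False
   have "homog deg (d - 1) ?q" using good by (simp add: homog_def good_def)
   then show ?thesis using d False by (intro P_positive[of "d - 1"]) auto
  qed
  then have "DB (H ?q) = ?q" using contraction[OF NE] D0 by (simp add: H_linear)
  then show ?thesis using G_Suc[of \<gamma>] l False by simp
 qed
qed

end

section \<open>The linear part of the morphism\<close>

context toupie
begin

text \<open>In positive degree \<open>G \<gamma>\<close> lies in the image of \<open>H\<close>,
  whose words end in a block that has just been joined.\<close>

lemma G_shape:
 assumes c: "\<gamma> \<in> chains Q W d" and U: "FW U \<in> keys (G \<gamma>)"
 shows "U \<noteq> [] \<and> [] \<notin> set U \<and> wdeg U = d \<and> (tl U = [] \<or> 2 \<le> length (last U))"
proof (cases "d = 0")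
 case True
 then show ?thesis using U chain_length[OF c] G_0[of \<gamma>] chain_ends(1)[OF c] by simp
next
 case False
 then have p: "0 < deg \<gamma>" using chain_length[OF c] by simp
 have "FW U \<in> keys (H (ahom G (\<delta>T \<gamma>)))" using U unfolding G_Suc[OF p] .
 then have "2 \<le> length (last U)" using keys_H keys_hr_last by blast
 then show ?thesis using G_good[OF c U] by (simp add: good_def)
qed

lemma prod_list_long_block:
 assumes "\<And>g. g \<in> set gs \<Longrightarrow> \<exists>e. g \<in> chains Q W e" "h \<in> set gs" "deg h \<noteq> 0" "FW U \<in> keys (prod_list (map G gs))"
 shows "\<exists>B\<in>set U. 2 \<le> length B"
 using assms
proof (induction gs arbitrary: U)
 case (Cons g gs)
 have "FW U \<in> keys (G g * prod_list (map G gs))" using Cons.prems(4) by simp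
 then obtain u v where uv: "FW u \<in> keys (G g)" "FW v \<in> keys (prod_list (map G gs))" "U = u @ v"
  by (rule keys_multD)
 show ?case
 proof (cases "h \<in> set gs")
  case True
  then have "\<exists>B\<in>set v. 2 \<le> length B" using Cons.prems uv(2) by (intro Cons.IH) auto
  then show ?thesis using uv(3) by auto
 next
  case False
  then have h: "g = h" using Cons.prems(2) by simp
  obtain e where e: "g \<in> chains Q W e" using Cons.prems(1)[of g] by auto
  note s = G_shape[OF e uv(1)]
  have "2 \<le> length (last u)"
  proof (cases "tl u = []")
   case True
   then obtain B where "u = [B]" using s by (cases u) auto
   then have "deg B = e" "e \<noteq> 0" using s Cons.prems(3) chain_length[OF e] h by auto
   then show ?thesis using \<open>u = [B]\<close> by (cases "length B") auto
  qed (use s in simp)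
  then show ?thesis using s uv(3) by (intro bexI[of _ "last u"]) auto
 qed
qed simp

text \<open>A later factor of positive degree contributes a long block, which cannot become a
  letter; otherwise the later factors are single letters and are multiplied out.\<close>

lemma coef_H_prod:
 assumes g: "g \<in> chains Q W e" and gs: "\<And>h. h \<in> set gs \<Longrightarrow> \<exists>e. h \<in> chains Q W e"
 shows "coef (H (prod_list (map G (g # gs)))) [Z] = (if (\<exists>h\<in>set gs. deg h \<noteq> 0) \<or> Z = [] then 0
   else - ((-1) ^ e * (coef (G g) [butlast Z] * coef (P (mon gs)) [[last Z]])))"
proof (cases "\<exists>h\<in>set gs. deg h \<noteq> 0")
 case True
 then obtain h where h: "h \<in> set gs" "deg h \<noteq> 0" by blast
 have "coef (H (G g * prod_list (map G gs))) [Z] = 0"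
 proof (rule coef_H_zero)
  fix U assume "FW U \<in> keys (G g * prod_list (map G gs))"
  then obtain u v where uv: "FW u \<in> keys (G g)" "FW v \<in> keys (prod_list (map G gs))" "U = u @ v"
   by (rule keys_multD)
  obtain Y u' where "u = Y # u'" "Y \<noteq> []" using G_shape[OF g uv(1)] by (cases u) auto
  moreover have "\<exists>B\<in>set v. 2 \<le> length B" using gs h uv(2) by (rule prod_list_long_block)
  ultimately show "\<exists>Y V. U = Y # V \<and> Y \<noteq> [] \<and> (\<exists>B\<in>set V. 2 \<le> length B)"
   using uv(3) by (intro exI[of _ Y] exI[of _ "u' @ v"]) auto
 qed
 then show ?thesis using True by simp
next
 case False
 then have "prod_list (map G gs) = mon gs" by (intro G_arrows) blast
 moreover have "coef (H (G g * mon gs)) [Z] =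
  (if Z = [] then 0 else - ((-1) ^ e * (coef (G g) [butlast Z] * coef (P (mon gs)) [[last Z]])))"
  by (rule coef_H_mult) (rule G_shape[OF g])
 ultimately show ?thesis using False by simp
qed

lemma decs_prefix:
 assumes c: "\<gamma> \<in> chains Q W (Suc d)" and nt: "\<And>b. b \<in> tips \<Longrightarrow> \<not> subpath Q b (path_prod \<gamma>)" and g: "deg g = d"
 shows "g # gs \<in> decs \<gamma> \<longleftrightarrow> g = butlast \<gamma> \<and> gs = arrows (last \<gamma>)"
proof -
 interpret toupie_path Q so si I Gmon W B4 r piv cf "path_prod \<gamma>" by (rule chain_universe[OF c])
 show ?thesis using decs_arrows[OF c refl nt g] .
qed

text \<open>Of all factorizations only \<open>butlast \<gamma>\<close> followed by the arrows of
  \<open>last \<gamma>\<close> can return to a single block. The sign of \<open>\<delta>T\<close>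
  cancels that of the linear part of \<open>G (butlast \<gamma>)\<close>, and \<open>H\<close> then
  contributes \<open>- (-1) ^ d\<close>.\<close>

lemma coef_G_mono:
 assumes "\<gamma> \<in> chains Q W d" "\<And>b. b \<in> tips \<Longrightarrow> \<not> subpath Q b (path_prod \<gamma>)"
 shows "coef (G \<gamma>) [Z] = (if Z = \<gamma> then (-1) ^ d else 0)"
 using assms
proof (induction d arbitrary: \<gamma> Z)
 case 0
 then show ?case using chain_length[OF 0(1)] G_0[of \<gamma>] by (auto simp: cf_mon)
next
 case (Suc d)
 note c = Suc.prems(1) and nt = Suc.prems(2)
 note l = chain_length[OF c]
 have none: "{i. i < r \<and> \<gamma> = split_chain Q (tip i)} = {}"
 proof (rule ccontr)
  assume "\<not> ?thesis"
  then obtain i where i: "i < r" "\<gamma> = split_chain Q (tip i)" by auto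
  then have "path_prod \<gamma> = tip i" using path_prod_split_chain[OF tip_B4[OF i(1)]] by simp
  moreover have "tip i \<in> tips" using i(1) by (auto simp: tips_def)
  ultimately show False using nt[of "tip i"] subpath_refl[OF chain_qpath[OF c]] by simp
 qed
 define gs0 where "gs0 = butlast \<gamma> # arrows (last \<gamma>)"
 have d0: "deg (butlast \<gamma>) = d" using l by simp
 have in0: "gs0 \<in> decs \<gamma>" using decs_prefix[OF c nt d0] by (simp add: gs0_def)
 obtain e where "butlast \<gamma> \<in> chains Q W e" using decs_letters[OF in0] by (auto simp: gs0_def)
 then have cb: "butlast \<gamma> \<in> chains Q W d" using chain_length[of "butlast \<gamma>" e] l by simp
 have pp: "path_prod \<gamma> = (fst (path_prod (butlast \<gamma>)), snd (path_prod (butlast \<gamma>)) @ concat (map snd (map path_prod (arrows (last \<gamma>)))))"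
  using in0 by (auto simp: decs_def chain_product_case_def gs0_def path_prod_def)
 have sub: "subpath Q (path_prod (butlast \<gamma>)) (path_prod \<gamma>)"
  unfolding subpath_iff using chain_qpath[OF c] by (intro conjI exI[of _ "[]"] exI) (auto simp: pp)
 have IH: "coef (G (butlast \<gamma>)) [Z'] = (if Z' = butlast \<gamma> then (-1) ^ d else 0)" for Z'
  using nt subpath_trans[OF _ sub] by (intro Suc.IH[OF cb]) blast
 have lastNT: "last \<gamma> \<in> NT" by (rule chain_NT[OF c]) (use chain_ends(1)[OF c] in simp)
 have PL: "P (mon (arrows (last \<gamma>))) = mon [[last \<gamma>]]"
 proof -
  have "nf (last \<gamma>) = Poly_Mapping.single (last \<gamma>) 1" by (rule nf_NT[OF lastNT])
  then show ?thesis using P_arrows[OF NT_qpaths[OF lastNT] NT_nonempty[OF lastNT]] by simp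
 qed
 have letters: "\<exists>e. h \<in> chains Q W e" if "gs \<in> decs \<gamma>" "h \<in> set gs" for gs h using decs_letters that by blast
 \<comment> \<open>If all later factors had degree 0, the first would have degree \<open>d\<close>
   and the factorization would be \<open>gs0\<close>.\<close>
 have zero: "coef (H (prod_list (map G gs))) [Z] = 0" if gs: "gs \<in> decs \<gamma>" "gs \<noteq> gs0" for gs
 proof -
  obtain g gs' where g: "gs = g # gs'" using gs(1) by (cases gs) (auto simp: decs_def chain_product_case_def)
  obtain e where e: "g \<in> chains Q W e" using letters[OF gs(1), of g] g by auto
  have "\<exists>h\<in>set gs'. deg h \<noteq> 0"
  proof (rule ccontr)
   assume "\<not> ?thesis"
   then have "map deg gs' = map (\<lambda>_. 0) gs'" by simp
   then have "sum_list (map deg gs') = 0" by (simp only: sum_list_0)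
   moreover have "deg g + sum_list (map deg gs') + 1 = deg \<gamma>" using decs_deg[OF gs(1)] unfolding g by simp
   ultimately have "deg g = d" unfolding l by linarith
   then show False using decs_prefix[OF c nt] gs unfolding g gs0_def by blast
  qed
  then show ?thesis using coef_H_prod[OF e, of gs' Z] letters[OF gs(1)] unfolding g by simp
 qed
 have p: "0 < deg \<gamma>" using l by simp
 have "coef (G \<gamma>) [Z] = coef (H (ahom G (\<delta>T \<gamma>))) [Z]" unfolding G_Suc[OF p] ..
 also have "\<dots> = (\<Sum>gs\<in>decs \<gamma>. (-1) ^ deg (hd gs) * coef (H (prod_list (map G gs))) [Z])"
  by (simp add: \<delta>T_def none ahom_simps H_linear lookup_sum lookup_sign_mult)
 also have "\<dots> = (\<Sum>gs\<in>{gs0}. (-1) ^ deg (hd gs) * coef (H (prod_list (map G gs))) [Z])"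
  using in0 zero finite_decs by (intro sum.mono_neutral_right) auto
 also have "\<dots> = (-1) ^ d * coef (H (prod_list (map G gs0))) [Z]" using l by (simp add: gs0_def)
 also have "coef (H (prod_list (map G gs0))) [Z] = (if Z = [] then 0
   else - ((-1) ^ d * (coef (G (butlast \<gamma>)) [butlast Z] * coef (P (mon (arrows (last \<gamma>)))) [[last Z]])))"
 proof -
  have "\<not> (\<exists>h\<in>set (arrows (last \<gamma>)). deg h \<noteq> 0)" by (auto simp: arrows_def)
  moreover have "\<exists>e. h \<in> chains Q W e" if "h \<in> set (arrows (last \<gamma>))" for h
   using letters[OF in0] that by (simp add: gs0_def)
  then have "coef (H (prod_list (map G (butlast \<gamma> # arrows (last \<gamma>))))) [Z] =
   (if (\<exists>h\<in>set (arrows (last \<gamma>)). deg h \<noteq> 0) \<or> Z = [] then 0 else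
    - ((-1) ^ d * (coef (G (butlast \<gamma>)) [butlast Z] * coef (P (mon (arrows (last \<gamma>)))) [[last Z]])))"
   by (rule coef_H_prod[OF cb])
  ultimately show ?thesis unfolding gs0_def by presburger
 qed
 also have "\<dots> = (if Z = \<gamma> then - 1 else 0)"
  using chain_ends(1)[OF c] unfolding IH PL cf_mon
  by (cases Z rule: rev_cases; cases \<gamma> rule: rev_cases) (auto simp flip: power_add)
 finally show ?case by simp
qed

text \<open>A branch of the relation minus its first arrow: for the tip this is a proper subpath of
  a tip, otherwise a subpath of a nontip.\<close>

lemma rest_NT:
 assumes i: "i < r" and \<rho>: "\<rho> i b \<noteq> 0" and b: "snd b = a # as"
 shows "(head Q a, as) \<in> NT"
proof -
 have bB: "b \<in> set B4" using \<rho>_B4[OF \<rho> i] .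
 have q: "b \<in> qpaths Q" using B4_branch[OF bB] by blast
 have rq: "(head Q a, as) \<in> qpaths Q" using q b by (simp add: qpaths_walk)
 have sub: "subpath Q (head Q a, as) b" unfolding subpath_iff using q b
  by (intro conjI exI[of _ "[a]"] exI[of _ "[]"]) auto
 have n: "as \<noteq> []" using B4_length[OF bB] b by auto
 have "(head Q a, as) \<in> nontip Q W"
 proof (cases "b = tip i")
  case True
  then have bW: "b \<in> W" using i by (auto simp: W_eq tips_def)
  have "\<not> subpath Q w (head Q a, as)" if "w \<in> W" for w
  proof
   assume s: "subpath Q w (head Q a, as)"
   then have "w = b" using W_antichain[OF that bW] subpath_trans[OF s sub] by blast
   then show False using s b by (auto simp: subpath_iff dest: arg_cong[where f = length])
  qed
  then show ?thesis using rq by (auto simp: nontip_def)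
 next
  case False
  then show ?thesis using \<rho>_nontip[OF i \<rho>] nontip_subpath[OF _ sub] by blast
 qed
 then show ?thesis using trivial_paths_iff[OF rq] n by simp
qed

text \<open>\<open>\<delta>T\<close> produces the words of arrows of the relation. \<open>H\<close>
  keeps the first arrow and multiplies the others to one letter, a nontip by \<open>rest_NT\<close>;
  this is \<open>split_chain\<close> of each branch, not only of the tip.\<close>

lemma coef_G_tip:
 assumes i: "i < r"
 shows "coef (G (split_chain Q (tip i))) [Z] = - (\<Sum>b\<in>set B4. if Z = split_chain Q b then \<rho> i b else 0)"
proof -
 let ?\<gamma> = "split_chain Q (tip i)"
 have ti: "tip i \<in> tips" using i by (auto simp: tips_def)
 have c: "?\<gamma> \<in> chains Q W 1" by (rule split_chain_chain[OF ti])
 have pp: "path_prod (split_chain Q (tip j)) = tip j" if "j < r" for j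
  by (rule path_prod_split_chain[OF tip_B4[OF that]])
 have d: "decs ?\<gamma> = {}"
  using decs_chain(2)[of _ ?\<gamma>, OF _ ti] subpath_refl[OF chain_qpath[OF c]] pp[OF i] by auto
 have one: "{j. j < r \<and> ?\<gamma> = split_chain Q (tip j)} = {i}"
 proof -
  have "j = i" if "j < r" "?\<gamma> = split_chain Q (tip j)" for j
   using tip_inj[OF that(1) i] pp[OF that(1)] pp[OF i] that(2) by simp
  then show ?thesis using i by blast
 qed
 have p: "0 < deg ?\<gamma>" using chain_length[OF c] by simp
 have "coef (G ?\<gamma>) [Z] = coef (H (ahom G (\<delta>T ?\<gamma>))) [Z]" unfolding G_Suc[OF p] ..
 also have "\<dots> = (\<Sum>b\<in>set B4. \<rho> i b * coef (H (prod_list (map G (arrows b)))) [Z])"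
  by (simp add: \<delta>T_def d one ahom_simps H_linear lookup_sum lookup_cst)
 also have "\<dots> = (\<Sum>b\<in>set B4. - (if Z = split_chain Q b then \<rho> i b else 0))"
 proof (rule sum.cong[OF refl])
  fix b assume b: "b \<in> set B4"
  show "\<rho> i b * coef (H (prod_list (map G (arrows b)))) [Z] = - (if Z = split_chain Q b then \<rho> i b else 0)"
  proof (cases "\<rho> i b = 0")
   case False
   obtain a as where as: "snd b = a # as" using B4_length[OF b] by (cases "snd b") auto
   define x where "x = (head Q a, as)"
   have x: "x \<in> NT" unfolding x_def by (rule rest_NT[OF i False as])
   have "walk (fst b) (snd b)" using B4_branch[OF b] qpaths_walk[of b] by blast
   then have arcs: "set (snd b) \<subseteq> arcs Q" by (rule walk_arcs)
   have ab: "arrows b = [arrow_path Q a] # arrows x" by (simp add: arrows_def as x_def)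
   have ca: "[arrow_path Q a] \<in> chains Q W 0" using arcs as by (intro arrow_chain) auto
   have cx: "\<exists>e. h \<in> chains Q W e" if "h \<in> set (arrows x)" for h
    using that arcs as arrow_chain by (auto simp: arrows_def x_def)
   have "nf x = Poly_Mapping.single x 1" by (rule nf_NT[OF x])
   then have P: "P (mon (arrows x)) = mon [[x]]"
    using P_arrows[OF NT_qpaths[OF x] NT_nonempty[OF x]] by simp
   have G0: "G [arrow_path Q a] = mon [[arrow_path Q a]]" by (simp add: G_0)
   have "\<not> (\<exists>h\<in>set (arrows x). deg h \<noteq> 0)" by (auto simp: arrows_def)
   moreover have "coef (H (prod_list (map G ([arrow_path Q a] # arrows x)))) [Z] =
    (if (\<exists>h\<in>set (arrows x). deg h \<noteq> 0) \<or> Z = [] then 0 else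
     - ((-1) ^ 0 * (coef (G [arrow_path Q a]) [butlast Z] * coef (P (mon (arrows x))) [[last Z]])))"
    using cx by (rule coef_H_prod[OF ca])
   ultimately have "coef (H (prod_list (map G (arrows b)))) [Z] = (if Z = [] then 0
    else - (coef (mon [[arrow_path Q a]] :: (('v, 'e) qpath list, 'k) fa) [butlast Z] *
     coef (mon [[x]] :: (('v, 'e) qpath list, 'k) fa) [[last Z]]))"
    unfolding ab P G0 by (simp del: prod_list.Cons map_map list.map)
   also have "\<dots> = - (if Z = split_chain Q b then 1 else 0)"
    by (cases Z rule: rev_cases) (auto simp: cf_mon split_chain_def as x_def)
   finally show ?thesis by simp
  qed simp
 qed
 finally show ?thesis by (simp add: sum_negf)
qed

end

section \<open>Signs\<close>

fun evw :: "('x \<Rightarrow> 'k::field) list \<Rightarrow> 'x list \<Rightarrow> 'k" where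
 "evw [] [] = 1"
| "evw (x # xs) (g # gs) = x g * evw xs gs"
| "evw _ _ = 0"

definition ev :: "('x \<Rightarrow> 'k::field) list \<Rightarrow> ('x, 'k) fa \<Rightarrow> 'k" where
 "ev xs p = (\<Sum>w\<in>keys p. lookup p w * evw xs (fwl w))"

lemma ev_lin:
 fixes xs :: "('x \<Rightarrow> 'k::field) list"
 shows "ev xs p = lookup (lin (\<lambda>w. cst (evw xs w) :: ('x, 'k) fa) p) 0"
 by (simp add: ev_def lin_def lookup_sum lookup_cst) (simp add: cst_def)

lemma ev_simps: "ev xs 0 = 0" "ev xs (p + q) = ev xs p + ev xs q" "ev xs (p - q) = ev xs p - ev xs q"
 "ev xs (- p) = - ev xs p" "ev xs (cst c * p) = c * ev xs p" "ev xs ((-1) ^ n * p) = (-1) ^ n * ev xs p"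
 "ev xs (\<Sum>i\<in>I. f i) = (\<Sum>i\<in>I. ev xs (f i))"
 by (simp_all add: ev_lin lin_simps lookup_add lookup_minus lookup_cst lookup_sign_mult lookup_sum)

lemma ev_mon [simp]: "ev xs (mon w) = evw xs w"
 by (simp add: ev_def cf_mon)

lemma evw_nonzero: "evw xs w \<noteq> 0 \<Longrightarrow> list_all2 (\<lambda>x g. x g \<noteq> 0) xs w"
 by (induction xs w rule: evw.induct) auto

lemma evw_length: "length xs \<noteq> length w \<Longrightarrow> evw xs w = 0"
 using evw_nonzero list_all2_lengthD by blast

lemma evw_append: "length u \<le> length xs \<Longrightarrow> evw xs (u @ v) = evw (take (length u) xs) u * evw (drop (length u) xs) v"
proof (induction u arbitrary: xs)
 case (Cons g u)
 then show ?case by (cases xs) (auto simp: mult.assoc)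
qed simp

lemma evw_append_sum: "evw xs (u @ v) = (\<Sum>k\<le>length xs. evw (take k xs) u * evw (drop k xs) v)"
proof (cases "length u \<le> length xs")
 case True
 have "(\<Sum>k\<le>length xs. evw (take k xs) u * evw (drop k xs) v) =
   (\<Sum>k\<in>{length u}. evw (take k xs) u * evw (drop k xs) v)"
  using True by (intro sum.mono_neutral_right) (auto simp: evw_length)
 then show ?thesis using evw_append[OF True] by simp
next
 case False
 then have "evw (take k xs) u = 0" for k by (intro evw_length) simp
 then show ?thesis using False by (simp add: evw_length)
qed

lemma ev_mult: "ev xs (p * q) = (\<Sum>k\<le>length xs. ev (take k xs) p * ev (drop k xs) q)"
proof (induction p rule: fa_induct)
 case (mon u)
 show ?case
  by (induction q rule: fa_induct)
   (simp_all add: ev_simps distrib_left cst_left[of "mon u"] sum.distrib sum_distrib_left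
    mult.left_commute evw_append_sum flip: mon_append)
qed (simp_all add: ev_simps distrib_right sum.distrib sum_distrib_left mult.assoc)

lemma ev_Cons: "ev (x # xs) (mon [g] * p) = x g * ev xs p"
 by (induction p rule: fa_induct)
  (simp_all add: ev_simps distrib_left cst_left[of "mon [g]"] flip: mon_Cons)

lemma ev_Nil: "ev [] (mon [g] * p) = 0"
 by (simp add: ev_mult)

lemma ev_nonzero: "ev xs p \<noteq> 0 \<Longrightarrow> \<exists>w. FW w \<in> keys p \<and> evw xs w \<noteq> 0"
proof (rule ccontr)
 assume e: "ev xs p \<noteq> 0" and n: "\<not> ?thesis"
 have "evw xs (fwl w) = 0" if "w \<in> keys p" for w using n that by (metis fw.collapse)
 then show False using e by (simp add: ev_def)
qed

lemma ev_scale: "(\<And>w. evw xs w = c * evw ys w) \<Longrightarrow> ev xs p = c * ev ys p"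
 by (simp add: ev_def sum_distrib_left mult.left_commute)

lemma evw_scale: "evw (xs @ (\<lambda>g. c * f g) # ys) w = c * evw (xs @ f # ys) w"
proof (induction xs arbitrary: w)
 case Nil
 then show ?case by (cases w) (auto simp: mult.assoc)
next
 case (Cons x xs)
 then show ?case by (cases w) (auto simp: mult.left_commute)
qed

lemma powi_sign: "(-1 :: 'k::field) powi m = (if even m then 1 else - 1)"
 by (simp add: power_int_minus_left)

lemma powi_mult: "(-1 :: 'k::field) powi m * (-1) powi n = (-1) powi (m + n)"
 by (simp add: powi_sign)

lemma powi_parity: "m - n = 2 * k \<Longrightarrow> (-1 :: 'k::field) powi m = (-1) powi n"
proof -
 assume "m - n = 2 * k"
 then have "even m = even n" by presburger
 then show ?thesis by (simp only: powi_sign)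
qed

text \<open>Each element is moved past the suspensions that belong to the later arguments.\<close>

primrec eps :: "int list \<Rightarrow> int" where
 "eps [] = 0"
| "eps (d # ds) = int (length ds) * d + eps ds"

lemma eps_append: "eps (ds @ es) = eps ds + int (length es) * sum_list ds + eps es"
 by (induction ds) (simp_all add: algebra_simps)

text \<open>The degree is the length of the list. The empty list is excluded because truncation
  would give it the same \<open>deg\<close> as a one-letter list.\<close>

definition supp_deg :: "int \<Rightarrow> ('y list \<Rightarrow> 'k::zero) \<Rightarrow> bool" where
 "supp_deg d x \<longleftrightarrow> (\<forall>g. x g \<noteq> 0 \<longrightarrow> g \<noteq> [] \<and> int (length g) = d)"

text \<open>
 The operation dual to \<open>\<phi>\<close>, with the signs of the iterated suspensions; \<open>l\<close> and \<open>l'\<close> are the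
 exponents of the sign by which a basis element is changed in the source and the target.
\<close>

definition tw :: "(int \<Rightarrow> int) \<Rightarrow> (int \<Rightarrow> int) \<Rightarrow> ('y list \<Rightarrow> ('z list, 'k::field) fa) \<Rightarrow>
  ('z list \<Rightarrow> 'k) list \<Rightarrow> 'y list \<Rightarrow> 'k" where
 "tw l l' \<phi> xs g = (\<Sum>w\<in>keys (\<phi> g).
   (-1) powi (eps (map (\<lambda>h. int (length h)) (fwl w)) + (\<Sum>h\<leftarrow>fwl w. l (int (length h))) + l' (int (length g)))
   * (lookup (\<phi> g) w * evw xs (fwl w)))"

lemma supp_deg_word: "list_all2 supp_deg ds xs \<Longrightarrow> evw xs w \<noteq> 0 \<Longrightarrow> [] \<notin> set w \<and> map (\<lambda>h. int (length h)) w = ds"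
proof (induction ds xs arbitrary: w rule: list_all2_induct)
 case Nil
 then show ?case by (cases w) auto
next
 case (Cons d ds x xs)
 then show ?case by (cases w) (auto simp: supp_deg_def)
qed

lemma tw_eq:
 assumes "list_all2 supp_deg ds xs"
 shows "tw l l' \<phi> xs g = (-1) powi (eps ds + (\<Sum>d\<leftarrow>ds. l d) + l' (int (length g))) * ev xs (\<phi> g)"
 unfolding tw_def ev_def sum_distrib_left
proof (intro sum.cong refl)
 fix w
 show "(-1) powi (eps (map (\<lambda>h. int (length h)) (fwl w)) + (\<Sum>h\<leftarrow>fwl w. l (int (length h))) + l' (int (length g)))
   * (lookup (\<phi> g) w * evw xs (fwl w)) =
  (-1) powi (eps ds + (\<Sum>d\<leftarrow>ds. l d) + l' (int (length g))) * (lookup (\<phi> g) w * evw xs (fwl w))"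
 proof (cases "evw xs (fwl w) = 0")
  case False
  then have "ds = map (\<lambda>h. int (length h)) (fwl w)" using supp_deg_word[OF assms] by blast
  then show ?thesis by (simp add: o_def)
 qed simp
qed

text \<open>\<open>c = 2\<close> is the case of a differential, \<open>c = 1\<close> that of a
  morphism: they give the degrees \<open>2 - n\<close> and \<open>1 - n\<close> of the dual
  operations.\<close>

definition shifts :: "int \<Rightarrow> ('y list \<Rightarrow> ('z list, 'k::field) fa) \<Rightarrow> bool" where
 "shifts c \<phi> \<longleftrightarrow> (\<forall>g w. FW w \<in> keys (\<phi> g) \<longrightarrow> [] \<notin> set w \<longrightarrow>
   g \<noteq> [] \<and> (\<Sum>h\<leftarrow>w. int (length h)) - int (length w) + c = int (length g))"

lemma supp_deg_ev:
 assumes "shifts c \<phi>" "list_all2 supp_deg ds xs" "n = int (length xs)"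
 shows "supp_deg (sum_list ds - n + c) (\<lambda>g. ev xs (\<phi> g))"
 unfolding supp_deg_def
proof (intro allI impI)
 fix g assume "ev xs (\<phi> g) \<noteq> 0"
 then obtain w where w: "FW w \<in> keys (\<phi> g)" "evw xs w \<noteq> 0" using ev_nonzero by blast
 note s = supp_deg_word[OF assms(2) w(2)]
 have "length xs = length w" using list_all2_lengthD[OF evw_nonzero[OF w(2)]] .
 then show "g \<noteq> [] \<and> int (length g) = sum_list ds - n + c"
  using assms(1) w(1) s assms(3) unfolding shifts_def by auto
qed

lemma supp_deg_tw:
 assumes "shifts c \<phi>" "list_all2 supp_deg ds xs" "n = int (length xs)"
 shows "supp_deg (sum_list ds - n + c) (tw l l' \<phi> xs)"
 using supp_deg_ev[OF assms] unfolding supp_deg_def tw_eq[OF assms(2)] by simp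

lemma tw_supp:
 assumes "shifts c \<phi>" "list_all2 supp_deg ds xs" "n = int (length xs)"
 shows "tw l l' \<phi> xs = (\<lambda>g. (-1) powi (eps ds + (\<Sum>d\<leftarrow>ds. l d) + l' (sum_list ds - n + c)) * ev xs (\<phi> g))"
proof
 fix g
 show "tw l l' \<phi> xs g = (-1) powi (eps ds + (\<Sum>d\<leftarrow>ds. l d) + l' (sum_list ds - n + c)) * ev xs (\<phi> g)"
 proof (cases "ev xs (\<phi> g) = 0")
  case False
  then have "int (length g) = sum_list ds - n + c" using supp_deg_ev[OF assms] by (simp add: supp_deg_def)
  then show ?thesis by (simp add: tw_eq[OF assms(2)])
 qed (simp add: tw_eq[OF assms(2)])
qed

section \<open>Derivations dualize to insertion of one operation into another\<close>

abbreviation splits :: "nat \<Rightarrow> (nat \<times> nat \<times> nat) set" where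
 "splits n \<equiv> {(r, u, t). r + u + t = n \<and> u \<ge> 1}"

lemma finite_splits: "finite (splits n)"
 by (rule finite_subset[of _ "{..n} \<times> {..n} \<times> {..n}"]) auto

lemma sum_splits_Suc: "(\<Sum>(r, u, t)\<in>splits (Suc n). F r u t) =
  (\<Sum>u=1..Suc n. F 0 u (Suc n - u)) + (\<Sum>(r, u, t)\<in>splits n. F (Suc r) u t)"
proof -
 let ?S = "splits (Suc n)" and ?F = "\<lambda>(r, u, t). F r u t"
 have "sum ?F ?S = sum ?F {z \<in> ?S. fst z = 0} + sum ?F {z \<in> ?S. fst z \<noteq> 0}"
  by (subst sum.union_disjoint[symmetric]) (auto intro!: sum.cong finite_subset[OF _ finite_splits[of "Suc n"]])
 also have "sum ?F {z \<in> ?S. fst z = 0} = (\<Sum>u=1..Suc n. F 0 u (Suc n - u))"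
  by (rule sum.reindex_bij_witness[where i = "\<lambda>u. (0, u, Suc n - u)" and j = "\<lambda>(r, u, t). u"]) (auto, metis diff_add_inverse)
 also have "sum ?F {z \<in> ?S. fst z \<noteq> 0} = (\<Sum>(r, u, t)\<in>splits n. F (Suc r) u t)"
  by (rule sum.reindex_bij_witness[where i = "\<lambda>(r, u, t). (Suc r, u, t)" and j = "\<lambda>(r, u, t). (r - 1, u, t)"]) auto
 finally show ?thesis .
qed

lemma splits_0: "splits 0 = {}"
 by auto

text \<open>The Leibniz sign counts the shifted degrees \<open>d - 1\<close> of the functionals to
  the left of the insertion.\<close>

lemma ev_der_word:
 assumes "list_all2 supp_deg ds xs" "\<And>g. ev [] (\<delta> g) = 0"
 shows "ev xs (derw deg \<delta> w) = (\<Sum>(r, u, t)\<in>splits (length xs). (-1 :: 'k::field) powi (sum_list (take r ds) - int r) *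
   evw (take r xs @ [\<lambda>g. ev (take u (drop r xs)) (\<delta> g)] @ drop (r + u) xs) w)"
 using assms(1)
proof (induction w arbitrary: ds xs)
 case Nil
 have "evw (take r xs @ [f] @ ys) [] = 0" for r f ys by (rule evw_length) simp
 then show ?case by (simp add: ev_simps case_prod_beta del: append.simps)
next
 case (Cons g w)
 have L: "ev xs (derw deg \<delta> (g # w)) = ev xs (\<delta> g * mon w) + (-1) ^ deg g * ev xs (mon [g] * derw deg \<delta> w)"
  by (simp add: ev_simps)
 show ?case
 proof (cases "xs = []")
  case True
  then show ?thesis unfolding L by (simp add: ev_mult ev_Nil assms(2) splits_0)
 next
  case False
  then obtain x xs' where xs: "xs = x # xs'" by (cases xs) auto
  then obtain d ds' where ds: "ds = d # ds'" "supp_deg d x" "list_all2 supp_deg ds' xs'"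
   using Cons.prems by (auto simp: list_all2_Cons2)
  let ?n = "length xs'"
  let ?F = "\<lambda>r u t. (-1 :: 'k) powi (sum_list (take r ds) - int r) *
   evw (take r xs @ [\<lambda>g. ev (take u (drop r xs)) (\<delta> g)] @ drop (r + u) xs) (g # w)"
  have 1: "ev xs (\<delta> g * mon w) = (\<Sum>u=1..Suc ?n. ?F 0 u (Suc ?n - u))"
  proof -
   have "ev xs (\<delta> g * mon w) = (\<Sum>u\<in>{..Suc ?n}. ev (take u xs) (\<delta> g) * evw (drop u xs) w)"
    by (simp add: ev_mult xs del: sum.atMost_Suc)
   also have "\<dots> = (\<Sum>u=1..Suc ?n. ev (take u xs) (\<delta> g) * evw (drop u xs) w)"
    using assms(2) by (intro sum.mono_neutral_right) (auto simp: not_le)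
   finally show ?thesis by simp
  qed
  have 2: "(-1) ^ deg g * ev xs (mon [g] * derw deg \<delta> w) = (\<Sum>(r, u, t)\<in>splits ?n. ?F (Suc r) u t)"
  proof -
   have sg: "(-1) ^ deg g * (x g * c) = (-1) powi (d - 1) * (x g * c)" for c :: 'k
   proof (cases "x g = 0")
    case False
    then have "g \<noteq> []" "d = int (length g)" using ds(2) by (auto simp: supp_deg_def)
    then have "d - 1 = int (deg g)" by (cases g) auto
    then show ?thesis by (simp only: power_int_of_nat)
   qed simp
   have "(-1) ^ deg g * ev xs (mon [g] * derw deg \<delta> w) = (-1) ^ deg g * (x g * ev xs' (derw deg \<delta> w))"
    by (simp add: xs ev_Cons)
   also have "\<dots> = (-1) powi (d - 1) * (x g * ev xs' (derw deg \<delta> w))" by (rule sg)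
   also have "\<dots> = (\<Sum>(r, u, t)\<in>splits ?n. (-1) powi (d - 1) * (x g * ((-1 :: 'k) powi (sum_list (take r ds') - int r) *
     evw (take r xs' @ [\<lambda>g. ev (take u (drop r xs')) (\<delta> g)] @ drop (r + u) xs') w)))"
    unfolding Cons.IH[OF ds(3)] by (simp add: sum_distrib_left case_prod_beta)
   also have "\<dots> = (\<Sum>(r, u, t)\<in>splits ?n. ?F (Suc r) u t)"
   proof (intro sum.cong refl)
    fix z :: "nat \<times> nat \<times> nat"
    obtain r u t where z: "z = (r, u, t)" by (cases z) auto
    have "(-1 :: 'k) powi (d - 1) * (-1) powi (sum_list (take r ds') - int r) = (-1) powi (sum_list (take (Suc r) ds) - int (Suc r))"
     unfolding powi_mult ds by (simp add: algebra_simps)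
    then show "(case z of (r, u, t) \<Rightarrow> (-1) powi (d - 1) * (x g * ((-1 :: 'k) powi (sum_list (take r ds') - int r) *
     evw (take r xs' @ [\<lambda>g. ev (take u (drop r xs')) (\<delta> g)] @ drop (r + u) xs') w))) =
     (case z of (r, u, t) \<Rightarrow> ?F (Suc r) u t)"
     unfolding z by (simp add: xs mult.assoc[symmetric] mult.commute[of "x g"])
   qed
   finally show ?thesis .
  qed
  have n: "length xs = Suc ?n" by (simp add: xs)
  show ?thesis unfolding L 1 2 n sum_splits_Suc[of ?F ?n] ..
 qed
qed

lemma ev_der:
 assumes "list_all2 supp_deg ds xs" "\<And>g. ev [] (\<delta> g) = 0"
 shows "ev xs (der deg \<delta> q) = (\<Sum>(r, u, t)\<in>splits (length xs). (-1 :: 'k::field) powi (sum_list (take r ds) - int r) *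
   ev (take r xs @ [\<lambda>g. ev (take u (drop r xs)) (\<delta> g)] @ drop (r + u) xs) q)"
proof (induction q rule: fa_induct)
 case (mon w)
 show ?case using ev_der_word[OF assms, where w = w] by simp
qed (simp_all add: der_simps ev_simps case_prod_beta distrib_left sum.distrib sum_distrib_left mult.left_commute)

text \<open>The correction \<open>l\<close> of the inserted value occurs once as output and once as
  input and cancels, so any \<open>l\<close> is compatible. What remains is that the suspension
  signs turn the Leibniz sign into the one of the A-infinity identity.\<close>

theorem tw_insert:
 assumes hom: "list_all2 supp_deg ds xs" and \<delta>: "\<And>g. ev [] (\<delta> g) = 0" "shifts 2 \<delta>"
 shows "(\<Sum>(r, u, t)\<in>splits (length xs). (-1) powi (int (r + u * t) + (2 - int u) * sum_list (take r ds)) *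
   tw l l' \<phi> (take r xs @ [tw l l \<delta> (take u (drop r xs))] @ drop (r + u) xs) g) =
  (-1 :: 'k::field) powi (eps ds + (\<Sum>d\<leftarrow>ds. l d) + l' (int (length g))) * ev xs (der deg \<delta> (\<phi> g))"
proof -
 let ?s = "eps ds + (\<Sum>d\<leftarrow>ds. l d) + l' (int (length g))"
 have "(-1) powi (int (r + u * t) + (2 - int u) * sum_list (take r ds)) *
   tw l l' \<phi> (take r xs @ [tw l l \<delta> (take u (drop r xs))] @ drop (r + u) xs) g =
  (-1) powi ?s * ((-1) powi (sum_list (take r ds) - int r) *
   ev (take r xs @ [\<lambda>g. ev (take u (drop r xs)) (\<delta> g)] @ drop (r + u) xs) (\<phi> g))"
  if rut: "r + u + t = length xs" for r u t
 proof -
  define A B C where "A = take r ds" and "B = take u (drop r ds)" and "C = drop (r + u) ds"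
  have "B @ C = drop r ds" using append_take_drop_id[of u "drop r ds"] by (simp add: B_def C_def add.commute)
  then have ds: "ds = A @ B @ C" by (simp add: A_def)
  have len: "length ds = length xs" using list_all2_lengthD[OF hom] .
  have l3: "length A = r" "length B = u" "length C = t" using rut len by (simp_all add: A_def B_def C_def)
  define e where "e = sum_list B - int u + 2"
  have hB: "list_all2 supp_deg B (take u (drop r xs))" unfolding B_def using hom by (simp add: list_all2_takeI list_all2_dropI)
  have lB: "int u = int (length (take u (drop r xs)))" using rut by simp
  have y: "supp_deg e (tw l l \<delta> (take u (drop r xs)))" unfolding e_def by (rule supp_deg_tw[OF \<delta>(2) hB lB])
  have "list_all2 supp_deg (A @ [e] @ C) (take r xs @ [tw l l \<delta> (take u (drop r xs))] @ drop (r + u) xs)"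
   unfolding A_def C_def using hom y by (intro list_all2_appendI) (simp_all add: list_all2_takeI list_all2_dropI)
  note 1 = tw_eq[OF this]
  have 2: "ev (take r xs @ [tw l l \<delta> (take u (drop r xs))] @ drop (r + u) xs) p =
   (-1) powi (eps B + (\<Sum>d\<leftarrow>B. l d) + l e) * ev (take r xs @ [\<lambda>g. ev (take u (drop r xs)) (\<delta> g)] @ drop (r + u) xs) p" for p
   unfolding tw_supp[OF \<delta>(2) hB lB] e_def[symmetric] by (rule ev_scale) (simp add: evw_scale)
  \<comment> \<open>The exponent of the identity together with those of the two operations, compared
    with the common exponent and the Leibniz exponent; the difference is displayed as an even
    number.\<close>
  have "int (r + u * t) + (2 - int u) * sum_list A + (eps (A @ [e] @ C) + (\<Sum>d\<leftarrow>A @ [e] @ C. l d) + l' (int (length g))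
    + (eps B + (\<Sum>d\<leftarrow>B. l d) + l e)) - (?s + (sum_list A - int r)) =
   2 * (int r + sum_list A - int u * sum_list A + int t + l e)"
   unfolding ds eps_append e_def by (simp add: l3 algebra_simps)
  note par = powi_parity[OF this]
  show ?thesis unfolding 1 2 mult.assoc[symmetric] powi_mult A_def[symmetric] par ..
 qed
 then have "(\<Sum>(r, u, t)\<in>splits (length xs). (-1) powi (int (r + u * t) + (2 - int u) * sum_list (take r ds)) *
   tw l l' \<phi> (take r xs @ [tw l l \<delta> (take u (drop r xs))] @ drop (r + u) xs) g) =
  (\<Sum>(r, u, t)\<in>splits (length xs). (-1) powi ?s * ((-1) powi (sum_list (take r ds) - int r) *
   ev (take r xs @ [\<lambda>g. ev (take u (drop r xs)) (\<delta> g)] @ drop (r + u) xs) (\<phi> g)))"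
  by (intro sum.cong) auto
 also have "\<dots> = (-1) powi ?s * ev xs (der deg \<delta> (\<phi> g))"
  unfolding ev_der[OF hom \<delta>(1), where q = "\<phi> g"] by (simp add: sum_distrib_left case_prod_beta)
 finally show ?thesis .
qed

section \<open>Algebra homomorphisms dualize to sums over compositions\<close>

primrec segs :: "nat list \<Rightarrow> 'a list \<Rightarrow> 'a list list" where
 "segs [] xs = []"
| "segs (j # js) xs = take j xs # segs js (drop j xs)"

lemma map_segs: "map (\<lambda>l. f (js ! l) (take (js ! l) (drop (sum_list (take l js)) xs))) [0..<length js] =
  map2 f js (segs js xs)"
proof (induction js arbitrary: xs)
 case (Cons j js)
 have "map (\<lambda>l. f ((j # js) ! l) (take ((j # js) ! l) (drop (sum_list (take l (j # js))) xs))) [0..<length (j # js)] =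
  f j (take j xs) # map (\<lambda>l. f (js ! l) (take (js ! l) (drop (sum_list (take l js)) (drop j xs)))) [0..<length js]"
  by (simp add: map_upt_Suc add.commute del: upt_Suc)
 then show ?case unfolding Cons by simp
qed simp

lemma length_segs: "length (segs js xs) = length js"
 by (induction js arbitrary: xs) auto

lemma concat_segs: "sum_list js = length xs \<Longrightarrow> concat (segs js xs) = xs"
 by (induction js arbitrary: xs) auto

lemma segs_list_all2: "list_all2 R ds xs \<Longrightarrow> list_all2 (list_all2 R) (segs js ds) (segs js xs)"
 by (induction js arbitrary: ds xs) (auto simp: list_all2_takeI list_all2_dropI)

lemma compositions_0: "compositions 0 = {[]}"
proof (intro equalityI subsetI)
 fix js assume "js \<in> compositions 0"
 then show "js \<in> {[]}" by (cases js) (auto simp: compositions_def)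
qed (auto simp: compositions_def)

lemma compositions_Suc: "compositions (Suc n) = (\<Union>j\<in>{1..Suc n}. (#) j ` compositions (Suc n - j))"
proof (intro equalityI subsetI)
 fix js assume js: "js \<in> compositions (Suc n)"
 then obtain j js' where "js = j # js'" by (cases js) (auto simp: compositions_def)
 then show "js \<in> (\<Union>j\<in>{1..Suc n}. (#) j ` compositions (Suc n - j))"
  using js by (auto simp: compositions_def intro!: bexI[of _ j] imageI)
qed (auto simp: compositions_def)

lemma finite_compositions: "finite (compositions n)"
proof (induction n rule: less_induct)
 case (less n)
 then show ?case by (cases n) (auto simp: compositions_0 compositions_Suc)
qed

lemma sum_compositions_Suc:
 "(\<Sum>js\<in>compositions (Suc n). F js) = (\<Sum>j=1..Suc n. \<Sum>js\<in>compositions (Suc n - j). F (j # js))"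
 unfolding compositions_Suc
 by (subst sum.UNION_disjoint) (auto simp: finite_compositions sum.reindex inj_on_def)

lemma ev_ahom_word:
 fixes \<phi> :: "'x \<Rightarrow> ('y, 'k::field) fa"
 assumes "\<And>g. ev [] (\<phi> g) = 0"
 shows "ev xs (prod_list (map \<phi> w)) = (\<Sum>js\<in>compositions (length xs). evw (map (\<lambda>s g. ev s (\<phi> g)) (segs js xs)) w)"
proof (induction w arbitrary: xs)
 case Nil
 show ?case
 proof (cases "length xs")
  case 0
  then show ?thesis using ev_mon[of xs "[]"] by (simp add: compositions_0)
 next
  case (Suc n)
  then have "ev xs (1 :: ('y, 'k) fa) = 0" using ev_mon[of xs "[]"] evw_length[of xs "[]"] by simp
  then show ?thesis unfolding Suc sum_compositions_Suc by simp
 qed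
next
 case (Cons g w)
 show ?case
 proof (cases "length xs")
  case 0
  then show ?thesis using assms by (simp add: compositions_0 ev_mult)
 next
  case (Suc n)
  have "ev xs (prod_list (map \<phi> (g # w))) = (\<Sum>j\<le>Suc n. ev (take j xs) (\<phi> g) * ev (drop j xs) (prod_list (map \<phi> w)))"
   by (simp add: ev_mult Suc del: sum.atMost_Suc)
  also have "\<dots> = (\<Sum>j=1..Suc n. ev (take j xs) (\<phi> g) * ev (drop j xs) (prod_list (map \<phi> w)))"
   using assms by (intro sum.mono_neutral_right) (auto simp: not_le)
  also have "\<dots> = (\<Sum>j=1..Suc n. \<Sum>js\<in>compositions (Suc n - j). ev (take j xs) (\<phi> g) *
    evw (map (\<lambda>s g. ev s (\<phi> g)) (segs js (drop j xs))) w)"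
   unfolding Cons.IH by (simp add: Suc sum_distrib_left)
  finally show ?thesis unfolding Suc sum_compositions_Suc by simp
 qed
qed

lemma ev_ahom:
 fixes \<phi> :: "'x \<Rightarrow> ('y, 'k::field) fa"
 assumes "\<And>g. ev [] (\<phi> g) = 0"
 shows "ev xs (ahom \<phi> q) = (\<Sum>js\<in>compositions (length xs). ev (map (\<lambda>s g. ev s (\<phi> g)) (segs js xs)) q)"
 by (induction q rule: fa_induct)
  (simp_all add: ahom_simps ev_simps sum.distrib sum_distrib_left ev_ahom_word[OF assms])

lemma evw_tw_list:
 assumes "shifts c \<phi>"
 shows "list_all2 (list_all2 supp_deg) dss xss \<Longrightarrow> evw (map (tw l l' \<phi>) xss) w =
  (-1) powi (\<Sum>s\<leftarrow>dss. eps s + (\<Sum>d\<leftarrow>s. l d) + l' (sum_list s - int (length s) + c)) *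
   evw (map (\<lambda>s g. ev s (\<phi> g)) xss) w"
proof (induction dss xss arbitrary: w rule: list_all2_induct)
 case (Cons ds dss xs xss)
 have n: "int (length ds) = int (length xs)" using list_all2_lengthD[OF Cons(1)] by simp
 show ?case
 proof (cases w)
  case (Cons g w')
  show ?thesis unfolding Cons list.map evw.simps tw_supp[OF assms Cons.hyps(1) n] Cons.IH
   by (simp add: powi_mult[symmetric] mult_ac)
 qed simp
qed simp

text \<open>\<open>eps\<close> of the whole list is the sum over the segments plus cross terms.
  Modulo 2 these are made up by the exponents in the definition of \<open>ainf_morphism\<close> and
  by \<open>eps\<close> of the degrees of the segment values. The induction splits off the first
  segment.\<close>

lemma composition_exponent:
 assumes "sum_list js = length ds" "\<forall>j\<in>set js. j \<ge> 1"
 shows "\<exists>k. int (\<Sum>l<length js. (length js - 1 - l) * (js ! l - 1)) +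
   (\<Sum>l<length js. (1 - int (js ! l)) * sum_list (take (sum_list (take l js)) ds)) +
   eps (map (\<lambda>s. sum_list s - int (length s) + 1) (segs js ds)) + (\<Sum>s\<leftarrow>segs js ds. eps s) = eps ds + 2 * k"
 using assms
proof (induction js arbitrary: ds)
 case (Cons j js)
 let ?D = "drop j ds" and ?T = "sum_list (take j ds)"
 have j: "j \<ge> 1" "j \<le> length ds" and sj: "sum_list js = length ?D" using Cons.prems by auto
 obtain k where k: "int (\<Sum>l<length js. (length js - 1 - l) * (js ! l - 1)) +
   (\<Sum>l<length js. (1 - int (js ! l)) * sum_list (take (sum_list (take l js)) ?D)) +
   eps (map (\<lambda>s. sum_list s - int (length s) + 1) (segs js ?D)) + (\<Sum>s\<leftarrow>segs js ?D. eps s) = eps ?D + 2 * k"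
  using Cons.IH[OF sj] Cons.prems by auto
 have 1: "(\<Sum>l<length (j # js). (length (j # js) - 1 - l) * ((j # js) ! l - 1)) =
   length js * (j - 1) + (\<Sum>l<length js. (length js - 1 - l) * (js ! l - 1))"
  by (simp add: sum.lessThan_Suc_shift diff_diff_left del: sum.lessThan_Suc)
 have "(\<Sum>l<length (j # js). (1 - int ((j # js) ! l)) * sum_list (take (sum_list (take l (j # js))) ds)) =
   (\<Sum>l<length js. (1 - int (js ! l)) * sum_list (take (j + sum_list (take l js)) ds))"
  by (simp add: sum.lessThan_Suc_shift del: sum.lessThan_Suc)
 also have "\<dots> = (\<Sum>l<length js. (1 - int (js ! l)) * ?T + (1 - int (js ! l)) * sum_list (take (sum_list (take l js)) ?D))"
  by (simp add: take_add distrib_left)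
 also have "\<dots> = (\<Sum>l<length js. 1 - int (js ! l)) * ?T + (\<Sum>l<length js. (1 - int (js ! l)) * sum_list (take (sum_list (take l js)) ?D))"
  by (simp add: sum.distrib sum_distrib_right)
 also have "(\<Sum>l<length js. 1 - int (js ! l)) = int (length js) - int (length ?D)"
  unfolding sum_subtractf sj[symmetric] by (simp add: sum_list_sum_nth atLeast0LessThan)
 finally have 2: "(\<Sum>l<length (j # js). (1 - int ((j # js) ! l)) * sum_list (take (sum_list (take l (j # js))) ds)) =
   (int (length js) - int (length ?D)) * ?T + (\<Sum>l<length js. (1 - int (js ! l)) * sum_list (take (sum_list (take l js)) ?D))" .
 have 3: "eps ds = eps (take j ds) + int (length ?D) * ?T + eps ?D"
  using eps_append[of "take j ds" ?D] by simp
 have 4: "eps (map (\<lambda>s. sum_list s - int (length s) + 1) (segs (j # js) ds)) =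
   int (length js) * (?T - int j + 1) + eps (map (\<lambda>s. sum_list s - int (length s) + 1) (segs js ?D))"
  using j(2) by (simp add: length_segs min_absorb2)
 have 5: "int (length js * (j - 1)) = int (length js) * (int j - 1)" using j(1) by (simp add: of_nat_diff)
 have "int (\<Sum>l<length (j # js). (length (j # js) - 1 - l) * ((j # js) ! l - 1)) +
   (\<Sum>l<length (j # js). (1 - int ((j # js) ! l)) * sum_list (take (sum_list (take l (j # js))) ds)) +
   eps (map (\<lambda>s. sum_list s - int (length s) + 1) (segs (j # js) ds)) + (\<Sum>s\<leftarrow>segs (j # js) ds. eps s) =
  eps ds + 2 * (k + (int (length js) - int (length ?D)) * ?T)"
  unfolding 1 2 3 4 of_nat_add 5 using k by (simp add: algebra_simps)
 then show ?case by blast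
qed simp

theorem tw_compositions:
 fixes \<phi> :: "'y list \<Rightarrow> ('z list, 'k::field) fa" and \<delta> :: "'x list \<Rightarrow> ('y list, 'k) fa"
 assumes hom: "list_all2 supp_deg ds xs" and \<phi>: "\<And>g. ev [] (\<phi> g) = 0" "shifts 1 \<phi>"
 shows "(\<Sum>js\<in>compositions (length xs).
   (-1) powi (int (\<Sum>l<length js. (length js - 1 - l) * (js ! l - 1)) +
     (\<Sum>l<length js. (1 - int (js ! l)) * sum_list (take (sum_list (take l js)) ds))) *
   tw l' l' \<delta> (map (\<lambda>l'a. tw l l' \<phi> (take (js ! l'a) (drop (sum_list (take l'a js)) xs))) [0..<length js]) g) =
  (-1) powi (eps ds + (\<Sum>d\<leftarrow>ds. l d) + l' (int (length g))) * ev xs (ahom \<phi> (\<delta> g))"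
 unfolding ev_ahom[OF \<phi>(1)] sum_distrib_left
proof (rule sum.cong[OF refl])
 fix js assume "js \<in> compositions (length xs)"
 then have sjx: "sum_list js = length xs" and pos: "\<forall>j\<in>set js. j \<ge> 1" by (auto simp: compositions_def)
 have sj: "sum_list js = length ds" using sjx list_all2_lengthD[OF hom] by simp
 let ?e = "\<lambda>s. sum_list s - int (length s) + 1"
 let ?X = "int (\<Sum>l<length js. (length js - 1 - l) * (js ! l - 1)) +
     (\<Sum>l<length js. (1 - int (js ! l)) * sum_list (take (sum_list (take l js)) ds))"
 have m: "map (\<lambda>l'a. tw l l' \<phi> (take (js ! l'a) (drop (sum_list (take l'a js)) xs))) [0..<length js] =
   map (tw l l' \<phi>) (segs js xs)"
  unfolding map_segs[of "\<lambda>_. tw l l' \<phi>" js xs] by (rule nth_equalityI) (simp_all add: length_segs)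
 note S = segs_list_all2[OF hom, of js]
 have h: "list_all2 supp_deg (map ?e (segs js ds)) (map (tw l l' \<phi>) (segs js xs))"
 proof -
  have "list_all2 supp_deg (map ?e dss) (map (tw l l' \<phi>) xss)" if "list_all2 (list_all2 supp_deg) dss xss" for dss xss
   using that
  proof (induction rule: list_all2_induct)
   case (Cons d dss x xss)
   have "int (length d) = int (length x)" using list_all2_lengthD[OF Cons(1)] by simp
   from supp_deg_tw[OF \<phi>(2) Cons(1) this] show ?case using Cons(3) by simp
  qed simp
  from this[OF S] show ?thesis .
 qed
 have E: "ev (map (tw l l' \<phi>) (segs js xs)) p = (-1) powi (\<Sum>s\<leftarrow>segs js ds. eps s + (\<Sum>d\<leftarrow>s. l d) + l' (?e s)) *
   ev (map (\<lambda>s g. ev s (\<phi> g)) (segs js xs)) p" for p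
  by (rule ev_scale) (rule evw_tw_list[OF \<phi>(2) S])
 obtain k where k: "?X + eps (map ?e (segs js ds)) + (\<Sum>s\<leftarrow>segs js ds. eps s) = eps ds + 2 * k"
  using composition_exponent[OF sj pos] by (rule exE)
 have sl: "(\<Sum>s\<leftarrow>dss. \<Sum>d\<leftarrow>s. l d) = (\<Sum>d\<leftarrow>concat dss. l d)" for dss by (induction dss) auto
 have "(\<Sum>s\<leftarrow>segs js ds. eps s + (\<Sum>d\<leftarrow>s. l d) + l' (?e s)) =
  (\<Sum>s\<leftarrow>segs js ds. eps s) + (\<Sum>d\<leftarrow>ds. l d) + (\<Sum>s\<leftarrow>segs js ds. l' (?e s))"
  unfolding sum_list_addf sl concat_segs[OF sj] ..
 then have "?X + (eps (map ?e (segs js ds)) + (\<Sum>d\<leftarrow>map ?e (segs js ds). l' d) + l' (int (length g)) +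
   (\<Sum>s\<leftarrow>segs js ds. eps s + (\<Sum>d\<leftarrow>s. l d) + l' (?e s))) - (eps ds + (\<Sum>d\<leftarrow>ds. l d) + l' (int (length g))) =
  2 * (k + (\<Sum>s\<leftarrow>segs js ds. l' (?e s)))"
  using k by (simp add: o_def)
 note par = powi_parity[OF this]
 show "(-1) powi ?X * tw l' l' \<delta> (map (\<lambda>l'a. tw l l' \<phi> (take (js ! l'a) (drop (sum_list (take l'a js)) xs))) [0..<length js]) g =
  (-1) powi (eps ds + (\<Sum>d\<leftarrow>ds. l d) + l' (int (length g))) * ev (map (\<lambda>s g. ev s (\<phi> g)) (segs js xs)) (\<delta> g)"
  unfolding m tw_eq[OF h] E mult.assoc[symmetric] powi_mult par ..
qed

section \<open>The A-infinity structure and the morphism\<close>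

lemma sum_fun_apply: "(\<Sum>i\<in>A. f i) x = (\<Sum>i\<in>A. f i x)" for f :: "'i \<Rightarrow> 'b \<Rightarrow> 'k::comm_monoid_add"
 by (induction A rule: infinite_finite_induct) simp_all

lemma vector_space_fscale: "vector_space (fscale :: 'k::field \<Rightarrow> ('b \<Rightarrow> 'k) \<Rightarrow> 'b \<Rightarrow> 'k)"
 by unfold_locales (auto simp: fscale_def algebra_simps fun_eq_iff)

lemma supp_deg_dual:
 assumes "\<And>n y. 1 \<le> n \<Longrightarrow> y \<in> X n \<Longrightarrow> length y = n" "x \<in> dual_space X d"
 shows "supp_deg d x"
 unfolding supp_deg_def
proof (intro allI impI)
 fix g assume g: "x g \<noteq> 0"
 have d: "1 \<le> d" using assms(2) g by (auto simp: dual_space_def split: if_splits)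
 then have "g \<in> X (nat d)" using assms(2) g by (auto simp: dual_space_def)
 then have "length g = nat d" using assms(1)[of "nat d" g] d by simp
 then show "g \<noteq> [] \<and> int (length g) = d" using d by auto
qed

lemma dual_spaceI:
 assumes "supp_deg d x" "\<And>g. x g \<noteq> 0 \<Longrightarrow> g \<in> X (length g)"
 shows "x \<in> dual_space X d"
proof (cases "1 \<le> d")
 case True
 have "g \<in> X (nat d)" if "x g \<noteq> 0" for g
  using assms(2)[OF that] assms(1) that by (auto simp: supp_deg_def)
 then show ?thesis using True by (simp add: dual_space_def)
next
 case False
 have "x g = 0" for g
 proof (rule ccontr)
  assume "x g \<noteq> 0"
  then have "g \<noteq> []" "int (length g) = d" using assms(1) by (auto simp: supp_deg_def)
  then show False using False by (cases g) auto
 qed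
 then show ?thesis using False by (auto simp: dual_space_def)
qed

lemma homogeneous_supp:
 assumes "\<And>n y. 1 \<le> n \<Longrightarrow> y \<in> X n \<Longrightarrow> length y = n" "homogeneous (dual_space X) ds xs"
 shows "list_all2 supp_deg ds xs"
 using assms(2) unfolding homogeneous_def by (rule list_all2_mono) (rule supp_deg_dual[OF assms(1)])

lemma graded_space_dual:
 assumes X: "\<And>n y. 1 \<le> n \<Longrightarrow> y \<in> X n \<Longrightarrow> length y = n"
 shows "graded_space (fscale :: 'k::field \<Rightarrow> _) (dual_space X)"
proof -
 interpret vector_space "fscale :: 'k \<Rightarrow> ('a list \<Rightarrow> 'k) \<Rightarrow> 'a list \<Rightarrow> 'k" by (rule vector_space_fscale)
 have "subspace (dual_space X d :: ('a list \<Rightarrow> 'k) set)" for d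
 proof (rule subspaceI)
  fix x y :: "'a list \<Rightarrow> 'k" assume xy: "x \<in> dual_space X d" "y \<in> dual_space X d"
  have "x g \<noteq> 0 \<or> y g \<noteq> 0" if "(x + y) g \<noteq> 0" for g using that by auto
  then show "x + y \<in> dual_space X d" using xy by (auto simp: dual_space_def fun_eq_iff split: if_splits)
 qed (auto simp: dual_space_def fscale_def fun_eq_iff)
 moreover have "x d = 0" if h: "finite D" "\<forall>d\<in>D. x d \<in> dual_space X d" "(\<Sum>d\<in>D. x d) = 0" "d \<in> D"
  for D d and x :: "int \<Rightarrow> 'a list \<Rightarrow> 'k"
 proof (rule ext, rule ccontr)
  fix g assume g: "x d g \<noteq> 0 g"
  have sd: "supp_deg d' (x d')" if "d' \<in> D" for d' using supp_deg_dual[OF X] h(2) that by blast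
  have "x d' g = 0" if "d' \<in> D - {d}" for d'
  proof (rule ccontr)
   assume "x d' g \<noteq> 0"
   then have "int (length g) = d'" using sd[of d'] that by (simp add: supp_deg_def)
   moreover have "int (length g) = d" using sd[OF h(4)] g by (simp add: supp_deg_def)
   ultimately show False using that by simp
  qed
  then have "(\<Sum>d\<in>D. x d g) = x d g" using h(1,4) by (simp add: sum.remove)
  moreover have "(\<Sum>d\<in>D. x d g) = 0" using h(3) sum_fun_apply[of x D g] by simp
  ultimately show False using g by simp
 qed
 ultimately show ?thesis unfolding graded_space_def using vector_space_axioms by blast
qed

lemma evw_update_add: "i < length xs \<Longrightarrow> evw (xs[i := f + g]) w = evw (xs[i := f]) w + evw (xs[i := g]) w"
proof (induction xs arbitrary: i w)
 case (Cons x xs)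
 then show ?case by (cases w; cases i) (auto simp: distrib_left distrib_right)
qed simp

lemma evw_update_scale: "i < length xs \<Longrightarrow> evw (xs[i := fscale c f]) w = c * evw (xs[i := f]) w"
proof (induction xs arbitrary: i w)
 case (Cons x xs)
 then show ?case by (cases w; cases i) (auto simp: fscale_def mult_ac)
qed simp

lemma tw_update:
 assumes "i < length xs"
 shows "tw l l' \<phi> (xs[i := xs ! i + y]) = tw l l' \<phi> xs + tw l l' \<phi> (xs[i := y])"
  "tw l l' \<phi> (xs[i := fscale c (xs ! i)]) = fscale c (tw l l' \<phi> xs)"
proof -
 show "tw l l' \<phi> (xs[i := xs ! i + y]) = tw l l' \<phi> xs + tw l l' \<phi> (xs[i := y])"
  by (rule ext) (simp add: tw_def evw_update_add[OF assms] distrib_left sum.distrib)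
 show "tw l l' \<phi> (xs[i := fscale c (xs ! i)]) = fscale c (tw l l' \<phi> xs)"
  by (rule ext) (simp add: tw_def evw_update_scale[OF assms] fscale_def[of c "tw l l' \<phi> xs"] sum_distrib_left mult.left_commute)
qed

lemma tw_nonzero: "tw l l' \<phi> xs g \<noteq> 0 \<Longrightarrow> \<phi> g \<noteq> 0"
 by (auto simp: tw_def)

lemma tw_multilinear:
 fixes \<phi> :: "'y list \<Rightarrow> ('z list, 'k::field) fa"
 assumes X: "\<And>n y. 1 \<le> n \<Longrightarrow> y \<in> X n \<Longrightarrow> length y = n" and \<phi>: "shifts c \<phi>"
  and Y: "\<And>g. \<phi> g \<noteq> 0 \<Longrightarrow> g \<in> Y (length g)"
 shows "graded_multilinear fscale (dual_space X) fscale (dual_space Y) n (c - int n) (tw l l' \<phi>)"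
 unfolding graded_multilinear_def
proof (intro allI impI conjI ballI)
 fix ds and xs :: "('z list \<Rightarrow> 'k) list"
 assume n: "length xs = n" and h: "homogeneous (dual_space X) ds xs"
 note s = homogeneous_supp[OF X h]
 have "supp_deg (sum_list ds + (c - int n)) (tw l l' \<phi> xs)"
  using supp_deg_tw[OF \<phi> s, of "int n"] n by (simp add: algebra_simps)
 then show "tw l l' \<phi> xs \<in> dual_space Y (sum_list ds + (c - int n))"
  by (rule dual_spaceI) (auto intro: Y dest: tw_nonzero)
qed (auto simp: tw_update)

lemma sum_splits_apply: "(\<Sum>(r, u, t)\<in>A. fscale (a r u t) (F r u t)) g = (\<Sum>(r, u, t)\<in>A. a r u t * F r u t g)"
 by (simp add: sum_fun_apply case_prod_beta fscale_def)

text \<open>The sum in the A-infinity identity is, up to sign, the evaluation of the square of the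
  derivation.\<close>

lemma tw_ainf:
 fixes \<delta> :: "'z list \<Rightarrow> ('z list, 'k::field) fa"
 assumes X: "\<And>n y. 1 \<le> n \<Longrightarrow> y \<in> X n \<Longrightarrow> length y = n"
  and \<delta>: "\<And>g. ev [] (\<delta> g) = 0" "shifts 2 \<delta>" "\<And>g. der deg \<delta> (\<delta> g) = 0" "\<And>g. \<delta> g \<noteq> 0 \<Longrightarrow> g \<in> X (length g)"
 shows "ainf_algebra fscale (dual_space X) (\<lambda>n. tw l l \<delta>)"
 unfolding ainf_algebra_def
proof (intro conjI allI impI)
 show "graded_space (fscale :: 'k \<Rightarrow> _) (dual_space X)" by (rule graded_space_dual[OF X])
 show "graded_multilinear fscale (dual_space X) fscale (dual_space X) n (2 - int n) (tw l l \<delta>)" for n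
  by (rule tw_multilinear[OF X \<delta>(2,4)])
 fix n ds and xs :: "('z list \<Rightarrow> 'k) list"
 assume n: "length xs = n" and h: "homogeneous (dual_space X) ds xs"
 note s = homogeneous_supp[OF X h]
 show "(\<Sum>(r, u, t)\<in>splits n. fscale ((-1) powi (int (r + u * t) + (2 - int u) * sum_list (take r ds)))
   (tw l l \<delta> (take r xs @ [tw l l \<delta> (take u (drop r xs))] @ drop (r + u) xs))) = 0"
 proof
  fix g
  show "(\<Sum>(r, u, t)\<in>splits n. fscale ((-1) powi (int (r + u * t) + (2 - int u) * sum_list (take r ds)))
   (tw l l \<delta> (take r xs @ [tw l l \<delta> (take u (drop r xs))] @ drop (r + u) xs))) g = 0 g"
   using tw_insert[OF s \<delta>(1,2), where l = l and l' = l and \<phi> = \<delta> and g = g]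
   unfolding sum_splits_apply n \<delta>(3) by (simp add: ev_simps)
 qed
qed

text \<open>Duality reverses the direction: \<open>\<phi>\<close> goes from the generators for the
  target to words for the source. The operations \<open>m\<close> need only agree with dual ones on
  homogeneous arguments, as \<open>bar_dual_ops\<close> has its own formulas.\<close>

lemma tw_morphism:
 fixes \<phi> :: "'y list \<Rightarrow> ('z list, 'k::field) fa"
 assumes X: "\<And>n y. 1 \<le> n \<Longrightarrow> y \<in> X n \<Longrightarrow> length y = n"
  and m: "\<And>ds xs. xs \<noteq> [] \<Longrightarrow> homogeneous (dual_space X) ds xs \<Longrightarrow> m (length xs) xs = tw l l \<epsilon> xs"
  and \<epsilon>: "\<And>g. ev [] (\<epsilon> g) = 0" "shifts 2 \<epsilon>"
  and \<phi>: "\<And>g. ev [] (\<phi> g) = 0" "shifts 1 \<phi>" "\<And>g. \<phi> g \<noteq> 0 \<Longrightarrow> g \<in> Y (length g)"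
  and comm: "\<And>g. der deg \<epsilon> (\<phi> g) = ahom \<phi> (\<delta> g)"
 shows "ainf_morphism fscale (dual_space X) m fscale (dual_space Y) (\<lambda>n. tw l' l' \<delta>) (\<lambda>n. tw l l' \<phi>)"
 unfolding ainf_morphism_def
proof (intro conjI allI impI)
 show "graded_multilinear fscale (dual_space X) fscale (dual_space Y) n (1 - int n) (tw l l' \<phi>)" for n
  by (rule tw_multilinear[OF X \<phi>(2,3)])
 fix n ds and xs :: "('z list \<Rightarrow> 'k) list"
 assume n: "length xs = n" and h: "homogeneous (dual_space X) ds xs"
 note s = homogeneous_supp[OF X h]
 have m': "m u (take u (drop r xs)) = tw l l \<epsilon> (take u (drop r xs))" if "r + u + t = n" "u \<ge> 1" for r u t
 proof -
  have a: "homogeneous (dual_space X) (take u (drop r ds)) (take u (drop r xs))"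
   using h unfolding homogeneous_def by (intro list_all2_takeI list_all2_dropI)
  have b: "length (take u (drop r xs)) = u" and c: "take u (drop r xs) \<noteq> []" using that n by auto
  show ?thesis using m[OF c a] unfolding b .
 qed
 show "(\<Sum>(r, u, t)\<in>splits n. fscale ((-1) powi (int (r + u * t) + (2 - int u) * sum_list (take r ds)))
   (tw l l' \<phi> (take r xs @ [m u (take u (drop r xs))] @ drop (r + u) xs))) =
  (\<Sum>js\<in>compositions n. let q = length js; start = \<lambda>l. sum_list (take l js) in
   fscale ((-1) powi (int (\<Sum>l<q. (q - 1 - l) * (js ! l - 1)) + (\<Sum>l<q. (1 - int (js ! l)) * sum_list (take (start l) ds))))
    (tw l' l' \<delta> (map (\<lambda>k. tw l l' \<phi> (take (js ! k) (drop (start k) xs))) [0..<q])))" (is "?L = ?R")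
 proof
  fix g
  have "?L g = (\<Sum>(r, u, t)\<in>splits n. (-1) powi (int (r + u * t) + (2 - int u) * sum_list (take r ds)) *
    tw l l' \<phi> (take r xs @ [m u (take u (drop r xs))] @ drop (r + u) xs) g)"
   by (rule sum_splits_apply)
  also have "\<dots> = (\<Sum>(r, u, t)\<in>splits (length xs). (-1) powi (int (r + u * t) + (2 - int u) * sum_list (take r ds)) *
    tw l l' \<phi> (take r xs @ [tw l l \<epsilon> (take u (drop r xs))] @ drop (r + u) xs) g)"
   unfolding n by (rule sum.cong[OF refl]) (auto simp: m')
  also have "\<dots> = (-1) powi (eps ds + (\<Sum>d\<leftarrow>ds. l d) + l' (int (length g))) * ev xs (ahom \<phi> (\<delta> g))"
   using tw_insert[OF s \<epsilon>, where l = l and l' = l' and \<phi> = \<phi> and g = g] unfolding comm .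
  also have "\<dots> = (\<Sum>js\<in>compositions n.
   (-1) powi (int (\<Sum>l<length js. (length js - 1 - l) * (js ! l - 1)) +
     (\<Sum>l<length js. (1 - int (js ! l)) * sum_list (take (sum_list (take l js)) ds))) *
   tw l' l' \<delta> (map (\<lambda>l'a. tw l l' \<phi> (take (js ! l'a) (drop (sum_list (take l'a js)) xs))) [0..<length js]) g)"
   using tw_compositions[OF s \<phi>(1,2), of l' \<delta> l g] unfolding n by (rule sym)
  also have "\<dots> = ?R g" unfolding Let_def sum_fun_apply by (simp add: fscale_def)
  finally show "?L g = ?R g" .
 qed
qed

lemma lowers_shifts: "lowers deg \<delta> \<Longrightarrow> shifts 2 \<delta>"
 unfolding shifts_def
proof (intro allI impI)
 fix g w assume l: "lowers deg \<delta>" and w: "FW w \<in> keys (\<delta> g)" and n: "[] \<notin> set w"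
 have "(\<Sum>h\<leftarrow>w. int (length h)) - int (length w) = int (sum_list (map deg w))"
  using n
 proof (induction w)
  case (Cons h w)
  then show ?case by (cases h) auto
 qed simp
 moreover have "sum_list (map deg w) + 1 = deg g" using l w unfolding lowers_def by blast
 ultimately show "g \<noteq> [] \<and> (\<Sum>h\<leftarrow>w. int (length h)) - int (length w) + 2 = int (length g)"
  by (cases g) auto
qed

lemma derw_cong: "(\<And>x. x \<in> set w \<Longrightarrow> \<delta> x = \<delta>' x) \<Longrightarrow> derw p \<delta> w = derw p \<delta>' w"
proof (induction w)
 case (Cons x w)
 have "\<delta> x = \<delta>' x" "derw p \<delta> w = derw p \<delta>' w" using Cons.prems by (auto intro: Cons.IH)
 then show ?case by simp
qed simp

lemma ev_Nil_zero:
 assumes n: "\<And>w. FW w \<in> keys p \<Longrightarrow> w \<noteq> []" shows "ev [] p = 0"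
 unfolding ev_def
proof (intro sum.neutral ballI)
 fix v assume "v \<in> keys p"
 then have "fwl v \<noteq> []" by (intro n) simp
 then show "lookup p v * evw [] (fwl v) = 0" by (cases "fwl v") simp_all
qed

context bar_words
begin

text \<open>Appending a letter, \<open>\<delta>B_snoc\<close> creates three terms whose derivatives
  cancel by \<open>D_cx\<close> and \<open>D_mx\<close>.\<close>

theorem DB_\<delta>B: "DB (\<delta>B Y) = 0"
proof (induction Y rule: rev_induct)
 case (snoc x Y)
 show ?case
 proof (cases "Y = []")
  case False
  have h: "homog deg (deg Y - 1) (\<delta>B Y)" using lowers_homog[OF lowers_\<delta>B, of Y] .
  have nY: "NE (mon [Y])" using False by (simp add: NE_simps(8))
  have 1: "DB (cx x (\<delta>B Y)) = - (- ((-1) ^ deg Y * (\<delta>B Y * mon [[x]] - mx x (\<delta>B Y))))"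
  proof (cases "deg Y = 0")
   case True
   then have "\<delta>B Y = 0" using lowers_0[OF lowers_\<delta>B] by blast
   then show ?thesis by (simp add: cx_linear mx_linear)
  next
   case False
   then have "(-1) ^ (deg Y - 1) = - ((-1) ^ deg Y :: ('a list, 'k) fa)" by (cases "deg Y") auto
   then show ?thesis unfolding D_cx[OF NE_\<delta>B h] snoc by (simp add: cx_linear)
  qed
  have 2: "DB (mon [Y, [x]]) = \<delta>B Y * mon [[x]]" using derw_single[of "[Y]" x] by simp
  have 3: "DB (mx x (mon [Y])) = mx x (\<delta>B Y)" unfolding D_mx[OF nY] by simp
  show ?thesis unfolding \<delta>B_snoc[OF False] der_simps 1 2 3 by simp
 qed simp
qed simp

end

context toupie
begin

abbreviation basis :: "('v, 'e) qpath list \<Rightarrow> bool" where "basis xs \<equiv> xs \<in> bar_basis Q W (length xs)"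

text \<open>Cut down to basis words, since the operations on the bar dual are zero elsewhere.
  \<open>Gc\<close> is cut down to chains for the same reason.\<close>

definition \<delta>bar :: "('v, 'e) qpath list \<Rightarrow> (('v, 'e) qpath list, 'k) fa" where
 "\<delta>bar xs = (if basis xs then \<delta>B xs else 0)"

definition Gc :: "('v, 'e) qpath list \<Rightarrow> (('v, 'e) qpath list, 'k) fa" where
 "Gc \<gamma> = (if \<gamma> \<in> chains Q W (deg \<gamma>) then G \<gamma> else 0)"

lemma basis_iff: "basis xs \<longleftrightarrow> set xs \<subseteq> NT \<and> composable Q xs"
 by (auto simp: bar_basis_def)

lemma basis_words: "xs \<in> words u v \<Longrightarrow> basis xs"
 by (simp add: words_def basis_iff)

lemma composable_sub: "composable Q (us @ xs @ vs) \<Longrightarrow> composable Q xs"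
proof (cases "xs = []")
 case False
 assume c: "composable Q (us @ xs @ vs)"
 have "composable Q (xs @ vs)" using c False by (cases "us = []") (auto simp: composable_append)
 then show ?thesis using False by (cases "vs = []") (auto simp: composable_append)
qed (simp add: composable_Nil)

lemma composable_merge:
 "composable Q (us @ [y, x] @ vs) \<Longrightarrow> z \<in> qpaths Q \<Longrightarrow> fst z = fst y \<Longrightarrow> ptarget Q z = ptarget Q x \<Longrightarrow>
  composable Q (us @ [z] @ vs)"
proof (induction us)
 case Nil
 then show ?case by (cases vs) (auto simp: composable_Cons2 composable_single)
next
 case (Cons u us)
 then show ?case by (cases us) (auto simp: composable_Cons2)
qed

lemma basis_sub: "basis (us @ xs @ vs) \<Longrightarrow> basis xs"
 unfolding basis_iff using composable_sub[of us xs vs] by auto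

lemma good_basis: "good u v d w \<Longrightarrow> Y \<in> set w \<Longrightarrow> basis Y"
proof -
 assume g: "good u v d w" and "Y \<in> set w"
 then obtain a b where "w = a @ Y # b" by (auto dest: split_list)
 then have "concat a @ Y @ concat b \<in> words u v" using g by (simp add: good_def)
 then have "basis (concat a @ Y @ concat b)" by (rule basis_words)
 then show ?thesis by (rule basis_sub)
qed

lemma \<delta>bar: "ev [] (\<delta>bar g) = 0" "shifts 2 \<delta>bar"
proof -
 show "ev [] (\<delta>bar g) = 0" using NE_\<delta>B[of g] by (intro ev_Nil_zero) (auto simp: \<delta>bar_def NE_def split: if_splits)
 have "lowers deg \<delta>bar" using lowers_\<delta>B unfolding lowers_def by (simp add: \<delta>bar_def)
 then show "shifts 2 \<delta>bar" by (rule lowers_shifts)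
qed

lemma keys_\<delta>bar_basis: "FW w \<in> keys (\<delta>B g) \<Longrightarrow> basis g \<Longrightarrow> Y \<in> set w \<Longrightarrow> basis Y"
proof -
 assume w: "FW w \<in> keys (\<delta>B g)" and g: "basis g" and Y: "Y \<in> set w"
 obtain i where i: "i \<in> {1..<length g}" "FW w \<in> keys ((-1) ^ i * (mon [take i g, drop i g] - mg i g))"
  using keys_sumD[OF w[unfolded \<delta>B_def]] by blast
 then have "FW w \<in> keys (mon [take i g, drop i g] :: (('v, 'e) qpath list, 'k) fa) \<or> FW w \<in> keys (mg i g)"
  by (auto simp: in_keys_iff lookup_minus cf_mon split: if_splits)
 then show ?thesis
 proof
  assume "FW w \<in> keys (mon [take i g, drop i g] :: (('v, 'e) qpath list, 'k) fa)"
  then have "Y = take i g \<or> Y = drop i g" using Y by auto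
  then show ?thesis using g basis_sub[of "[]" "take i g" "drop i g"] basis_sub[of "take i g" "drop i g" "[]"] by auto
 next
  assume "FW w \<in> keys (mg i g)"
  then obtain z where z: "z \<in> keys (mul (g ! (i - 1)) (g ! i))" and
   wz: "FW w \<in> keys (cst (lookup (mul (g ! (i - 1)) (g ! i)) z) * mon [take (i - 1) g @ [z] @ drop (i + 1) g])"
   unfolding mg_def MS_def using keys_sumD[of "FW w"] by blast
  have "FW w \<in> keys (mon [take (i - 1) g @ [z] @ drop (i + 1) g] :: (('v, 'e) qpath list, 'k) fa)"
   using wz keys_cst_mult by (rule rev_subsetD)
  then have Yz: "Y = take (i - 1) g @ [z] @ drop (i + 1) g" using Y by simp
  obtain n where n: "i = Suc n" "Suc n < length g" using i(1) by (cases i) auto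
  have "drop n g = [g ! n, g ! Suc n] @ drop (Suc (Suc n)) g" using n by (simp add: Cons_nth_drop_Suc)
  then have "take n g @ [g ! n, g ! Suc n] @ drop (Suc (Suc n)) g = g" using append_take_drop_id[of n g] by simp
  then have b: "basis (take n g @ [g ! n, g ! Suc n] @ drop (Suc (Suc n)) g)" using g by simp
  note k = keys_mul[OF z[unfolded n(1) diff_Suc_1]]
  have "composable Q (take n g @ [z] @ drop (Suc (Suc n)) g)"
   using b k NT_qpaths[OF k(3)] unfolding basis_iff by (intro composable_merge[of _ "g ! n" "g ! Suc n"]) auto
  then show ?thesis using b k(3) n unfolding basis_iff Yz by simp
 qed
qed

lemma der_\<delta>bar:
 assumes "\<And>w Y. FW w \<in> keys q \<Longrightarrow> Y \<in> set w \<Longrightarrow> basis Y"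
 shows "der deg \<delta>bar q = DB q"
 unfolding der_def
proof (intro lin_cong derw_cong)
 fix w Y assume "FW w \<in> keys q" "Y \<in> set w"
 then have "basis Y" by (rule assms)
 then show "\<delta>bar Y = \<delta>B Y" by (simp add: \<delta>bar_def)
qed

lemma \<delta>bar_sq: "der deg \<delta>bar (\<delta>bar g) = 0"
proof (cases "basis g")
 case True
 have "der deg \<delta>bar (\<delta>B g) = DB (\<delta>B g)"
 proof (rule der_\<delta>bar)
  fix w Y assume "FW w \<in> keys (\<delta>B g)" "Y \<in> set w"
  then show "basis Y" using keys_\<delta>bar_basis True by blast
 qed
 then show ?thesis using True DB_\<delta>B by (simp add: \<delta>bar_def)
qed (simp add: \<delta>bar_def)

lemma \<delta>T_chain: "\<delta>T \<gamma> \<noteq> 0 \<Longrightarrow> \<gamma> \<in> chains Q W (deg \<gamma>)"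
proof -
 assume "\<delta>T \<gamma> \<noteq> 0"
 then have "keys (\<delta>T \<gamma>) \<noteq> {}" by simp
 then obtain w where "w \<in> keys (\<delta>T \<gamma>)" by blast
 then have "FW (fwl w) \<in> keys (\<delta>T \<gamma>)" by simp
 then have "\<exists>d. \<gamma> \<in> chains Q W d"
 proof (cases rule: keys_\<delta>T)
  case 1
  then show ?thesis using decs_chain(1) by blast
 next
  case (2 i b)
  then show ?thesis using split_chain_chain[of "tip i"] by (auto simp: tips_def)
 qed
 then obtain d where d: "\<gamma> \<in> chains Q W d" by blast
 then show ?thesis using chain_length[OF d] by simp
qed

lemma Gc: "ev [] (Gc g) = 0" "shifts 1 Gc" "Gc g \<noteq> 0 \<Longrightarrow> g \<in> chains Q W (length g - 1)"
proof -
 show "ev [] (Gc g) = 0"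
  using G_good by (intro ev_Nil_zero) (auto simp: Gc_def good_def split: if_splits)
 show "Gc g \<noteq> 0 \<Longrightarrow> g \<in> chains Q W (length g - 1)" by (auto simp: Gc_def split: if_splits)
 show "shifts 1 Gc" unfolding shifts_def
 proof (intro allI impI)
  fix g w assume w: "FW w \<in> keys (Gc g)" and n: "[] \<notin> set w"
  have c: "g \<in> chains Q W (deg g)" and wG: "FW w \<in> keys (G g)" using w by (auto simp: Gc_def split: if_splits)
  have d: "wdeg w = deg g" using G_good[OF c wG] by (simp add: good_def)
  have "(\<Sum>h\<leftarrow>w. int (length h)) - int (length w) = int (wdeg w)"
   using n
  proof (induction w)
   case (Cons h w)
   then show ?case by (cases h) auto
  qed simp
  then show "g \<noteq> [] \<and> (\<Sum>h\<leftarrow>w. int (length h)) - int (length w) + 1 = int (length g)"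
   using d chain_ends(1)[OF c] by (cases g) auto
 qed
qed

lemma Gc_comm: "der deg \<delta>bar (Gc \<gamma>) = ahom Gc (\<delta>T \<gamma>)"
proof (cases "\<gamma> \<in> chains Q W (deg \<gamma>)")
 case True
 have "der deg \<delta>bar (G \<gamma>) = DB (G \<gamma>)"
 proof (rule der_\<delta>bar)
  fix w Y assume "FW w \<in> keys (G \<gamma>)" "Y \<in> set w"
  then show "basis Y" using good_basis[OF G_good[OF True]] by blast
 qed
 moreover have "ahom Gc (\<delta>T \<gamma>) = ahom G (\<delta>T \<gamma>)" unfolding ahom_def
 proof (rule lin_cong)
  fix w assume w: "FW w \<in> keys (\<delta>T \<gamma>)"
  have "Gc g = G g" if g: "g \<in> set w" for g
  proof -
   obtain e where e: "g \<in> chains Q W e" using \<delta>T_word(2)[OF True w g] by blast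
   then show ?thesis using chain_length[OF e] by (simp add: Gc_def)
  qed
  then have "map Gc w = map G w" by (intro map_cong refl)
  then show "prod_list (map Gc w) = prod_list (map G w)" by (rule arg_cong)
 qed
 ultimately show ?thesis using True DB_G[OF True] by (simp add: Gc_def)
next
 case False
 then have "\<delta>T \<gamma> = 0" using \<delta>T_chain by blast
 then show ?thesis using False by (simp add: Gc_def ahom_simps)
qed

lemma \<delta>T: "ev [] (\<delta>T g) = 0" "shifts 2 \<delta>T" "\<delta>T g \<noteq> 0 \<Longrightarrow> g \<in> chains Q W (length g - 1)"
proof -
 show "ev [] (\<delta>T g) = 0"
 proof (rule ev_Nil_zero)
  fix w assume w: "FW w \<in> keys (\<delta>T g)"
  then have "\<delta>T g \<noteq> 0" by auto
  then show "w \<noteq> []" using \<delta>T_word(1)[OF \<delta>T_chain w] by blast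
 qed
 show "shifts 2 \<delta>T" by (rule lowers_shifts[OF lowers_\<delta>T])
 show "\<delta>T g \<noteq> 0 \<Longrightarrow> g \<in> chains Q W (length g - 1)" using \<delta>T_chain by simp
qed

text \<open>A quadratic function with polarization \<open>a * b\<close> (\<open>lbar_add\<close>),
  hence the correction that produces the Koszul sign in the product of the bar dual.\<close>

definition lbar :: "int \<Rightarrow> int" where "lbar d = d * (d - 1) div 2"
text \<open>The extra 1 negates every basis element and changes an \<open>n\<close>-ary product by
  \<open>(-1) ^ (n + 1)\<close>, which is what the exponent \<open>M\<close> asks for.\<close>

definition lext :: "int \<Rightarrow> int" where "lext d = lbar d + 1"

lemma lbar_eq: "2 * lbar d = d * (d - 1)"
 unfolding lbar_def by (rule dvd_mult_div_cancel) simp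

lemma lbar_add: "lbar (a + b) = lbar a + lbar b + a * b"
proof -
 have "2 * lbar (a + b) = 2 * (lbar a + lbar b + a * b)"
  unfolding distrib_left lbar_eq by (simp add: algebra_simps)
 then show ?thesis by simp
qed

text \<open>One map serves all arities: \<open>evw\<close> vanishes on words whose length differs
  from the number of arguments.\<close>

abbreviation mT :: "nat \<Rightarrow> (('v, 'e) qpath list \<Rightarrow> 'k) list \<Rightarrow> ('v, 'e) qpath list \<Rightarrow> 'k" where
 "mT n \<equiv> tw lext lext \<delta>T"

abbreviation fT :: "nat \<Rightarrow> (('v, 'e) qpath list \<Rightarrow> 'k) list \<Rightarrow> ('v, 'e) qpath list \<Rightarrow> 'k" where
 "fT n \<equiv> tw lbar lext Gc"

lemma chains_length1: "1 \<le> n \<Longrightarrow> y \<in> chains Q W (n - 1) \<Longrightarrow> length y = n"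
 by (simp add: chain_length)

lemma bar_basis_length: "y \<in> bar_basis Q W n \<Longrightarrow> length y = n"
 by (simp add: bar_basis_def)

theorem ainf_mT: "ainf_algebra fscale (ext_space Q W) mT"
 unfolding ext_space_def by (rule tw_ainf) (use chains_length1 \<delta>T \<delta>T_sq in blast)+

text \<open>The composite with the bar differential, expressed through \<open>mul\<close>; see
  \<open>bar_diff_sum\<close>.\<close>

definition dd :: "(('v, 'e) qpath list \<Rightarrow> 'k) \<Rightarrow> ('v, 'e) qpath list \<Rightarrow> 'k" where
 "dd x xs = (\<Sum>i=1..<length xs. (-1) ^ i * ev [x] (mg i xs))"

lemma ev_mg: "ev [x] (mg i xs) = (\<Sum>z\<in>keys (mul (xs ! (i - 1)) (xs ! i)).
  lookup (mul (xs ! (i - 1)) (xs ! i)) z * x (take (i - 1) xs @ [z] @ drop (i + 1) xs))"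
 by (simp add: mg_def MS_def ev_simps)

lemma ev_\<delta>B_1: "ev [x] (\<delta>B xs) = - dd x xs"
 by (simp add: \<delta>B_def dd_def ev_simps sum_negf)

lemma ev_\<delta>B_2: "ev [x, y] (\<delta>B xs) = (\<Sum>i=1..<length xs. (-1) ^ i * (x (take i xs) * y (drop i xs)))"
 by (simp add: \<delta>B_def mg_def MS_def ev_simps)

lemma ev_\<delta>B_3: "ev (x # y # z # zs) (\<delta>B xs) = 0"
 by (simp add: \<delta>B_def mg_def MS_def ev_simps)

lemma bar_diff_eq:
 assumes b: "basis xs"
 shows "bar_diff Q I W xs ys = (\<Sum>i=1..<length xs. \<Sum>z\<in>keys (mul (xs ! (i - 1)) (xs ! i)).
   (-1) ^ i * lookup (mul (xs ! (i - 1)) (xs ! i)) z * (if ys = take (i - 1) xs @ [z] @ drop (i + 1) xs then 1 else 0))"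
 unfolding bar_diff_def sum_fun_apply[where A = "{1..<length xs}"]
proof (rule sum.cong[OF refl])
 fix i assume "i \<in> {1..<length xs}"
 then obtain n where n: "i = Suc n" "Suc n < length xs" by (cases i) auto
 let ?p = "path_prod [xs ! (i - 1), xs ! i]"
 have s: "set xs \<subseteq> NT" using b unfolding basis_iff by (rule conjunct1)
 have N: "xs ! n \<in> NT" "xs ! Suc n \<in> NT" by (rule subsetD[OF s], use n(2) in simp)+
 have c: "composable Q [xs ! n, xs ! Suc n]"
  using b n(2) NT_qpaths[OF N(1)] NT_qpaths[OF N(2)] by (simp add: basis_iff composable_pair) (simp add: composable_def)
 have q: "?p \<in> qpaths Q" "snd ?p \<noteq> []"
  using composable_append_walk[OF c] NT_nonempty[OF N(1)] by (simp_all add: n path_prod_pair)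
 have m: "mul (xs ! (i - 1)) (xs ! i) = nf ?p" using N c by (simp add: n mul_def)
 have g: "normal_form Q I W (delta ?p) = lookup (mul (xs ! (i - 1)) (xs ! i))"
  unfolding m lookup_nf[OF q] ..
 have k: "{c. lookup (mul (xs ! (i - 1)) (xs ! i)) c \<noteq> 0} = keys (mul (xs ! (i - 1)) (xs ! i))"
  by (auto simp: in_keys_iff)
 show "(let g = normal_form Q I W (delta ?p) in
    \<Sum>c | g c \<noteq> 0. fscale ((-1) ^ i * g c) (delta (take (i - 1) xs @ [c] @ drop (i + 1) xs))) ys =
  (\<Sum>z\<in>keys (mul (xs ! (i - 1)) (xs ! i)).
   (-1) ^ i * lookup (mul (xs ! (i - 1)) (xs ! i)) z * (if ys = take (i - 1) xs @ [z] @ drop (i + 1) xs then 1 else 0))"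
  unfolding Let_def g k sum_fun_apply by (simp add: fscale_def)
qed

lemma bar_diff_sum:
 assumes b: "basis xs"
 shows "(\<Sum>ys | bar_diff Q I W xs ys \<noteq> 0. bar_diff Q I W xs ys * f ys) = dd f xs"
proof -
 let ?w = "\<lambda>i z. take (i - 1) xs @ [z] @ drop (i + 1) xs"
 let ?m = "\<lambda>i. mul (xs ! (i - 1)) (xs ! i)"
 define T where "T = (\<Union>i\<in>{1..<length xs}. ?w i ` keys (?m i))"
 have fT: "finite T" by (simp add: T_def)
 have "(\<Sum>ys | bar_diff Q I W xs ys \<noteq> 0. bar_diff Q I W xs ys * f ys) = (\<Sum>ys\<in>T. bar_diff Q I W xs ys * f ys)"
 proof (rule sum.mono_neutral_left[OF fT])
  show "{ys. bar_diff Q I W xs ys \<noteq> 0} \<subseteq> T"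
  proof
   fix ys assume "ys \<in> {ys. bar_diff Q I W xs ys \<noteq> 0}"
   then have nz: "bar_diff Q I W xs ys \<noteq> 0" by simp
   show "ys \<in> T"
   proof (rule ccontr)
    assume "ys \<notin> T"
    then have "bar_diff Q I W xs ys = 0" unfolding bar_diff_eq[OF b]
     by (intro sum.neutral ballI) (auto simp: T_def)
    then show False using nz by simp
   qed
  qed
 qed simp
 also have "\<dots> = (\<Sum>ys\<in>T. \<Sum>i=1..<length xs. \<Sum>z\<in>keys (?m i). if ys = ?w i z then (-1) ^ i * lookup (?m i) z * f (?w i z) else 0)"
  unfolding bar_diff_eq[OF b] sum_distrib_right by (intro sum.cong refl) auto
 also have "\<dots> = (\<Sum>i=1..<length xs. \<Sum>z\<in>keys (?m i). \<Sum>ys\<in>T. if ys = ?w i z then (-1) ^ i * lookup (?m i) z * f (?w i z) else 0)"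
  by (subst sum.swap) (rule sum.cong[OF refl], rule sum.swap)
 also have "\<dots> = (\<Sum>i=1..<length xs. \<Sum>z\<in>keys (?m i). (-1) ^ i * lookup (?m i) z * f (?w i z))"
 proof (intro sum.cong refl)
  fix i z assume iz: "i \<in> {1..<length xs}" "z \<in> keys (?m i)"
  have "?w i z \<in> T" unfolding T_def by (rule UN_I[OF iz(1)]) (rule imageI[OF iz(2)])
  then show "(\<Sum>ys\<in>T. if ys = ?w i z then (-1) ^ i * lookup (?m i) z * f (?w i z) else 0) = (-1) ^ i * lookup (?m i) z * f (?w i z)"
   using fT by (simp only: sum.delta if_True)
 qed
 also have "\<dots> = dd f xs" unfolding dd_def ev_mg sum_distrib_left by (simp only: mult.assoc)
 finally show ?thesis .
qed

lemma bar_dual_diff_eq: "bar_dual_diff Q I W f xs = (if basis xs then (-1) ^ length xs * dd f xs else 0)"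
 unfolding bar_dual_diff_def using bar_diff_sum[of xs f] by simp

text \<open>\<open>\<delta>B\<close> has only words of one and two letters, so the dual structure
  has a differential and a product. The increments of \<open>lbar\<close> give their signs:
  \<open>d\<close> from \<open>d\<close> to \<open>d + 1\<close>, and \<open>d * e\<close> for a
  product.\<close>

theorem bar_dual_ops_eq:
 assumes "xs \<noteq> []" "homogeneous (bar_dual Q W) ds xs"
 shows "bar_dual_ops Q I W (length xs) xs = tw lbar lbar \<delta>bar xs"
proof
 fix g
 have s: "list_all2 supp_deg ds xs"
  using homogeneous_supp[of "bar_basis Q W"] assms(2) bar_basis_length unfolding bar_dual_def by blast
 show "bar_dual_ops Q I W (length xs) xs g = tw lbar lbar \<delta>bar xs g"
 proof (cases "basis g")
  case False
  then show ?thesis by (simp add: bar_dual_ops_def bar_dual_diff_eq bar_dual_mult_def tw_def \<delta>bar_def)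
 next
  case True
  have t: "tw lbar lbar \<delta>bar xs g = (-1) powi (eps ds + (\<Sum>d\<leftarrow>ds. lbar d) + lbar (int (length g))) * ev xs (\<delta>B g)"
  proof -
   have e: "\<delta>bar g = \<delta>B g" using True by (simp add: \<delta>bar_def)
   show ?thesis unfolding tw_eq[OF s] e ..
  qed
  consider x where "xs = [x]" | x y where "xs = [x, y]" | x y z zs where "xs = x # y # z # zs"
   using assms(1) by (cases xs; cases "tl xs"; cases "tl (tl xs)") auto
  then show ?thesis
  proof cases
   case 1
   obtain d where ds: "ds = [d]" using s 1 by (auto simp: list_all2_Cons2)
   show ?thesis
   proof (cases "dd x g = 0")
    case True
    then show ?thesis unfolding t using \<open>basis g\<close> by (simp add: 1 bar_dual_ops_def bar_dual_diff_eq ev_\<delta>B_1)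
   next
    case False
    then have "ev xs (\<delta>bar g) \<noteq> 0" using True by (simp add: 1 \<delta>bar_def ev_\<delta>B_1)
    then have L: "int (length g) = d + 1"
     using supp_deg_ev[OF \<delta>bar(2) s, of 1] by (simp add: ds 1 supp_deg_def)
    obtain n where n: "length g = Suc n" "d = int n" using L \<open>ev xs (\<delta>bar g) \<noteq> 0\<close> supp_deg_ev[OF \<delta>bar(2) s, of 1]
     by (cases "length g") (auto simp: supp_deg_def 1)
    have "lbar (d + 1) = lbar d + d" unfolding lbar_add by (simp add: lbar_def)
    then have "eps ds + (\<Sum>d\<leftarrow>ds. lbar d) + lbar (int (length g)) - d = 2 * lbar d" unfolding L by (simp add: ds)
    then have "(-1 :: 'k) powi (eps ds + (\<Sum>d\<leftarrow>ds. lbar d) + lbar (int (length g))) = (-1) powi d" by (rule powi_parity)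
    then have e: "(-1 :: 'k) powi (eps ds + (\<Sum>d\<leftarrow>ds. lbar d) + lbar (int (length g))) = - ((-1) ^ length g)"
     by (simp add: n)
    show ?thesis unfolding t e using True by (simp add: 1 bar_dual_ops_def bar_dual_diff_eq ev_\<delta>B_1)
   qed
  next
   case 2
   obtain d e where ds: "ds = [d, e]" and sd: "supp_deg d x" "supp_deg e y" using s 2 by (auto simp: list_all2_Cons2)
   have "(-1) ^ ((length g - i) * i) * x (take i g) * y (drop i g) =
    (-1) powi (eps ds + (\<Sum>d\<leftarrow>ds. lbar d) + lbar (int (length g))) * ((-1) ^ i * (x (take i g) * y (drop i g)))"
    if i: "i \<in> {1..<length g}" for i
   proof (cases "x (take i g) * y (drop i g) = 0")
    case False
    then have de: "d = int i" "e = int (length g - i)" using sd i by (auto simp: supp_deg_def)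
    have L: "int (length g) = d + e" using de i by simp
    have "(-1 :: 'k) powi (eps ds + (\<Sum>d\<leftarrow>ds. lbar d) + lbar (int (length g))) * (-1) ^ i =
     (-1) powi (eps ds + (\<Sum>d\<leftarrow>ds. lbar d) + lbar (int (length g)) + d)"
     by (simp add: de(1) power_int_add)
    also have "\<dots> = (-1) powi (int ((length g - i) * i))"
     by (rule powi_parity[where k = "d + lbar d + lbar e"]) (unfold L lbar_add, simp add: ds de)
    also have "\<dots> = (-1) ^ ((length g - i) * i)" by (simp only: power_int_of_nat)
    finally show ?thesis by (simp flip: mult.assoc)
   qed auto
   note T = this
   have "bar_dual_ops Q I W (length xs) xs g = (\<Sum>i=1..<length g. (-1) ^ ((length g - i) * i) * x (take i g) * y (drop i g))"
    using True by (simp add: 2 bar_dual_ops_def bar_dual_mult_def)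
   also have "\<dots> = (\<Sum>i=1..<length g. (-1) powi (eps ds + (\<Sum>d\<leftarrow>ds. lbar d) + lbar (int (length g))) *
     ((-1) ^ i * (x (take i g) * y (drop i g))))"
    by (rule sum.cong[OF refl]) (rule T)
   also have "\<dots> = tw lbar lbar \<delta>bar xs g" unfolding 2 t[unfolded 2] ev_\<delta>B_2 sum_distrib_left ..
   finally show ?thesis .
  next
   case 3
   then show ?thesis unfolding t by (simp add: bar_dual_ops_def ev_\<delta>B_3)
  qed
 qed
qed

theorem morphism_fT: "ainf_morphism fscale (bar_dual Q W) (bar_dual_ops Q I W) fscale (ext_space Q W) mT fT"
 unfolding ext_space_def bar_dual_def
proof (rule tw_morphism)
 show "bar_dual_ops Q I W (length xs) xs = tw lbar lbar \<delta>bar xs"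
  if "xs \<noteq> []" "homogeneous (dual_space (bar_basis Q W)) ds xs" for ds and xs :: "(('v, 'e) qpath list \<Rightarrow> 'k) list"
  using bar_dual_ops_eq[OF that(1), of ds] that(2) unfolding bar_dual_def .
 show "y \<in> bar_basis Q W n \<Longrightarrow> length y = n" for n y by (rule bar_basis_length)
qed (rule \<delta>bar Gc Gc_comm; assumption?)+

end

section \<open>The linear part is a quasi-isomorphism\<close>

text \<open>
 A bar word that is not a chain is split uniquely after its longest prefix which is a chain. If
 the last letter of this prefix and the next letter have a nonzero product, then they can be
 merged; merging is a bijection onto the remaining words, and it matches all words except the
 chains.
\<close>

context toupie
begin

definition chn :: "nat \<Rightarrow> ('v, 'e) qpath list \<Rightarrow> bool" where
 "chn k xs \<longleftrightarrow> k \<le> length xs \<and> (k = 0 \<or> take k xs \<in> chains Q W (k - 1))"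

text \<open>Level 0 is possible: it means that the first letter is not an arrow.\<close>

definition level :: "('v, 'e) qpath list \<Rightarrow> nat" where
 "level xs = Max {k. chn k xs}"

lemma level: "chn (level xs) xs" "chn k xs \<Longrightarrow> k \<le> level xs"
proof -
 have f: "finite {k. chn k xs}" by (rule finite_subset[of _ "{..length xs}"]) (auto simp: chn_def)
 have "0 \<in> {k. chn k xs}" by (simp add: chn_def)
 then have "Max {k. chn k xs} \<in> {k. chn k xs}" using f by (intro Max_in) auto
 then show "chn (level xs) xs" by (simp add: level_def)
 show "chn k xs \<Longrightarrow> k \<le> level xs" using f by (simp add: level_def)
qed

lemma chains_append:
 assumes c: "ys \<in> chains Q W d"
 shows "ys @ [x] \<in> chains Q W (Suc d) \<longleftrightarrow> x \<in> NT \<and> uf_arrow Q W (last ys) x"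
proof -
 have l: "length ys = Suc d" by (rule chain_length[OF c])
 have n: "last ys = ys ! d" using l by (cases ys rule: rev_cases) (auto simp: nth_append)
 have 1: "uf_arrow Q W ((ys @ [x]) ! k) ((ys @ [x]) ! Suc k)" if k: "k < d" for k
  using chainsD(5)[OF c k] l k by (simp add: nth_append)
 have 2: "(ys @ [x]) ! d = last ys" "(ys @ [x]) ! Suc d = x" using l n by (simp_all add: nth_append)
 have E: "(\<forall>k<Suc d. uf_arrow Q W ((ys @ [x]) ! k) ((ys @ [x]) ! Suc k)) \<longleftrightarrow> uf_arrow Q W (last ys) x"
  using 1 unfolding All_less_Suc 2 by blast
 have z: "(ys @ [x]) ! 0 = ys ! 0" using l by (simp add: nth_append)
 have Z: "\<exists>e\<in>trivial_paths Q. uf_arrow Q W e ((ys @ [x]) ! 0)"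
  using c unfolding z chains_def mem_Collect_eq by (elim conjE)
 have S: "set (ys @ [x]) \<subseteq> NT \<longleftrightarrow> x \<in> NT" using chainsD(2)[OF c] by simp
 have L: "length (ys @ [x]) = Suc d + 1" by (simp add: l)
 show ?thesis unfolding chains_def mem_Collect_eq S E using L Z by (simp only: simp_thms)
qed

lemma chains_take: "xs \<in> chains Q W d \<Longrightarrow> 1 \<le> k \<Longrightarrow> k \<le> Suc d \<Longrightarrow> take k xs \<in> chains Q W (k - 1)"
proof -
 assume c: "xs \<in> chains Q W d" and k: "1 \<le> k" "k \<le> Suc d"
 have l: "length xs = Suc d" by (rule chain_length[OF c])
 have "\<forall>j<k - 1. uf_arrow Q W (take k xs ! j) (take k xs ! Suc j)"
 proof (intro allI impI)
  fix j assume "j < k - 1"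
  then have "j < d" "Suc j < k" using k by auto
  then show "uf_arrow Q W (take k xs ! j) (take k xs ! Suc j)" using chainsD(5)[OF c \<open>j < d\<close>] by simp
 qed
 moreover have z: "take k xs ! 0 = xs ! 0" using k by simp
 have "\<exists>e\<in>trivial_paths Q. uf_arrow Q W e (take k xs ! 0)"
  using c unfolding z chains_def mem_Collect_eq by (elim conjE)
 moreover have "set (take k xs) \<subseteq> NT" using chainsD(2)[OF c] set_take_subset[of k xs] by (rule subset_trans[rotated])
 moreover have "length (take k xs) = k - 1 + 1" using l k by simp
 ultimately show ?thesis unfolding chains_def mem_Collect_eq by (intro conjI)
qed

lemma chn_mono: "chn k xs \<Longrightarrow> j \<le> k \<Longrightarrow> chn j xs"
proof -
 assume c: "chn k xs" and j: "j \<le> k"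
 show ?thesis
 proof (cases "j = 0")
  case False
  then have "take k xs \<in> chains Q W (k - 1)" using c j by (auto simp: chn_def)
  from chains_take[OF this, of j] have "take j xs \<in> chains Q W (j - 1)" using False j by (simp add: min_absorb1)
  then show ?thesis using c j by (simp add: chn_def)
 qed (simp add: chn_def)
qed

lemma level_eq: "chn k xs \<Longrightarrow> \<not> chn (Suc k) xs \<Longrightarrow> level xs = k"
 using level(2)[of k xs] chn_mono[OF level(1)[of xs], of "Suc k"] by linarith

lemma level_le: "level xs \<le> length xs"
 using level(1) by (simp add: chn_def)

definition mrg :: "('v, 'e) qpath list \<Rightarrow> ('v, 'e) qpath list" where
 "mrg xs = take (level xs - 1) xs @ [path_prod [xs ! (level xs - 1), xs ! level xs]] @ drop (Suc (level xs)) xs"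

definition isM :: "('v, 'e) qpath list \<Rightarrow> bool" where
 "isM xs \<longleftrightarrow> basis xs \<and> 1 \<le> level xs \<and> level xs < length xs \<and>
   path_prod [xs ! (level xs - 1), xs ! level xs] \<in> NT"

lemma composable_split:
 "composable Q (us @ [p] @ vs) \<Longrightarrow> w \<in> qpaths Q \<Longrightarrow> z \<in> qpaths Q \<Longrightarrow> ptarget Q w = fst z \<Longrightarrow>
  fst w = fst p \<Longrightarrow> ptarget Q z = ptarget Q p \<Longrightarrow> composable Q (us @ [w, z] @ vs)"
proof (induction us)
 case Nil
 then show ?case by (cases vs) (auto simp: composable_Cons2 composable_single)
next
 case (Cons u us)
 then show ?case by (cases us) (auto simp: composable_Cons2)
qed

lemma uf_arrow_pair:
 assumes "u \<in> NT" "uf_arrow Q W u v"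
 shows "composable Q [u, v]" "path_prod [u, v] \<in> path_ideal Q W" "path_prod [u, v] \<notin> NT"
  "left_factor Q y (path_prod [u, v]) \<Longrightarrow> y \<noteq> path_prod [u, v] \<Longrightarrow> y \<notin> path_ideal Q W"
proof -
 have "u \<notin> trivial_paths Q" using assms(1) by blast
 note U = assms(2)[unfolded uf_arrow_nontrivial[OF this]]
 show c: "composable Q [u, v]" and p: "path_prod [u, v] \<in> path_ideal Q W" using U by blast+
 have "path_prod [u, v] \<in> qpaths Q" using composable_append_walk[OF c] by blast
 from path_ideal_iff[OF this] show "path_prod [u, v] \<notin> NT" using p by blast
 show "left_factor Q y (path_prod [u, v]) \<Longrightarrow> y \<noteq> path_prod [u, v] \<Longrightarrow> y \<notin> path_ideal Q W" using U by blast
qed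

lemma path_ideal_left: "y \<in> path_ideal Q W \<Longrightarrow> left_factor Q y x \<Longrightarrow> x \<notin> nontip Q W"
proof
 assume y: "y \<in> path_ideal Q W" and l: "left_factor Q y x" and x: "x \<in> nontip Q W"
 obtain bs where bs: "x \<in> qpaths Q" "fst y = fst x" "snd x = snd y @ bs" using l by (auto simp: left_factor_iff)
 then have "subpath Q y x" unfolding subpath_iff by (intro conjI exI[of _ "[]"] exI[of _ bs]) simp_all
 with x have n: "y \<in> nontip Q W" by (rule nontip_subpath)
 then have "y \<in> qpaths Q" by (simp add: nontip_def)
 from path_ideal_iff[OF this] show False using n y by simp
qed

text \<open>The product \<open>u w\<close> is a minimal left factor in the ideal of the tips; a
  proper extension of it is no longer minimal but still contains a tip.\<close>

lemma uf_arrow_extend: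
 assumes u: "u \<in> NT" "uf_arrow Q W u w" and p: "p \<in> qpaths Q" "fst p = fst w" "snd p = snd w @ bs" "bs \<noteq> []"
 shows "\<not> uf_arrow Q W u p" "path_prod [u, p] \<notin> NT"
proof -
 note a = uf_arrow_pair[OF u]
 have c: "composable Q [u, p]" using a(1) p by (simp add: composable_pair)
 have q: "path_prod [u, p] \<in> qpaths Q" using composable_append_walk[OF c] by blast
 have l: "left_factor Q (path_prod [u, w]) (path_prod [u, p])"
  unfolding left_factor_iff using q p by (simp add: path_prod_pair)
 have n: "path_prod [u, w] \<noteq> path_prod [u, p]" using p by (simp add: path_prod_pair)
 show "\<not> uf_arrow Q W u p"
 proof
  assume "uf_arrow Q W u p"
  then show False using uf_arrow_pair(4)[OF u(1) _ l n] a(2) by blast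
 qed
 show "path_prod [u, p] \<notin> NT" using path_ideal_left[OF a(2) l] by blast
qed

lemma uf_arrow_unique:
 assumes u: "u \<in> NT" "uf_arrow Q W u w" "uf_arrow Q W u w'" and "fst w = fst w'" "snd w @ a = snd w' @ b"
 shows "w = w'"
proof (rule ccontr)
 assume n: "w \<noteq> w'"
 have q: "w \<in> qpaths Q" "w' \<in> qpaths Q"
  using uf_arrow_pair(1)[OF u(1,2)] uf_arrow_pair(1)[OF u(1,3)] by (simp_all add: composable_pair)
 have "\<exists>c. snd w = snd w' @ c \<or> snd w' = snd w @ c"
  using assms(5) unfolding append_eq_append_conv2 by metis
 then obtain c where "snd w = snd w' @ c \<or> snd w' = snd w @ c" ..
 then show False
 proof
  assume e: "snd w = snd w' @ c"
  then have "c \<noteq> []" using n assms(4) by (auto simp: prod_eq_iff)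
  then show False using uf_arrow_extend(1)[OF u(1,3) q(1) assms(4) e] u(2) by blast
 next
  assume e: "snd w' = snd w @ c"
  then have "c \<noteq> []" using n assms(4) by (auto simp: prod_eq_iff)
  then show False using uf_arrow_extend(1)[OF u(1,2) q(2) assms(4)[symmetric] e] u(3) by blast
 qed
qed

lemma chain_last_NT: "us \<in> chains Q W d \<Longrightarrow> last us \<in> NT"
 using chain_NT[of us d "last us"] chain_ends(1)[of us d] by simp

lemma isM_I:
 assumes b: "basis (us @ [w, z] @ vs)" and c: "us @ [w] \<in> chains Q W (length us)" and n: "path_prod [w, z] \<in> NT"
 shows "isM (us @ [w, z] @ vs)" "level (us @ [w, z] @ vs) = Suc (length us)"
  "mrg (us @ [w, z] @ vs) = us @ [path_prod [w, z]] @ vs"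
proof -
 let ?x = "us @ [w, z] @ vs"
 have w: "w \<in> NT" using chain_last_NT[OF c] by simp
 have "chn (Suc (length us)) ?x" using c by (simp add: chn_def)
 moreover have "\<not> chn (Suc (Suc (length us))) ?x"
 proof
  assume "chn (Suc (Suc (length us))) ?x"
  then have "(us @ [w]) @ [z] \<in> chains Q W (Suc (length us))" by (simp add: chn_def)
  then have "uf_arrow Q W w z" using chains_append[OF c, of z] by simp
  then show False using uf_arrow_pair(3)[OF w] n by blast
 qed
 ultimately show L: "level ?x = Suc (length us)" by (rule level_eq)
 show "mrg ?x = us @ [path_prod [w, z]] @ vs" unfolding mrg_def L by (simp add: nth_append)
 show "isM ?x" unfolding isM_def L using b n by (simp add: nth_append)
qed

lemma isM_E:
 assumes "isM xs"
 obtains us w z vs where "xs = us @ [w, z] @ vs" "basis xs" "us @ [w] \<in> chains Q W (length us)" "path_prod [w, z] \<in> NT"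
  "level xs = Suc (length us)" "mrg xs = us @ [path_prod [w, z]] @ vs"
proof -
 obtain j where j: "level xs = Suc j" "Suc j < length xs" using assms by (cases "level xs") (auto simp: isM_def)
 define us w z vs where "us = take j xs" and "w = xs ! j" and "z = xs ! Suc j" and "vs = drop (Suc (Suc j)) xs"
 have d: "drop j xs = [w, z] @ vs" using j by (simp add: w_def z_def vs_def Cons_nth_drop_Suc)
 have x: "xs = us @ [w, z] @ vs" using append_take_drop_id[of j xs] unfolding d us_def by simp
 have lu: "length us = j" using j by (simp add: us_def)
 have "take (Suc j) xs = us @ [w]" using j by (simp add: us_def w_def take_Suc_conv_app_nth)
 then have c: "us @ [w] \<in> chains Q W (length us)" using level(1)[of xs] j(1) lu by (simp add: chn_def)
 have b: "basis xs" and n: "path_prod [w, z] \<in> NT" using assms j by (simp_all add: isM_def w_def z_def)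
 show ?thesis using that[OF x b c n] isM_I[OF _ c n, of vs] b unfolding x[symmetric] by blast
qed

lemma pair_facts:
 assumes "basis (us @ [w, z] @ vs)"
 shows "w \<in> NT" "z \<in> NT" "composable Q [w, z]"
proof -
 have "basis [w, z]" by (rule basis_sub[OF assms])
 then show "w \<in> NT" "z \<in> NT" "composable Q [w, z]" unfolding basis_iff by simp_all
qed

text \<open>The merged letter properly extends \<open>w\<close>, so it neither continues the chain
  \<open>us\<close> nor has a nontip product with \<open>last us\<close>. The level drops by exactly
  one and no second merge is possible.\<close>

lemma mrg_facts:
 assumes "isM xs"
 shows "basis (mrg xs)" "Suc (length (mrg xs)) = length xs" "Suc (level (mrg xs)) = level xs"
  "\<not> isM (mrg xs)" "level (mrg xs) < length (mrg xs)" "mrg xs \<noteq> []"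
proof -
 obtain us w z vs where h: "xs = us @ [w, z] @ vs" "basis xs" "us @ [w] \<in> chains Q W (length us)"
  "path_prod [w, z] \<in> NT" "level xs = Suc (length us)" "mrg xs = us @ [path_prod [w, z]] @ vs"
  using assms by (rule isM_E)
 let ?p = "path_prod [w, z]"
 note pf = pair_facts[OF h(2)[unfolded h(1)]]
 have pq: "?p \<in> qpaths Q" "ptarget Q ?p = ptarget Q z" using composable_append_walk[OF pf(3)] by simp_all
 have pw: "fst ?p = fst w" "snd ?p = snd w @ snd z" "snd z \<noteq> []" using NT_nonempty[OF pf(2)] by (simp_all add: path_prod_pair)
 have cb: "composable Q (us @ [w, z] @ vs)" and sN: "set (us @ [w, z] @ vs) \<subseteq> NT"
  using h(2) unfolding h(1) basis_iff by blast+
 have "composable Q (us @ [?p] @ vs)" using cb pq(1) pw(1) pq(2) by (rule composable_merge)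
 then show "basis (mrg xs)" unfolding h(6) basis_iff using sN h(4) by simp
 show "Suc (length (mrg xs)) = length xs" "mrg xs \<noteq> []" unfolding h(6) by (simp_all add: h(1))
 have prefix: "us = [] \<or> us \<in> chains Q W (length us - 1) \<and> uf_arrow Q W (last us) w"
 proof (cases "us = []")
  case True
  then show ?thesis by (rule disjI1)
 next
  case False
  then have l: "Suc (length us - 1) = length us" by (cases us) simp_all
  have "take (length us) (us @ [w]) \<in> chains Q W (length us - 1)"
   by (intro chains_take[OF h(3)]) (use False in \<open>simp_all add: Suc_le_eq\<close>)
  moreover have "take (length us) (us @ [w]) = us" by simp
  ultimately have u: "us \<in> chains Q W (length us - 1)" by (simp only:)
  have "us @ [w] \<in> chains Q W (Suc (length us - 1))" unfolding l by (rule h(3))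
  then show ?thesis using u chains_append[OF u, of w] by blast
 qed
 have no: "\<not> uf_arrow Q W (last us) ?p" "path_prod [last us, ?p] \<notin> NT" if "us \<noteq> []"
 proof -
  have c: "us \<in> chains Q W (length us - 1)" "uf_arrow Q W (last us) w" using prefix that by blast+
  show "\<not> uf_arrow Q W (last us) ?p" "path_prod [last us, ?p] \<notin> NT"
   by (rule uf_arrow_extend[OF chain_last_NT[OF c(1)] c(2) pq(1) pw])+
 qed
 have 1: "chn (length us) (mrg xs)"
 proof (cases "us = []")
  case False
  then have "us \<in> chains Q W (length us - 1)" using prefix by blast
  then show ?thesis by (simp add: chn_def h(6))
 qed (simp add: chn_def)
 have 2: "\<not> chn (Suc (length us)) (mrg xs)"
 proof
  assume "chn (Suc (length us)) (mrg xs)"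
  then have c: "us @ [?p] \<in> chains Q W (length us)" by (simp add: chn_def h(6))
  show False
  proof (cases "us = []")
   case True
   have "?p \<in> arrow_path Q ` arcs Q" using chainsD(3)[OF c] unfolding True append_Nil nth_Cons_0 .
   then have "length (snd ?p) = 1" using arrow_path_iff[OF pq(1)] by blast
   then show False using pw(2,3) NT_nonempty[OF pf(1)] by (cases "snd w"; cases "snd z") auto
  next
   case False
   then have l: "Suc (length us - 1) = length us" by (cases us) simp_all
   have u: "us \<in> chains Q W (length us - 1)" using prefix False by blast
   have "us @ [?p] \<in> chains Q W (Suc (length us - 1))" unfolding l by (rule c)
   then show False using chains_append[OF u, of ?p] no(1)[OF False] by blast
  qed
 qed
 have L: "level (mrg xs) = length us" using 1 2 by (rule level_eq)
 show "Suc (level (mrg xs)) = level xs" "level (mrg xs) < length (mrg xs)" unfolding L by (simp_all add: h(5,6))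
 show "\<not> isM (mrg xs)"
 proof
  assume "isM (mrg xs)"
  then have ne: "us \<noteq> []" and pp: "path_prod [mrg xs ! (length us - 1), mrg xs ! length us] \<in> NT"
   unfolding isM_def L by auto
  have e: "mrg xs ! (length us - 1) = last us" "mrg xs ! length us = ?p"
   using ne by (simp_all add: h(6) nth_append last_conv_nth)
  show False using no(2)[OF ne] pp unfolding e by (rule notE)
 qed
qed

text \<open>The level tells where to cut. The first part of the merged letter is an arrow if it
  comes first, and otherwise is determined by the preceding letter through
  \<open>uf_arrow_unique\<close>.\<close>

lemma mrg_inj:
 assumes "isM xs" "isM xs'" "mrg xs = mrg xs'"
 shows "xs = xs'"
proof -
 obtain us w z vs where h: "xs = us @ [w, z] @ vs" "basis xs" "us @ [w] \<in> chains Q W (length us)"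
  "path_prod [w, z] \<in> NT" "level xs = Suc (length us)" "mrg xs = us @ [path_prod [w, z]] @ vs"
  using assms(1) by (rule isM_E)
 obtain us' w' z' vs' where h': "xs' = us' @ [w', z'] @ vs'" "basis xs'" "us' @ [w'] \<in> chains Q W (length us')"
  "path_prod [w', z'] \<in> NT" "level xs' = Suc (length us')" "mrg xs' = us' @ [path_prod [w', z']] @ vs'"
  using assms(2) by (rule isM_E)
 have "length us = length us'" 
  using mrg_facts(3)[OF assms(1)] mrg_facts(3)[OF assms(2)] unfolding assms(3) h(5) h'(5) by linarith
 then have e: "us' = us" "vs' = vs" "path_prod [w, z] = path_prod [w', z']" using assms(3) unfolding h(6) h'(6) by auto
 note f = pair_facts[OF h(2)[unfolded h(1)]] and f' = pair_facts[OF h'(2)[unfolded h'(1)]]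
 have p: "fst w = fst w'" "snd w @ snd z = snd w' @ snd z'" using e(3) by (simp_all add: path_prod_pair)
 have ww: "w = w'"
 proof (cases "us = []")
  case True
  have T': "us' = []" using True e(1) by simp
  have "w \<in> arrow_path Q ` arcs Q" using chainsD(3)[OF h(3)] unfolding True append_Nil nth_Cons_0 .
  then have l1: "length (snd w) = 1" using arrow_path_iff[OF NT_qpaths[OF f(1)]] by blast
  have "w' \<in> arrow_path Q ` arcs Q" using chainsD(3)[OF h'(3)] unfolding T' append_Nil nth_Cons_0 .
  then have "length (snd w') = 1" using arrow_path_iff[OF NT_qpaths[OF f'(1)]] by blast
  then have "length (snd w) = length (snd w')" using l1 by (simp only:)
  then show ?thesis using p by (simp add: prod_eq_iff)
 next
  case False
  then have l: "Suc (length us - 1) = length us" by (cases us) simp_all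
  have "take (length us) (us @ [w]) \<in> chains Q W (length us - 1)"
   by (intro chains_take[OF h(3)]) (use False in \<open>simp_all add: Suc_le_eq\<close>)
  moreover have "take (length us) (us @ [w]) = us" by simp
  ultimately have u: "us \<in> chains Q W (length us - 1)" by (simp only:)
  have "us @ [w] \<in> chains Q W (Suc (length us - 1))" "us @ [w'] \<in> chains Q W (Suc (length us - 1))"
   unfolding l using h(3) h'(3) unfolding e(1) by this+
  then have "uf_arrow Q W (last us) w" "uf_arrow Q W (last us) w'" using chains_append[OF u] by blast+
  then show ?thesis using uf_arrow_unique[OF chain_last_NT[OF u] _ _ p] by blast
 qed
 have "z = z'" using p f(3) f'(3) unfolding ww by (simp add: composable_pair prod_eq_iff)
 then show ?thesis using ww e h(1) h'(1) by simp
qed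

lemma chain_last_uf: "us \<in> chains Q W d \<Longrightarrow> last us \<in> uf_vertices Q W"
proof -
 assume c: "us \<in> chains Q W d"
 have l: "length us = Suc d" by (rule chain_length[OF c])
 have n: "last us = us ! d" using l by (cases us rule: rev_cases) (auto simp: nth_append)
 show ?thesis
 proof (cases d)
  case 0
  then show ?thesis using chainsD(3)[OF c] n by (simp add: uf_vertices_def)
 next
  case (Suc e)
  have a: "uf_arrow Q W (us ! e) (us ! Suc e)" using chainsD(5)[OF c, of e] Suc by simp
  have "us ! e \<in> NT" by (rule chain_NT[OF c]) (use l Suc in simp)
  then have "us ! e \<notin> trivial_paths Q" by blast
  from a[unfolded uf_arrow_nontrivial[OF this]] show ?thesis using n Suc by simp
 qed
qed

text \<open>The letter \<open>p\<close> after the maximal chain prefix has to be cut so that its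
  first part prolongs the chain.\<close>

lemma mrg_surj:
 assumes b: "basis s" and l: "level s < length s" and m: "\<not> isM s"
 shows "\<exists>xs. isM xs \<and> mrg xs = s"
proof -
 define j us p vs where "j = level s" and "us = take j s" and "p = s ! j" and "vs = drop (Suc j) s"
 have s: "s = us @ [p] @ vs" using l id_take_nth_drop[of j s] by (simp add: us_def p_def vs_def j_def)
 have lu: "length us = j" using l by (simp add: us_def j_def)
 have cs: "composable Q (us @ [p] @ vs)" and sN: "set (us @ [p] @ vs) \<subseteq> NT" using b unfolding s basis_iff by blast+
 have pN: "p \<in> NT" using sN by simp
 have pq: "p \<in> qpaths Q" by (rule NT_qpaths[OF pN])
 have notchn: "us @ [p] \<notin> chains Q W j"
 proof
  assume "us @ [p] \<in> chains Q W j"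
  then have "chn (Suc j) s" using lu by (simp add: chn_def s)
  then show False using level(2)[of "Suc j" s] by (simp add: j_def)
 qed
 have "\<exists>w z. us @ [w] \<in> chains Q W j \<and> z \<in> NT \<and> composable Q [w, z] \<and> path_prod [w, z] = p"
 \<comment> \<open>An empty prefix means that \<open>p\<close> is not an arrow; its first arrow is
   split off.\<close>
 proof (cases "j = 0")
  case True
  then have us: "us = []" using lu by simp
  obtain a as where a: "snd p = a # as" using NT_nonempty[OF pN] by (cases "snd p") auto
  have w: "walk (fst p) (a # as)" using pq a by (simp add: qpaths_walk)
  then have aa: "a \<in> arcs Q" "tail Q a = fst p" "walk (head Q a) as" by simp_all
  have c: "us @ [arrow_path Q a] \<in> chains Q W j" using arrow_chain[OF aa(1)] True us by simp
  have pp: "path_prod [arrow_path Q a, (head Q a, as)] = p" using a aa(2) by (simp add: path_prod_pair arrow_path_def prod_eq_iff)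
  have "as \<noteq> []"
  proof
   assume "as = []"
   then have "p = arrow_path Q a" using a aa(2) by (simp add: arrow_path_def prod_eq_iff)
   then show False using c notchn by simp
  qed
  have zq: "(head Q a, as) \<in> qpaths Q" using aa(3) by (simp add: qpaths_walk)
  have sb: "subpath Q (head Q a, as) p" unfolding subpath_iff using pq a by (intro conjI exI[of _ "[a]"] exI[of _ "[]"]) auto
  have "p \<in> nontip Q W" using pN by blast
  from nontip_subpath[OF this sb] have "(head Q a, as) \<in> nontip Q W" .
  then have "(head Q a, as) \<in> NT" using trivial_paths_iff[OF zq] \<open>as \<noteq> []\<close> by simp
  moreover have "composable Q [arrow_path Q a, (head Q a, as)]"
   using arrow_path_qpaths[OF aa(1)] zq by (simp add: composable_pair ptarget_tgt) (simp add: arrow_path_def)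
  ultimately show ?thesis using c pp by blast
 next
  case False
  have usc: "us \<in> chains Q W (j - 1)" using level(1)[of s] False by (simp add: chn_def us_def j_def)
  define u where "u = last us"
  have une: "us \<noteq> []" using lu False by auto
  have uN: "u \<in> NT" unfolding u_def by (rule chain_last_NT[OF usc])
  have sj: "s ! (j - 1) = u" using lu False by (simp add: s u_def nth_append last_conv_nth une)
  have upN: "path_prod [u, p] \<notin> NT" using m b l False unfolding isM_def j_def[symmetric] sj p_def[symmetric] by auto
  have nuf: "\<not> uf_arrow Q W u p"
   using notchn chains_append[OF usc, of p] pN False by (simp add: u_def)
  have "us = butlast us @ [u]" using une by (simp add: u_def)
  then have "us @ [p] @ vs = butlast us @ [u, p] @ vs" by (metis append.assoc append_Cons append_Nil)
  then have "basis (butlast us @ [u, p] @ vs)" using b s by metis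
  from pair_facts(3)[OF this] have cup: "composable Q [u, p]" .
  \<comment> \<open>As \<open>s\<close> cannot be merged, this path contains a tip. The first one to
    end starts in \<open>u\<close>, for \<open>p\<close> is a nontip, and the cut is made at its
    end.\<close>
  define x where "x = path_prod [u, p]"
  have xq: "x \<in> qpaths Q" unfolding x_def using composable_append_walk[OF cup] by blast
  interpret path_in_quiver Q W x by unfold_locales (rule xq)
  define k where "k = length (snd u)"
  have N: "N = k + length (snd p)" by (simp add: x_def k_def path_prod_pair)
  have kN: "0 < k" "k < N" using NT_nonempty[OF uN] NT_nonempty[OF pN] N by (simp_all add: k_def)
  have su: "sp x 0 k = u" by (simp add: sp_def x_def k_def path_prod_pair prod_eq_iff)
  have spp: "sp x k N = p"
   using cup by (simp add: sp_def x_def k_def path_prod_pair prod_eq_iff composable_pair ptarget_tgt)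
  have xN: "x \<notin> nontip Q W" using upN xq kN N trivial_paths_iff[OF xq] unfolding x_def[symmetric] by auto
  have r1: "re 0 \<le> N" using sp_nontip_iff[of 0 N] xN by (simp add: sp_all)
  have r2: "k < re 0" using sp_NT_iff[of 0 k] kN uN unfolding su by simp
  have r3: "N < re k" using sp_NT_iff[of k N] kN pN unfolding spp by simp
  have h0: "has 0" using re_le_has[OF r1] .
  have r4: "rs 0 < k"
  proof (rule ccontr)
   assume "\<not> rs 0 < k"
   then have "re k \<le> re 0" using re_least[of k "rs 0" "re 0"] has_rs[OF h0] by simp
   then show False using r1 r3 by simp
  qed
  have uv: "sp x 0 k \<in> uf_vertices Q W" unfolding su u_def by (rule chain_last_uf[OF usc])
  note U = uf_arrow_spI[OF kN(1) r2 r1 r4 uv]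
  \<comment> \<open>If the tip ended with \<open>p\<close>, then \<open>p\<close> itself would
    prolong the chain.\<close>
  have lt: "re 0 < N"
  proof (rule ccontr)
   assume "\<not> re 0 < N"
   then have "re 0 = N" using r1 by simp
   then show False using U(1) nuf unfolding su spp by (simp add: spp)
  qed
  have "re k \<le> re (re 0)" using e_mono[of k "re 0"] r2 by simp
  then have zN: "sp x (re 0) N \<in> NT" using sp_NT_iff[of "re 0" N] lt r3 by simp
  have "us @ [sp x k (re 0)] \<in> chains Q W (Suc (j - 1))"
   using chains_append[OF usc, of "sp x k (re 0)"] U(1,3) unfolding su u_def by blast
  then have c: "us @ [sp x k (re 0)] \<in> chains Q W j" using False by simp
  have "composable Q [sp x k (re 0), sp x (re 0) N]"
   using NT_qpaths[OF U(3)] NT_qpaths[OF zN] ptarget_sp[of k "re 0" x N] r2 by (simp add: composable_pair)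
  moreover have "path_prod [sp x k (re 0), sp x (re 0) N] = p"
   using sp_prod[of k "re 0" N] r2 r1 spp by simp
  ultimately show ?thesis using c zN by blast
 qed
 then obtain w z where wz: "us @ [w] \<in> chains Q W j" "z \<in> NT" "composable Q [w, z]" "path_prod [w, z] = p" by blast
 have wN: "w \<in> NT" using chain_last_NT[OF wz(1)] by simp
 have "composable Q (us @ [w, z] @ vs)"
 proof (rule composable_split[OF cs NT_qpaths[OF wN] NT_qpaths[OF wz(2)]])
  show "ptarget Q w = fst z" using wz(3) by (simp add: composable_pair)
  show "fst w = fst p" unfolding wz(4)[symmetric] by (simp add: path_prod_pair)
  show "ptarget Q z = ptarget Q p" unfolding wz(4)[symmetric] using composable_append_walk[OF wz(3)] by simp
 qed
 then have B: "basis (us @ [w, z] @ vs)" unfolding basis_iff using sN wN wz(2) by simp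
 have "us @ [w] \<in> chains Q W (length us)" using wz(1) lu by simp
 from isM_I[OF B this] show ?thesis using pN wz(4) s by auto
qed

text \<open>Triangularity of the matching with respect to the level: among all merges in the
  differential only the matched one can count.\<close>

lemma dd_merge:
 assumes m: "isM xs" and x: "\<And>v. level xs \<le> level v \<Longrightarrow> x v = 0"
 shows "dd x xs = (-1) ^ level xs * x (mrg xs)"
proof -
 obtain us w z vs where h: "xs = us @ [w, z] @ vs" "basis xs" "us @ [w] \<in> chains Q W (length us)"
  "path_prod [w, z] \<in> NT" "level xs = Suc (length us)" "mrg xs = us @ [path_prod [w, z]] @ vs"
  using m by (rule isM_E)
 let ?l = "Suc (length us)"
 note pf = pair_facts[OF h(2)[unfolded h(1)]]
 have sN: "set xs \<subseteq> NT" and cx': "composable Q xs" using h(2) unfolding basis_iff by blast+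
 \<comment> \<open>Inside the chain prefix consecutive letters have product 0: it contains a tip,
   and it is not a non monomial tip because another letter follows. Merges further right leave the
   prefix intact, so the level does not drop and \<open>x\<close> vanishes there.\<close>
 have z: "ev [x] (mg i xs) = 0" if i: "i \<in> {1..<length xs} - {?l}" for i
 proof (cases "i < ?l")
  case True
  obtain k where k: "i = Suc k" "k < length us" using i True by (cases i) auto
  let ?a = "xs ! k" and ?b = "xs ! Suc k" and ?c = "xs ! Suc (Suc k)"
  have lx: "Suc (Suc k) < length xs" using k by (simp add: h(1))
  have ab: "?a = (us @ [w]) ! k" "?b = (us @ [w]) ! Suc k" using k by (auto simp: h(1) nth_append)
  have uf: "uf_arrow Q W ?a ?b" unfolding ab by (rule chainsD(5)[OF h(3) k(2)])
  have N: "?a \<in> NT" "?b \<in> NT" "?c \<in> NT" by (rule subsetD[OF sN], use lx in simp)+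
  note u = uf_arrow_pair[OF N(1) uf]
  have cbc: "ptarget Q ?b = fst ?c" using cx' lx by (simp add: composable_def)
  have "path_prod [?a, ?b] \<notin> tips"
  proof
   assume t: "path_prod [?a, ?b] \<in> tips"
   have "composable Q [path_prod [?a, ?b], ?c]"
    using composable_append_walk[OF u(1)] cbc NT_qpaths[OF N(3)] by (simp add: composable_pair)
   then show False by (rule B4_left[OF tips_B4[OF t] N(3)])
  qed
  then have "nf (path_prod [?a, ?b]) = 0" by (rule nf_0[OF u(3)])
  then have "mul ?a ?b = 0" by (simp add: mul_def)
  then show ?thesis by (simp add: ev_mg k(1))
 next
  case False
  then have i2: "?l \<le> i - 1" "i < length xs" using i by auto
  have "x (take (i - 1) xs @ [c] @ drop (i + 1) xs) = 0" for c
  proof (rule x)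
   have "take ?l (take (i - 1) xs @ [c] @ drop (i + 1) xs) = us @ [w]"
    using i2 by (simp add: h(1) min_absorb1)
   moreover have "?l \<le> length (take (i - 1) xs @ [c] @ drop (i + 1) xs)" using i2 by simp
   ultimately have "chn ?l (take (i - 1) xs @ [c] @ drop (i + 1) xs)" using h(3) by (simp only: chn_def diff_Suc_1) simp
   then show "level xs \<le> level (take (i - 1) xs @ [c] @ drop (i + 1) xs)" unfolding h(5) by (rule level(2))
  qed
  then show ?thesis unfolding ev_mg by simp
 qed
 have "nf (path_prod [w, z]) = Poly_Mapping.single (path_prod [w, z]) 1" by (rule nf_NT[OF h(4)])
 then have mwz: "mul w z = Poly_Mapping.single (path_prod [w, z]) 1" using pf unfolding mul_def by simp
 have "xs ! length us = w" "xs ! ?l = z" "take (length us) xs = us" "drop (Suc ?l) xs = vs" by (simp_all add: h(1) nth_append)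
 then have e: "ev [x] (mg ?l xs) = x (mrg xs)" unfolding ev_mg h(6) by (simp add: mwz)
 have "dd x xs = (\<Sum>i\<in>{?l}. (-1) ^ i * ev [x] (mg i xs))"
  unfolding dd_def by (rule sum.mono_neutral_right) (use z in \<open>auto simp: h(1)\<close>)
 then show ?thesis using e h(5) by simp
qed

lemma dd_add: "dd (\<lambda>v. x v + y v) xs = dd x xs + dd y xs"
 by (simp add: dd_def ev_mg distrib_left sum.distrib)

lemma dd_scale: "dd (\<lambda>v. c * y v) xs = c * dd y xs"
 by (simp add: dd_def ev_mg sum_distrib_left mult.left_commute)

lemma dd_length: "(\<And>v. x v \<noteq> 0 \<Longrightarrow> length v = n) \<Longrightarrow> dd x xs \<noteq> 0 \<Longrightarrow> length xs = Suc n"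
proof (rule ccontr)
 assume x: "\<And>v. x v \<noteq> 0 \<Longrightarrow> length v = n" and d: "dd x xs \<noteq> 0" and n: "length xs \<noteq> Suc n"
 have "ev [x] (mg i xs) = 0" if i: "i \<in> {1..<length xs}" for i
 proof -
  have "x (take (i - 1) xs @ [c] @ drop (i + 1) xs) = 0" for c
  proof (rule ccontr)
   assume "x (take (i - 1) xs @ [c] @ drop (i + 1) xs) \<noteq> 0"
   then have "length (take (i - 1) xs @ [c] @ drop (i + 1) xs) = n" by (rule x)
   then show False using n i by auto
  qed
  then show ?thesis unfolding ev_mg by simp
 qed
 then show False using d by (simp add: dd_def)
qed

text \<open>The triangular system is solved from the highest level downwards; by
  \<open>dd_merge\<close> a correction made for one level does not disturb the higher ones.\<close>

lemma dd_fill: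
 "\<exists>x. (\<forall>v. x v \<noteq> x0 v \<longrightarrow> length v = n \<and> (\<exists>xs. isM xs \<and> mrg xs = v)) \<and>
   (\<forall>xs. isM xs \<longrightarrow> length xs = Suc n \<longrightarrow> dd x xs = t xs)"
proof -
 have "\<exists>x. (\<forall>v. x v \<noteq> x0 v \<longrightarrow> length v = n \<and> (\<exists>xs. isM xs \<and> mrg xs = v)) \<and>
   (\<forall>xs. isM xs \<longrightarrow> length xs = Suc n \<longrightarrow> Suc n \<le> level xs + m \<longrightarrow> dd x xs = t xs)" for m
 proof (induction m)
  case 0
  have "\<not> Suc n \<le> level xs + 0" if "isM xs" "length xs = Suc n" for xs using that by (simp add: isM_def)
  then show ?case by (intro exI[of _ x0]) blast
 next
  case (Suc m)
  then obtain x where x: "\<And>v. x v \<noteq> x0 v \<Longrightarrow> length v = n \<and> (\<exists>xs. isM xs \<and> mrg xs = v)"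
   "\<And>xs. isM xs \<Longrightarrow> length xs = Suc n \<Longrightarrow> Suc n \<le> level xs + m \<Longrightarrow> dd x xs = t xs" by blast
  define A where "A v xs \<longleftrightarrow> isM xs \<and> mrg xs = v \<and> length xs = Suc n \<and> level xs + Suc m = Suc n" for v xs
  \<comment> \<open>The remaining defect is placed on the merged word, with the sign that
    \<open>dd_merge\<close> will cancel. \<open>mrg_inj\<close> makes \<open>SOME\<close>
    unambiguous.\<close>
  define c where "c v = (if \<exists>xs. A v xs then (let xs = (SOME xs. A v xs) in (-1) ^ level xs * (t xs - dd x xs)) else 0)" for v
  have cA: "c (mrg xs) = (-1) ^ level xs * (t xs - dd x xs)" if "A (mrg xs) xs" for xs
  proof -
   have "(SOME ys. A (mrg xs) ys) = xs"
   proof (rule some_equality[of "A (mrg xs)" xs, OF that])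
    fix ys assume "A (mrg xs) ys"
    then show "ys = xs" using that mrg_inj[of ys xs] by (simp add: A_def)
   qed
   moreover have "\<exists>ys. A (mrg xs) ys" using that by (rule exI)
   ultimately show ?thesis unfolding c_def Let_def by simp
  qed
  have c0: "\<exists>xs. A v xs" if "c v \<noteq> 0" for v using that by (auto simp: c_def split: if_splits)
  have "dd (\<lambda>v. x v + c v) xs = t xs" if h: "isM xs" "length xs = Suc n" "Suc n \<le> level xs + Suc m" for xs
  proof -
   have "dd c xs = (-1) ^ level xs * c (mrg xs)"
   proof (rule dd_merge[OF h(1)], rule ccontr)
    fix v assume v: "level xs \<le> level v" "c v \<noteq> 0"
    then obtain ys where "A v ys" using c0 by blast
    then have "Suc (level v) = level ys" "level ys + Suc m = Suc n" using mrg_facts(3)[of ys] by (auto simp: A_def)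
    then show False using v(1) h(3) by linarith
   qed
   also have "\<dots> = t xs - dd x xs"
   proof (cases "Suc n \<le> level xs + m")
    case True
    have "c (mrg xs) = 0"
    proof (rule ccontr)
     assume "c (mrg xs) \<noteq> 0"
     then obtain ys where "A (mrg xs) ys" using c0 by blast
     then have "ys = xs" "level ys + Suc m = Suc n" using mrg_inj[of ys xs] h(1) by (auto simp: A_def)
     then show False using True by simp
    qed
    then show ?thesis using x(2)[OF h(1,2) True] by simp
   next
    case False
    then have "A (mrg xs) xs" using h by (simp add: A_def)
    then show ?thesis using cA by (simp flip: mult.assoc power_add)
   qed
   finally show ?thesis by (simp add: dd_add)
  qed
  moreover have "length v = n \<and> (\<exists>xs. isM xs \<and> mrg xs = v)" if "x v + c v \<noteq> x0 v" for v
  proof (cases "c v = 0")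
   case True
   then show ?thesis using x(1)[of v] that by simp
  next
   case False
   then obtain ys where "A v ys" using c0 by blast
   then show ?thesis using mrg_facts(2)[of ys] by (auto simp: A_def)
  qed
  ultimately show ?case by (intro exI[of _ "\<lambda>v. x v + c v"]) blast
 qed
 from this[of "Suc n"] show ?thesis by simp
qed

text \<open>Uniqueness for the same triangular system: a word that is neither mergeable nor a chain
  is the merge of some \<open>xs\<close>, and the equation at \<open>xs\<close> determines its value
  from higher levels.\<close>

lemma dd_zero:
 assumes x: "\<And>v. x v \<noteq> 0 \<Longrightarrow> basis v \<and> length v = n"
  and M: "\<And>v. isM v \<Longrightarrow> x v = 0" and C: "\<And>v. level v = length v \<Longrightarrow> x v = 0"
  and d: "\<And>xs. isM xs \<Longrightarrow> dd x xs = 0"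
 shows "x v = 0"
proof (induction "n - level v" arbitrary: v rule: less_induct)
 case less
 show ?case
 proof (rule ccontr)
  assume nz: "x v \<noteq> 0"
  have v: "basis v" "length v = n" "\<not> isM v" "level v \<noteq> length v" using x[OF nz] M[of v] C[of v] nz by auto
  then have l: "level v < length v" using level_le[of v] by simp
  obtain xs where xs: "isM xs" "mrg xs = v" using mrg_surj[OF v(1) l v(3)] by blast
  have L: "level xs = Suc (level v)" using mrg_facts(3)[OF xs(1)] xs(2) by simp
  have "dd x xs = (-1) ^ level xs * x (mrg xs)"
  proof (rule dd_merge[OF xs(1)])
   fix v' assume "level xs \<le> level v'"
   then show "x v' = 0" using L l v(2) by (intro less) linarith
  qed
  then show False using d[OF xs(1)] xs(2) nz by simp
 qed
qed

text \<open>Minimality: a single factor of degree one less would leave the last letter of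
  \<open>\<gamma>\<close> without arrows, and branches in relations have length at least 2.\<close>

lemma \<delta>T_length: "FW w \<in> keys (\<delta>T \<gamma>) \<Longrightarrow> length w \<noteq> 1"
proof
 assume w: "FW w \<in> keys (\<delta>T \<gamma>)" and "length w = 1"
 then obtain g where g: "w = [g]" by (auto simp: length_Suc_conv)
 from w show False
 proof (cases rule: keys_\<delta>T)
  case 1
  obtain d where c: "\<gamma> \<in> chains Q W d" using decs_chain(1)[OF 1] by blast
  have dg: "deg g + 1 = d" using decs_deg[OF 1] chain_length[OF c] by (simp add: g)
  then have c': "\<gamma> \<in> chains Q W (Suc (deg g))" using c by simp
  have "g # [] \<in> decs \<gamma> \<longleftrightarrow> g = butlast \<gamma> \<and> [] = arrows (last \<gamma>)"
   by (rule decs_prefix[OF c']) (use decs_chain(2)[OF 1] in auto)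
  then have "arrows (last \<gamma>) = []" using 1 g by simp
  then show False using NT_nonempty[OF chain_last_NT[OF c]] by (simp add: arrows_def)
 next
  case (2 i b)
  have "length w = length (snd b)" unfolding 2(5) by (simp add: arrows_def)
  then show False using B4_length[OF 2(3)] unfolding g by simp
 qed
qed

lemma ev_\<delta>T_1: "ev [y] (\<delta>T \<gamma>) = 0"
 unfolding ev_def
proof (intro sum.neutral ballI)
 fix v assume "v \<in> keys (\<delta>T \<gamma>)"
 then have "FW (fwl v) \<in> keys (\<delta>T \<gamma>)" by simp
 then have "length (fwl v) \<noteq> 1" by (rule \<delta>T_length)
 then have "evw [y] (fwl v) = 0" by (intro evw_length) simp
 then show "lookup (\<delta>T \<gamma>) v * evw [y] (fwl v) = 0" by simp
qed

lemma mT_1: "mT 1 [y] = 0"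
proof
 fix \<gamma>
 have "evw [y] (fwl v) = 0" if "v \<in> keys (\<delta>T \<gamma>)" for v
 proof -
  have "FW (fwl v) \<in> keys (\<delta>T \<gamma>)" using that by simp
  then have "length (fwl v) \<noteq> 1" by (rule \<delta>T_length)
  then show ?thesis by (intro evw_length) simp
 qed
 then show "mT 1 [y] \<gamma> = 0 \<gamma>" by (simp add: tw_def)
qed

lemma ev_singles:
 assumes A: "finite A" and p: "\<And>Z. coef p [Z] \<noteq> 0 \<Longrightarrow> Z \<in> A"
 shows "ev [x] p = (\<Sum>Z\<in>A. coef p [Z] * x Z)"
proof -
 let ?K = "(\<lambda>Z. FW [Z]) ` A"
 have "ev [x] p = (\<Sum>w\<in>keys p \<union> ?K. lookup p w * evw [x] (fwl w))"
  unfolding ev_def using A by (intro sum.mono_neutral_left) (auto simp: in_keys_iff)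
 also have "\<dots> = (\<Sum>w\<in>?K. lookup p w * evw [x] (fwl w))"
 proof (rule sum.mono_neutral_right)
  show "\<forall>w\<in>keys p \<union> ?K - ?K. lookup p w * evw [x] (fwl w) = 0"
  proof
   fix w assume w: "w \<in> keys p \<union> ?K - ?K"
   show "lookup p w * evw [x] (fwl w) = 0"
   proof (cases "length (fwl w) = 1")
    case True
    then obtain Z where "fwl w = [Z]" by (auto simp: length_Suc_conv)
    then have "w = FW [Z]" by (cases w) simp
    then show ?thesis using w p[of Z] by (auto simp: in_keys_iff)
   next
    case False
    then have "evw [x] (fwl w) = 0" by (intro evw_length) simp
    then show ?thesis by simp
   qed
  qed
 qed (use A in auto)
 also have "\<dots> = (\<Sum>Z\<in>A. coef p [Z] * x Z)"
  by (subst sum.reindex) (auto simp: inj_on_def)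
 finally show ?thesis .
qed

text \<open>The two letters multiply to \<open>b\<close>, a nontip, so the extra terms in
  \<open>coef_G_tip\<close> are matched words.\<close>

lemma split_isM:
 assumes i: "i < r" and \<rho>: "\<rho> i b \<noteq> 0" "b \<noteq> tip i"
 shows "isM (split_chain Q b)"
proof -
 have bB: "b \<in> set B4" using \<rho>_B4[OF \<rho>(1) i] .
 obtain a as where a: "snd b = a # as" using B4_length[OF bB] by (cases "snd b") auto
 have w: "walk (fst b) (a # as)" using B4_branch[OF bB] qpaths_walk[of b] a by simp
 then have aa: "a \<in> arcs Q" "walk (head Q a) as" by simp_all
 have zN: "(head Q a, as) \<in> NT" by (rule rest_NT[OF i \<rho>(1) a])
 have sc: "split_chain Q b = [] @ [arrow_path Q a, (head Q a, as)] @ []" by (simp add: split_chain_def a)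
 have "composable Q [arrow_path Q a, (head Q a, as)]"
  using arrow_path_qpaths[OF aa(1)] NT_qpaths[OF zN] by (simp add: composable_pair ptarget_tgt) (simp add: arrow_path_def)
 then have B: "basis ([] @ [arrow_path Q a, (head Q a, as)] @ [])"
  unfolding basis_iff using arrow_nontip[OF aa(1)] zN by simp
 have "[] @ [arrow_path Q a] \<in> chains Q W (length ([] :: ('v, 'e) qpath list))" using arrow_chain[OF aa(1)] by simp
 moreover have "path_prod [arrow_path Q a, (head Q a, as)] \<in> NT"
  using path_prod_split_chain[OF bB] \<rho>_NT[OF i \<rho>] unfolding sc by simp
 ultimately show ?thesis unfolding sc by (rule isM_I(1)[OF B])
qed

text \<open>On functionals that vanish on mergeable words the linear part of \<open>G\<close> is
  diagonal: the additional terms for a tip are mergeable by \<open>split_isM\<close>.\<close>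

lemma ev_G:
 assumes c: "\<gamma> \<in> chains Q W d" and M: "\<And>v. isM v \<Longrightarrow> x v = 0"
 shows "ev [x] (G \<gamma>) = (-1) ^ d * x \<gamma>"
proof (cases "\<exists>b\<in>tips. subpath Q b (path_prod \<gamma>)")
 case False
 then have cf: "coef (G \<gamma>) [Z] = (if Z = \<gamma> then (-1) ^ d else 0)" for Z using coef_G_mono[OF c] by blast
 have "ev [x] (G \<gamma>) = (\<Sum>Z\<in>{\<gamma>}. coef (G \<gamma>) [Z] * x Z)"
  by (rule ev_singles) (auto simp: cf split: if_splits)
 then show ?thesis by (simp add: cf)
next
 case True
 then obtain b where b: "b \<in> tips" "subpath Q b (path_prod \<gamma>)" by blast
 obtain i where i: "i < r" "b = tip i" using b(1) by (auto simp: tips_def)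
 have d: "d = 1" "\<gamma> = split_chain Q (tip i)" using chain_tip[OF c b] i by simp_all
 have cf: "coef (G \<gamma>) [Z] = - (\<Sum>b\<in>set B4. if Z = split_chain Q b then \<rho> i b else 0)" for Z
  unfolding d(2) by (rule coef_G_tip[OF i(1)])
 have "ev [x] (G \<gamma>) = (\<Sum>Z\<in>split_chain Q ` set B4. coef (G \<gamma>) [Z] * x Z)"
 proof (rule ev_singles)
  fix Z assume nz: "coef (G \<gamma>) [Z] \<noteq> 0"
  show "Z \<in> split_chain Q ` set B4"
  proof (rule ccontr)
   assume "Z \<notin> split_chain Q ` set B4"
   then have "coef (G \<gamma>) [Z] = - (\<Sum>b\<in>set B4. 0)" unfolding cf by (intro arg_cong[where f = uminus] sum.cong) auto
   then show False using nz by simp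
  qed
 qed simp
 also have "\<dots> = - (\<Sum>Z\<in>split_chain Q ` set B4. \<Sum>b\<in>set B4. if Z = split_chain Q b then \<rho> i b * x (split_chain Q b) else 0)"
  unfolding cf minus_mult_left[symmetric] sum_negf sum_distrib_right by (intro arg_cong[where f = uminus] sum.cong) auto
 also have "\<dots> = - (\<Sum>b\<in>set B4. \<rho> i b * x (split_chain Q b))"
  by (subst sum.swap) (simp add: sum.delta)
 also have "(\<Sum>b\<in>set B4. \<rho> i b * x (split_chain Q b)) = (\<Sum>b\<in>{tip i}. \<rho> i b * x (split_chain Q b))"
 proof (rule sum.mono_neutral_right)
  show "\<forall>b\<in>set B4 - {tip i}. \<rho> i b * x (split_chain Q b) = 0"
  proof
   fix b assume "b \<in> set B4 - {tip i}"
   then show "\<rho> i b * x (split_chain Q b) = 0" using split_isM[OF i(1), of b] M by (cases "\<rho> i b = 0") auto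
  qed
 qed (use tip_B4[OF i(1)] in auto)
 finally show ?thesis using \<rho>_tip[OF i(1) i(1)] by (simp add: d)
qed

lemma ev_Gc:
 assumes "\<And>v. isM v \<Longrightarrow> x v = 0"
 shows "ev [x] (Gc \<gamma>) = (if \<gamma> \<in> chains Q W (deg \<gamma>) then (-1) ^ deg \<gamma> * x \<gamma> else 0)"
proof (cases "\<gamma> \<in> chains Q W (deg \<gamma>)")
 case True
 then show ?thesis using ev_G[OF True assms] by (simp add: Gc_def)
qed (simp add: Gc_def ev_simps)

lemma fT_1: "supp_deg d x \<Longrightarrow> fT 1 [x] \<gamma> = - ev [x] (Gc \<gamma>)"
proof (cases "ev [x] (Gc \<gamma>) = 0")
 case False
 assume s: "supp_deg d x"
 then have l: "list_all2 supp_deg [d] [x]" by simp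
 have "int (length \<gamma>) = d" using supp_deg_ev[OF Gc(2) l, of 1] False by (simp add: supp_deg_def)
 then have "eps [d] + (\<Sum>d\<leftarrow>[d]. lbar d) + lext (int (length \<gamma>)) - 1 = 2 * lbar d" by (simp add: lext_def)
 then have "(-1 :: 'k) powi (eps [d] + (\<Sum>d\<leftarrow>[d]. lbar d) + lext (int (length \<gamma>))) = (-1) powi 1" by (rule powi_parity)
 then show ?thesis unfolding tw_eq[OF l] by simp
next
 case True
 assume "supp_deg d x"
 then have l: "list_all2 supp_deg [d] [x]" by simp
 show ?thesis unfolding tw_eq[OF l] True by simp
qed

section \<open>Cohomology: the linear part is injective and surjective\<close>

definition cob :: "(('v, 'e) qpath list \<Rightarrow> 'k) \<Rightarrow> ('v, 'e) qpath list \<Rightarrow> 'k" where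
 "cob y g = ev [y] (\<delta>bar g)"

lemma cob_eq: "cob y g = (if basis g then - dd y g else 0)"
 by (simp add: cob_def \<delta>bar_def ev_\<delta>B_1 ev_simps)

lemma splits_1: "{(r, u, t). r + u + t = Suc 0 \<and> Suc 0 \<le> u} = {(0, Suc 0, 0)}"
 by auto

lemma ev_der_1: "supp_deg d y \<Longrightarrow> ev [y] (der deg \<delta>bar q) = ev [cob y] q"
 using ev_der[of "[d]" "[y]" \<delta>bar q] \<delta>bar(1) by (simp add: splits_1 cob_def[abs_def])

lemma dd_cob: "supp_deg d y \<Longrightarrow> basis xs \<Longrightarrow> dd (cob y) xs = 0"
proof -
 assume "supp_deg d y" "basis xs"
 then have "- dd (cob y) xs = ev [y] (der deg \<delta>bar (\<delta>bar xs))"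
  unfolding ev_der_1[OF \<open>supp_deg d y\<close>] by (simp add: \<delta>bar_def ev_\<delta>B_1)
 then show ?thesis by (simp add: \<delta>bar_sq ev_simps)
qed

text \<open>The morphism property rewrites this as the linear part of
  \<open>ahom Gc (\<delta>T \<gamma>)\<close>, and \<open>\<delta>T\<close> has no linear
  part.\<close>

lemma ev_cob_Gc: "supp_deg d y \<Longrightarrow> ev [cob y] (Gc \<gamma>) = 0"
proof -
 assume s: "supp_deg d y"
 have "compositions (Suc 0) = {[Suc 0]}" by (simp add: compositions_Suc compositions_0)
 then have "ev [y] (ahom Gc (\<delta>T \<gamma>)) = 0"
  using ev_ahom[of Gc "[y]" "\<delta>T \<gamma>"] Gc(1) by (simp add: ev_\<delta>T_1)
 then show ?thesis using ev_der_1[OF s, of "Gc \<gamma>"] by (simp add: Gc_comm)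
qed

lemma ev_diff_1: "ev [\<lambda>v. x v - y v] p = ev [x] p - ev [y] p"
proof -
 have "evw [\<lambda>v. x v - y v] w = evw [x] w - evw [y] w" for w
  by (cases w; cases "tl w") (auto simp: left_diff_distrib)
 then show ?thesis by (simp add: ev_def right_diff_distrib sum_subtractf)
qed

lemma isM_basis: "isM v \<Longrightarrow> basis v" and isM_level: "isM v \<Longrightarrow> level v \<noteq> length v"
 by (auto simp: isM_def)

lemma level_chain: "v \<noteq> [] \<Longrightarrow> level v = length v \<Longrightarrow> v \<in> chains Q W (deg v)"
 using level(1)[of v] by (simp add: chn_def)

lemma chain_level: "v \<in> chains Q W d \<Longrightarrow> level v = length v"
proof -
 assume c: "v \<in> chains Q W d"
 have "chn (length v) v" using c chain_length[OF c] by (simp add: chn_def)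
 then show ?thesis using level(2) level_le[of v] by (simp add: le_antisym)
qed

lemma chain_basis: "v \<in> chains Q W d \<Longrightarrow> basis v"
 using chainsD(2,4) by (simp add: basis_iff)

lemma bar_dual_supp: "x \<in> bar_dual Q W d \<Longrightarrow> supp_deg d x"
 unfolding bar_dual_def by (rule supp_deg_dual[of "bar_basis Q W"]) (auto simp: bar_basis_length)

lemma ext_supp: "x \<in> ext_space Q W d \<Longrightarrow> supp_deg d x"
 unfolding ext_space_def by (rule supp_deg_dual[of "\<lambda>n. chains Q W (n - 1)"]) (auto simp: chains_length1)

lemma bar_dual_basis: "x \<in> bar_dual Q W d \<Longrightarrow> x v \<noteq> 0 \<Longrightarrow> basis v"
 using bar_basis_length by (auto simp: bar_dual_def dual_space_def split: if_splits)

lemma ext_chain: "y \<in> ext_space Q W d \<Longrightarrow> y v \<noteq> 0 \<Longrightarrow> v \<in> chains Q W (deg v)"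
 using chain_length[of v "nat d - 1"] by (auto simp: ext_space_def dual_space_def split: if_splits)

lemma zero_dual: "0 \<in> dual_space X d"
 by (auto simp: dual_space_def)

lemma ops_1: "bar_dual_ops Q I W 1 [x] = bar_dual_diff Q I W x"
 by (simp add: bar_dual_ops_def)

text \<open>Only values at merged words are changed, so \<open>y0\<close> survives on chains and on
  mergeable words.\<close>

lemma cob_fill:
 "\<exists>y. (\<forall>v. y v \<noteq> y0 v \<longrightarrow> length v = n \<and> v \<noteq> [] \<and> basis v \<and> \<not> isM v \<and> level v \<noteq> length v) \<and>
   (\<forall>xs. isM xs \<longrightarrow> length xs = Suc n \<longrightarrow> cob y xs = t xs)"
proof -
 obtain y where y: "\<And>v. y v \<noteq> y0 v \<Longrightarrow> length v = n \<and> (\<exists>xs. isM xs \<and> mrg xs = v)"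
  "\<And>xs. isM xs \<Longrightarrow> length xs = Suc n \<Longrightarrow> dd y xs = - t xs"
  using dd_fill[of y0 n "\<lambda>xs. - t xs"] by blast
 have "length v = n \<and> v \<noteq> [] \<and> basis v \<and> \<not> isM v \<and> level v \<noteq> length v" if v: "y v \<noteq> y0 v" for v
 proof -
  have lv: "length v = n" using y(1)[OF v] by (rule conjunct1)
  obtain xs where xs: "isM xs" "mrg xs = v" using y(1)[OF v] by (elim conjE exE) (rule that)
  show ?thesis using lv mrg_facts(1,4,5,6)[OF xs(1)] unfolding xs(2) by (intro conjI; (assumption | simp))
 qed
 note c1 = this
 have c2: "cob y xs = t xs" if "isM xs" "length xs = Suc n" for xs
  using y(2)[OF that] isM_basis[OF that(1)] by (simp add: cob_eq)
 show ?thesis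
 proof (rule exI[of _ y], rule conjI)
  show "\<forall>v. y v \<noteq> y0 v \<longrightarrow> length v = n \<and> v \<noteq> [] \<and> basis v \<and> \<not> isM v \<and> level v \<noteq> length v"
   by (intro allI impI) (rule c1)
  show "\<forall>xs. isM xs \<longrightarrow> length xs = Suc n \<longrightarrow> cob y xs = t xs" by (intro allI impI) (rule c2)
 qed
qed

text \<open>A coboundary \<open>cob y\<close> is chosen to agree with \<open>x\<close> on mergeable
  words. The difference is a cocycle that vanishes there, and on chains because \<open>fT 1\<close>
  kills it; \<open>dd_zero\<close> applies.\<close>

lemma cohomology_injective:
 assumes x: "x \<in> bar_dual Q W d" and c: "bar_dual_ops Q I W 1 [x] = 0" and f: "fT 1 [x] = 0"
 shows "\<exists>y\<in>bar_dual Q W (d - 1). x = bar_dual_ops Q I W 1 [y]"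
proof (cases "1 \<le> d")
 case False
 then have x0: "x = 0" using x by (auto simp: bar_dual_def dual_space_def)
 have "dd 0 g = 0" for g using dd_scale[of 0 0 g] by (simp add: zero_fun_def)
 then have o: "bar_dual_ops Q I W 1 [0] = 0" unfolding ops_1 by (auto simp: bar_dual_diff_eq fun_eq_iff)
 have "0 \<in> bar_dual Q W (d - 1)" unfolding bar_dual_def by (rule zero_dual)
 then show ?thesis unfolding x0 using o[symmetric] by (intro bexI[of _ 0])
next
 case True
 define n where "n = nat d - 1"
 have d: "d = int (Suc n)" using True by (simp add: n_def)
 have xl: "length v = Suc n" "basis v" if "x v \<noteq> 0" for v
  using bar_dual_supp[OF x] bar_dual_basis[OF x that] that by (auto simp: supp_deg_def d)
 obtain y where y: "\<And>v. y v \<noteq> 0 \<Longrightarrow> length v = n \<and> v \<noteq> [] \<and> basis v \<and> \<not> isM v \<and> level v \<noteq> length v"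
  "\<And>xs. isM xs \<Longrightarrow> length xs = Suc n \<Longrightarrow> cob y xs = x xs"
  using cob_fill[of "\<lambda>v. 0" n x] by blast
 have sy: "supp_deg (int n) y" using y(1) by (auto simp: supp_deg_def)
 have cl: "length v = Suc n" "basis v" if "cob y v \<noteq> 0" for v
  using that dd_length[of y n v] y(1) by (auto simp: cob_eq split: if_splits)
 have dx: "dd x xs = 0" if "basis xs" for xs
 proof -
  have "bar_dual_diff Q I W x xs = 0" using c unfolding ops_1 by simp
  then show ?thesis using that by (simp add: bar_dual_diff_eq)
 qed
 define z where "z v = x v - cob y v" for v
 have zM: "z v = 0" if "isM v" for v
 proof (cases "length v = Suc n")
  case True
  then show ?thesis using y(2)[OF that True] by (simp add: z_def)
 next
  case False
  then show ?thesis using xl(1)[of v] cl(1)[of v] by (cases "x v = 0"; cases "cob y v = 0") (auto simp: z_def)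
 qed
 have ez: "ev [z] (Gc \<gamma>) = 0" for \<gamma>
 proof -
  have "ev [x] (Gc \<gamma>) = 0" using fT_1[OF bar_dual_supp[OF x], of \<gamma>] f by simp
  then show ?thesis unfolding z_def[abs_def] ev_diff_1 ev_cob_Gc[OF sy] by simp
 qed
 have eG: "ev [z] (Gc \<gamma>) = (if \<gamma> \<in> chains Q W (deg \<gamma>) then (-1) ^ deg \<gamma> * z \<gamma> else 0)" for \<gamma>
  by (rule ev_Gc) (rule zM)
 have "z v = 0" for v
 proof (rule dd_zero[where n = "Suc n"])
  show "z v \<noteq> 0 \<Longrightarrow> basis v \<and> length v = Suc n" for v using xl[of v] cl[of v] by (cases "x v = 0"; cases "cob y v = 0") (auto simp: z_def)
  show "isM v \<Longrightarrow> z v = 0" for v by (rule zM)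
  show "z v = 0" if l: "level v = length v" for v
  proof (cases "v = []")
   case True
   then show ?thesis using xl(1)[of v] cl(1)[of v] by (cases "x v = 0"; cases "cob y v = 0") (auto simp: z_def)
  next
   case False
   then show ?thesis using ez[of v] level_chain[OF False l] unfolding eG by simp
  qed
  show "dd z xs = 0" if "isM xs" for xs
  proof -
   have "z = (\<lambda>v. x v + - 1 * cob y v)" by (auto simp: z_def)
   then show ?thesis using dx dd_cob[OF sy] isM_basis[OF that] by (simp only: dd_add dd_scale) simp
  qed
 qed
 then have xc: "x v = cob y v" for v using z_def by simp
 \<comment> \<open>Compensates the sign between \<open>cob\<close> and \<open>bar_dual_diff\<close>
   in this degree.\<close>
 define y' where "y' v = (-1) ^ n * y v" for v
 have "y' \<in> bar_dual Q W (d - 1)" unfolding bar_dual_def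
 proof (rule dual_spaceI)
  show "supp_deg (d - 1) y'" using sy by (auto simp: supp_deg_def y'_def d)
  show "y' g \<noteq> 0 \<Longrightarrow> basis g" for g using y(1)[of g] by (auto simp: y'_def)
 qed
 moreover have "x = bar_dual_ops Q I W 1 [y']" unfolding ops_1
 proof
  fix v
  have a: "dd y' v = (-1) ^ n * dd y v" unfolding y'_def[abs_def] by (rule dd_scale)
  show "x v = bar_dual_diff Q I W y' v"
  proof (cases "basis v")
   case False
   then show ?thesis by (simp add: xc cob_eq bar_dual_diff_eq)
  next
   case b: True
   show ?thesis
   proof (cases "length v = Suc n")
    case True
    have "bar_dual_diff Q I W y' v = (-1) ^ length v * ((-1) ^ n * dd y v)"
     using b by (simp only: bar_dual_diff_eq a if_True)
    also have "\<dots> = - dd y v" unfolding True by (cases "even n") simp_all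
    also have "\<dots> = x v" using b by (simp only: xc cob_eq if_True)
    finally show ?thesis by (rule sym)
   next
    case False
    have "dd y v = 0"
    proof (rule ccontr)
     assume "dd y v \<noteq> 0"
     then have "cob y v \<noteq> 0" using b by (simp add: cob_eq)
     from cl(1)[OF this] False show False by (rule notE[rotated])
    qed
    then show ?thesis using b by (simp add: xc cob_eq bar_dual_diff_eq a)
   qed
  qed
 qed
 ultimately show ?thesis by blast
qed

text \<open>The functional prescribed on chains is extended by values at merged words so that its
  coboundary vanishes on mergeable words; \<open>dd_zero\<close> then shows that it is a
  cocycle.\<close>

lemma cohomology_surjective:
 assumes y: "y \<in> ext_space Q W d"
 shows "\<exists>x\<in>bar_dual Q W d. bar_dual_ops Q I W 1 [x] = 0 \<and> fT 1 [x] = y"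
proof -
 define n where "n = nat d"
 have yl: "length v = n" "v \<in> chains Q W (deg v)" "v \<noteq> []" "int n = d" if "y v \<noteq> 0" for v
  using ext_supp[OF y] ext_chain[OF y that] that by (auto simp: supp_deg_def n_def)
 \<comment> \<open>Inverts the sign of \<open>fT 1\<close> on chains, see \<open>fT_1\<close> and
   \<open>ev_Gc\<close>.\<close>
 define x0 where "x0 v = - ((-1) ^ deg v * y v)" for v
 obtain x where x: "\<And>v. x v \<noteq> x0 v \<Longrightarrow> length v = n \<and> v \<noteq> [] \<and> basis v \<and> \<not> isM v \<and> level v \<noteq> length v"
  "\<And>xs. isM xs \<Longrightarrow> length xs = Suc n \<Longrightarrow> cob x xs = 0"
  using cob_fill[of x0 n "\<lambda>v. 0"] by blast
 have xl: "length v = n" "basis v" "v \<noteq> []" if "x v \<noteq> 0" for v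
 proof -
  have "length v = n \<and> basis v \<and> v \<noteq> []"
  proof (cases "x v = x0 v")
   case True
   then have "y v \<noteq> 0" using that by (auto simp: x0_def)
   from yl[OF this] chain_basis[OF yl(2)[OF this]] show ?thesis by blast
  qed (use x(1) in blast)
  then show "length v = n" "basis v" "v \<noteq> []" by blast+
 qed
 have nd: "int n = d" if "x v \<noteq> 0" for v
  using xl[OF that] y by (cases "1 \<le> d") (auto simp: n_def)
 have sx: "supp_deg d x" using xl nd by (auto simp: supp_deg_def)
 have xb: "x \<in> bar_dual Q W d" unfolding bar_dual_def by (rule dual_spaceI[OF sx]) (rule xl(2))
 have xM: "x v = 0" if m: "isM v" for v
 proof -
  have "y v = 0"
  proof (rule ccontr)
   assume "y v \<noteq> 0"
   from isM_level[OF m] chain_level[OF yl(2)[OF this]] show False by (rule notE)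
  qed
  then show ?thesis using x(1)[of v] m by (auto simp: x0_def)
 qed
 have cl: "length v = Suc n" "basis v" if "cob x v \<noteq> 0" for v
  using that dd_length[of x n v] xl(1) by (auto simp: cob_eq split: if_splits)
 have cM: "cob x v = 0" if "isM v" for v using x(2)[OF that] cl(1)[of v] by blast
 have eG: "ev [cob x] (Gc \<gamma>) = (if \<gamma> \<in> chains Q W (deg \<gamma>) then (-1) ^ deg \<gamma> * cob x \<gamma> else 0)" for \<gamma>
  by (rule ev_Gc) (rule cM)
 have c0: "cob x v = 0" for v
 proof (rule dd_zero[where n = "Suc n"])
  show "cob x v \<noteq> 0 \<Longrightarrow> basis v \<and> length v = Suc n" for v using cl[of v] by blast
  show "isM v \<Longrightarrow> cob x v = 0" for v by (rule cM)
  show "cob x v = 0" if l: "level v = length v" for v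
  proof (cases "v = []")
   case True
   then show ?thesis using cl(1)[of v] by auto
  next
   case False
   then show ?thesis using ev_cob_Gc[OF sx, of v] level_chain[OF False l] unfolding eG by simp
  qed
  show "dd (cob x) xs = 0" if "isM xs" for xs by (rule dd_cob[OF sx isM_basis[OF that]])
 qed
 have dz: "dd x xs = 0" if "basis xs" for xs using c0[of xs] that unfolding cob_eq by simp
 have xG: "ev [x] (Gc \<gamma>) = (if \<gamma> \<in> chains Q W (deg \<gamma>) then (-1) ^ deg \<gamma> * x \<gamma> else 0)" for \<gamma>
  by (rule ev_Gc) (rule xM)
 have sq: "(-1) ^ m * ((-1) ^ m * a) = a" for m and a :: 'k by (cases "even m") simp_all
 have "bar_dual_ops Q I W 1 [x] = 0" unfolding ops_1 by (auto simp: bar_dual_diff_eq dz fun_eq_iff)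
 moreover have "fT 1 [x] = y"
 proof
  fix \<gamma>
  show "fT 1 [x] \<gamma> = y \<gamma>"
  proof (cases "\<gamma> \<in> chains Q W (deg \<gamma>)")
   case True
   have "x \<gamma> = x0 \<gamma>"
   proof (rule ccontr)
    assume "x \<gamma> \<noteq> x0 \<gamma>"
    from x(1)[OF this] show False using chain_level[OF True] by simp
   qed
   then show ?thesis unfolding fT_1[OF sx] xG using True by (simp add: x0_def sq)
  next
   case False
   then have "y \<gamma> = 0" using yl(2)[of \<gamma>] by blast
   then show ?thesis unfolding fT_1[OF sx] xG using False by simp
  qed
 qed
 ultimately show ?thesis using xb by blast
qed

theorem canonical_mT: "canonical Q I W mT"
proof -
 have "ainf_quasi_iso fscale (bar_dual Q W) (bar_dual_ops Q I W) fscale (ext_space Q W) mT fT"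
  unfolding ainf_quasi_iso_def
 proof (intro conjI allI ballI impI)
  show "ainf_morphism fscale (bar_dual Q W) (bar_dual_ops Q I W) fscale (ext_space Q W) mT fT" by (rule morphism_fT)
  fix d x
  assume h: "x \<in> bar_dual Q W d" "bar_dual_ops Q I W 1 [x] = 0" "\<exists>z\<in>ext_space Q W (d - 1). fT 1 [x] = mT 1 [z]"
  then have "fT 1 [x] = 0" using mT_1 by auto
  then show "\<exists>y\<in>bar_dual Q W (d - 1). x = bar_dual_ops Q I W 1 [y]" by (rule cohomology_injective[OF h(1,2)])
 next
  fix d and y :: "('v, 'e) qpath list \<Rightarrow> 'k"
  assume y: "y \<in> ext_space Q W d"
  obtain x where x: "x \<in> bar_dual Q W d" "bar_dual_ops Q I W 1 [x] = 0" "fT 1 [x] = y"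
   using cohomology_surjective[OF y] by blast
  have "0 \<in> ext_space Q W (d - 1)" unfolding ext_space_def by (rule zero_dual)
  moreover have "y - fT 1 [x] = mT 1 [0]" using x(3) unfolding mT_1 by simp
  ultimately show "\<exists>x\<in>bar_dual Q W d. bar_dual_ops Q I W 1 [x] = 0 \<and>
    (\<exists>z\<in>ext_space Q W (d - 1). y - fT 1 [x] = mT 1 [z])" using x by blast
 qed
 then show ?thesis unfolding canonical_def ainf_quasi_isomorphic_def by blast
qed

end

section \<open>The higher products on basis elements\<close>

lemma evw_deltas: "evw (map delta gs) w = (if w = gs then 1 else 0 :: 'k::field)"
proof (induction gs arbitrary: w)
 case Nil
 then show ?case by (cases w) auto
next
 case (Cons g gs)
 then show ?case by (cases w) auto
qed

lemma evw_indicators: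
 "evw (map (\<lambda>a b. if b = a then 1 else 0) gs) w = (if w = gs then 1 else 0 :: 'k::field)"
proof (induction gs arbitrary: w)
 case Nil
 then show ?case by (cases w) auto
next
 case (Cons g gs)
 then show ?case by (cases w) auto
qed

lemma ev_deltas: "ev (map delta gs) p = coef p gs"
 by (induction p rule: fa_induct) (simp_all add: ev_simps evw_deltas evw_indicators cf_mon lookup_add lookup_cst)

primrec pair_sum :: "nat list \<Rightarrow> int" where
 "pair_sum [] = 0"
| "pair_sum (x # xs) = int x * int (sum_list xs) + pair_sum xs"

lemma sign_exponent_eq:
 "rs \<noteq> [] \<Longrightarrow> sign_exponent rs = hd rs + (\<Sum>i<length rs. (length rs + i + 2) * rs ! i) +
   (\<Sum>j<length rs. \<Sum>i<j. rs ! i * rs ! j) + length rs * (length rs + 1) div 2"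
proof -
 assume "rs \<noteq> []"
 have A: "sum f {1..n} = (\<Sum>k<n. f (Suc k))" for f :: "nat \<Rightarrow> nat" and n
  by (simp add: sum.atLeast1_atMost_eq)
 have B: "{1..<Suc j} = {1..j}" for j by auto
 show ?thesis unfolding sign_exponent_def Let_def A B using \<open>rs \<noteq> []\<close> by (simp add: hd_conv_nth)
qed

lemma pair_sum_eq: "int (\<Sum>j<length rs. \<Sum>i<j. rs ! i * rs ! j) = pair_sum rs"
proof (induction rs)
 case (Cons x xs)
 have "(\<Sum>j<length (x # xs). \<Sum>i<j. (x # xs) ! i * (x # xs) ! j) =
   (\<Sum>j<length xs. x * xs ! j + (\<Sum>i<j. xs ! i * xs ! j))"
  by (simp add: sum.lessThan_Suc_shift del: sum.lessThan_Suc)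
 also have "\<dots> = x * sum_list xs + (\<Sum>j<length xs. \<Sum>i<j. xs ! i * xs ! j)"
  by (simp add: sum.distrib sum_distrib_left[symmetric] sum_list_sum_nth atLeast0LessThan)
 finally show ?case using Cons by simp
qed simp

lemma triangle_Suc: "Suc n * (Suc n + 1) div 2 = n * (n + 1) div 2 + Suc n"
proof -
 have "Suc n * (Suc n + 1) = n * (n + 1) + Suc n * 2" by (simp add: algebra_simps)
 then show ?thesis by simp
qed

text \<open>Counting from 1, the weight of the \<open>i\<close>-th degree in \<open>eps\<close> is
  \<open>n - i\<close>; with the added sum of the \<open>rs\<close> it becomes
  \<open>n - i + 1\<close>, of the same parity as \<open>n + i + 1\<close>.\<close>

lemma sign_linear_part: "\<exists>k. int ((\<Sum>i<length rs. (length rs + i + 2) * rs ! i) + length rs * (length rs + 1) div 2) =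
  eps (map (\<lambda>r. int r + 1) rs) + int (sum_list rs) + int (length rs) + 2 * k"
proof (induction rs)
 case (Cons x xs)
 let ?n = "length xs"
 obtain k where k: "int ((\<Sum>i<?n. (?n + i + 2) * xs ! i) + ?n * (?n + 1) div 2) =
  eps (map (\<lambda>r. int r + 1) xs) + int (sum_list xs) + int ?n + 2 * k" using Cons by (rule exE)
 have "(\<Sum>i<length (x # xs). (length (x # xs) + i + 2) * (x # xs) ! i) =
   (Suc ?n + 0 + 2) * x + (\<Sum>i<?n. (Suc ?n + Suc i + 2) * xs ! i)"
  by (simp only: length_Cons sum.lessThan_Suc_shift nth_Cons_0 nth_Cons_Suc)
 also have "\<dots> = (?n + 3) * x + (\<Sum>i<?n. (?n + i + 2) * xs ! i + 2 * xs ! i)"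
  by (intro arg_cong2[where f = "(+)"] sum.cong refl) (simp_all add: algebra_simps)
 also have "\<dots> = (?n + 3) * x + (\<Sum>i<?n. (?n + i + 2) * xs ! i) + 2 * sum_list xs"
  by (simp add: sum.distrib sum_distrib_left[symmetric] sum_list_sum_nth atLeast0LessThan)
 finally have 1: "(\<Sum>i<length (x # xs). (length (x # xs) + i + 2) * (x # xs) ! i) =
  (?n + 3) * x + (\<Sum>i<?n. (?n + i + 2) * xs ! i) + 2 * sum_list xs" .
 have 2: "length (x # xs) * (length (x # xs) + 1) div 2 = ?n * (?n + 1) div 2 + Suc ?n"
  using triangle_Suc[of ?n] by simp
 have "int ((\<Sum>i<length (x # xs). (length (x # xs) + i + 2) * (x # xs) ! i) +
   length (x # xs) * (length (x # xs) + 1) div 2) =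
  int ((\<Sum>i<?n. (?n + i + 2) * xs ! i) + ?n * (?n + 1) div 2) + (int ?n + 3) * int x + 2 * int (sum_list xs) + int ?n + 1"
  unfolding 1 2 by simp
 also have "\<dots> = eps (map (\<lambda>r. int r + 1) (x # xs)) + int (sum_list (x # xs)) + int (length (x # xs)) +
   2 * (k + int x + int (sum_list xs))"
  unfolding k by (simp add: algebra_simps)
 finally show ?case by blast
qed simp

context toupie
begin

lemma lbar_sum: "lbar (int (sum_list rs)) = (\<Sum>r\<leftarrow>rs. lbar (int r)) + pair_sum rs"
proof (induction rs)
 case (Cons x xs)
 then show ?case using lbar_add[of "int x" "int (sum_list xs)"] by simp
qed (simp add: lbar_def)

text \<open>Each part of \<open>M\<close> has its source: the linear part is \<open>eps\<close> with
  the linear terms of \<open>lext\<close>, the products come from \<open>lbar\<close> of the total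
  degree by \<open>lbar_sum\<close>, and the first degree is the sign in
  \<open>\<delta>T\<close>.\<close>

lemma chain_sign:
 assumes "rs \<noteq> []"
 shows "(-1 :: 'k) powi (eps (map (\<lambda>r. int r + 1) rs) + (\<Sum>r\<leftarrow>rs. lext (int r + 1)) + lext (int (sum_list rs) + 2)) *
  (-1) ^ hd rs = (-1) ^ sign_exponent rs"
proof -
 have l1: "lbar (int r + 1) = lbar (int r) + int r" for r using lbar_add[of "int r" 1] by (simp add: lbar_def)
 have l2: "lbar (int (sum_list rs) + 2) = lbar (int (sum_list rs)) + 1 + 2 * int (sum_list rs)"
  using lbar_add[of "int (sum_list rs)" 2] by (simp add: lbar_def)
 have s: "(\<Sum>r\<leftarrow>qs. lext (int r + 1)) = (\<Sum>r\<leftarrow>qs. lbar (int r)) + int (sum_list qs) + int (length qs)" for qs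
  by (induction qs) (simp_all add: lext_def l1)
 obtain k where k: "int ((\<Sum>i<length rs. (length rs + i + 2) * rs ! i) + length rs * (length rs + 1) div 2) =
  eps (map (\<lambda>r. int r + 1) rs) + int (sum_list rs) + int (length rs) + 2 * k"
  using sign_linear_part by (rule exE)
 have "int (sign_exponent rs) = int (hd rs) +
  int ((\<Sum>i<length rs. (length rs + i + 2) * rs ! i) + length rs * (length rs + 1) div 2) +
  int (\<Sum>j<length rs. \<Sum>i<j. rs ! i * rs ! j)"
  unfolding sign_exponent_eq[OF assms] by simp
 then have e: "int (sign_exponent rs) = int (hd rs) + (eps (map (\<lambda>r. int r + 1) rs) + int (sum_list rs) + int (length rs) + 2 * k) + pair_sum rs"
  unfolding k pair_sum_eq .
 have E: "(-1 :: 'k) ^ hd rs = (-1) powi int (hd rs)" "(-1 :: 'k) ^ sign_exponent rs = (-1) powi int (sign_exponent rs)"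
  by (simp_all only: power_int_of_nat)
 have "(eps (map (\<lambda>r. int r + 1) rs) + (\<Sum>r\<leftarrow>rs. lext (int r + 1)) + lext (int (sum_list rs) + 2)) + int (hd rs)
   - int (sign_exponent rs) = 2 * ((\<Sum>r\<leftarrow>rs. lbar (int r)) + int (sum_list rs) + 1 - k)"
  unfolding e s unfolding lext_def l2 lbar_sum by simp
 from powi_parity[OF this] show ?thesis unfolding E powi_mult .
qed

lemma branch_sign:
 "(-1 :: 'k) powi (eps (map (\<lambda>_. 1) as) + (\<Sum>a\<leftarrow>as. lext 1) + lext 2) = (-1) ^ (length as * (length as + 1) div 2)"
proof -
 have 1: "eps (map (\<lambda>_. 1) as) + int (length as) = int (length as * (length as + 1) div 2)"
 proof (induction as)
  case (Cons a as)
  show ?case using Cons triangle_Suc[of "length as"] by simp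
 qed simp
 have 2: "(\<Sum>a\<leftarrow>as. lext 1) = int (length as)" by (induction as) (simp_all add: lext_def lbar_def)
 have 3: "lext 2 = 2" by (simp add: lext_def lbar_def)
 have E: "(-1 :: 'k) ^ (length as * (length as + 1) div 2) = (-1) powi int (length as * (length as + 1) div 2)"
  by (simp only: power_int_of_nat)
 have "eps (map (\<lambda>_. 1) as) + (\<Sum>a\<leftarrow>as. lext 1) + lext 2 - int (length as * (length as + 1) div 2) = 2 * 1"
  unfolding 2 3 1[symmetric] by simp
 from powi_parity[OF this] show ?thesis unfolding E .
qed

lemma supp_deg_deltas: "[] \<notin> set gs \<Longrightarrow> list_all2 supp_deg (map (\<lambda>g. int (length g)) gs) (map (delta :: _ \<Rightarrow> _ \<Rightarrow> 'k) gs)"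
 by (induction gs) (auto simp: supp_deg_def)

lemma mT_deltas:
 assumes "[] \<notin> set gs"
 shows "mT n (map delta gs) \<gamma> = (-1) powi (eps (map (\<lambda>g. int (length g)) gs) +
   (\<Sum>d\<leftarrow>map (\<lambda>g. int (length g)) gs. lext d) + lext (int (length \<gamma>))) * coef (\<delta>T \<gamma>) gs"
 unfolding tw_eq[OF supp_deg_deltas[OF assms]] ev_deltas ..

lemma arrows_product: "b \<in> set B4 \<Longrightarrow> path_prod (map path_prod (arrows b)) = b"
proof -
 assume b: "b \<in> set B4"
 have "walk (fst b) (snd b)" using B4_branch[OF b] qpaths_walk[of b] by blast
 moreover have "snd b \<noteq> []" using B4_length[OF b] by auto
 ultimately show ?thesis using arrows_composable unfolding arrows_path by simp
qed

lemma decs_path: "gs \<in> decs \<gamma> \<Longrightarrow> path_prod \<gamma> = path_prod (map path_prod gs)"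
 by (auto simp: decs_def chain_product_case_def)

text \<open>Such a \<open>\<gamma>\<close> would be a 1-chain with path \<open>b\<close> free of non
  monomial tips, hence containing a monomial relation, which branches in \<open>B4\<close> do not.
  So the first two cases of the theorem never concern the same word.\<close>

lemma B4_no_decs: "b \<in> set B4 \<Longrightarrow> arrows b \<notin> decs \<gamma>"
proof
 assume b: "b \<in> set B4" and d: "arrows b \<in> decs \<gamma>"
 have p: "path_prod \<gamma> = b" using decs_path[OF d] arrows_product[OF b] by simp
 obtain e where c: "\<gamma> \<in> chains Q W e" using decs_chain(1)[OF d] by blast
 have "wdeg (map (\<lambda>a. [arrow_path Q a]) as) = 0" for as by (induction as) simp_all
 then have "wdeg (arrows b) = 0" by (simp only: arrows_def)
 then have "length \<gamma> = 2" using decs_deg[OF d] by linarith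
 then obtain u v where uv: "\<gamma> = [u, v]" by (auto simp: numeral_2_eq_2 length_Suc_conv)
 have "e = 1" using chain_length[OF c] uv by simp
 then have "uf_arrow Q W u v" using chainsD(5)[OF c, of 0] by (simp add: uv)
 moreover have "u \<in> NT" by (rule chain_NT[OF c]) (simp add: uv)
 ultimately have "b \<in> path_ideal Q W" using uf_arrow_pair(2) p uv by blast
 then obtain y where y: "y \<in> W" "subpath Q y b" by (auto simp: path_ideal_def)
 then show False using toupieD(7)[OF b, of y] decs_chain(2)[OF d, of y] p by (auto simp: W_eq)
qed

text \<open>The factors determine the path and the degree of the chain, and these determine the
  chain.\<close>

lemma decs_unique: "gs \<in> decs \<gamma> \<Longrightarrow> gs \<in> decs \<gamma>' \<Longrightarrow> \<gamma> = \<gamma>'"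
proof -
 assume d: "gs \<in> decs \<gamma>" "gs \<in> decs \<gamma>'"
 obtain e where c: "\<gamma> \<in> chains Q W e" using decs_chain(1)[OF d(1)] by blast
 obtain e' where c': "\<gamma>' \<in> chains Q W e'" using decs_chain(1)[OF d(2)] by blast
 have "e = e'" using decs_deg[OF d(1)] decs_deg[OF d(2)] chain_length[OF c] chain_length[OF c'] by simp
 interpret toupie_path Q so si I Gmon W B4 r piv cf "path_prod \<gamma>" by (rule chain_universe[OF c])
 have p: "path_prod \<gamma>' = path_prod \<gamma>" by (rule trans[OF decs_path[OF d(2)] decs_path[OF d(1), symmetric]])
 have c'': "\<gamma>' \<in> chains Q W e" unfolding \<open>e = e'\<close> by (rule c')
 show ?thesis by (rule trans[OF chain_whole(2)[OF c refl] chain_whole(2)[OF c'' p, symmetric]])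
qed

lemma coef_decs:
 assumes "gs \<in> decs g"
 shows "coef (\<delta>T \<gamma>) gs = (if \<gamma> = g then (-1) ^ deg (hd gs) else 0)"
proof -
 have "gs \<in> decs \<gamma> \<longleftrightarrow> \<gamma> = g" using decs_unique assms by blast
 moreover have "gs \<noteq> arrows b" if "b \<in> set B4" for b using B4_no_decs[OF that] assms by blast
 ultimately show ?thesis unfolding cf_\<delta>T by simp
qed

lemma arrows_inj:
 assumes "b \<in> set B4" "b' \<in> set B4" "arrows b = arrows b'"
 shows "b = b'"
 using arrows_product[OF assms(1)] arrows_product[OF assms(2)] unfolding assms(3) by (rule trans[OF sym])

lemma coef_arrows:
 assumes "b \<in> set B4"
 shows "coef (\<delta>T \<gamma>) (arrows b) = (\<Sum>i | i < r \<and> \<gamma> = split_chain Q (tip i). \<rho> i b)"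
proof -
 have "(\<Sum>b'\<in>set B4. if arrows b = arrows b' then \<rho> i b' else 0) = \<rho> i b" for i
 proof -
  have "(\<Sum>b'\<in>set B4. if arrows b = arrows b' then \<rho> i b' else 0) = (\<Sum>b'\<in>set B4. if b' = b then \<rho> i b' else 0)"
   using arrows_inj[OF assms] by (intro sum.cong) auto
  then show ?thesis using assms by (simp add: sum.delta)
 qed
 then show ?thesis unfolding cf_\<delta>T using B4_no_decs[OF assms] by simp
qed

lemma mT_chain_product:
 assumes "chain_product_case Q W tips gs rs g"
 shows "mT n (map delta gs) = fscale ((-1) ^ sign_exponent rs) (delta g)"
proof
 fix \<gamma>
 have d: "gs \<in> decs g" using assms by (auto simp: decs_def)
 have l: "list_all2 (\<lambda>\<gamma> r. \<gamma> \<in> chains Q W r) gs rs" and n: "gs \<noteq> []" and c: "g \<in> chains Q W (sum_list rs + 1)"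
  using assms unfolding chain_product_case_def by blast+
 have m: "map (\<lambda>g. int (length g)) gs = map (\<lambda>r. int r + 1) rs"
  using l by (induction rule: list_all2_induct) (auto dest: chain_length)
 obtain g0 gs' r0 rs' where gr: "gs = g0 # gs'" "rs = r0 # rs'" using l n by (cases gs; cases rs) auto
 then have "g0 \<in> chains Q W r0" using l by simp
 then have r: "rs \<noteq> []" "deg (hd gs) = hd rs" using chain_length gr by simp_all
 have ne: "[] \<notin> set gs" using decs_letters[OF d] chain_ends(1) by blast
 show "mT n (map delta gs) \<gamma> = fscale ((-1) ^ sign_exponent rs) (delta g) \<gamma>"
 proof (cases "\<gamma> = g")
  case True
  have "int (length \<gamma>) = int (sum_list rs) + 2" using chain_length[OF c] True by simp
  then show ?thesis unfolding mT_deltas[OF ne] coef_decs[OF d] m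
   using chain_sign[OF r(1)] True by (simp add: fscale_def r(2) o_def)
 next
  case False
  then show ?thesis unfolding mT_deltas[OF ne] coef_decs[OF d] by (simp add: fscale_def)
 qed
qed

lemma mT_branch:
 assumes "nonmon_branch_case Q so si B4 r piv cf as"
 shows "mT n (map (\<lambda>a. delta [arrow_path Q a]) as) = (\<Sum>i | i < r \<and> \<rho> i (so, as) \<noteq> 0.
   fscale ((-1) ^ (length as * (length as + 1) div 2) * \<rho> i (so, as)) (delta (split_chain Q (tip i))))"
proof
 fix \<gamma>
 let ?b = "(so, as)" and ?c = "(-1 :: 'k) ^ (length as * (length as + 1) div 2)"
 have b: "?b \<in> set B4" using assms \<rho>_B4[of _ ?b] unfolding nonmon_branch_case_def by blast
 have A: "arrows ?b = map (\<lambda>a. [arrow_path Q a]) as" by (simp add: arrows_def)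
 have ne: "[] \<notin> set (arrows ?b)" by (auto simp: A)
 have D: "map (\<lambda>a. delta [arrow_path Q a]) as = map delta (arrows ?b)" by (simp add: A)
 have m: "map (\<lambda>g. int (length g)) (arrows ?b) = map (\<lambda>_. 1) as" by (simp add: A)
 have sl: "(\<Sum>d\<leftarrow>map (\<lambda>_. 1) as. lext d) = (\<Sum>a\<leftarrow>as. lext 1)" by (simp add: o_def)
 have "mT n (map delta (arrows ?b)) \<gamma> = ?c * (\<Sum>i | i < r \<and> \<gamma> = split_chain Q (tip i). \<rho> i ?b)"
 proof (cases "{i. i < r \<and> \<gamma> = split_chain Q (tip i)} = {}")
  case True
  show ?thesis unfolding mT_deltas[OF ne] coef_arrows[OF b] True by simp
 next
  case False
  then have "int (length \<gamma>) = 2" by (auto simp: split_chain_def)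
  then show ?thesis unfolding mT_deltas[OF ne] coef_arrows[OF b] m sl using branch_sign[of as] by simp
 qed
 also have "\<dots> = (\<Sum>i<r. ?c * \<rho> i ?b * (if \<gamma> = split_chain Q (tip i) then 1 else 0))"
 proof -
  have "(\<Sum>i | i < r \<and> \<gamma> = split_chain Q (tip i). \<rho> i ?b) = (\<Sum>i<r. if \<gamma> = split_chain Q (tip i) then \<rho> i ?b else 0)"
   using sum.inter_filter[of "{..<r}" "\<lambda>i. \<rho> i ?b" "\<lambda>i. \<gamma> = split_chain Q (tip i)"] by simp
  then show ?thesis by (simp add: sum_distrib_left) (intro sum.cong, auto)
 qed
 also have "\<dots> = (\<Sum>i | i < r \<and> \<rho> i ?b \<noteq> 0. ?c * \<rho> i ?b * (if \<gamma> = split_chain Q (tip i) then 1 else 0))"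
  by (rule sum.mono_neutral_right) auto
 also have "\<dots> = (\<Sum>i | i < r \<and> \<rho> i ?b \<noteq> 0. fscale (?c * \<rho> i ?b) (delta (split_chain Q (tip i)))) \<gamma>"
  unfolding sum_fun_apply by (simp add: fscale_def)
 finally show "mT n (map (\<lambda>a. delta [arrow_path Q a]) as) \<gamma> = (\<Sum>i | i < r \<and> \<rho> i ?b \<noteq> 0.
   fscale (?c * \<rho> i ?b) (delta (split_chain Q (tip i)))) \<gamma>" unfolding D .
qed

lemma mT_otherwise:
 assumes gs: "set gs \<subseteq> (\<Union>i. chains Q W i)"
  and 1: "\<not> (\<exists>rs g. chain_product_case Q W tips gs rs g)"
  and 2: "\<not> (\<exists>as. nonmon_branch_case Q so si B4 r piv cf as \<and> gs = map (\<lambda>a. [arrow_path Q a]) as)"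
 shows "mT n (map delta gs) = 0"
proof
 fix \<gamma>
 have ne: "[] \<notin> set gs" using gs chain_ends(1) by blast
 have "gs \<noteq> arrows b" if b: "b \<in> set B4" for b
 proof
  assume g: "gs = arrows b"
  have so: "b = (so, snd b)" using B4_branch[OF b] by (simp add: prod_eq_iff)
  have "b \<in> branches Q so si \<and> (\<exists>i<r. \<rho> i b \<noteq> 0)" using b unfolding toupieD(6) by blast
  moreover have "snd b \<noteq> []" using B4_length[OF b] by auto
  ultimately have "nonmon_branch_case Q so si B4 r piv cf (snd b)"
   unfolding nonmon_branch_case_def so[symmetric] by blast
  then show False using 2 g by (auto simp: arrows_def)
 qed
 moreover have "gs \<notin> decs \<gamma>" using 1 by (auto simp: decs_def)
 ultimately have "coef (\<delta>T \<gamma>) gs = 0" unfolding cf_\<delta>T by simp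
 then show "mT n (map delta gs) \<gamma> = 0 \<gamma>" unfolding mT_deltas[OF ne] by simp
qed

end

theorem corollary4p8:
  fixes Q :: "('v, 'e) pre_digraph" and so si :: 'v
    and I :: "(('v, 'e) qpath \<Rightarrow> 'k::field_char_0) set"
    and Gmon W :: "('v, 'e) qpath set" and B4 :: "('v, 'e) qpath list"
    and r :: nat and piv :: "nat \<Rightarrow> nat" and cf :: "nat \<Rightarrow> nat \<Rightarrow> 'k"
  assumes toupie: "toupie_algebra Q so si I Gmon B4 r piv cf"
    and W: "W = Gmon \<union> nonmon_tips B4 r piv"
  shows "\<exists>m :: nat \<Rightarrow> (('v, 'e) qpath list \<Rightarrow> 'k) list \<Rightarrow> (('v, 'e) qpath list \<Rightarrow> 'k).
    ainf_algebra fscale (ext_space Q W) m \<and>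
    canonical Q I W m \<and>
    (\<forall>gs rs g. chain_product_case Q W (nonmon_tips B4 r piv) gs rs g \<longrightarrow>
       m (length gs) (map delta gs) = fscale ((-1) ^ sign_exponent rs) (delta g)) \<and>
    (\<forall>as. nonmon_branch_case Q so si B4 r piv cf as \<longrightarrow>
       m (length as) (map (\<lambda>a. delta [arrow_path Q a]) as) =
         (\<Sum>i | i < r \<and> rho B4 piv cf i (so, as) \<noteq> 0.
            fscale ((-1) ^ (length as * (length as + 1) div 2) * rho B4 piv cf i (so, as))
              (delta (split_chain Q (B4 ! piv i))))) \<and>
    (\<forall>gs. gs \<noteq> [] \<and> set gs \<subseteq> (\<Union>i. chains Q W i) \<and>
       \<not> (\<exists>rs g. chain_product_case Q W (nonmon_tips B4 r piv) gs rs g) \<and>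
       \<not> (\<exists>as. nonmon_branch_case Q so si B4 r piv cf as \<and>
               gs = map (\<lambda>a. [arrow_path Q a]) as) \<longrightarrow>
       m (length gs) (map delta gs) = 0)"
proof -
  interpret toupie Q so si I Gmon W B4 r piv cf by unfold_locales (rule toupie, rule W)
  show ?thesis
    by (intro exI[of _ mT] conjI allI impI; (rule ainf_mT canonical_mT | erule mT_chain_product | erule mT_branch
      | (elim conjE, rule mT_otherwise; assumption)))
qed

end
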